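(* Let $k\ge0$ be an integer. There is a constant $C>0$, independent of the mesh size, such that $$\|(\hat v_h,\hat u_h)\|_{\hat X_{h,0}^k}^2\le C\,\mathcal A_h((\hat v_h,\hat u_h),(\hat v_h,\hat u_h))\qquad\text{for all }(\hat v_h,\hat u_h)\in\hat X_{h,0}^k,$$ and consequently, for every $f\in L^2(\Omega)$, the discrete problem: find $(\hat y_h,\hat z_h)\in\hat X_{h,0}^k$ such that $\mathcal A_h((\hat y_h,\hat z_h),(\hat v_h,\hat u_h))=(f,u_{\mathcal T_h})$ for all $(\hat v_h,\hat u_h)\in\hat X_{h,0}^k$, is well-posed (has a unique solution).
   Context: $\Omega\subset\mathbb R^d$, $d\in\{2,3\}$, is an open bounded convex domain with polygonal (polyhedral) boundary, $\kappa>0$ is a constant. $(\cdot,\cdot)_S$ and $\|\cdot\|_S$ are the $L^2(S)$ inner product and norm (subscript omitted if $S=\Omega$). Meshes. $(\mathcal T_h,\mathcal F_h)$ is a polytopal mesh of $\Omega$ (cells $T$, faces $F$) belonging to a regular mesh sequence: there is $\rho\in(0,1)$, independent of $h$, such that each mesh admits a matching simplicial submesh whose simplices $\tau$ satisfy $\rho h_\tau\le r_\tau$ (diameter, inradius) and $\rho h_T\le h_\tau$ whenever $\tau\subset T$. $h_T$ is the diameter of $T$, $n_T$ the unit outward normal to $T$, $n_F$ a fixed unit normal to $F$ (outward if $F\subset\partial\Omega$), $\mathcal F_h^b$ the set of boundary faces, $\mathcal F_{\partial T}$ the set of faces contained in $\partial T$. $\mathbb P^l(T)$ are polynomials of degree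 $\le l$, $\mathbb P^l(\mathcal F_{\partial T})=\times_{F\in\mathcal F_{\partial T}}\mathbb P^l(F)$, $\mathbb P^l(\mathcal T_h),\mathbb P^l(\mathcal F_h)$ the piecewise polynomials on cells and faces, $\Pi_{\partial T}^l$ the $L^2$-orthogonal projection onto $\mathbb P^l(\mathcal F_{\partial T})$. $\partial_n,\partial_t,\partial_{nn},\partial_{nt}$ denote the normal derivative, the ($\mathbb R^d$-valued) tangential derivative, and the normal-normal and ($\mathbb R^d$-valued) normal-tangential second derivatives on $\partial T$. Local spaces and reconstructions. $\hat V_T^k:=\mathbb P^{k+2}(T)\times\mathbb P^{k+2}(\mathcal F_{\partial T})\times\mathbb P^k(\mathcal F_{\partial T})$ with elements $\hat v_T=(v_T,v_{\partial T},\eta_{\partial T})$; $\hat U_T^k:=\mathbb P^{k+1}(T)\times\mathbb P^k(\mathcal F_{\partial T})$ with elements $\hat u_T=(u_T,u_{\partial T})$. Semi-norms: $|\hat v_T|^2_{\hat V_T^k}=\|\nabla^2v_T\|_T^2+h_T^{-1}\|\partial_nv_T-\eta_{\partial T}\|_{\partial T}^2+h_T^{-3}\|v_T-v_{\partial T}\|_{\partial T}^2$ and $|\hat u_T|^2_{\hat U_T^k}=\|\nabla u_T\|_T^2+h_T^{-1}\|u_T-u_{\partial T}\|_{\partial T}^2$. $\mathcal R_T:\hat V_T^k\to\mathbb P^{k+2}(T)$ is defined by $(\nabla^2\mathcal R_T(\hat v_T),\nabla^2w)_T=(\nabla^2v_T,\nabla^2w)_T+(v_T-v_{\partial T},\partial_n\Delta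 w)_{\partial T}-(\partial_nv_T-\eta_{\partial T},\partial_{nn}w)_{\partial T}-(\partial_t(v_T-v_{\partial T}),\partial_{nt}w)_{\partial T}$ for all $w\in\mathbb P^{k+2}(T)$ and $(\mathcal R_T(\hat v_T),\xi)_T=(v_T,\xi)_T$ for all $\xi\in\mathbb P^1(T)$. $\mathcal G_T:\hat U_T^k\to\mathbb P^{k+1}(T)$ is defined by $(\nabla\mathcal G_T(\hat u_T),\nabla w)_T=(\nabla u_T,\nabla w)_T-(u_T-u_{\partial T},\partial_nw)_{\partial T}$ for all $w\in\mathbb P^{k+1}(T)$ and $(\mathcal G_T(\hat u_T),1)_T=(u_T,1)_T$. Bilinear forms. For $\hat y_T=(y_T,y_{\partial T},\gamma_{\partial T})$, $\hat v_T=(v_T,v_{\partial T},\eta_{\partial T})$: $S^\Delta_{\partial T}(\hat y_T,\hat v_T)=h_T^{-3}(y_{\partial T}-y_T,v_{\partial T}-v_T)_{\partial T}+h_T^{-1}(\Pi^k_{\partial T}(\gamma_{\partial T}-\partial_ny_T),\Pi^k_{\partial T}(\eta_{\partial T}-\partial_nv_T))_{\partial T}$; $S^\nabla_{\partial T}(\hat z_T,\hat u_T)=h_T^{-1}(\Pi^k_{\partial T}(z_{\partial T}-z_T),\Pi^k_{\partial T}(u_{\partial T}-u_T))_{\partial T}$; $a_h^\Delta(\hat y_h,\hat v_h)=\sum_T[(\nabla^2\mathcal R_T(\hat y_T),\nabla^2\mathcal R_T(\hat v_T))_T+S^\Delta_{\partial T}(\hat y_T,\hat v_T)]$; $a_h^\nabla(\hat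 z_h,\hat u_h)=\sum_T[(\nabla\mathcal G_T(\hat z_T),\nabla\mathcal G_T(\hat u_T))_T+S^\nabla_{\partial T}(\hat z_T,\hat u_T)]$. Global spaces. $\hat V_{h,0}^k$ is the set of $\hat v_h=(v_{\mathcal T_h},v_{\mathcal F_h},\eta_{\mathcal F_h})\in\mathbb P^{k+2}(\mathcal T_h)\times\mathbb P^{k+2}(\mathcal F_h)\times\mathbb P^k(\mathcal F_h)$ with $v_F=0$ for all $F\in\mathcal F_h^b$; local components $\hat v_T=(v_T,v_{\partial T},\eta_{\partial T})$ with $v_{\partial T}|_F=v_F$, $\eta_{\partial T}|_F=(n_F\cdot n_T)\eta_F$. $\hat U_{h,0}^k$ is the set of $\hat u_h=(u_{\mathcal T_h},u_{\mathcal F_h})\in\mathbb P^{k+1}(\mathcal T_h)\times\mathbb P^k(\mathcal F_h)$ with $u_F=0$ for all $F\in\mathcal F_h^b$; local components $\hat u_T=(u_T,u_{\partial T})$, $u_{\partial T}|_F=u_F$. $\hat X_{h,0}^k:=\hat V_{h,0}^k\times\hat U_{h,0}^k$ with $\|(\hat v_h,\hat u_h)\|^2_{\hat X_{h,0}^k}=\sum_T|\hat v_T|^2_{\hat V_T^k}+\sum_T|\hat u_T|^2_{\hat U_T^k}$. $\mathcal A_h((\hat y_h,\hat z_h),(\hat v_h,\hat u_h)):=a_h^\Delta(\hat y_h,\hat v_h)-(z_{\mathcal T_h},v_{\mathcal T_h})+(y_{\mathcal T_h},u_{\mathcal T_h})+\kappa a_h^\nabla(\hat z_h,\hat u_h)$.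 *)

theory Defs
  imports "HOL-Analysis.Analysis"
begin

section \<open>Polynomials and derivatives\<close>

text \<open>Polynomial functions of total degree at most \<open>l\<close>. A cell is open and nonempty, so a
  polynomial on a cell is identified with the polynomial function on the whole space; this
  gives a meaning to its traces on the boundary of the cell.\<close>

definition polys :: "nat \<Rightarrow> ('a::euclidean_space \<Rightarrow> real) set" where
  "polys l = {p. \<exists>c. \<forall>x. p x =
     (\<Sum>\<alpha> | \<alpha> \<in> Basis \<rightarrow>\<^sub>E UNIV \<and> sum \<alpha> Basis \<le> l. c \<alpha> * (\<Prod>b\<in>Basis. (x \<bullet> b) ^ \<alpha> b))}"

text \<open>A polynomial on a face is only determined as a function on that face (many polynomials
  on the space restrict to it), hence the extensional restriction.\<close>

definition face_polys :: "nat \<Rightarrow> 'a::euclidean_space set \<Rightarrow> ('a \<Rightarrow> real) set" where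
  "face_polys l F = (\<lambda>p. restrict p F) ` polys l"

definition dderiv :: "'a::euclidean_space \<Rightarrow> ('a \<Rightarrow> real) \<Rightarrow> 'a \<Rightarrow> real" where
  "dderiv v f x = frechet_derivative f (at x) v"

definition grad :: "('a::euclidean_space \<Rightarrow> real) \<Rightarrow> 'a \<Rightarrow> 'a" where
  "grad f x = (\<Sum>b\<in>Basis. dderiv b f x *\<^sub>R b)"

definition laplacian :: "('a::euclidean_space \<Rightarrow> real) \<Rightarrow> 'a \<Rightarrow> real" where
  "laplacian f x = (\<Sum>b\<in>Basis. dderiv b (dderiv b f) x)"

text \<open>Tangential gradient at \<open>x\<close> on the hyperplane through \<open>x\<close> with unit normal \<open>n\<close>: the
  gradient of the extension that is constant along \<open>n\<close>. Near \<open>x\<close> it only involves the values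
  on the hyperplane, so it applies to functions defined on a (relatively open) face; for a
  function differentiable in space it is the gradient minus its normal part.\<close>

definition tgrad :: "'a::euclidean_space \<Rightarrow> ('a \<Rightarrow> real) \<Rightarrow> 'a \<Rightarrow> 'a" where
  "tgrad n f x = grad (\<lambda>y. f (y - (n \<bullet> (y - x)) *\<^sub>R n)) x"


section \<open>Integration on cells and faces\<close>

definition L2_inner :: "'a::euclidean_space set \<Rightarrow> ('a \<Rightarrow> 'b::real_inner) \<Rightarrow> ('a \<Rightarrow> 'b) \<Rightarrow> real" where
  "L2_inner S f g = (LINT x:S|lebesgue. f x \<bullet> g x)"

definition L2_fun :: "'a::euclidean_space set \<Rightarrow> ('a \<Rightarrow> real) \<Rightarrow> bool" where
  "L2_fun S f \<longleftrightarrow> set_borel_measurable lebesgue S f \<and> set_integrable lebesgue S (\<lambda>x. (f x)\<^sup>2)"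

text \<open>Inner product of the Hessians, with the Frobenius product of matrices.\<close>

definition hess_inner :: "'a::euclidean_space set \<Rightarrow> ('a \<Rightarrow> real) \<Rightarrow> ('a \<Rightarrow> real) \<Rightarrow> real" where
  "hess_inner S f g =
     (\<Sum>a\<in>Basis. \<Sum>b\<in>Basis. L2_inner S (dderiv a (dderiv b f)) (dderiv a (dderiv b g)))"

text \<open>The surface (\<open>d - 1\<close>-dimensional Lebesgue) measure on the hyperplane \<open>n \<bullet> x = c\<close>, for a
  unit vector \<open>n\<close>: a set in the hyperplane is measured by the volume of the right cylinder of
  height one over it.\<close>

definition hyperplane_measure :: "'a::euclidean_space \<Rightarrow> real \<Rightarrow> 'a measure" where
  "hyperplane_measure n c =
     distr (restrict_space lborel {x. c \<le> n \<bullet> x \<and> n \<bullet> x \<le> c + 1}) borel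
       (\<lambda>x. x - (n \<bullet> x - c) *\<^sub>R n)"

text \<open>The choice below is unique up to \<open>(n, c) \<mapsto> (- n, - c)\<close> when \<open>F\<close> is nonempty and open in a
  hyperplane, and this does not change the measure.\<close>

definition face_measure :: "'a::euclidean_space set \<Rightarrow> 'a measure" where
  "face_measure F =
     (case SOME (n, c). norm n = 1 \<and> F \<subseteq> {x. n \<bullet> x = c} of
        (n, c) \<Rightarrow> restrict_space (hyperplane_measure n c) F)"

text \<open>A function on the boundary of a cell is a family of functions indexed by the faces in
  that boundary, here the set \<open>\<F>\<close>; it may be two-valued where faces meet.\<close>

type_synonym 'a ffun = "'a set \<Rightarrow> 'a \<Rightarrow> real"

definition bd_inner ::
  "'a::euclidean_space set set \<Rightarrow> ('a set \<Rightarrow> 'a \<Rightarrow> 'b::real_inner) \<Rightarrow> ('a set \<Rightarrow> 'a \<Rightarrow> 'b) \<Rightarrow> real" where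
  "bd_inner \<F> v w = (\<Sum>F\<in>\<F>. \<integral>x. v F x \<bullet> w F x \<partial>face_measure F)"

definition bd_proj :: "nat \<Rightarrow> 'a::euclidean_space set set \<Rightarrow> 'a ffun \<Rightarrow> 'a ffun" where
  "bd_proj l \<F> v =
     (THE p. p \<in> (\<Pi>\<^sub>E F\<in>\<F>. face_polys l F) \<and>
             (\<forall>q \<in> (\<Pi>\<^sub>E F\<in>\<F>. face_polys l F). bd_inner \<F> p q = bd_inner \<F> v q))"


section \<open>Meshes\<close>

text \<open>Polytopal sets are not assumed convex: they are (relative) interiors of finite unions of
  simplices of the given dimension.\<close>

definition polytopal_set :: "int \<Rightarrow> 'a::euclidean_space set \<Rightarrow> bool" where
  "polytopal_set m P \<longleftrightarrow> P \<noteq> {} \<and>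
     (\<exists>\<S>. finite \<S> \<and> (\<forall>s\<in>\<S>. m simplex s) \<and> aff_dim (\<Union>\<S>) = m \<and> P = rel_interior (\<Union>\<S>))"

text \<open>\<open>D\<close> lies on one side of \<open>F\<close> near almost every point of \<open>F\<close>.\<close>

definition outward_normal :: "'a::euclidean_space set \<Rightarrow> 'a set \<Rightarrow> 'a \<Rightarrow> bool" where
  "outward_normal D F n \<longleftrightarrow> norm n = 1 \<and> (\<forall>x\<in>F. \<forall>y\<in>F. n \<bullet> (y - x) = 0) \<and>
     (AE x in face_measure F. \<exists>e>0. D \<inter> ball x e = {y \<in> ball x e. n \<bullet> (y - x) < 0})"

definition cell_normal :: "'a::euclidean_space set \<Rightarrow> 'a set \<Rightarrow> 'a" where
  "cell_normal T F = (THE n. outward_normal T F n)"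

definition cell_faces :: "'a::euclidean_space set set \<Rightarrow> 'a set \<Rightarrow> 'a set set" where
  "cell_faces Fh T = {F \<in> Fh. F \<subseteq> frontier T}"

definition boundary_faces :: "'a::euclidean_space set \<Rightarrow> 'a set set \<Rightarrow> 'a set set" where
  "boundary_faces \<Omega> Fh = {F \<in> Fh. F \<subseteq> frontier \<Omega>}"

text \<open>Cells are open and faces are relatively open. The last condition makes the outward normal
  of a cell constant on each of its faces; it excludes, for instance, a face with the same
  cell on either side of it along different parts.\<close>

definition polytopal_mesh :: "'a::euclidean_space set \<Rightarrow> 'a set set \<Rightarrow> 'a set set \<Rightarrow> bool" where
  "polytopal_mesh \<Omega> Th Fh \<longleftrightarrow>
     finite Th \<and> (\<forall>T\<in>Th. polytopal_set (int DIM('a)) T) \<and> disjoint Th \<and>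
     closure \<Omega> = (\<Union>T\<in>Th. closure T) \<and>
     finite Fh \<and> (\<forall>F\<in>Fh. polytopal_set (int DIM('a) - 1) F) \<and> disjoint Fh \<and>
     (\<forall>F\<in>Fh. (\<exists>T\<in>Th. \<exists>T'\<in>Th. T \<noteq> T' \<and> F \<subseteq> frontier T \<inter> frontier T') \<or>
             (\<exists>T\<in>Th. F \<subseteq> frontier T \<inter> frontier \<Omega>)) \<and>
     (\<Union>T\<in>Th. frontier T) = (\<Union>F\<in>Fh. closure F) \<and>
     (\<forall>T\<in>Th. \<forall>F\<in>cell_faces Fh T. \<exists>n. outward_normal T F n)"

definition face_normals :: "'a::euclidean_space set \<Rightarrow> 'a set set \<Rightarrow> ('a set \<Rightarrow> 'a) \<Rightarrow> bool" where
  "face_normals \<Omega> Fh nF \<longleftrightarrow>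
     (\<forall>F\<in>Fh. norm (nF F) = 1 \<and> (\<forall>x\<in>F. \<forall>y\<in>F. nF F \<bullet> (y - x) = 0)) \<and>
     (\<forall>F\<in>boundary_faces \<Omega> Fh. outward_normal \<Omega> F (nF F))"

text \<open>The simplices of a triangulation are closed, and two of them meet in a common face.\<close>

definition matching_simplicial_submesh ::
  "'a::euclidean_space set \<Rightarrow> 'a set set \<Rightarrow> 'a set set \<Rightarrow> 'a set set \<Rightarrow> bool" where
  "matching_simplicial_submesh \<Omega> Th Fh \<S> \<longleftrightarrow>
     triangulation \<S> \<and> (\<forall>\<tau>\<in>\<S>. int DIM('a) simplex \<tau>) \<and> \<Union>\<S> = closure \<Omega> \<and>
     (\<forall>\<tau>\<in>\<S>. \<exists>T\<in>Th. interior \<tau> \<subseteq> T) \<and>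
     (\<forall>\<tau>\<in>\<S>. \<forall>\<sigma>. \<sigma> facet_of \<tau> \<longrightarrow>
        (\<forall>F\<in>Fh. rel_interior \<sigma> \<inter> F = {} \<or> rel_interior \<sigma> \<subseteq> F))"

definition inradius :: "'a::euclidean_space set \<Rightarrow> real" where
  "inradius S = Sup {r. 0 \<le> r \<and> (\<exists>x. cball x r \<subseteq> S)}"

definition regular_mesh ::
  "real \<Rightarrow> 'a::euclidean_space set \<Rightarrow> 'a set set \<Rightarrow> 'a set set \<Rightarrow> bool" where
  "regular_mesh \<rho> \<Omega> Th Fh \<longleftrightarrow> polytopal_mesh \<Omega> Th Fh \<and>
     (\<exists>\<S>. matching_simplicial_submesh \<Omega> Th Fh \<S> \<and>
        (\<forall>\<tau>\<in>\<S>. \<rho> * diameter \<tau> \<le> inradius \<tau>) \<and>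
        (\<forall>T\<in>Th. \<forall>\<tau>\<in>\<S>. interior \<tau> \<subseteq> T \<longrightarrow> \<rho> * diameter T \<le> diameter \<tau>))"


section \<open>Local seminorms, reconstructions and stabilizations\<close>

text \<open>Throughout, \<open>k\<close> is the polynomial degree, \<open>Fh\<close> the set of mesh faces and \<open>T\<close> a cell.\<close>

type_synonym 'a lV = "('a \<Rightarrow> real) \<times> 'a ffun \<times> 'a ffun"
type_synonym 'a lU = "('a \<Rightarrow> real) \<times> 'a ffun"

text \<open>Normal derivative on the boundary of \<open>T\<close>, as a family indexed by faces.\<close>

definition ndiff :: "'a::euclidean_space set \<Rightarrow> ('a \<Rightarrow> real) \<Rightarrow> 'a ffun" where
  "ndiff T v F x = dderiv (cell_normal T F) v x"

fun semiV_sq :: "'a::euclidean_space set set \<Rightarrow> 'a set \<Rightarrow> 'a lV \<Rightarrow> real" where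
  "semiV_sq Fh T (v, vb, \<eta>) =
     (let dn = (\<lambda>F x. ndiff T v F x - \<eta> F x); dv = (\<lambda>F x. v x - vb F x) in
      hess_inner T v v
      + bd_inner (cell_faces Fh T) dn dn / diameter T
      + bd_inner (cell_faces Fh T) dv dv / diameter T ^ 3)"

fun semiU_sq :: "'a::euclidean_space set set \<Rightarrow> 'a set \<Rightarrow> 'a lU \<Rightarrow> real" where
  "semiU_sq Fh T (u, ub) =
     (let du = (\<lambda>F x. u x - ub F x) in
      L2_inner T (grad u) (grad u) + bd_inner (cell_faces Fh T) du du / diameter T)"

fun recR :: "nat \<Rightarrow> 'a::euclidean_space set set \<Rightarrow> 'a set \<Rightarrow> 'a lV \<Rightarrow> 'a \<Rightarrow> real" where
  "recR k Fh T (v, vb, \<eta>) =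
     (THE r. r \<in> polys (k + 2) \<and>
        (\<forall>w\<in>polys (k + 2).
           hess_inner T r w =
             hess_inner T v w
             + bd_inner (cell_faces Fh T) (\<lambda>F x. v x - vb F x) (ndiff T (laplacian w))
             - bd_inner (cell_faces Fh T) (\<lambda>F x. ndiff T v F x - \<eta> F x)
                 (\<lambda>F. dderiv (cell_normal T F) (dderiv (cell_normal T F) w))
             - bd_inner (cell_faces Fh T)
                 (\<lambda>F. tgrad (cell_normal T F) (\<lambda>x. v x - vb F x))
                 (\<lambda>F. tgrad (cell_normal T F) (dderiv (cell_normal T F) w))) \<and>
        (\<forall>\<xi>\<in>polys 1. L2_inner T r \<xi> = L2_inner T v \<xi>))"

fun recG :: "nat \<Rightarrow> 'a::euclidean_space set set \<Rightarrow> 'a set \<Rightarrow> 'a lU \<Rightarrow> 'a \<Rightarrow> real" where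
  "recG k Fh T (u, ub) =
     (THE g. g \<in> polys (k + 1) \<and>
        (\<forall>w\<in>polys (k + 1).
           L2_inner T (grad g) (grad w) =
             L2_inner T (grad u) (grad w)
             - bd_inner (cell_faces Fh T) (\<lambda>F x. u x - ub F x) (ndiff T w)) \<and>
        L2_inner T g (\<lambda>_. 1) = L2_inner T u (\<lambda>_. 1))"

fun stabV :: "nat \<Rightarrow> 'a::euclidean_space set set \<Rightarrow> 'a set \<Rightarrow> 'a lV \<Rightarrow> 'a lV \<Rightarrow> real" where
  "stabV k Fh T (y, yb, \<gamma>) (v, vb, \<eta>) =
     bd_inner (cell_faces Fh T) (\<lambda>F x. yb F x - y x) (\<lambda>F x. vb F x - v x) / diameter T ^ 3
     + bd_inner (cell_faces Fh T)
         (bd_proj k (cell_faces Fh T) (\<lambda>F x. \<gamma> F x - ndiff T y F x))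
         (bd_proj k (cell_faces Fh T) (\<lambda>F x. \<eta> F x - ndiff T v F x)) / diameter T"

fun stabU :: "nat \<Rightarrow> 'a::euclidean_space set set \<Rightarrow> 'a set \<Rightarrow> 'a lU \<Rightarrow> 'a lU \<Rightarrow> real" where
  "stabU k Fh T (z, zb) (u, ub) =
     bd_inner (cell_faces Fh T)
       (bd_proj k (cell_faces Fh T) (\<lambda>F x. zb F x - z x))
       (bd_proj k (cell_faces Fh T) (\<lambda>F x. ub F x - u x)) / diameter T"


section \<open>Global spaces and bilinear forms\<close>

text \<open>Families indexed by cells and by faces; being extensional, they are determined by the
  discrete functions they stand for.\<close>

type_synonym 'a gV = "'a ffun \<times> 'a ffun \<times> 'a ffun"
type_synonym 'a gU = "'a ffun \<times> 'a ffun"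

definition spaceV ::
  "nat \<Rightarrow> 'a::euclidean_space set \<Rightarrow> 'a set set \<Rightarrow> 'a set set \<Rightarrow> 'a gV set" where
  "spaceV k \<Omega> Th Fh = {(v, vF, \<eta>).
     v \<in> Th \<rightarrow>\<^sub>E polys (k + 2) \<and>
     vF \<in> (\<Pi>\<^sub>E F\<in>Fh. face_polys (k + 2) F) \<and>
     \<eta> \<in> (\<Pi>\<^sub>E F\<in>Fh. face_polys k F) \<and>
     (\<forall>F\<in>boundary_faces \<Omega> Fh. \<forall>x\<in>F. vF F x = 0)}"

definition spaceU ::
  "nat \<Rightarrow> 'a::euclidean_space set \<Rightarrow> 'a set set \<Rightarrow> 'a set set \<Rightarrow> 'a gU set" where
  "spaceU k \<Omega> Th Fh = {(u, uF).
     u \<in> Th \<rightarrow>\<^sub>E polys (k + 1) \<and>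
     uF \<in> (\<Pi>\<^sub>E F\<in>Fh. face_polys k F) \<and>
     (\<forall>F\<in>boundary_faces \<Omega> Fh. \<forall>x\<in>F. uF F x = 0)}"

definition spaceX ::
  "nat \<Rightarrow> 'a::euclidean_space set \<Rightarrow> 'a set set \<Rightarrow> 'a set set \<Rightarrow> ('a gV \<times> 'a gU) set" where
  "spaceX k \<Omega> Th Fh = spaceV k \<Omega> Th Fh \<times> spaceU k \<Omega> Th Fh"

fun localV ::
  "'a::euclidean_space set set \<Rightarrow> ('a set \<Rightarrow> 'a) \<Rightarrow> 'a set \<Rightarrow> 'a gV \<Rightarrow> 'a lV" where
  "localV Fh nF T (v, vF, \<eta>) =
     (v T, restrict vF (cell_faces Fh T),
      \<lambda>F\<in>cell_faces Fh T. \<lambda>x\<in>F. (nF F \<bullet> cell_normal T F) * \<eta> F x)"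

fun localU :: "'a::euclidean_space set set \<Rightarrow> 'a set \<Rightarrow> 'a gU \<Rightarrow> 'a lU" where
  "localU Fh T (u, uF) = (u T, restrict uF (cell_faces Fh T))"

fun normX_sq ::
  "'a::euclidean_space set set \<Rightarrow> 'a set set \<Rightarrow> ('a set \<Rightarrow> 'a) \<Rightarrow> 'a gV \<times> 'a gU \<Rightarrow> real" where
  "normX_sq Th Fh nF (v, u) =
     (\<Sum>T\<in>Th. semiV_sq Fh T (localV Fh nF T v)) + (\<Sum>T\<in>Th. semiU_sq Fh T (localU Fh T u))"

definition formV ::
  "nat \<Rightarrow> 'a::euclidean_space set set \<Rightarrow> 'a set set \<Rightarrow> ('a set \<Rightarrow> 'a) \<Rightarrow> 'a gV \<Rightarrow> 'a gV \<Rightarrow> real" where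
  "formV k Th Fh nF y v =
     (\<Sum>T\<in>Th. hess_inner T (recR k Fh T (localV Fh nF T y)) (recR k Fh T (localV Fh nF T v))
              + stabV k Fh T (localV Fh nF T y) (localV Fh nF T v))"

definition formU ::
  "nat \<Rightarrow> 'a::euclidean_space set set \<Rightarrow> 'a set set \<Rightarrow> 'a gU \<Rightarrow> 'a gU \<Rightarrow> real" where
  "formU k Th Fh z u =
     (\<Sum>T\<in>Th. L2_inner T (grad (recG k Fh T (localU Fh T z))) (grad (recG k Fh T (localU Fh T u)))
              + stabU k Fh T (localU Fh T z) (localU Fh T u))"

text \<open>The piecewise polynomial function on the domain given by its restrictions to the cells.\<close>

definition broken :: "'a::euclidean_space set set \<Rightarrow> 'a ffun \<Rightarrow> 'a \<Rightarrow> real" where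
  "broken Th v x = (\<Sum>T\<in>Th. indicator T x * v T x)"

fun formA ::
  "real \<Rightarrow> nat \<Rightarrow> 'a::euclidean_space set \<Rightarrow> 'a set set \<Rightarrow> 'a set set \<Rightarrow> ('a set \<Rightarrow> 'a) \<Rightarrow>
   'a gV \<times> 'a gU \<Rightarrow> 'a gV \<times> 'a gU \<Rightarrow> real" where
  "formA \<kappa> k \<Omega> Th Fh nF (y, z) (v, u) =
     formV k Th Fh nF y v
     - L2_inner \<Omega> (broken Th (fst z)) (broken Th (fst v))
     + L2_inner \<Omega> (broken Th (fst y)) (broken Th (fst u))
     + \<kappa> * formU k Th Fh z u"

end

theory Submission
  imports Defs "HOL-Library.Function_Algebras"
begin

text \<open>Coercivity. With equal arguments the two coupling terms of the form cancel, so what is left is a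
  sum over the cells, and it suffices to bound the local seminorms by the local forms on each
  cell, with a constant that depends only on the dimension, on \<open>\<rho>\<close> and on the
  degree. The Hessian of the cell unknown \<open>v\<close> is bounded by testing the equation of
  the reconstruction with \<open>w = v\<close>: the boundary terms are pairings of the differences
  of traces with derivatives of \<open>v\<close> of order at least two, and inverse and trace
  inequalities bound the latter by the Hessian, so that they are absorbed (\<open>absorb\<close>).
  The stabilization only sees the projection to degree \<open>k\<close> of the difference of the
  normal derivatives, but this difference is paired with the second normal derivative of
  \<open>v\<close>, which has degree \<open>k\<close>. The full difference is recovered
  afterwards: the projection is a best approximation (\<open>Pr_best\<close>), and the normal
  derivative differs from its value at an interior point by a quantity that the Hessian bounds
  (\<open>coercive_V\<close>). The second-order part is the same argument with one derivative
  fewer (\<open>coercive_U\<close>).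

  Inequalities for polynomials. All inverse and trace inequalities come from one fact: values and
  derivatives of a polynomial on a ball are bounded by its \<open>L\<^sup>2\<close> norm on a
  smaller ball, with constants independent of the balls after rescaling
  (\<open>poly_bound\<close>). A cell contains a ball and is contained in a ball, both of radius
  comparable to its diameter. Each of its faces contains a disc of comparable radius, because it
  contains a facet of a simplex of the submesh (\<open>face_contains_facet\<close>,
  \<open>simplex_facet_disc\<close>), and the number of its faces is bounded by comparing volumes
  (\<open>card_cell_faces\<close>). Surface integrals are turned into volume integrals over
  cylinders of height comparable to the diameter (\<open>cyl_integral_linear\<close>).

  Well-posedness. The discrete problem is a linear system of finite dimension, square since trial
  and test space agree, so it is uniquely solvable if the form is definite
  (\<open>psd_solve\<close>). By coercivity this holds once the seminorm vanishes only at zero.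
  Where it vanishes, the cell unknowns are affine, and two of them coincide if their cells share a
  face. A generic line through the cells that carry a given affine function leaves their union at
  both ends through the boundary of the domain, where the function is zero; so the function
  vanishes on almost every such line (\<open>affine_zero\<close>, \<open>kernel\<close>).\<close>

section \<open>Linear algebra\<close>

instantiation "fun" :: (type, real_vector) real_vector
begin

definition scaleR_fun :: "real \<Rightarrow> ('a \<Rightarrow> 'b) \<Rightarrow> 'a \<Rightarrow> 'b" where
  "scaleR_fun c f = (\<lambda>x. c *\<^sub>R f x)"

instance
  by standard (auto simp: scaleR_fun_def fun_eq_iff algebra_simps)

end

lemma scaleR_fun_apply [simp]: "(c *\<^sub>R f) x = c *\<^sub>R f x"
  by (simp add: scaleR_fun_def)

text \<open>Derivatives of arbitrary functions are not additive, so linearity is only claimed on a subspace,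
  such as the polynomials of bounded degree.\<close>

definition lin_on :: "'v::real_vector set \<Rightarrow> ('v \<Rightarrow> 'w::real_vector) \<Rightarrow> bool" where
  "lin_on V f \<longleftrightarrow> (\<forall>x\<in>V. \<forall>y\<in>V. f (x + y) = f x + f y) \<and> (\<forall>x\<in>V. \<forall>c. f (c *\<^sub>R x) = c *\<^sub>R f x)"

definition bilin_on :: "'v::real_vector set \<Rightarrow> ('v \<Rightarrow> 'v \<Rightarrow> real) \<Rightarrow> bool" where
  "bilin_on V b \<longleftrightarrow> (\<forall>x\<in>V. lin_on V (b x)) \<and> (\<forall>x\<in>V. lin_on V (\<lambda>y. b y x))"

lemma lin_onI:
  assumes "\<And>x y. x \<in> V \<Longrightarrow> y \<in> V \<Longrightarrow> f (x + y) = f x + f y"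
    and "\<And>x c. x \<in> V \<Longrightarrow> f (c *\<^sub>R x) = c *\<^sub>R f x"
  shows "lin_on V f"
  using assms by (simp add: lin_on_def)

lemma lin_on_add: "lin_on V f \<Longrightarrow> x \<in> V \<Longrightarrow> y \<in> V \<Longrightarrow> f (x + y) = f x + f y"
  and lin_on_scale: "lin_on V f \<Longrightarrow> x \<in> V \<Longrightarrow> f (c *\<^sub>R x) = c *\<^sub>R f x"
  by (simp_all add: lin_on_def)

lemma lin_on_zero: "lin_on V f \<Longrightarrow> subspace V \<Longrightarrow> f 0 = 0"
  using lin_on_scale[of V f 0 0] by (simp add: subspace_0)

lemma lin_on_diff:
  assumes "lin_on V f" "subspace V" "x \<in> V" "y \<in> V"
  shows "f (x - y) = f x - f y"
proof -
  have "f (x + (-1) *\<^sub>R y) = f x + (-1) *\<^sub>R f y"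
    using assms lin_on_add[OF assms(1), of x "(-1) *\<^sub>R y"] lin_on_scale[OF assms(1), of y "-1"]
    by (metis subspace_scale)
  then show ?thesis by simp
qed

lemma lin_on_mono: "lin_on V f \<Longrightarrow> W \<subseteq> V \<Longrightarrow> lin_on W f"
  unfolding lin_on_def by blast

lemma bilin_onI:
  assumes "\<And>x. x \<in> V \<Longrightarrow> lin_on V (b x)" "\<And>x. x \<in> V \<Longrightarrow> lin_on V (\<lambda>y. b y x)"
  shows "bilin_on V b"
  using assms by (simp add: bilin_on_def)

lemma bilin_on_mono: "bilin_on V b \<Longrightarrow> W \<subseteq> V \<Longrightarrow> bilin_on W b"
  by (auto simp: bilin_on_def intro: lin_on_mono)

lemma bilin_onD:
  assumes "bilin_on V b" "x \<in> V"
  shows "lin_on V (b x)" "lin_on V (\<lambda>y. b y x)"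
  using assms by (auto simp: bilin_on_def)

lemma lin_on_compose:
  assumes "lin_on V f" "\<And>x. x \<in> V \<Longrightarrow> f x \<in> W" "lin_on W g"
  shows "lin_on V (\<lambda>x. g (f x))"
  using assms by (auto simp: lin_on_def)

lemma lin_on_plus: "lin_on V f \<Longrightarrow> lin_on V g \<Longrightarrow> lin_on V (\<lambda>x. f x + g x)"
  by (simp add: lin_on_def algebra_simps)

lemma lin_on_minus:
  fixes f g :: "'v::real_vector \<Rightarrow> 'w::real_vector"
  shows "lin_on V f \<Longrightarrow> lin_on V g \<Longrightarrow> lin_on V (\<lambda>x. f x - g x)"
  by (simp add: lin_on_def algebra_simps)

lemma lin_on_divide:
  fixes f :: "'v::real_vector \<Rightarrow> real"
  shows "lin_on V f \<Longrightarrow> lin_on V (\<lambda>x. f x / c)"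
  by (simp add: lin_on_def add_divide_distrib)

lemma bilin_on_pullback:
  assumes "bilin_on W b" "lin_on V A" "\<And>x. x \<in> V \<Longrightarrow> A x \<in> W"
  shows "bilin_on V (\<lambda>x y. b (A x) (A y))"
proof (rule bilin_onI)
  fix x assume "x \<in> V"
  then have x: "A x \<in> W" by (rule assms(3))
  show "lin_on V (\<lambda>y. b (A x) (A y))"
    by (rule lin_on_compose[OF assms(2) _ bilin_onD(1)[OF assms(1) x]]) (rule assms(3))
  show "lin_on V (\<lambda>y. b (A y) (A x))"
    by (rule lin_on_compose[OF assms(2) _ bilin_onD(2)[OF assms(1) x]]) (rule assms(3))
qed

lemma lin_on_cong:
  assumes "lin_on V f" "subspace V" "\<And>x. x \<in> V \<Longrightarrow> g x = f x"
  shows "lin_on V g"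
proof (rule lin_onI)
  fix x y assume V: "x \<in> V" "y \<in> V"
  then show "g (x + y) = g x + g y"
    using subspace_add[OF assms(2) V] by (simp add: assms(3) lin_on_add[OF assms(1)])
next
  fix x c assume V: "x \<in> V"
  then show "g (c *\<^sub>R x) = c *\<^sub>R g x"
    using subspace_scale[OF assms(2) V] by (simp add: assms(3) lin_on_scale[OF assms(1)])
qed

lemma bilin_on_cong:
  assumes "bilin_on V b" "subspace V" "\<And>x y. x \<in> V \<Longrightarrow> y \<in> V \<Longrightarrow> b' x y = b x y"
  shows "bilin_on V b'"
  using assms(3)
  by (intro bilin_onI lin_on_cong[OF bilin_onD(1)[OF assms(1)] assms(2)]
      lin_on_cong[OF bilin_onD(2)[OF assms(1)] assms(2)]) auto

lemma lin_on_sum_fun: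
  fixes f :: "'i \<Rightarrow> 'v::real_vector \<Rightarrow> real"
  assumes "\<And>i. i \<in> I \<Longrightarrow> lin_on V (f i)"
  shows "lin_on V (\<lambda>x. \<Sum>i\<in>I. f i x)"
  using assms by (simp add: lin_on_def sum.distrib sum_distrib_left)

lemma bilin_on_sum:
  assumes "\<And>i. i \<in> I \<Longrightarrow> bilin_on V (b i)"
  shows "bilin_on V (\<lambda>x y. \<Sum>i\<in>I. b i x y)"
  using assms by (intro bilin_onI lin_on_sum_fun) (auto intro: bilin_onD)

lemma span_insertE:
  assumes "z \<in> span (insert x B)"
  obtains v t where "v \<in> span B" "z = v + t *\<^sub>R x"
proof -
  obtain t where t: "z - t *\<^sub>R x \<in> span B" using assms by (auto simp: span_insert)
  show ?thesis by (rule that[OF t, of t]) simp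
qed

text \<open>Induction on the spanning set as in the Gram--Schmidt process. As \<open>b\<close> need not be
  symmetric, the new vector is made orthogonal to the previous ones once from the left and once
  from the right, by solving with \<open>b\<close> and with its transpose; the two corrected
  vectors differ by an element of the old span, so \<open>b\<close> takes the same value on them
  and between them. Degenerate directions are allowed as long as the right-hand side vanishes on
  them: the Hessian does not see affine functions, and different polynomials can have the same
  restriction to a face.\<close>

lemma psd_solve:
  fixes b :: "'v::real_vector \<Rightarrow> 'v \<Rightarrow> real"
  assumes "finite B" "bilin_on (span B) b"
    and "\<And>p q. p \<in> span B \<Longrightarrow> q \<in> span B \<Longrightarrow> b p p = 0 \<Longrightarrow> b p q = 0 \<and> b q p = 0"
    and "lin_on (span B) \<phi>" "\<And>p. p \<in> span B \<Longrightarrow> b p p = 0 \<Longrightarrow> \<phi> p = 0"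
  shows "\<exists>w\<in>span B. \<forall>v\<in>span B. b w v = \<phi> v"
  using assms
proof (induction B arbitrary: b \<phi> rule: finite_induct)
  case empty
  then have "\<phi> 0 = 0" "b 0 0 = 0"
    using lin_on_zero[of "{0}" \<phi>] lin_on_zero[of "{0}" "b 0"] subspace_span[of "{}"]
    by (auto simp: bilin_on_def)
  then show ?case by simp
next
  case (insert x B)
  let ?V = "span B" and ?W = "span (insert x B)"
  have sub: "?V \<subseteq> ?W" by (rule span_mono) auto
  have xW: "x \<in> ?W" by (simp add: span_base)
  have sW: "subspace ?W" by (rule subspace_span)
  have bV: "bilin_on ?V b" using insert.prems(1) sub by (rule bilin_on_mono)
  note b1 = bilin_onD(1)[OF insert.prems(1)] and b2 = bilin_onD(2)[OF insert.prems(1)]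
  have degV: "b p q = 0 \<and> b q p = 0" if "p \<in> ?V" "q \<in> ?V" "b p p = 0" for p q
    using insert.prems(2)[of p q] that sub by auto
  have rx: "b p x = 0 \<and> b x p = 0" if "p \<in> ?V" "b p p = 0" for p
    using insert.prems(2)[OF _ xW that(2)] that(1) sub by blast
  have "\<exists>p\<in>?V. \<forall>v\<in>?V. b p v = b x v"
    by (rule insert.IH[OF bV degV lin_on_mono[OF b1[OF xW] sub]]) (use rx in blast)+
  then obtain p where p: "p \<in> ?V" "\<And>v. v \<in> ?V \<Longrightarrow> b p v = b x v" by blast
  have "\<exists>q\<in>?V. \<forall>v\<in>?V. (\<lambda>y z. b z y) q v = b v x"
  proof (rule insert.IH)
    show "bilin_on ?V (\<lambda>y z. b z y)" using bV by (auto simp: bilin_on_def)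
    show "lin_on ?V (\<lambda>v. b v x)" using lin_on_mono[OF b2[OF xW] sub] .
    show "b q p = 0 \<and> b p q = 0" if "p \<in> ?V" "q \<in> ?V" "b p p = 0" for p q
      using degV[OF that] by blast
    show "b p x = 0" if "p \<in> ?V" "b p p = 0" for p using rx[OF that] by blast
  qed
  then obtain q where q: "q \<in> ?V" "\<And>v. v \<in> ?V \<Longrightarrow> b v q = b v x" by blast
  have "\<exists>w\<in>?V. \<forall>v\<in>?V. b w v = \<phi> v"
    by (rule insert.IH[OF bV degV lin_on_mono[OF insert.prems(3) sub]])
      (use insert.prems(4) sub in blast)+
  then obtain w0 where w0: "w0 \<in> ?V" "\<And>v. v \<in> ?V \<Longrightarrow> b w0 v = \<phi> v" by blast
  define x1 x2 where "x1 = x - p" and "x2 = x - q"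
  have x1W: "x1 \<in> ?W" and x2W: "x2 \<in> ?W"
    using xW p(1) q(1) sub by (auto simp: x1_def x2_def intro!: subspace_diff[OF sW])
  have x1: "b x1 v = 0" if "v \<in> ?V" for v
    using lin_on_diff[OF b2[of v] sW xW, of p] p that sub by (auto simp: x1_def)
  have x2: "b v x2 = 0" if "v \<in> ?V" for v
    using lin_on_diff[OF b1[of v] sW xW, of q] q that sub by (auto simp: x2_def)
  define d where "d = p - q"
  have dV: "d \<in> ?V" using p q by (auto simp: d_def intro: span_diff)
  have x2_eq: "x2 = x1 + d" by (simp add: x1_def x2_def d_def)
  have b12: "b x1 x2 = b x1 x1"
    using lin_on_add[OF b1[OF x1W] x1W, of d] dV sub x1[OF dV] x2_eq by auto
  have b22: "b x2 x2 = b x1 x2"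
    using lin_on_add[OF b2[OF x2W] x1W, of d] dV sub x2[OF dV] x2_eq by auto
  define t where "t = (if b x1 x1 = 0 then 0 else \<phi> x2 / b x1 x1)"
  have t: "t * b x1 x2 = \<phi> x2"
    using insert.prems(4)[OF x2W] b12 b22 by (auto simp: t_def)
  have txW: "t *\<^sub>R x1 \<in> ?W" using x1W sW by (rule subspace_scale[rotated])
  show ?case
  proof (intro bexI[of _ "w0 + t *\<^sub>R x1"] ballI)
    show "w0 + t *\<^sub>R x1 \<in> ?W" using w0(1) sub txW sW by (auto intro: subspace_add)
    fix z assume "z \<in> ?W"
    then obtain v s where z: "v \<in> ?V" "z = v + s *\<^sub>R x" by (rule span_insertE)
    define v' where "v' = v + s *\<^sub>R q"
    have v': "v' \<in> ?V" "z = v' + s *\<^sub>R x2"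
      using z q(1) by (auto simp: v'_def x2_def algebra_simps intro: span_add span_scale)
    then have v'W: "v' \<in> ?W" and w0W: "w0 \<in> ?W" using sub w0 by auto
    have sx: "s *\<^sub>R x2 \<in> ?W" using x2W sW by (rule subspace_scale[rotated])
    have e: "b y (v' + s *\<^sub>R x2) = b y v' + s * b y x2" if "y \<in> ?W" for y
      using lin_on_add[OF b1[OF that] v'W sx] lin_on_scale[OF b1[OF that] x2W, of s] by simp
    have f: "b (w0 + t *\<^sub>R x1) y = b w0 y + t * b x1 y" if "y \<in> ?W" for y
      using lin_on_add[OF b2[OF that] w0W txW] lin_on_scale[OF b2[OF that] x1W, of t] by simp
    have "\<phi> z = \<phi> v' + s * \<phi> x2"
      using lin_on_add[OF insert.prems(3) v'W sx] lin_on_scale[OF insert.prems(3) x2W, of s] v'(2)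
      by simp
    moreover have "b (w0 + t *\<^sub>R x1) z = b w0 v' + s * b w0 x2 + t * (b x1 v' + s * b x1 x2)"
      using f[of z] e[OF w0W] e[OF x1W] \<open>z \<in> ?W\<close> v'(2) by simp
    moreover have "\<dots> = \<phi> v' + s * \<phi> x2"
      using w0(2)[OF v'(1)] x1[OF v'(1)] x2[OF w0(1)] t by (simp add: algebra_simps)
    ultimately show "b (w0 + t *\<^sub>R x1) z = \<phi> z" by simp
  qed
qed

locale psd_form =
  fixes V :: "'v::real_vector set" and b :: "'v \<Rightarrow> 'v \<Rightarrow> real"
  assumes subsp: "subspace V" and bilin: "bilin_on V b"
    and sym: "x \<in> V \<Longrightarrow> y \<in> V \<Longrightarrow> b x y = b y x"
    and nonneg: "x \<in> V \<Longrightarrow> 0 \<le> b x x"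
begin

lemma lin1: "x \<in> V \<Longrightarrow> lin_on V (b x)" and lin2: "x \<in> V \<Longrightarrow> lin_on V (\<lambda>y. b y x)"
  using bilin by (auto simp: bilin_on_def)

lemma expand:
  assumes "x \<in> V" "y \<in> V"
  shows "b (x + t *\<^sub>R y) (x + t *\<^sub>R y) = b x x + 2 * t * b x y + t\<^sup>2 * b y y"
proof -
  have ty: "t *\<^sub>R y \<in> V" and xy: "x + t *\<^sub>R y \<in> V"
    using assms subsp by (auto intro: subspace_add subspace_scale)
  have "b (x + t *\<^sub>R y) (x + t *\<^sub>R y) = b (x + t *\<^sub>R y) x + t * b (x + t *\<^sub>R y) y"
    using lin_on_add[OF lin1[OF xy] assms(1) ty] lin_on_scale[OF lin1[OF xy] assms(2), of t] by simp
  also have "\<dots> = b x x + t * b y x + t * (b x y + t * b y y)"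
    using lin_on_add[OF lin2[OF assms(1)] assms(1) ty] lin_on_scale[OF lin2[OF assms(1)] assms(2), of t]
      lin_on_add[OF lin2[OF assms(2)] assms(1) ty] lin_on_scale[OF lin2[OF assms(2)] assms(2), of t]
    by simp
  finally show ?thesis using sym[OF assms] by (simp add: power2_eq_square algebra_simps)
qed

lemma cauchy_schwarz:
  assumes "x \<in> V" "y \<in> V"
  shows "(b x y)\<^sup>2 \<le> b x x * b y y"
proof -
  have q: "0 \<le> b x x + 2 * t * b x y + t\<^sup>2 * b y y" for t
    using nonneg[of "x + t *\<^sub>R y"] assms subsp
    by (simp add: expand subspace_add subspace_scale)
  show ?thesis
  proof (cases "b y y = 0")
    case True
    have "b x y = 0"
    proof (rule ccontr)
      assume "b x y \<noteq> 0"
      then show False using q[of "- (b x x + 1) / (2 * b x y)"] True by (simp add: field_simps)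
    qed
    then show ?thesis using True by simp
  next
    case False
    then have pos: "0 < b y y" using nonneg[OF assms(2)] by simp
    have "0 \<le> b x x - (b x y)\<^sup>2 / b y y"
      using q[of "- b x y / b y y"] pos by (simp add: power2_eq_square field_simps)
    then show ?thesis using pos by (simp add: field_simps)
  qed
qed

lemma radical: "x \<in> V \<Longrightarrow> y \<in> V \<Longrightarrow> b x x = 0 \<Longrightarrow> b x y = 0 \<and> b y x = 0"
  using cauchy_schwarz[of x y] sym[of x y] by auto

lemma add_sq_le:
  assumes "x \<in> V" "y \<in> V"
  shows "b (x + y) (x + y) \<le> 2 * b x x + 2 * b y y"
proof -
  have "0 \<le> b (x + (- 1) *\<^sub>R y) (x + (- 1) *\<^sub>R y)"
    using assms subsp by (intro nonneg subspace_add subspace_scale)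
  then show ?thesis using expand[OF assms, of 1] expand[OF assms, of "- 1"] by simp
qed

lemma pythagoras_le:
  assumes "x \<in> V" "y \<in> V" "b x y = 0"
  shows "b x x \<le> b (x + y) (x + y)"
  using expand[OF assms(1,2), of 1] assms(3) nonneg[OF assms(2)] by simp

end

lemma psd_form_pullback_sum:
  assumes "psd_form W b" "subspace V" "\<And>i x. i \<in> I \<Longrightarrow> x \<in> V \<Longrightarrow> A i x \<in> W" "\<And>i. i \<in> I \<Longrightarrow> lin_on V (A i)"
  shows "psd_form V (\<lambda>x y. \<Sum>i\<in>I. b (A i x) (A i y))"
proof -
  interpret psd_form W b by fact
  show ?thesis
  proof
    show "bilin_on V (\<lambda>x y. \<Sum>i\<in>I. b (A i x) (A i y))"
    proof (rule bilin_onI; rule lin_onI)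
      fix x y z assume V: "x \<in> V" "y \<in> V" "z \<in> V"
      show "(\<Sum>i\<in>I. b (A i x) (A i (y + z))) = (\<Sum>i\<in>I. b (A i x) (A i y)) + (\<Sum>i\<in>I. b (A i x) (A i z))"
        using assms(3)[OF _ V(1)] assms(3)[OF _ V(2)] assms(3)[OF _ V(3)]
        by (simp add: lin_on_add[OF assms(4) V(2,3)] lin_on_add[OF lin1] sum.distrib cong: sum.cong)
      show "(\<Sum>i\<in>I. b (A i (y + z)) (A i x)) = (\<Sum>i\<in>I. b (A i y) (A i x)) + (\<Sum>i\<in>I. b (A i z) (A i x))"
        using assms(3)[OF _ V(1)] assms(3)[OF _ V(2)] assms(3)[OF _ V(3)]
        by (simp add: lin_on_add[OF assms(4) V(2,3)] lin_on_add[OF lin2] sum.distrib cong: sum.cong)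
    next
      fix x y c assume V: "x \<in> V" "y \<in> V"
      show "(\<Sum>i\<in>I. b (A i x) (A i (c *\<^sub>R y))) = c *\<^sub>R (\<Sum>i\<in>I. b (A i x) (A i y))"
        using assms(3)[OF _ V(1)] assms(3)[OF _ V(2)]
        by (simp add: lin_on_scale[OF assms(4) V(2)] lin_on_scale[OF lin1] sum_distrib_left cong: sum.cong)
      show "(\<Sum>i\<in>I. b (A i (c *\<^sub>R y)) (A i x)) = c *\<^sub>R (\<Sum>i\<in>I. b (A i y) (A i x))"
        using assms(3)[OF _ V(1)] assms(3)[OF _ V(2)]
        by (simp add: lin_on_scale[OF assms(4) V(2)] lin_on_scale[OF lin2] sum_distrib_left cong: sum.cong)
    qed
    show "(\<Sum>i\<in>I. b (A i x) (A i y)) = (\<Sum>i\<in>I. b (A i y) (A i x))" if "x \<in> V" "y \<in> V" for x y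
      using assms(3) that by (intro sum.cong refl sym) auto
    show "0 \<le> (\<Sum>i\<in>I. b (A i x) (A i x))" if "x \<in> V" for x
      using assms(3) that by (intro sum_nonneg nonneg) auto
  qed (rule assms(2))
qed

lemma psd_form_cong:
  assumes "psd_form V b" "\<And>x y. x \<in> V \<Longrightarrow> y \<in> V \<Longrightarrow> b' x y = b x y"
  shows "psd_form V b'"
proof -
  interpret psd_form V b by fact
  have add: "x + y \<in> V" if "x \<in> V" "y \<in> V" for x y using that subsp by (rule subspace_add[rotated])
  have scale: "c *\<^sub>R x \<in> V" if "x \<in> V" for x c using that subsp by (rule subspace_scale[rotated])
  show ?thesis
  proof
    show "bilin_on V b'"
    proof (rule bilin_onI; rule lin_onI)
      fix x y z assume V: "x \<in> V" "y \<in> V" "z \<in> V"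
      show "b' x (y + z) = b' x y + b' x z"
        using V add by (simp add: assms(2) lin_on_add[OF lin1])
      show "b' (y + z) x = b' y x + b' z x"
        using V add by (simp add: assms(2) lin_on_add[OF lin2])
    next
      fix x y c assume V: "x \<in> V" "y \<in> V"
      show "b' x (c *\<^sub>R y) = c *\<^sub>R b' x y" using V scale by (simp add: assms(2) lin_on_scale[OF lin1])
      show "b' (c *\<^sub>R y) x = c *\<^sub>R b' y x" using V scale by (simp add: assms(2) lin_on_scale[OF lin2])
    qed
  qed (use subsp sym nonneg assms(2) in auto)
qed

text \<open>One vector is added at a time, and the functionals are bounded separately on the old span and on
  the part of the new vector that is orthogonal to it. The constant is uniform over the family of
  functionals, which serves to bound the values at all points of a ball at once.\<close>

lemma psd_bound:
  fixes b :: "'v::real_vector \<Rightarrow> 'v \<Rightarrow> real" and \<phi> :: "'i \<Rightarrow> 'v \<Rightarrow> real"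
  assumes "finite B" "psd_form (span B) b"
    and "\<And>i. i \<in> I \<Longrightarrow> lin_on (span B) (\<phi> i)"
    and "\<And>i p. i \<in> I \<Longrightarrow> p \<in> span B \<Longrightarrow> b p p = 0 \<Longrightarrow> \<phi> i p = 0"
    and "\<And>p. p \<in> span B \<Longrightarrow> \<exists>M. \<forall>i\<in>I. \<bar>\<phi> i p\<bar> \<le> M"
  shows "\<exists>C\<ge>0. \<forall>i\<in>I. \<forall>p\<in>span B. (\<phi> i p)\<^sup>2 \<le> C * b p p"
  using assms
proof (induction B rule: finite_induct)
  case empty
  then have "\<phi> i 0 = 0" if "i \<in> I" for i
    using lin_on_zero[of "{0}" "\<phi> i"] subspace_span[of "{}"] that by auto
  moreover have "b 0 0 = 0" using empty.prems(1)
    by (metis lin_on_zero psd_form.lin1 psd_form.subsp span_zero)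
  ultimately show ?case by (auto intro: exI[of _ 0])
next
  case (insert x B)
  let ?V = "span B" and ?W = "span (insert x B)"
  have sub: "?V \<subseteq> ?W" by (rule span_mono) auto
  interpret W: psd_form ?W b by (rule insert.prems)
  have xW: "x \<in> ?W" by (simp add: span_base)
  have V: "psd_form ?V b"
    using sub bilin_on_mono[OF W.bilin sub] W.sym W.nonneg
    by (unfold_locales) (auto simp: subset_iff)
  then interpret V: psd_form ?V b .
  have "\<exists>C\<ge>0. \<forall>i\<in>I. \<forall>p\<in>?V. (\<phi> i p)\<^sup>2 \<le> C * b p p"
  proof (rule insert.IH[OF V])
    show "lin_on ?V (\<phi> i)" if "i \<in> I" for i using insert.prems(2)[OF that] sub by (rule lin_on_mono)
  qed (use sub insert.prems(3,4) in auto)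
  then obtain C where C: "0 \<le> C" "\<And>i p. i \<in> I \<Longrightarrow> p \<in> ?V \<Longrightarrow> (\<phi> i p)\<^sup>2 \<le> C * b p p" by blast
  have "\<exists>p\<in>?V. \<forall>v\<in>?V. b p v = b x v"
    by (rule psd_solve[OF insert.hyps(1) V.bilin V.radical lin_on_mono[OF W.lin1[OF xW] sub]])
      (use W.radical[OF _ xW] sub in blast)+
  then obtain p where p: "p \<in> ?V" "\<And>v. v \<in> ?V \<Longrightarrow> b p v = b x v" by blast
  define y where "y = x - p"
  have yW: "y \<in> ?W" using xW p(1) sub by (auto simp: y_def intro: span_diff)
  have yV: "b v y = 0" if "v \<in> ?V" for v
    using lin_on_diff[OF W.lin2[of v] W.subsp xW, of p] p that sub W.sym[OF yW, of v]
    by (auto simp: y_def)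
  obtain M where M: "\<forall>i\<in>I. \<bar>\<phi> i y\<bar> \<le> M" using insert.prems(4)[OF yW] by blast
  define D where "D = (if b y y = 0 then 0 else 2 * M\<^sup>2 / b y y)"
  have D0: "0 \<le> D" using W.nonneg[OF yW] by (auto simp: D_def)
  have D: "2 * (\<phi> i y)\<^sup>2 \<le> D * b y y" if "i \<in> I" for i
  proof (cases "b y y = 0")
    case True
    then show ?thesis using insert.prems(3)[OF that yW] by simp
  next
    case False
    have "(\<phi> i y)\<^sup>2 \<le> M\<^sup>2" using M that by (metis abs_ge_zero power2_abs power_mono)
    then show ?thesis using False by (simp add: D_def)
  qed
  show ?case
  proof (intro exI[of _ "2 * C + D"] conjI ballI)
    fix i z assume i: "i \<in> I" and "z \<in> ?W"
    then obtain v' t where "v' \<in> ?V" "z = v' + t *\<^sub>R x" by (metis span_insertE)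
    then obtain v where v: "v \<in> ?V" "z = v + t *\<^sub>R y"
      using p(1) that[of "v' + t *\<^sub>R p"] by (auto simp: y_def algebra_simps intro: span_add span_scale)
    have vW: "v \<in> ?W" using v sub by auto
    have "\<phi> i z = \<phi> i v + t * \<phi> i y"
      using insert.prems(2)[OF i] vW yW v(2) W.subsp
      by (simp add: lin_on_add lin_on_scale subspace_scale)
    then have "(\<phi> i z)\<^sup>2 \<le> 2 * (\<phi> i v)\<^sup>2 + t\<^sup>2 * (2 * (\<phi> i y)\<^sup>2)"
      using sum_squares_ge_zero[of "\<phi> i v - t * \<phi> i y" 0]
      by (simp add: power2_eq_square algebra_simps)
    also have "\<dots> \<le> 2 * (C * b v v) + t\<^sup>2 * (D * b y y)"
      using C(2)[OF i v(1)] D[OF i] by (intro add_mono mult_left_mono) auto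
    also have "\<dots> \<le> (2 * C + D) * (b v v + t\<^sup>2 * b y y)"
      using C(1) D0 W.nonneg[OF vW] W.nonneg[OF yW] by (simp add: algebra_simps)
    also have "b v v + t\<^sup>2 * b y y = b z z"
      using W.expand[OF vW yW, of t] yV[OF v(1)] v(2) by simp
    finally show "(\<phi> i z)\<^sup>2 \<le> (2 * C + D) * b z z" .
  qed (use C(1) D0 in auto)
qed

definition fin_dim :: "'v::real_vector set \<Rightarrow> bool" where
  "fin_dim V \<longleftrightarrow> (\<exists>B. finite B \<and> V = span B)"

lemma fin_dim_subspace: "fin_dim V \<Longrightarrow> subspace V"
  by (auto simp: fin_dim_def)

lemma fin_dim_sub:
  assumes "fin_dim V" "subspace W" "W \<subseteq> V"
  shows "fin_dim W"
proof -
  obtain B where B: "finite B" "V = span B" using assms by (auto simp: fin_dim_def)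
  obtain A where A: "A \<subseteq> W" "independent A" "W \<subseteq> span A" by (rule maximal_independent_subset)
  have "finite A" using independent_span_bound[OF B(1) A(2)] A(1) assms(3) B(2) by auto
  moreover have "W = span A" using A assms(2) by (metis span_minimal subset_antisym)
  ultimately show ?thesis by (auto simp: fin_dim_def)
qed

lemma lin_on_image_span:
  assumes "lin_on (span B) f"
  shows "f ` span B = span (f ` B)"
proof
  have "x \<in> span B \<and> f x \<in> span (f ` B)" if "x \<in> span B" for x
    using that
  proof (induction rule: span_induct_alt)
    case base
    then show ?case using lin_on_zero[OF assms] by (simp add: span_zero)
  next
    case (step c x y)
    have x: "x \<in> span B" "f x \<in> span (f ` B)" using step by (simp_all add: span_base)
    then have "f (c *\<^sub>R x + y) = c *\<^sub>R f x + f y"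
      using step lin_on_add[OF assms, of "c *\<^sub>R x" y] lin_on_scale[OF assms, of x c]
      by (simp add: span_scale)
    then show ?case using step x by (simp add: span_scale span_add)
  qed
  then show "f ` span B \<subseteq> span (f ` B)" by auto
  have "subspace (f ` span B)"
  proof (rule subspaceI)
    show "0 \<in> f ` span B" using lin_on_zero[OF assms] by (force simp: span_zero)
  next
    fix x y assume "x \<in> f ` span B" "y \<in> f ` span B"
    then show "x + y \<in> f ` span B" by (auto simp flip: lin_on_add[OF assms] intro: span_add)
  next
    fix c x assume "x \<in> f ` span B"
    then show "c *\<^sub>R x \<in> f ` span B" by (auto simp flip: lin_on_scale[OF assms] intro: span_scale)
  qed
  then show "span (f ` B) \<subseteq> f ` span B" by (intro span_minimal image_mono span_superset)
qed

lemma fin_dim_image: "fin_dim V \<Longrightarrow> lin_on V f \<Longrightarrow> fin_dim (f ` V)"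
  unfolding fin_dim_def using lin_on_image_span by blast

lemma fin_dim_Times:
  assumes "fin_dim V" "fin_dim W"
  shows "fin_dim (V \<times> W)"
proof -
  obtain A B where A: "finite A" "V = span A" and B: "finite B" "W = span B"
    using assms by (auto simp: fin_dim_def)
  let ?C = "(\<lambda>x. (x, 0)) ` A \<union> (\<lambda>y. (0, y)) ` B"
  have "lin_on V (\<lambda>x. (x, 0::'b))" "lin_on W (\<lambda>y. (0::'a, y))" by (auto simp: lin_on_def)
  then have i: "(\<lambda>x. (x, 0::'b)) ` V = span ((\<lambda>x. (x, 0)) ` A)"
    "(\<lambda>y. (0::'a, y)) ` W = span ((\<lambda>y. (0, y)) ` B)"
    using A B lin_on_image_span by blast+
  have "(x, y) \<in> span ?C" if "x \<in> V" "y \<in> W" for x y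
  proof -
    have "(x, 0) \<in> span ?C" "(0, y) \<in> span ?C"
      using i that span_mono[of "(\<lambda>x. (x, 0)) ` A" ?C] span_mono[of "(\<lambda>y. (0, y)) ` B" ?C] by blast+
    from span_add[OF this] show ?thesis by simp
  qed
  moreover have "span ?C \<subseteq> V \<times> W"
    using A B by (intro span_minimal subspace_Times) (auto simp: span_base span_zero)
  ultimately have "V \<times> W = span ?C" by auto
  then show ?thesis using A B unfolding fin_dim_def by (intro exI[of _ ?C]) auto
qed

definition families :: "'i set \<Rightarrow> ('i \<Rightarrow> 'v set) \<Rightarrow> ('i \<Rightarrow> 'v::real_vector) set" where
  "families I V = {f. (\<forall>i\<in>I. f i \<in> V i) \<and> (\<forall>i. i \<notin> I \<longrightarrow> f i = 0)}"

lemma fin_dim_families: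
  assumes "finite I" "\<And>i. i \<in> I \<Longrightarrow> fin_dim (V i)"
  shows "fin_dim (families I V)"
  using assms
proof (induction I rule: finite_induct)
  case empty
  have "families {} V = span {}" by (auto simp: families_def fun_eq_iff)
  then show ?case by (auto simp: fin_dim_def)
next
  case (insert i I)
  let ?g = "\<lambda>(x, f). f(i := x)"
  have "?g ` (V i \<times> families I V) = families (insert i I) V"
  proof (intro equalityI subsetI)
    fix f assume f: "f \<in> families (insert i I) V"
    then have "(f i, f(i := 0)) \<in> V i \<times> families I V" using insert.hyps by (auto simp: families_def)
    moreover have "f = ?g (f i, f(i := 0))" by simp
    ultimately show "f \<in> ?g ` (V i \<times> families I V)" by (rule rev_image_eqI)
  qed (use insert.hyps in \<open>auto simp: families_def\<close>)
  moreover have "lin_on (V i \<times> families I V) ?g" by (auto simp: lin_on_def fun_eq_iff)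
  moreover have "fin_dim (V i \<times> families I V)" using insert by (intro fin_dim_Times) auto
  ultimately show ?case using fin_dim_image[of "V i \<times> families I V" ?g] by simp
qed

section \<open>Polynomials of bounded degree\<close>

definition monomial :: "('a::euclidean_space \<Rightarrow> nat) \<Rightarrow> 'a \<Rightarrow> real" where
  "monomial \<alpha> x = (\<Prod>b\<in>Basis. (x \<bullet> b) ^ \<alpha> b)"

definition exponents :: "nat \<Rightarrow> ('a::euclidean_space \<Rightarrow> nat) set" where
  "exponents l = {\<alpha> \<in> Basis \<rightarrow>\<^sub>E UNIV. sum \<alpha> Basis \<le> l}"

lemma finite_exponents: "finite (exponents l :: ('a::euclidean_space \<Rightarrow> nat) set)"
proof (rule finite_subset)
  show "exponents l \<subseteq> (Basis \<rightarrow>\<^sub>E {..l} :: ('a \<Rightarrow> nat) set)"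
  proof
    fix \<alpha> :: "'a \<Rightarrow> nat" assume \<alpha>: "\<alpha> \<in> exponents l"
    have "\<alpha> b \<le> l" if "b \<in> Basis" for b
      using member_le_sum[of b Basis \<alpha>] that \<alpha> by (simp add: exponents_def)
    then show "\<alpha> \<in> Basis \<rightarrow>\<^sub>E {..l}" using \<alpha> by (simp add: exponents_def PiE_iff)
  qed
qed (simp add: finite_PiE)

lemma polys_eq: "polys l = {p. \<exists>c. \<forall>x. p x = (\<Sum>\<alpha>\<in>exponents l. c \<alpha> * monomial \<alpha> x)}"
  by (simp add: polys_def exponents_def monomial_def)

lemma subspace_polys: "subspace (polys l)"
proof (rule subspaceI)
  show "(0::'a \<Rightarrow> real) \<in> polys l" by (auto simp: polys_eq intro!: exI[of _ "\<lambda>_. 0"])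
next
  fix p q :: "'a \<Rightarrow> real" assume "p \<in> polys l" "q \<in> polys l"
  then obtain c d where "\<forall>x. p x = (\<Sum>\<alpha>\<in>exponents l. c \<alpha> * monomial \<alpha> x)" "\<forall>x. q x = (\<Sum>\<alpha>\<in>exponents l. d \<alpha> * monomial \<alpha> x)"
    by (auto simp: polys_eq)
  then show "p + q \<in> polys l"
    by (auto simp: polys_eq algebra_simps sum.distrib intro!: exI[of _ "\<lambda>\<alpha>. c \<alpha> + d \<alpha>"])
next
  fix r and p :: "'a \<Rightarrow> real" assume "p \<in> polys l"
  then obtain c where "\<forall>x. p x = (\<Sum>\<alpha>\<in>exponents l. c \<alpha> * monomial \<alpha> x)"
    by (auto simp: polys_eq)
  then show "r *\<^sub>R p \<in> polys l"
    by (auto simp: polys_eq sum_distrib_left mult.assoc intro!: exI[of _ "\<lambda>\<alpha>. r * c \<alpha>"])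
qed

lemma monomial_in_polys: "\<alpha> \<in> exponents l \<Longrightarrow> monomial \<alpha> \<in> polys l"
  by (auto simp: polys_eq finite_exponents sum.delta' if_distrib[of "\<lambda>c. c * _"] cong: if_cong
      intro!: exI[of _ "\<lambda>\<beta>. if \<beta> = \<alpha> then 1 else 0"])

lemma sum_fun_apply: "(\<Sum>i\<in>I. f i) x = (\<Sum>i\<in>I. f i x)"
  by (induction I rule: infinite_finite_induct) auto

lemma polys_span: "polys l = span (monomial ` exponents l)"
proof
  show "polys l \<subseteq> span (monomial ` exponents l)"
  proof
    fix p assume "p \<in> polys l"
    then obtain c where "p = (\<Sum>\<alpha>\<in>exponents l. c \<alpha> *\<^sub>R monomial \<alpha>)"
      by (auto simp: polys_eq fun_eq_iff sum_fun_apply)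
    then show "p \<in> span (monomial ` exponents l)"
      by (simp add: span_sum span_scale span_base)
  qed
  show "span (monomial ` exponents l) \<subseteq> polys l"
    by (intro span_minimal subspace_polys) (auto simp: monomial_in_polys)
qed

lemma fin_dim_polys: "fin_dim (polys l)"
  unfolding fin_dim_def polys_span using finite_exponents by blast

lemma polys_add: "p \<in> polys l \<Longrightarrow> q \<in> polys l \<Longrightarrow> (\<lambda>x. p x + q x) \<in> polys l"
  using subspace_add[OF subspace_polys, of p l q] by (simp add: plus_fun_def)

lemma polys_cmult: "p \<in> polys l \<Longrightarrow> (\<lambda>x. c * p x) \<in> polys l"
  using subspace_scale[OF subspace_polys, of p l c] by (simp add: scaleR_fun_def)

lemma polys_diff: "p \<in> polys l \<Longrightarrow> q \<in> polys l \<Longrightarrow> (\<lambda>x. p x - q x) \<in> polys l"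
  using subspace_diff[OF subspace_polys, of p l q] by (simp add: fun_diff_def)

lemma polys_sum:
  assumes "\<And>i. i \<in> I \<Longrightarrow> p i \<in> polys l"
  shows "(\<lambda>x. \<Sum>i\<in>I. p i x) \<in> polys l"
proof -
  have "(\<lambda>x. \<Sum>i\<in>I. p i x) = (\<Sum>i\<in>I. p i)" by (simp add: fun_eq_iff sum_fun_apply)
  then show ?thesis using subspace_sum[OF subspace_polys assms] by simp
qed

lemma polys_mono:
  assumes "l \<le> m"
  shows "polys l \<subseteq> polys m"
  unfolding polys_span using assms by (intro span_mono image_mono) (auto simp: exponents_def)

lemma polys_induct [consumes 1, case_names add scale mono]:
  assumes "p \<in> polys l"
    and "\<And>p q. p \<in> polys l \<Longrightarrow> q \<in> polys l \<Longrightarrow> P p \<Longrightarrow> P q \<Longrightarrow> P (\<lambda>x. p x + q x)"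
    and "\<And>p c. p \<in> polys l \<Longrightarrow> P p \<Longrightarrow> P (\<lambda>x. c * p x)"
    and "\<And>\<alpha>. \<alpha> \<in> exponents l \<Longrightarrow> P (monomial \<alpha>)"
  shows "P p"
proof -
  have "P (\<lambda>x. 0)"
  proof -
    obtain \<alpha> :: "'a \<Rightarrow> nat" where "\<alpha> \<in> exponents l"
      by (rule that[of "restrict (\<lambda>_. 0) Basis"]) (auto simp: exponents_def)
    then show ?thesis using assms(3)[of "monomial \<alpha>" 0] assms(4)[of \<alpha>] by (auto simp: monomial_in_polys)
  qed
  have "p \<in> polys l \<and> P p"
    using assms(1)[unfolded polys_span]
  proof (induction rule: span_induct_alt)
    case base
    then show ?case using \<open>P (\<lambda>x. 0)\<close> subspace_0[OF subspace_polys] by (simp add: zero_fun_def)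
  next
    case (step c p q)
    then have p: "p \<in> polys l" "P p" using assms(4) monomial_in_polys by auto
    have "(\<lambda>x. c * p x) \<in> polys l" "P (\<lambda>x. c * p x)"
      using p polys_cmult assms(3) by auto
    then have "(\<lambda>x. c * p x + q x) \<in> polys l" "P (\<lambda>x. c * p x + q x)"
      using step polys_add assms(2)[of "\<lambda>x. c * p x" q] by auto
    then show ?case by (simp add: plus_fun_def scaleR_fun_def)
  qed
  then show ?thesis by simp
qed

lemma polys_const: "(\<lambda>x. c) \<in> polys l"
proof -
  have "monomial (restrict (\<lambda>_. 0) Basis) \<in> polys l" by (rule monomial_in_polys) (auto simp: exponents_def)
  moreover have "monomial (restrict (\<lambda>_. 0) Basis) = (\<lambda>x::'a. 1)" by (auto simp: monomial_def fun_eq_iff)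
  ultimately have "(\<lambda>x::'a. 1) \<in> polys l" by metis
  from polys_cmult[OF this, of c] show ?thesis by simp
qed

lemma polys_inner: "(\<lambda>x. x \<bullet> v) \<in> polys 1"
proof -
  have "(\<lambda>x. x \<bullet> b) \<in> polys 1" if b: "b \<in> Basis" for b :: 'a
  proof -
    let ?\<alpha> = "restrict (\<lambda>a. if a = b then 1 else 0) Basis :: 'a \<Rightarrow> nat"
    have "monomial ?\<alpha> x = x \<bullet> b" for x
    proof -
      have "monomial ?\<alpha> x = (\<Prod>a\<in>Basis. if a = b then x \<bullet> b else 1)"
        unfolding monomial_def by (intro prod.cong) auto
      then show ?thesis using b by simp
    qed
    moreover have "?\<alpha> \<in> exponents 1" using b by (auto simp: exponents_def)
    ultimately show ?thesis using monomial_in_polys[of ?\<alpha> 1] by (metis (no_types, lifting) ext)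
  qed
  then have "(\<lambda>x. \<Sum>b\<in>Basis. (v \<bullet> b) * (x \<bullet> b)) \<in> polys 1"
    by (intro polys_sum polys_cmult) auto
  moreover have "(\<Sum>b\<in>Basis. (v \<bullet> b) * (x \<bullet> b)) = x \<bullet> v" for x
    by (subst (2) euclidean_inner) (simp add: mult.commute)
  ultimately show ?thesis by simp
qed

lemma monomial_mult: "monomial \<alpha> x * monomial \<beta> x = monomial (restrict (\<lambda>b. \<alpha> b + \<beta> b) Basis) x"
  by (simp add: monomial_def power_add prod.distrib)

lemma polys_mult:
  assumes "p \<in> polys l" "q \<in> polys m"
  shows "(\<lambda>x. p x * q x) \<in> polys (l + m)"
  using assms(1)
proof (induction p rule: polys_induct)
  case (add p1 p2)
  then show ?case using polys_add[of "\<lambda>x. p1 x * q x" "l + m" "\<lambda>x. p2 x * q x"]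
    by (simp add: algebra_simps)
next
  case (scale p c)
  then show ?case using polys_cmult[of "\<lambda>x. p x * q x" "l + m" c] by (simp add: mult.assoc)
next
  case (mono \<alpha>)
  show ?case using assms(2)
  proof (induction q rule: polys_induct)
    case (add q1 q2)
    then show ?case using polys_add[of "\<lambda>x. monomial \<alpha> x * q1 x" "l + m" "\<lambda>x. monomial \<alpha> x * q2 x"]
      by (simp add: algebra_simps)
  next
    case (scale q c)
    then show ?case using polys_cmult[of "\<lambda>x. monomial \<alpha> x * q x" "l + m" c]
      by (simp add: algebra_simps)
  next
    case (mono \<beta>)
    have "restrict (\<lambda>b. \<alpha> b + \<beta> b) Basis \<in> exponents (l + m)"
      using mono \<open>\<alpha> \<in> exponents l\<close> by (auto simp: exponents_def sum.distrib)
    then show ?case by (simp add: monomial_mult monomial_in_polys)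
  qed
qed

lemma polys_power: "p \<in> polys l \<Longrightarrow> (\<lambda>x. p x ^ n) \<in> polys (n * l)"
  by (induction n) (auto simp: polys_const dest!: polys_mult[of p])

lemma polys_prod:
  "finite I \<Longrightarrow> (\<And>i. i \<in> I \<Longrightarrow> p i \<in> polys (d i)) \<Longrightarrow> (\<lambda>x. \<Prod>i\<in>I. p i x) \<in> polys (\<Sum>i\<in>I. d i)"
  by (induction I rule: finite_induct) (auto simp: polys_const intro!: polys_mult)

lemma polys_compose_affine:
  assumes "p \<in> polys l" "\<And>b. b \<in> Basis \<Longrightarrow> (\<lambda>x. A x \<bullet> b) \<in> polys 1"
  shows "(\<lambda>x. p (A x)) \<in> polys l"
  using assms(1)
proof (induction p rule: polys_induct)
  case (mono \<alpha>)
  have "(\<lambda>x. \<Prod>b\<in>Basis. (A x \<bullet> b) ^ \<alpha> b) \<in> polys (\<Sum>b\<in>Basis. \<alpha> b * 1)"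
    by (intro polys_prod polys_power assms(2)) auto
  then show ?case using mono polys_mono[of "sum \<alpha> Basis" l] by (auto simp: monomial_def exponents_def)
qed (auto intro: polys_add polys_cmult)

lemma real_polynomial_function_polys:
  assumes "p \<in> polys l"
  shows "real_polynomial_function p"
  using assms
proof (induction p rule: polys_induct)
  case (mono \<alpha>)
  then show ?case unfolding monomial_def
    by (intro real_polynomial_function_prod real_polynomial_function_power
        real_polynomial_function.intros(1) bounded_linear_inner_left) auto
qed (auto intro: real_polynomial_function.intros)

lemma polys_continuous_on: "p \<in> polys l \<Longrightarrow> continuous_on S p"
  by (meson continuous_on_polymonial_function real_polynomial_function_eq real_polynomial_function_polys)

lemma polys_differentiable: "p \<in> polys l \<Longrightarrow> p differentiable at x"
  using real_polynomial_function_polys differentiable_at_real_polynomial_function by blast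

lemma polys_measurable: "p \<in> polys l \<Longrightarrow> p \<in> borel_measurable borel"
  using polys_continuous_on[of p l UNIV] by (simp add: borel_measurable_continuous_onI)

lemma dderiv_eqI: "(f has_derivative f') (at x) \<Longrightarrow> dderiv v f x = f' v"
  unfolding dderiv_def using frechet_derivative_at by metis

lemma polys_has_derivative: "p \<in> polys l \<Longrightarrow> (p has_derivative (\<lambda>v. dderiv v p x)) (at x)"
  using polys_differentiable[of p l x] unfolding dderiv_def by (simp add: frechet_derivative_works)

lemma dderiv_add:
  "p \<in> polys l \<Longrightarrow> q \<in> polys m \<Longrightarrow> dderiv v (\<lambda>x. p x + q x) x = dderiv v p x + dderiv v q x"
  by (rule dderiv_eqI) (auto intro!: derivative_intros polys_has_derivative)

lemma dderiv_diff:
  "p \<in> polys l \<Longrightarrow> q \<in> polys m \<Longrightarrow> dderiv v (\<lambda>x. p x - q x) x = dderiv v p x - dderiv v q x"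
  by (rule dderiv_eqI) (auto intro!: derivative_intros polys_has_derivative)

lemma dderiv_cmult:
  "p \<in> polys l \<Longrightarrow> dderiv v (\<lambda>x. c * p x) x = c * dderiv v p x"
  by (rule dderiv_eqI) (auto intro!: derivative_eq_intros polys_has_derivative)

lemma dderiv_const: "dderiv v (\<lambda>x. c) x = 0"
  by (rule dderiv_eqI) (auto intro!: derivative_eq_intros)

lemma dderiv_mult:
  "p \<in> polys l \<Longrightarrow> q \<in> polys m \<Longrightarrow> dderiv v (\<lambda>x. p x * q x) x = p x * dderiv v q x + dderiv v p x * q x"
  by (rule dderiv_eqI) (auto intro!: derivative_eq_intros polys_has_derivative)

lemma dderiv_inner: "dderiv v (\<lambda>x. x \<bullet> w) x = v \<bullet> w"
  by (rule dderiv_eqI) (auto intro!: derivative_eq_intros)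

lemma dderiv_linear:
  assumes "p \<in> polys l"
  shows "linear (\<lambda>v. dderiv v p x)"
  using polys_has_derivative[OF assms] has_derivative_linear by blast

lemma dderiv_basis:
  assumes "p \<in> polys l"
  shows "dderiv v p x = (\<Sum>b\<in>Basis. (v \<bullet> b) * dderiv b p x)"
proof -
  have "dderiv v p x = dderiv (\<Sum>b\<in>Basis. (v \<bullet> b) *\<^sub>R b) p x" by (simp add: euclidean_representation)
  then show ?thesis by (simp add: linear_sum[OF dderiv_linear[OF assms]] linear_cmul[OF dderiv_linear[OF assms]])
qed

lemma polys_0: "p \<in> polys 0 \<Longrightarrow> p = (\<lambda>x. p 0)"
proof (induction p rule: polys_induct)
  case (mono \<alpha>)
  then have "\<alpha> b = 0" if "b \<in> Basis" for b using that by (auto simp: exponents_def)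
  then show ?case by (auto simp: monomial_def fun_eq_iff)
qed (metis (mono_tags))+

lemma monomial_reduce:
  assumes "\<alpha> \<in> exponents (Suc l)" "sum \<alpha> Basis \<noteq> 0"
  obtains b \<beta> where "b \<in> Basis" "\<beta> \<in> exponents l" "monomial \<alpha> = (\<lambda>x. (x \<bullet> b) * monomial \<beta> x)"
proof -
  obtain b where b: "b \<in> Basis" "\<alpha> b \<noteq> 0" using assms(2) sum.neutral by metis
  define \<beta> where "\<beta> = \<alpha>(b := \<alpha> b - 1)"
  have "sum \<alpha> Basis = \<alpha> b + sum \<alpha> (Basis - {b})" "sum \<beta> Basis = \<beta> b + sum \<beta> (Basis - {b})"
    using b by (simp_all add: sum.remove)
  moreover have "sum \<beta> (Basis - {b}) = sum \<alpha> (Basis - {b})" by (intro sum.cong) (auto simp: \<beta>_def)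
  ultimately have "\<beta> \<in> exponents l" using assms(1) b by (auto simp: exponents_def \<beta>_def PiE_def extensional_def)
  moreover have "monomial \<alpha> x = (x \<bullet> b) * monomial \<beta> x" for x
  proof -
    have "monomial \<alpha> x = (x \<bullet> b) ^ \<alpha> b * (\<Prod>a\<in>Basis - {b}. (x \<bullet> a) ^ \<alpha> a)"
      "monomial \<beta> x = (x \<bullet> b) ^ \<beta> b * (\<Prod>a\<in>Basis - {b}. (x \<bullet> a) ^ \<beta> a)"
      using b by (simp_all add: monomial_def prod.remove)
    moreover have "(\<Prod>a\<in>Basis - {b}. (x \<bullet> a) ^ \<alpha> a) = (\<Prod>a\<in>Basis - {b}. (x \<bullet> a) ^ \<beta> a)"
      by (intro prod.cong) (auto simp: \<beta>_def)
    moreover have "(x \<bullet> b) ^ \<alpha> b = (x \<bullet> b) * (x \<bullet> b) ^ \<beta> b"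
      using b by (cases "\<alpha> b") (auto simp: \<beta>_def)
    ultimately show ?thesis by simp
  qed
  ultimately show ?thesis using that[of b \<beta>] b(1) by blast
qed

lemma dderiv_polys_0: "p \<in> polys 0 \<Longrightarrow> dderiv v p = (\<lambda>x. 0)"
  using polys_0[of p] dderiv_const[of v "p 0"] by (metis ext)

lemma dderiv_polys_Suc: "p \<in> polys (Suc l) \<Longrightarrow> dderiv v p \<in> polys l"
proof (induction p rule: polys_induct)
  case (add p q)
  then show ?case using dderiv_add[of p "Suc l" q "Suc l"] polys_add[of "dderiv v p" l "dderiv v q"]
    by (metis (no_types, lifting) ext)
next
  case (scale p c)
  then show ?case using dderiv_cmult[of p "Suc l"] polys_cmult[of "dderiv v p" l c]
    by (metis (no_types, lifting) ext)
next
  case (mono \<alpha>)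
  then show ?case
  proof (induction l arbitrary: \<alpha>)
    case (0 \<alpha>)
    show ?case
    proof (cases "sum \<alpha> Basis = 0")
      case True
      then have "monomial \<alpha> \<in> polys 0" using 0 by (intro monomial_in_polys) (auto simp: exponents_def)
      then show ?thesis by (simp add: dderiv_polys_0 polys_const)
    next
      case False
      then obtain b \<beta> where b: "b \<in> Basis" "\<beta> \<in> exponents 0" "monomial \<alpha> = (\<lambda>x. (x \<bullet> b) * monomial \<beta> x)"
        using monomial_reduce 0 by blast
      have "monomial \<alpha> = (\<lambda>x. (monomial \<beta> 0) * (x \<bullet> b))"
        using b(3) polys_0[OF monomial_in_polys[OF b(2)]] by (metis mult.commute)
      then have "dderiv v (monomial \<alpha>) = (\<lambda>x. monomial \<beta> 0 * (v \<bullet> b))"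
        using dderiv_cmult[OF polys_inner, of v "monomial \<beta> 0" b] by (auto simp: dderiv_inner)
      then show ?thesis by (simp add: polys_const)
    qed
  next
    case (Suc l \<alpha>)
    show ?case
    proof (cases "sum \<alpha> Basis = 0")
      case True
      then have "monomial \<alpha> \<in> polys 0" using Suc by (intro monomial_in_polys) (auto simp: exponents_def)
      then show ?thesis by (simp add: dderiv_polys_0 polys_const)
    next
      case False
      then obtain b \<beta> where b: "b \<in> Basis" "\<beta> \<in> exponents (Suc l)" "monomial \<alpha> = (\<lambda>x. (x \<bullet> b) * monomial \<beta> x)"
        using monomial_reduce Suc by blast
      have "dderiv v (monomial \<alpha>) = (\<lambda>x. (x \<bullet> b) * dderiv v (monomial \<beta>) x + (v \<bullet> b) * monomial \<beta> x)"
        unfolding b(3) by (auto simp: dderiv_mult[OF polys_inner monomial_in_polys[OF b(2)]] dderiv_inner)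
      moreover have "(\<lambda>x. (x \<bullet> b) * dderiv v (monomial \<beta>) x) \<in> polys (1 + l)"
        by (intro polys_mult polys_inner Suc.IH b)
      moreover have "(\<lambda>x. (v \<bullet> b) * monomial \<beta> x) \<in> polys (Suc l)"
        by (intro polys_cmult monomial_in_polys b)
      ultimately show ?thesis by (auto intro: polys_add)
    qed
  qed
qed

lemma dderiv_polys: "p \<in> polys l \<Longrightarrow> dderiv v p \<in> polys (l - 1)"
  by (cases l) (auto simp: dderiv_polys_0 polys_const dderiv_polys_Suc)

lemma dderiv_polys': "p \<in> polys l \<Longrightarrow> dderiv v p \<in> polys l"
  using dderiv_polys[of p l v] polys_mono[of "l - 1" l] by auto

lemma zero_dderiv_const:
  assumes "p \<in> polys l" "\<And>b x. b \<in> Basis \<Longrightarrow> dderiv b p x = 0"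
  shows "p x = p y"
proof -
  have "(p has_derivative (\<lambda>h. 0)) (at x)" for x
  proof -
    have "dderiv v p x = 0" for v using dderiv_basis[OF assms(1), of v x] assms(2) by simp
    then have "(\<lambda>v. dderiv v p x) = (\<lambda>v. 0)" by blast
    then show ?thesis using polys_has_derivative[OF assms(1), of x] by simp
  qed
  then show ?thesis using has_derivative_zero_unique[of UNIV p] by (metis UNIV_I convex_UNIV has_derivative_at_withinI)
qed

lemma zero_hessian_affine:
  assumes "p \<in> polys l" "\<And>a b x. a \<in> Basis \<Longrightarrow> b \<in> Basis \<Longrightarrow> dderiv a (dderiv b p) x = 0"
  shows "p x = p 0 + (\<Sum>b\<in>Basis. dderiv b p 0 * (x \<bullet> b))"
proof -
  let ?q = "\<lambda>x. \<Sum>b\<in>Basis. dderiv b p 0 * (x \<bullet> b)"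
  have c: "dderiv b p x = dderiv b p 0" if "b \<in> Basis" for b x
    using zero_dderiv_const[OF dderiv_polys[OF assms(1)], of b x 0] assms(2) that by blast
  have q: "?q \<in> polys 1" by (intro polys_sum polys_cmult polys_inner)
  have "dderiv b (\<lambda>x. p x - ?q x) x = 0" if b: "b \<in> Basis" for b x
  proof -
    have "dderiv b ?q x = (\<Sum>a\<in>Basis. dderiv a p 0 * (b \<bullet> a))"
      by (rule dderiv_eqI) (auto intro!: derivative_eq_intros)
    also have "\<dots> = dderiv b p 0" using b by (simp add: inner_Basis if_distrib cong: if_cong)
    finally show ?thesis using c[OF b] dderiv_diff[OF assms(1) q] by simp
  qed
  moreover have "(\<lambda>x. p x - ?q x) \<in> polys (max 1 l)"
    using assms(1) q polys_mono[of l "max 1 l"] polys_mono[of 1 "max 1 l"] by (intro polys_diff) auto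
  ultimately show ?thesis using zero_dderiv_const[of "\<lambda>x. p x - ?q x" "max 1 l" x 0] by simp
qed

lemma zero_hessian_polys_1:
  assumes "p \<in> polys l" "\<And>a b x. a \<in> Basis \<Longrightarrow> b \<in> Basis \<Longrightarrow> dderiv a (dderiv b p) x = 0"
  shows "p \<in> polys 1"
proof -
  have "(\<lambda>x. p 0 + (\<Sum>b\<in>Basis. dderiv b p 0 * (x \<bullet> b))) \<in> polys 1"
    by (intro polys_add polys_const polys_sum polys_cmult polys_inner)
  then show ?thesis using zero_hessian_affine[OF assms] by (metis (no_types, lifting) ext)
qed

text \<open>On a line through the centre the polynomial has infinitely many zeros.\<close>

lemma polys_zero_on_ball:
  assumes "p \<in> polys l" "0 < e" "\<And>x. x \<in> ball z e \<Longrightarrow> p x = 0"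
  shows "p y = 0"
proof (cases "y = z")
  case True
  then show ?thesis using assms by simp
next
  case False
  let ?q = "\<lambda>t::real. p (z + t *\<^sub>R (y - z))"
  have "real_polynomial_function (p \<circ> (\<lambda>t::real. z + t *\<^sub>R (y - z)))"
    by (intro real_polynomial_function_compose real_polynomial_function_polys[OF assms(1)]
        polynomial_function_add polynomial_function_const polynomial_function_bounded_linear
        bounded_linear_scaleR_left)
  then obtain a n where a: "?q = (\<lambda>t. \<Sum>i\<le>n. a i * t ^ i)"
    unfolding o_def using real_polynomial_function_iff_sum by blast
  let ?d = "e / (2 * norm (y - z))"
  have d: "0 < ?d" using False assms(2) by simp
  have "?q t = 0" if t: "t \<in> {0..?d}" for t
  proof -
    have "norm (t *\<^sub>R (y - z)) \<le> ?d * norm (y - z)"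
      using t by (auto simp del: times_divide_eq_left intro!: mult_right_mono)
    also have "\<dots> < e" using False assms(2) by simp
    finally show ?thesis by (intro assms(3)) (simp add: dist_norm)
  qed
  then have "{0..?d} \<subseteq> {t. (\<Sum>i\<le>n. a i * t ^ i) = 0}" using a by (auto simp: fun_eq_iff)
  moreover have "infinite {0..?d}" using d by (simp add: infinite_Icc)
  ultimately have "infinite {t. (\<Sum>i\<le>n. a i * t ^ i) = 0}" using finite_subset by blast
  then have "\<forall>i\<le>n. a i = 0" using polyfun_rootbound[of n a] polyfun_finite_roots by blast
  then show ?thesis using fun_cong[OF a, of 1] by simp
qed

lemma polys_zero_AE_ball:
  assumes "p \<in> polys l" "0 < e" "AE x in lborel. x \<in> ball z e \<longrightarrow> p x = 0"
  shows "p y = 0"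
proof (rule polys_zero_on_ball[OF assms(1,2)])
  let ?U = "{x \<in> ball z e. p x \<noteq> 0}"
  have "?U = ball z e \<inter> {x. p x \<noteq> 0}" by auto
  moreover have "open {x. p x \<noteq> 0}"
    using polys_continuous_on[OF assms(1)] by (intro open_Collect_neq) auto
  ultimately have "open ?U" by auto
  moreover have "AE x in lebesgue. x \<notin> ?U" using assms(3)
    by (intro AE_completion) (auto elim!: eventually_mono)
  then have "negligible ?U"
    using AE_iff_null_sets[of ?U lebesgue] \<open>open ?U\<close> by (simp add: negligible_iff_null_sets borel_open)
  then have "?U = {}" using \<open>open ?U\<close> open_not_negligible by blast
  then show "p x = 0" if "x \<in> ball z e" for x using that by blast
qed

section \<open>Scale-invariant bounds for polynomials\<close>

lemma set_integrable_lborel_continuous: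
  fixes f :: "'a::euclidean_space \<Rightarrow> real"
  assumes "continuous_on UNIV f" "bounded S" "S \<in> sets borel"
  shows "set_integrable lborel S f"
proof -
  obtain K where K: "compact K" "S \<subseteq> K"
    using assms(2) bounded_closure compact_closure closure_subset by metis
  have "set_integrable lborel K f"
    unfolding set_integrable_def
    using K(1) assms(1) by (intro borel_integrable_compact) (auto intro: continuous_on_subset)
  then show ?thesis by (rule set_integrable_subset) (use K assms in auto)
qed

lemma set_integral_eq_0_AE:
  fixes f :: "'a::euclidean_space \<Rightarrow> real"
  assumes "set_integrable lborel S f" "\<And>x. 0 \<le> f x" "(LINT x:S|lborel. f x) = 0"
  shows "AE x in lborel. x \<in> S \<longrightarrow> f x = 0"
proof -
  have "AE x in lborel. indicator S x *\<^sub>R f x = 0"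
    using assms by (subst (asm) set_lebesgue_integral_def)
      (subst (asm) integral_nonneg_eq_0_iff_AE, auto simp: set_integrable_def)
  then show ?thesis by eventually_elim (auto simp: indicator_def split: if_splits)
qed

lemma polys_set_integrable:
  assumes "p \<in> polys l" "bounded S" "S \<in> sets borel"
  shows "set_integrable lborel S p"
  using set_integrable_lborel_continuous[OF polys_continuous_on[OF assms(1)] assms(2,3)] .

lemma polys_set_integrable_mult:
  assumes "p \<in> polys l" "q \<in> polys m" "bounded S" "S \<in> sets borel"
  shows "set_integrable lborel S (\<lambda>x. p x * q x)"
  using polys_set_integrable[OF polys_mult[OF assms(1,2)] assms(3,4)] .

lemma psd_form_L2:
  assumes "bounded S" "S \<in> sets borel"
  shows "psd_form (polys l) (\<lambda>p q. LINT x:S|lborel. p x * q x)"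
proof
  show "subspace (polys l)" by (rule subspace_polys)
  show "bilin_on (polys l) (\<lambda>p q. LINT x:S|lborel. p x * q x)"
    using polys_set_integrable_mult[OF _ _ assms, of _ l _ l]
    by (intro bilin_onI lin_onI)
      (simp_all add: algebra_simps set_integral_add(2) flip: set_integral_mult_right)
qed (auto simp: mult.commute set_lebesgue_integral_def intro!: integral_nonneg)

lemma polys_integral_zero:
  assumes "p \<in> polys l" "0 < e" "(LINT x:ball z e|lborel. (p x)\<^sup>2) = 0"
  shows "p y = 0"
proof (rule polys_zero_AE_ball[OF assms(1,2)])
  have "set_integrable lborel (ball z e) (\<lambda>x. (p x)\<^sup>2)"
    using polys_set_integrable_mult[OF assms(1,1), of "ball z e"] by (simp add: power2_eq_square)
  from set_integral_eq_0_AE[OF this _ assms(3)]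
  show "AE x in lborel. x \<in> ball z e \<longrightarrow> p x = 0" by simp
qed

lemma bounded_polys_cball:
  assumes "p \<in> polys l"
  shows "\<exists>M. \<forall>x\<in>cball z e. \<bar>p x\<bar> \<le> M"
proof -
  have "compact (p ` cball z e)"
    by (intro compact_continuous_image polys_continuous_on[OF assms] compact_cball)
  then obtain M where "\<forall>y\<in>p ` cball z e. norm y \<le> M" using compact_imp_bounded bounded_iff by metis
  then show ?thesis by auto
qed

lemma integral_rescale:
  fixes f :: "'a::euclidean_space \<Rightarrow> real"
  assumes "0 < h" "f \<in> borel_measurable borel"
  shows "(LINT x:ball z (h * r)|lborel. f x) = h ^ DIM('a) * (LINT x:ball 0 r|lborel. f (z + h *\<^sub>R x))"
proof -
  let ?g = "\<lambda>x. indicator (ball z (h * r)) x *\<^sub>R f x"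
  have [measurable]: "?g \<in> borel_measurable borel"
    using assms(2) by (intro borel_measurable_scaleR borel_measurable_indicator) auto
  have "(\<lambda>x. \<bar>h\<bar> ^ DIM('a) * ?g x) \<in> borel_measurable borel"
    by (rule borel_measurable_times) (simp, fact)
  then have g': "(\<lambda>x. \<bar>h\<bar> ^ DIM('a) * (indicat_real (ball z (h * r)) x * f x)) \<in> borel_measurable borel"
    by simp
  have ind: "indicator (ball z (h * r)) (z + h *\<^sub>R x) = (indicator (ball 0 r) x :: real)" for x
    using assms(1) by (simp add: indicator_def dist_norm)
  have "(LINT x:ball z (h * r)|lborel. f x) = (\<integral>x. ?g x \<partial>density (distr lborel borel (\<lambda>x. z + h *\<^sub>R x)) (\<lambda>_. \<bar>h\<bar> ^ DIM('a)))"
    unfolding set_lebesgue_integral_def using lborel_affine[of h z] assms(1) by simp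
  also have "\<dots> = (\<integral>x. \<bar>h\<bar> ^ DIM('a) * ?g x \<partial>distr lborel borel (\<lambda>x. z + h *\<^sub>R x))"
    using g' \<open>?g \<in> borel_measurable borel\<close> by (subst integral_density) auto
  also have "\<dots> = (\<integral>x. \<bar>h\<bar> ^ DIM('a) * ?g (z + h *\<^sub>R x) \<partial>lborel)"
    using g' by (subst integral_distr) auto
  finally show ?thesis using assms(1) by (simp add: ind set_lebesgue_integral_def)
qed

lemma lin_on_dderiv: "lin_on (polys l) (\<lambda>p. dderiv v p x)"
  by (intro lin_onI)
    (simp_all add: plus_fun_def scaleR_fun_def dderiv_add[of _ l _ l] dderiv_cmult[of _ l])

text \<open>Evaluations and derivatives on the unit ball are functionals on a finite-dimensional space,
  so they are controlled by the norm of \<open>L\<^sup>2\<close> over any smaller ball; the powers of \<open>h\<close> come from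
  rescaling.\<close>

lemma poly_bound:
  fixes \<theta> :: real
  assumes "0 < \<theta>"
  shows "\<exists>C\<ge>0. \<forall>p\<in>polys l. \<forall>(z::'a::euclidean_space) h. 0 < h \<longrightarrow> (\<forall>y\<in>cball z h.
     (p y)\<^sup>2 \<le> C / h ^ DIM('a) * (LINT x:ball z (h * \<theta>)|lborel. (p x)\<^sup>2) \<and>
     (\<forall>b\<in>Basis. (h * dderiv b p y)\<^sup>2 \<le> C / h ^ DIM('a) * (LINT x:ball z (h * \<theta>)|lborel. (p x)\<^sup>2)))"
proof -
  let ?b = "\<lambda>p q. LINT x:ball (0::'a) \<theta>|lborel. p x * q x"
  obtain B where B: "finite B" "polys l = (span B :: ('a \<Rightarrow> real) set)"
    using fin_dim_polys[where ?'a='a] unfolding fin_dim_def by blast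
  have psd: "psd_form (span B) ?b" using psd_form_L2[of "ball (0::'a) \<theta>" l] B(2) by simp
  have zero: "p y = 0" if "p \<in> span B" "?b p p = 0" for p y
    using polys_integral_zero[of p l \<theta> 0 y] that B(2) assms by (simp add: power2_eq_square)
  have "\<exists>C\<ge>0. \<forall>y\<in>cball (0::'a) 1. \<forall>p\<in>span B. (p y)\<^sup>2 \<le> C * ?b p p"
  proof (rule psd_bound[OF B(1) psd])
    show "\<exists>M. \<forall>i\<in>cball 0 1. \<bar>p i\<bar> \<le> M" if "p \<in> span B" for p
      using bounded_polys_cball[of p l] that B(2) by simp
    show "lin_on (span B) (\<lambda>p. p y)" for y by (simp add: lin_on_def)
    show "p y = 0" if "p \<in> span B" "?b p p = 0" for p y using zero[OF that] .
  qed
  then obtain C1 where C1: "0 \<le> C1" "\<And>y p. y \<in> cball (0::'a) 1 \<Longrightarrow> p \<in> span B \<Longrightarrow> (p y)\<^sup>2 \<le> C1 * ?b p p"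
    by blast
  have "\<exists>C\<ge>0. \<forall>i\<in>cball (0::'a) 1 \<times> Basis. \<forall>p\<in>span B. (dderiv (snd i) p (fst i))\<^sup>2 \<le> C * ?b p p"
  proof (rule psd_bound[OF B(1) psd])
    show "lin_on (span B) (\<lambda>p. dderiv (snd i) p (fst i))" for i :: "'a \<times> 'a"
      unfolding B(2)[symmetric] by (rule lin_on_dderiv)
    show "dderiv (snd i) p (fst i) = 0" if "p \<in> span B" "?b p p = 0" for p and i :: "'a \<times> 'a"
    proof -
      have "p = (\<lambda>_. 0)" using zero[OF that] by blast
      then show ?thesis using dderiv_const[of "snd i" 0] by simp
    qed
    show "\<exists>M. \<forall>i\<in>cball 0 1 \<times> Basis. \<bar>dderiv (snd i) p (fst i)\<bar> \<le> M" if "p \<in> span B" for p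
    proof -
      have "\<exists>M. \<forall>x\<in>cball 0 1. \<bar>dderiv b p x\<bar> \<le> M" for b
        using bounded_polys_cball[OF dderiv_polys', of p l] that B(2) by simp
      then obtain M where M: "\<And>b x. x \<in> cball 0 1 \<Longrightarrow> \<bar>dderiv b p x\<bar> \<le> M b" by metis
      have "\<bar>dderiv b p x\<bar> \<le> (\<Sum>b\<in>Basis. \<bar>M b\<bar>)" if "x \<in> cball 0 1" "b \<in> Basis" for b x
        using M[OF that(1), of b] member_le_sum[of b Basis "\<lambda>b. \<bar>M b\<bar>"] that(2) by fastforce
      then show ?thesis by (intro exI[of _ "\<Sum>b\<in>Basis. \<bar>M b\<bar>"]) auto
    qed
  qed
  then obtain C2 where C2: "0 \<le> C2" "\<And>y b p. y \<in> cball (0::'a) 1 \<Longrightarrow> b \<in> Basis \<Longrightarrow> p \<in> span B \<Longrightarrow>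
      (dderiv b p y)\<^sup>2 \<le> C2 * ?b p p"
    by fastforce
  let ?C = "C1 + C2"
  show ?thesis
  proof (intro exI[of _ ?C] conjI ballI allI impI)
    show "0 \<le> ?C" using C1 C2 by simp
    fix p :: "'a \<Rightarrow> real" and z y :: 'a and h :: real
    assume p: "p \<in> polys l" and h: "0 < h" and y: "y \<in> cball z h"
    define q where "q = (\<lambda>x. p (z + h *\<^sub>R x))"
    have "(\<lambda>x. (z + h *\<^sub>R x) \<bullet> b) \<in> polys 1" for b
      using polys_add[OF polys_const polys_cmult[OF polys_inner], of "z \<bullet> b" h b]
      by (simp add: inner_add_left)
    then have q: "q \<in> polys l" unfolding q_def by (rule polys_compose_affine[OF p])
    define w where "w = (1 / h) *\<^sub>R (y - z)"
    have w: "w \<in> cball 0 1" "y = z + h *\<^sub>R w"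
      using h y by (simp_all add: w_def dist_norm norm_minus_commute)
    have int: "(LINT x:ball z (h * \<theta>)|lborel. (p x)\<^sup>2) = h ^ DIM('a) * ?b q q"
      using integral_rescale[OF h, of "\<lambda>x. (p x)\<^sup>2" z \<theta>] polys_measurable[OF p]
      by (simp add: q_def power2_eq_square)
    have b0: "0 \<le> ?b q q" by (auto simp: set_lebesgue_integral_def intro!: integral_nonneg)
    have rhs: "?C / h ^ DIM('a) * (LINT x:ball z (h * \<theta>)|lborel. (p x)\<^sup>2) = ?C * ?b q q"
      using h by (simp add: int)
    have "(p y)\<^sup>2 = (q w)\<^sup>2" by (simp add: w(2) q_def)
    also have "\<dots> \<le> C1 * ?b q q" using C1(2)[OF w(1)] q B(2) by simp
    also have "\<dots> \<le> ?C * ?b q q" using C2(1) b0 by (intro mult_right_mono) auto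
    finally show "(p y)\<^sup>2 \<le> ?C / h ^ DIM('a) * (LINT x:ball z (h * \<theta>)|lborel. (p x)\<^sup>2)"
      unfolding rhs .
    fix b :: 'a assume b: "b \<in> Basis"
    have "((\<lambda>x. p (z + h *\<^sub>R x)) has_derivative (\<lambda>v. dderiv (h *\<^sub>R v) p (z + h *\<^sub>R w))) (at w)"
      by (rule has_derivative_compose[OF _ polys_has_derivative[OF p]])
        (auto intro!: derivative_eq_intros)
    then have "dderiv b q w = h * dderiv b p y"
      using dderiv_eqI linear_cmul[OF dderiv_linear[OF p]] w(2) by (fastforce simp: q_def)
    then have "(h * dderiv b p y)\<^sup>2 = (dderiv b q w)\<^sup>2" by simp
    also have "\<dots> \<le> C2 * ?b q q" using C2(2)[OF w(1) b] q B(2) by simp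
    also have "\<dots> \<le> ?C * ?b q q" using C1(1) b0 by (intro mult_right_mono) auto
    finally show "(h * dderiv b p y)\<^sup>2 \<le> ?C / h ^ DIM('a) * (LINT x:ball z (h * \<theta>)|lborel. (p x)\<^sup>2)"
      unfolding rhs .
  qed
qed

lemma set_integral_mono_set:
  fixes f :: "'a::euclidean_space \<Rightarrow> real"
  assumes "set_integrable lborel T f" "S \<subseteq> T" "S \<in> sets borel" "\<And>x. 0 \<le> f x"
  shows "(LINT x:S|lborel. f x) \<le> (LINT x:T|lborel. f x)"
  unfolding set_lebesgue_integral_def
proof (rule integral_mono)
  show "integrable lborel (\<lambda>x. indicator S x *\<^sub>R f x)"
    using set_integrable_subset[OF assms(1)] assms(2,3) by (simp add: set_integrable_def)
qed (use assms in \<open>auto simp: set_integrable_def indicator_def\<close>)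

section \<open>Surface integrals on a face\<close>

text \<open>Additivity gives linearity on the rational numbers, and nonnegative additive functions are
  monotone.\<close>

lemma additive_nonneg_linear:
  fixes f :: "real \<Rightarrow> real"
  assumes add: "\<And>s t. 0 \<le> s \<Longrightarrow> 0 \<le> t \<Longrightarrow> f (s + t) = f s + f t"
    and nonneg: "\<And>t. 0 \<le> t \<Longrightarrow> 0 \<le> f t" and t: "0 \<le> t"
  shows "f t = t * f 1"
proof -
  have f0: "f 0 = 0" using add[of 0 0] by simp
  have nat: "f (real n * s) = real n * f s" if "0 \<le> s" for n s
  proof (induction n)
    case (Suc n)
    have "f (real n * s + s) = f (real n * s) + f s" using that by (intro add) auto
    then show ?case using Suc by (simp add: algebra_simps)
  qed (simp add: f0)
  have mono: "f s \<le> f s'" if "0 \<le> s" "s \<le> s'" for s s'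
    using add[of s "s' - s"] nonneg[of "s' - s"] that by simp
  have rat: "f (real m / real (Suc N)) = real m / real (Suc N) * f 1" for m N
  proof -
    have "f (real (Suc N) * (real m / real (Suc N))) = real (Suc N) * f (real m / real (Suc N))"
      by (rule nat) simp
    moreover have "f (real m * 1) = real m * f 1" by (rule nat) simp
    ultimately have "real (Suc N) * f (real m / real (Suc N)) = real m * f 1" by simp
    then show ?thesis by (metis eq_divide_imp mult.commute of_nat_Suc of_nat_neq_0 times_divide_eq_left)
  qed
  have *: "\<bar>f t - t * f 1\<bar> * real (Suc N) \<le> f 1" for N
  proof -
    define m where "m = nat \<lfloor>t * real (Suc N)\<rfloor>"
    have m: "real m \<le> t * real (Suc N)" "t * real (Suc N) \<le> real (Suc m)"
    proof -
      have "0 \<le> \<lfloor>t * real (Suc N)\<rfloor>" using t by simp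
      then have "real m = real_of_int \<lfloor>t * real (Suc N)\<rfloor>" by (simp add: m_def)
      then show "real m \<le> t * real (Suc N)" "t * real (Suc N) \<le> real (Suc m)"
        using of_int_floor_le[of "t * real (Suc N)"] real_of_int_floor_add_one_ge[of "t * real (Suc N)"]
        by linarith+
    qed
    then have m': "real m / real (Suc N) \<le> t" "t \<le> real (Suc m) / real (Suc N)"
      by (simp_all add: field_simps)
    have "real m / real (Suc N) * f 1 \<le> f t" "f t \<le> real (Suc m) / real (Suc N) * f 1"
      using mono[OF _ m'(1)] mono[OF t m'(2)] rat[of m N] rat[of "Suc m" N] by simp_all
    moreover have "real m / real (Suc N) * f 1 \<le> t * f 1" "t * f 1 \<le> real (Suc m) / real (Suc N) * f 1"
      using m' nonneg[of 1] by (intro mult_right_mono; simp)+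
    ultimately have "\<bar>f t - t * f 1\<bar> \<le> real (Suc m) / real (Suc N) * f 1 - real m / real (Suc N) * f 1"
      by linarith
    also have "\<dots> = f 1 / real (Suc N)" by (simp add: add_divide_distrib algebra_simps)
    finally show ?thesis by (simp add: field_simps)
  qed
  show ?thesis
  proof (rule ccontr)
    assume "f t \<noteq> t * f 1"
    then obtain N where "f 1 < real N * \<bar>f t - t * f 1\<bar>"
      using reals_Archimedean3[of "\<bar>f t - t * f 1\<bar>"] by auto
    also have "\<dots> \<le> \<bar>f t - t * f 1\<bar> * real (Suc N)" by (simp add: algebra_simps)
    finally show False using *[of N] by simp
  qed
qed

definition plane_proj :: "'a::euclidean_space \<Rightarrow> real \<Rightarrow> 'a \<Rightarrow> 'a" where
  "plane_proj n c x = x - (n \<bullet> x - c) *\<^sub>R n"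

lemma plane_proj_polys: "(\<lambda>x. plane_proj n c x \<bullet> b) \<in> polys 1"
proof -
  have "(\<lambda>x. x \<bullet> b - (n \<bullet> b) * (x \<bullet> n - c)) \<in> polys 1"
    by (intro polys_diff polys_cmult polys_inner polys_const)
  moreover have "plane_proj n c x \<bullet> b = x \<bullet> b - (n \<bullet> b) * (x \<bullet> n - c)" for x
    by (simp add: plane_proj_def inner_diff_left inner_commute[of n x] mult.commute)
  ultimately show ?thesis by simp
qed

lemma polys_plane_proj: "p \<in> polys l \<Longrightarrow> (\<lambda>x. p (plane_proj n c x)) \<in> polys l"
  using polys_compose_affine plane_proj_polys by blast

lemma plane_proj_continuous: "continuous_on S (plane_proj n c)"
  unfolding plane_proj_def by (intro continuous_intros)

lemma plane_proj_measurable [measurable]: "plane_proj n c \<in> borel_measurable borel"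
  by (intro borel_measurable_continuous_onI plane_proj_continuous)

lemma plane_proj_in: "norm n = 1 \<Longrightarrow> n \<bullet> plane_proj n c x = c"
  by (simp add: plane_proj_def inner_diff_right dot_square_norm)

lemma plane_proj_id: "n \<bullet> x = c \<Longrightarrow> plane_proj n c x = x"
  by (simp add: plane_proj_def)

lemma plane_proj_shift: "norm n = 1 \<Longrightarrow> plane_proj n c (x + t *\<^sub>R n) = plane_proj n c x"
  by (simp add: plane_proj_def inner_add_right dot_square_norm algebra_simps)

lemma plane_proj_dist:
  assumes "norm n = 1" "n \<bullet> z = c"
  shows "dist z (plane_proj n c x) \<le> dist z x"
proof -
  define w where "w = x - z"
  have "plane_proj n c x - z = w - (n \<bullet> w) *\<^sub>R n"
    using assms(2) by (simp add: plane_proj_def w_def inner_diff_right)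
  moreover have "norm (w - (n \<bullet> w) *\<^sub>R n) \<le> norm w"
  proof -
    have "n \<bullet> n = 1" using assms(1) by (simp add: norm_eq_1)
    then have "(w - (n \<bullet> w) *\<^sub>R n) \<bullet> (w - (n \<bullet> w) *\<^sub>R n) = w \<bullet> w - (n \<bullet> w)\<^sup>2"
      by (simp only: inner_diff_left inner_diff_right inner_scaleR_left inner_scaleR_right
          inner_commute[of w n] power2_eq_square) simp
    then show ?thesis unfolding norm_le by simp
  qed
  ultimately have "dist (plane_proj n c x) z \<le> dist x z" unfolding dist_norm by (metis w_def)
  then show ?thesis by (simp add: dist_commute)
qed

locale flat_face =
  fixes F :: "'a::euclidean_space set" and n :: 'a and c :: real
  assumes unit: "norm n = 1"
    and hull: "affine hull F = {x. n \<bullet> x = c}"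
    and op: "openin (top_of_set {x. n \<bullet> x = c}) F"
    and ne: "F \<noteq> {}"
    and bdd: "bounded F"
    and fm: "face_measure F = restrict_space (hyperplane_measure n c) F"
begin

lemma in_plane: "x \<in> F \<Longrightarrow> n \<bullet> x = c"
  using op openin_imp_subset by blast

lemma closed_plane: "closed {x. n \<bullet> x = c}"
  by (rule closed_hyperplane)

lemma borel: "F \<in> sets borel"
proof -
  obtain U where "open U" "F = {x. n \<bullet> x = c} \<inter> U" using op by (auto simp: openin_open)
  then show ?thesis using closed_plane by (auto intro!: borel_open borel_closed)
qed

lemma disc_in:
  assumes "x \<in> F"
  obtains r where "0 < r" "\<And>z. n \<bullet> z = c \<Longrightarrow> dist x z < r \<Longrightarrow> z \<in> F"
proof -
  obtain U where U: "open U" "F = {x. n \<bullet> x = c} \<inter> U" using op by (auto simp: openin_open)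
  then obtain r where "0 < r" "ball x r \<subseteq> U" using assms open_contains_ball by blast
  then show ?thesis using U(2) by (intro that[of r]) (auto simp: subset_iff)
qed

lemma normal_unique:
  assumes "norm m = 1" "\<And>x y. x \<in> F \<Longrightarrow> y \<in> F \<Longrightarrow> m \<bullet> (y - x) = 0"
  shows "m = n \<or> m = - n"
proof -
  obtain x0 where x0: "x0 \<in> F" using ne by blast
  have "F \<subseteq> {x. m \<bullet> x = m \<bullet> x0}" using assms(2)[OF x0] by (auto simp: inner_diff_right)
  then have h: "{x. n \<bullet> x = c} \<subseteq> {x. m \<bullet> x = m \<bullet> x0}"
    using hull_minimal[of F "{x. m \<bullet> x = m \<bullet> x0}" affine] affine_hyperplane hull by metis
  define w where "w = m - (m \<bullet> n) *\<^sub>R n"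
  have nw: "n \<bullet> w = 0" using unit by (simp add: w_def inner_diff_right inner_commute dot_square_norm)
  then have "n \<bullet> (x0 + w) = c" using in_plane[OF x0] by (simp add: inner_add_right)
  then have "m \<bullet> (x0 + w) = m \<bullet> x0" using h by blast
  then have "m \<bullet> w = 0" by (simp add: inner_add_right)
  moreover have "w \<bullet> w = m \<bullet> w - (m \<bullet> n) * (n \<bullet> w)" by (simp add: w_def inner_diff_left)
  ultimately have "w = 0" using nw by simp
  then have m: "m = (m \<bullet> n) *\<^sub>R n" by (simp add: w_def)
  then have "\<bar>m \<bullet> n\<bar> = 1" using assms(1) unit by (metis norm_scaleR mult.right_neutral)
  then have "m \<bullet> n = 1 \<or> m \<bullet> n = - 1" by linarith
  then show ?thesis using m by force
qed

definition cyl :: "real \<Rightarrow> 'a set" where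
  "cyl t = {x. c \<le> n \<bullet> x \<and> n \<bullet> x < c + t \<and> plane_proj n c x \<in> F}"

lemma cyl_borel: "cyl t \<in> sets borel"
proof -
  have [measurable]: "F \<in> sets borel" by (rule borel)
  have "cyl t = {x \<in> space borel. c \<le> n \<bullet> x \<and> n \<bullet> x < c + t \<and> plane_proj n c x \<in> F}"
    by (simp add: cyl_def)
  also have "\<dots> \<in> sets borel" by measurable
  finally show ?thesis .
qed

lemma cyl_subset_cball:
  assumes "F \<subseteq> cball z h" "0 \<le> t"
  shows "cyl t \<subseteq> cball z (h + t)"
proof
  fix x assume x: "x \<in> cyl t"
  then have "dist z (plane_proj n c x) \<le> h" using assms by (auto simp: cyl_def)
  moreover have "dist (plane_proj n c x) x = \<bar>n \<bullet> x - c\<bar>"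
    using unit by (simp add: dist_norm plane_proj_def)
  moreover have "\<bar>n \<bullet> x - c\<bar> \<le> t" using x assms by (auto simp: cyl_def)
  ultimately show "x \<in> cball z (h + t)"
    using dist_triangle[of z x "plane_proj n c x"] by simp
qed

lemma cyl_bounded: "0 \<le> t \<Longrightarrow> bounded (cyl t)"
proof -
  assume "0 \<le> t"
  obtain z h where "F \<subseteq> cball z h" using bdd bounded_subset_cball by blast
  then show ?thesis using cyl_subset_cball \<open>0 \<le> t\<close> bounded_cball bounded_subset by metis
qed

lemma cyl_shift: "x + s *\<^sub>R n \<in> {x. c + s \<le> n \<bullet> x \<and> n \<bullet> x < c + (s + t) \<and> plane_proj n c x \<in> F} \<longleftrightarrow> x \<in> cyl t"
  using unit by (auto simp: cyl_def plane_proj_shift inner_add_right dot_square_norm)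

definition cyl_integral :: "('a \<Rightarrow> real) \<Rightarrow> real \<Rightarrow> real" where
  "cyl_integral g t = (LINT x:cyl t|lborel. g (plane_proj n c x))"

lemma cont_proj: "continuous_on UNIV g \<Longrightarrow> continuous_on UNIV (\<lambda>x. g (plane_proj n c x))"
  using continuous_on_compose2[of UNIV g UNIV "plane_proj n c"] plane_proj_continuous by blast

lemma cyl_integrable:
  fixes g :: "'a \<Rightarrow> real"
  assumes "continuous_on UNIV g" "0 \<le> t"
  shows "set_integrable lborel (cyl t) (\<lambda>x. g (plane_proj n c x))"
  using cont_proj[OF assms(1)] cyl_bounded[OF assms(2)] cyl_borel[of t]
  by (intro set_integrable_lborel_continuous) auto

lemma cyl_integral_add:
  assumes g: "continuous_on UNIV g" and s: "0 \<le> s" and t: "0 \<le> t"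
  shows "cyl_integral g (s + t) = cyl_integral g s + cyl_integral g t"
proof -
  let ?S = "{x. c + s \<le> n \<bullet> x \<and> n \<bullet> x < c + (s + t) \<and> plane_proj n c x \<in> F}"
  let ?g = "\<lambda>x. g (plane_proj n c x)"
  have un: "cyl (s + t) = cyl s \<union> ?S" and dis: "cyl s \<inter> ?S = {}"
    using s t by (auto simp: cyl_def)
  have Sb: "?S \<in> sets borel"
  proof -
    have "?S = cyl (s + t) - cyl s" using un dis by blast
    then show ?thesis using cyl_borel by auto
  qed
  have int: "set_integrable lborel ?S ?g"
  proof (rule set_integrable_subset)
    show "set_integrable lborel (cyl (s + t)) ?g" using g s t by (intro cyl_integrable) auto
    show "?S \<in> sets lborel" using Sb by simp
    show "?S \<subseteq> cyl (s + t)" using un by blast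
  qed
  have "cyl_integral g (s + t) = cyl_integral g s + (LINT x:?S|lborel. ?g x)"
    unfolding cyl_integral_def un
    by (rule set_integral_Un[OF dis cyl_integrable[OF g s] int])
  also have "(LINT x:?S|lborel. ?g x) = cyl_integral g t"
  proof -
    define k where "k = (\<lambda>x. indicator ?S x *\<^sub>R ?g x)"
    have m: "k \<in> borel_measurable borel"
      unfolding k_def using Sb borel_measurable_continuous_onI[OF cont_proj[OF g]]
      by (intro borel_measurable_scaleR borel_measurable_indicator)
    have k: "k (s *\<^sub>R n + x) = indicator (cyl t) x *\<^sub>R ?g x" for x
    proof -
      have "s *\<^sub>R n + x \<in> ?S \<longleftrightarrow> x \<in> cyl t" using cyl_shift[of x s t] by (simp add: add.commute)
      moreover have "?g (s *\<^sub>R n + x) = ?g x"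
        using plane_proj_shift[OF unit, of c x s] by (simp add: add.commute)
      ultimately show ?thesis unfolding k_def indicator_def by (simp only:)
    qed
    have "(LINT x:?S|lborel. ?g x) = (\<integral>x. k x \<partial>distr lborel borel ((+) (s *\<^sub>R n)))"
      by (simp add: set_lebesgue_integral_def lborel_distr_plus k_def)
    also have "\<dots> = (\<integral>x. k (s *\<^sub>R n + x) \<partial>lborel)"
      by (rule integral_distr[OF _ m]) simp
    also have "\<dots> = (\<integral>x. indicator (cyl t) x *\<^sub>R ?g x \<partial>lborel)" by (simp only: k)
    finally show ?thesis by (simp add: cyl_integral_def set_lebesgue_integral_def)
  qed
  finally show ?thesis .
qed

text \<open>Surface integrals are defined through cylinders of height one; heights comparable to the
  diameter of the face are the natural ones, and the integral over a cylinder is proportional to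
  its height.\<close>

lemma cyl_integral_linear:
  assumes "continuous_on UNIV g" "\<And>x. 0 \<le> g x" "0 \<le> t"
  shows "cyl_integral g t = t * cyl_integral g 1"
proof (rule additive_nonneg_linear[OF _ _ assms(3)])
  show "0 \<le> cyl_integral g t" for t
    using assms(2) by (auto simp: cyl_integral_def set_lebesgue_integral_def intro!: integral_nonneg)
qed (rule cyl_integral_add[OF assms(1)])

lemma closed_cyl_borel: "{x. c \<le> n \<bullet> x \<and> n \<bullet> x \<le> c + 1 \<and> plane_proj n c x \<in> F} \<in> sets borel"
proof -
  have [measurable]: "F \<in> sets borel" by (rule borel)
  have "{x \<in> space borel. c \<le> n \<bullet> x \<and> n \<bullet> x \<le> c + 1 \<and> plane_proj n c x \<in> F} \<in> sets borel" by measurable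
  then show ?thesis by simp
qed

lemma sets_hyperplane_measure: "sets (hyperplane_measure n c) = sets borel"
  and space_hyperplane_measure: "space (hyperplane_measure n c) = UNIV"
  by (simp_all add: hyperplane_measure_def)

lemma space_face [simp]: "space (face_measure F) = F"
  by (simp add: fm space_restrict_space space_hyperplane_measure)

lemma slab_borel: "{x. c \<le> n \<bullet> x \<and> n \<bullet> x \<le> c + 1} \<in> sets borel"
proof -
  have "{x \<in> space borel. c \<le> n \<bullet> x \<and> n \<bullet> x \<le> c + 1} \<in> sets borel" by measurable
  then show ?thesis by simp
qed

lemma proj_restr_measurable:
  "(\<lambda>x. x - (n \<bullet> x - c) *\<^sub>R n) \<in> measurable (restrict_space lborel {x. c \<le> n \<bullet> x \<and> n \<bullet> x \<le> c + 1}) borel"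
  by (rule measurable_restrict_space1) measurable

lemma integral_face_closed_cyl:
  assumes g: "g \<in> borel_measurable borel"
  shows "(\<integral>x. g x \<partial>face_measure F) =
    (LINT x:{x. c \<le> n \<bullet> x \<and> n \<bullet> x \<le> c + 1 \<and> plane_proj n c x \<in> F}|lborel. g (plane_proj n c x) :: real)"
proof -
  have "(\<integral>x. g x \<partial>face_measure F) = (\<integral>x. indicator F x *\<^sub>R g x \<partial>hyperplane_measure n c)"
    unfolding fm using borel
    by (subst integral_restrict_space) (simp_all add: sets_hyperplane_measure space_hyperplane_measure)
  also have "\<dots> = (\<integral>x. indicator F (plane_proj n c x) *\<^sub>R g (plane_proj n c x)
      \<partial>restrict_space lborel {x. c \<le> n \<bullet> x \<and> n \<bullet> x \<le> c + 1})"
    unfolding hyperplane_measure_def plane_proj_def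
    using g borel proj_restr_measurable
    by (subst integral_distr) auto
  also have "\<dots> = (\<integral>x. indicator {x. c \<le> n \<bullet> x \<and> n \<bullet> x \<le> c + 1} x *\<^sub>R
      (indicator F (plane_proj n c x) *\<^sub>R g (plane_proj n c x)) \<partial>lborel)"
    using slab_borel by (subst integral_restrict_space) simp_all
  also have "\<dots> = (LINT x:{x. c \<le> n \<bullet> x \<and> n \<bullet> x \<le> c + 1 \<and> plane_proj n c x \<in> F}|lborel. g (plane_proj n c x))"
    unfolding set_lebesgue_integral_def
    by (intro Bochner_Integration.integral_cong) (auto simp: indicator_def)
  finally show ?thesis .
qed

lemma AE_not_plane: "AE x in lborel. n \<bullet> x \<noteq> d"
proof -
  have "negligible {x. n \<bullet> x = d}" using unit by (intro negligible_hyperplane) auto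
  then have "{x. n \<bullet> x = d} \<in> null_sets lborel"
    using closed_hyperplane[of n d]
    by (auto simp: negligible_iff_null_sets null_sets_completion_iff borel_closed)
  from AE_not_in[OF this] show ?thesis by simp
qed

lemma integral_face:
  assumes g: "continuous_on UNIV g"
  shows "(\<integral>x. g x \<partial>face_measure F) = cyl_integral g 1"
proof -
  have [measurable]: "F \<in> sets borel" by (rule borel)
  have m[measurable]: "(\<lambda>x. g (plane_proj n c x)) \<in> borel_measurable borel"
    by (rule borel_measurable_continuous_onI[OF cont_proj[OF g]])
  have "(\<integral>x. g x \<partial>face_measure F) = (LINT x:{x. c \<le> n \<bullet> x \<and> n \<bullet> x \<le> c + 1 \<and> plane_proj n c x \<in> F}|lborel. g (plane_proj n c x))"
    by (rule integral_face_closed_cyl[OF borel_measurable_continuous_onI[OF g]])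
  also have "\<dots> = cyl_integral g 1"
    unfolding cyl_integral_def set_lebesgue_integral_def
  proof (rule integral_cong_AE)
    show "AE x in lborel. indicator {x. c \<le> n \<bullet> x \<and> n \<bullet> x \<le> c + 1 \<and> plane_proj n c x \<in> F} x *\<^sub>R g (plane_proj n c x) =
       indicator (cyl 1) x *\<^sub>R g (plane_proj n c x)"
      using AE_not_plane[of "c + 1"] by eventually_elim (auto simp: indicator_def cyl_def)
  qed (use m closed_cyl_borel cyl_borel[of 1] in \<open>auto intro!: borel_measurable_times borel_measurable_indicator\<close>)
  finally show ?thesis .
qed

lemma emeasure_face: "A \<in> sets borel \<Longrightarrow> A \<subseteq> F \<Longrightarrow>
  emeasure (face_measure F) A = emeasure lborel {x. c \<le> n \<bullet> x \<and> n \<bullet> x \<le> c + 1 \<and> plane_proj n c x \<in> A}"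
proof -
  assume A: "A \<in> sets borel" "A \<subseteq> F"
  have pm: "plane_proj n c \<in> measurable (restrict_space lborel {x. c \<le> n \<bullet> x \<and> n \<bullet> x \<le> c + 1}) borel"
    using proj_restr_measurable by (simp add: plane_proj_def[abs_def])
  have "emeasure (face_measure F) A = emeasure (hyperplane_measure n c) A"
    unfolding fm using A borel by (intro emeasure_restrict_space)
      (simp_all add: sets_hyperplane_measure space_hyperplane_measure)
  also have "\<dots> = emeasure (restrict_space lborel {x. c \<le> n \<bullet> x \<and> n \<bullet> x \<le> c + 1})
     (plane_proj n c -` A \<inter> {x. c \<le> n \<bullet> x \<and> n \<bullet> x \<le> c + 1})"
    using emeasure_distr[OF pm A(1)] unfolding hyperplane_measure_def plane_proj_def[abs_def]
    by (simp add: space_restrict_space)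
  also have "\<dots> = emeasure lborel (plane_proj n c -` A \<inter> {x. c \<le> n \<bullet> x \<and> n \<bullet> x \<le> c + 1})"
    using slab_borel by (intro emeasure_restrict_space) auto
  also have "plane_proj n c -` A \<inter> {x. c \<le> n \<bullet> x \<and> n \<bullet> x \<le> c + 1} =
     {x. c \<le> n \<bullet> x \<and> n \<bullet> x \<le> c + 1 \<and> plane_proj n c x \<in> A}" by auto
  finally show ?thesis .
qed

lemma finite_face: "finite_measure (face_measure F)"
proof
  let ?S = "{x. c \<le> n \<bullet> x \<and> n \<bullet> x \<le> c + 1 \<and> plane_proj n c x \<in> F}"
  have "?S \<subseteq> cyl 2" by (auto simp: cyl_def)
  then have "emeasure lborel ?S < \<infinity>"
    using bounded_subset[OF cyl_bounded[of 2]] emeasure_bounded_finite[of ?S] by simp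
  then show "emeasure (face_measure F) (space (face_measure F)) \<noteq> \<infinity>"
    using emeasure_face[OF borel] by simp
qed

lemma integral_face_cong: "(\<And>x. x \<in> F \<Longrightarrow> f x = g x) \<Longrightarrow> (\<integral>x. f x \<partial>face_measure F) = (\<integral>x. g x \<partial>face_measure F)"
  by (intro Bochner_Integration.integral_cong) auto

lemma integrable_face:
  fixes g :: "'a \<Rightarrow> real"
  assumes g: "continuous_on UNIV g" and eq: "\<And>x. x \<in> F \<Longrightarrow> f x = g x"
  shows "integrable (face_measure F) f"
proof -
  interpret finite_measure "face_measure F" by (rule finite_face)
  obtain K where K: "compact K" "F \<subseteq> K"
    using bdd bounded_closure compact_closure closure_subset by metis
  then have "compact (g ` K)" using g by (meson compact_continuous_image continuous_on_subset subset_UNIV)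
  then obtain M where M: "\<forall>y\<in>g ` K. norm y \<le> M" using compact_imp_bounded bounded_iff by metis
  have "g \<in> borel_measurable (face_measure F)"
    unfolding fm
    by (rule measurable_restrict_space1)
      (use borel_measurable_continuous_onI[OF g] in \<open>simp add: measurable_cong_sets[OF sets_hyperplane_measure refl]\<close>)
  then have "integrable (face_measure F) g"
    using M K by (intro integrable_const_bound[of _ M] AE_I2) auto
  then show ?thesis using eq Bochner_Integration.integrable_cong[of "face_measure F" "face_measure F" f g] by simp
qed

text \<open>The cylinder of height \<open>h\<close> over the face lies in a ball of radius \<open>2 h\<close>,
  and the volume of a cylinder is its height times the area of the face.\<close>

lemma area_le:
  assumes "F \<subseteq> cball z h" "0 < h"
  shows "(\<integral>x. 1 \<partial>face_measure F) \<le> unit_ball_vol (real DIM('a)) * 2 ^ DIM('a) * h ^ DIM('a) / h"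
proof -
  have "cyl_integral (\<lambda>_. 1) h = h * cyl_integral (\<lambda>_. 1) 1" using assms(2) by (intro cyl_integral_linear) auto
  moreover have "cyl_integral (\<lambda>_. 1) h \<le> (LINT x:cball z (h + h)|lborel. 1)"
    unfolding cyl_integral_def
    using cyl_subset_cball[OF assms(1), of h] assms(2)
    by (intro set_integral_mono_set set_integrable_lborel_continuous cyl_borel) auto
  moreover have "(LINT x:cball z (h + h)|lborel. 1) = unit_ball_vol (real DIM('a)) * (2 * h) ^ DIM('a)"
    using content_cball[of "h + h" z] assms(2) by (simp add: set_lebesgue_integral_def)
  ultimately have "h * cyl_integral (\<lambda>_. 1) 1 \<le> unit_ball_vol (real DIM('a)) * (2 * h) ^ DIM('a)" by simp
  then have "cyl_integral (\<lambda>_. 1) 1 \<le> unit_ball_vol (real DIM('a)) * (2 * h) ^ DIM('a) / h"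
    using assms(2) by (simp add: field_simps)
  then show ?thesis using integral_face[of "\<lambda>_. 1"] by (simp add: power_mult_distrib mult.assoc)
qed

text \<open>The ball that touches the face at the centre of the disc lies in the cylinder over the disc.\<close>

lemma face_integral_ge:
  assumes g: "g \<in> polys l" and z: "z \<in> F" and r: "0 < r"
    and disc: "\<And>x. n \<bullet> x = c \<Longrightarrow> dist z x < r \<Longrightarrow> x \<in> F"
  shows "(LINT x:ball (z + (r / 2) *\<^sub>R n) (r / 2)|lborel. (g (plane_proj n c x))\<^sup>2)
     \<le> r * (\<integral>x. (g x)\<^sup>2 \<partial>face_measure F)"
proof -
  have g2: "continuous_on UNIV (\<lambda>x. (g x)\<^sup>2)"
    using polys_continuous_on[OF g] by (intro continuous_intros)
  have "ball (z + (r / 2) *\<^sub>R n) (r / 2) \<subseteq> cyl r"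
  proof
    fix x assume x: "x \<in> ball (z + (r / 2) *\<^sub>R n) (r / 2)"
    have "n \<bullet> x = c + r / 2 + n \<bullet> (x - (z + (r / 2) *\<^sub>R n))"
      using in_plane[OF z] unit by (simp add: inner_diff_right inner_add_right dot_square_norm)
    moreover have "\<bar>n \<bullet> (x - (z + (r / 2) *\<^sub>R n))\<bar> \<le> norm n * norm (x - (z + (r / 2) *\<^sub>R n))"
      by (rule Cauchy_Schwarz_ineq2)
    moreover have "norm (x - (z + (r / 2) *\<^sub>R n)) < r / 2"
      using x by (simp add: dist_norm norm_minus_commute)
    ultimately have "\<bar>n \<bullet> x - (c + r / 2)\<bar> < r / 2" using unit by simp
    then have "c \<le> n \<bullet> x \<and> n \<bullet> x < c + r" by linarith
    moreover have "plane_proj n c x = plane_proj n c (x + (- (r / 2)) *\<^sub>R n)"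
      by (rule plane_proj_shift[OF unit, symmetric])
    then have "dist z (plane_proj n c x) \<le> dist z (x + (- (r / 2)) *\<^sub>R n)"
      using plane_proj_dist[OF unit in_plane[OF z]] by metis
    moreover have "dist z (x + (- (r / 2)) *\<^sub>R n) < r"
      using x r by (simp add: dist_norm algebra_simps)
    ultimately show "x \<in> cyl r"
      using disc[of "plane_proj n c x"] plane_proj_in[OF unit] by (auto simp: cyl_def)
  qed
  then have sub: "ball (z + (r / 2) *\<^sub>R n) (r / 2) \<subseteq> cyl r" .
  have "(LINT x:ball (z + (r / 2) *\<^sub>R n) (r / 2)|lborel. (g (plane_proj n c x))\<^sup>2)
     \<le> (LINT x:cyl r|lborel. (g (plane_proj n c x))\<^sup>2)"
  proof (rule set_integral_mono_set[OF _ sub])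
    show "set_integrable lborel (cyl r) (\<lambda>x. (g (plane_proj n c x))\<^sup>2)"
      using cyl_integrable[OF g2, of r] r by linarith
  qed simp_all
  also have "\<dots> = cyl_integral (\<lambda>x. (g x)\<^sup>2) r" by (simp add: cyl_integral_def)
  also have "\<dots> = r * (\<integral>x. (g x)\<^sup>2 \<partial>face_measure F)"
    unfolding integral_face[OF g2] by (rule cyl_integral_linear[OF g2 zero_le_power2 less_imp_le[OF r]])
  finally show ?thesis .
qed

lemma face_integral_zero:
  assumes g: "g \<in> polys l" and 0: "(\<integral>x. (g x)\<^sup>2 \<partial>face_measure F) = 0"
  shows "g (plane_proj n c x) = 0"
proof -
  obtain z where z: "z \<in> F" using ne by blast
  obtain r where r: "0 < r" "\<And>x. n \<bullet> x = c \<Longrightarrow> dist z x < r \<Longrightarrow> x \<in> F"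
    using disc_in[OF z] by blast
  let ?I = "LINT x:ball (z + (r / 2) *\<^sub>R n) (r / 2)|lborel. (g (plane_proj n c x))\<^sup>2"
  have "?I \<le> 0" using face_integral_ge[OF g z r] 0 by simp
  moreover have "0 \<le> ?I" by (auto simp: set_lebesgue_integral_def intro!: integral_nonneg)
  ultimately have "?I = 0" by simp
  from polys_integral_zero[OF polys_plane_proj[OF g] _ this] r(1) show ?thesis by simp
qed

lemma face_integral_zero_on:
  assumes "g \<in> polys l" "(\<integral>x. (g x)\<^sup>2 \<partial>face_measure F) = 0" "n \<bullet> x = c"
  shows "g x = 0"
  using face_integral_zero[OF assms(1,2), of x] assms(3) by (simp add: plane_proj_id)

lemma AE_face_witness:
  assumes "AE x in face_measure F. P x"
  shows "\<exists>x\<in>F. P x"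
proof (rule ccontr)
  assume "\<not> ?thesis"
  then have "AE x in face_measure F. False" using assms
    by (rule_tac AE_mp[OF assms]) (auto intro!: AE_I2)
  then have "(\<integral>x. (1::real)\<^sup>2 \<partial>face_measure F) = (\<integral>x. 0 \<partial>face_measure F)"
    by (intro integral_cong_AE) (auto elim!: eventually_mono)
  then have "(\<integral>x. (1::real)\<^sup>2 \<partial>face_measure F) = 0" by simp
  from face_integral_zero[OF polys_const[of 1 0], simplified] this show False by simp
qed

end

section \<open>Sets swept out along a direction\<close>

text \<open>If the set swept out is negligible, then almost every line in the direction \<open>e\<close>
  misses \<open>A\<close>.\<close>

definition sweep :: "'a::euclidean_space \<Rightarrow> 'a set \<Rightarrow> 'a set" where
  "sweep e A = {x + t *\<^sub>R e | x t. x \<in> A}"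

lemma sweep_mono: "A \<subseteq> B \<Longrightarrow> sweep e A \<subseteq> sweep e B"
  by (auto simp: sweep_def)

lemma sweep_Un: "sweep e (A \<union> B) = sweep e A \<union> sweep e B"
  by (auto simp: sweep_def)

lemma sweep_UN: "sweep e (\<Union>i\<in>I. A i) = (\<Union>i\<in>I. sweep e (A i))"
  by (auto simp: sweep_def)

text \<open>One direction more still leaves a subspace of positive codimension.\<close>

lemma negligible_sweep_lowdim:
  fixes A :: "'a::euclidean_space set"
  assumes "aff_dim A \<le> int DIM('a) - 2"
  shows "negligible (sweep e A)"
proof (cases "A = {}")
  case True
  then show ?thesis by (simp add: sweep_def)
next
  case False
  then obtain a where a: "a \<in> A" by blast
  let ?V = "(\<lambda>x. x - a) ` A"
  have "aff_dim A = int (dim ?V)" using a by (intro aff_dim_eq_dim_subtract) (simp add: hull_inc)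
  then have "dim (insert e ?V) < DIM('a)" using assms by (auto simp: dim_insert)
  then obtain w where w: "w \<noteq> 0" "span (insert e ?V) \<subseteq> {x. w \<bullet> x = 0}"
    using lowdim_subset_hyperplane by blast
  have "w \<bullet> e = 0" using w(2) span_base[of e "insert e ?V"] by blast
  moreover have "w \<bullet> (x - a) = 0" if "x \<in> A" for x
  proof -
    have "x - a \<in> span (insert e ?V)" using that by (intro span_base) auto
    then show ?thesis using w(2) by blast
  qed
  ultimately have "sweep e A \<subseteq> {x. w \<bullet> x = w \<bullet> a}"
    by (auto simp: sweep_def inner_add_right inner_diff_right)
  then show ?thesis using negligible_hyperplane[of w "w \<bullet> a"] w(1) negligible_subset by blast
qed

lemma negligible_sweep_finite:
  assumes "finite \<A>" "\<And>A. A \<in> \<A> \<Longrightarrow> aff_dim A \<le> int DIM('a) - 2" "N \<subseteq> \<Union>\<A>"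
  shows "negligible (sweep e (N :: 'a::euclidean_space set))"
proof -
  have "negligible (\<Union>A\<in>\<A>. sweep e A)"
  proof (rule negligible_Union)
    show "finite (sweep e ` \<A>)" using assms(1) by simp
    show "negligible T" if "T \<in> sweep e ` \<A>" for T
      using that assms(2) negligible_sweep_lowdim by blast
  qed
  moreover have "sweep e N \<subseteq> (\<Union>A\<in>\<A>. sweep e A)" using sweep_mono[OF assms(3), of e]
    sweep_UN[of e "\<lambda>A. A" \<A>] by simp
  ultimately show ?thesis using negligible_subset by blast
qed

context flat_face
begin

text \<open>If \<open>e\<close> is tangential, the sweep stays in the hyperplane. Otherwise a shear maps the
  infinite right cylinder over the exceptional set, a countable union of translates of a null set,
  onto the sweep.\<close>

lemma negligible_sweep_AE:
  assumes "AE x in face_measure F. P x"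
  shows "negligible (sweep e {x \<in> F. \<not> P x})"
proof -
  obtain N where N: "{x \<in> space (face_measure F). \<not> P x} \<subseteq> N" "emeasure (face_measure F) N = 0"
    "N \<in> sets (face_measure F)"
    using assms by (rule AE_E)
  then have NF: "N \<in> sets borel" "N \<subseteq> F"
    using borel by (auto simp: fm sets_restrict_space sets_hyperplane_measure)
  let ?S = "{x. c \<le> n \<bullet> x \<and> n \<bullet> x \<le> c + 1 \<and> plane_proj n c x \<in> N}"
  have Sb: "?S \<in> sets borel"
  proof -
    have [measurable]: "N \<in> sets borel" by (rule NF)
    have "{x \<in> space borel. c \<le> n \<bullet> x \<and> n \<bullet> x \<le> c + 1 \<and> plane_proj n c x \<in> N} \<in> sets borel" by measurable
    then show ?thesis by simp
  qed
  have "emeasure lborel ?S = 0" using emeasure_face[OF NF] N(2) by simp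
  then have S0: "negligible ?S"
    using Sb by (auto simp: negligible_iff_null_sets null_sets_def intro!: null_sets_completionI)
  let ?C = "{x. plane_proj n c x \<in> N}"
  have "?C \<subseteq> (\<Union>j::int. (+) (of_int j *\<^sub>R n) ` ?S)"
  proof
    fix x assume x: "x \<in> ?C"
    define j where "j = \<lfloor>n \<bullet> x - c\<rfloor>"
    have "n \<bullet> (x + (- of_int j) *\<^sub>R n) = n \<bullet> x - of_int j"
      using unit by (simp add: inner_diff_right dot_square_norm)
    then have "c \<le> n \<bullet> (x + (- of_int j) *\<^sub>R n)" "n \<bullet> (x + (- of_int j) *\<^sub>R n) \<le> c + 1"
      unfolding j_def by linarith+
    moreover have "plane_proj n c (x + (- of_int j) *\<^sub>R n) \<in> N"
      using x plane_proj_shift[OF unit] by (metis mem_Collect_eq)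
    ultimately have "x + (- of_int j) *\<^sub>R n \<in> ?S" by simp
    moreover have "x = of_int j *\<^sub>R n + (x + (- of_int j) *\<^sub>R n)" by simp
    ultimately show "x \<in> (\<Union>j::int. (+) (of_int j *\<^sub>R n) ` ?S)" by blast
  qed
  moreover have "negligible (\<Union>j::int. (+) (of_int j *\<^sub>R n) ` ?S)"
    by (intro negligible_countable_Union countable_image) (auto intro!: negligible_translation S0)
  ultimately have C0: "negligible ?C" using negligible_subset by blast
  have "negligible (sweep e N)"
  proof (cases "n \<bullet> e = 0")
    case True
    then have "sweep e N \<subseteq> {x. n \<bullet> x = c}" using NF(2) in_plane by (auto simp: sweep_def inner_add_right)
    moreover have "n \<noteq> 0" using unit by auto
    ultimately show ?thesis using negligible_hyperplane[of n c] negligible_subset by blast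
  next
    case False
    define A where "A = (\<lambda>x. x + (n \<bullet> x - c) *\<^sub>R ((1 / (n \<bullet> e)) *\<^sub>R e - n))"
    have "sweep e N \<subseteq> A ` ?C"
    proof
      fix y assume "y \<in> sweep e N"
      then obtain z t where z: "z \<in> N" "y = z + t *\<^sub>R e" by (auto simp: sweep_def)
      define x where "x = z + (t * (n \<bullet> e)) *\<^sub>R n"
      have nz: "n \<bullet> z = c" using z NF(2) in_plane by blast
      then have nx: "n \<bullet> x - c = t * (n \<bullet> e)"
        using unit by (simp add: x_def inner_add_right dot_square_norm)
      have "plane_proj n c x = z"
        using plane_proj_shift[OF unit, of c z] nz by (simp add: x_def plane_proj_id)
      moreover have "A x = y"
        unfolding A_def nx using False by (simp add: x_def z(2) algebra_simps)
      ultimately show "y \<in> A ` ?C" using z(1) by blast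
    qed
    moreover have "negligible (A ` ?C)"
    proof (rule negligible_differentiable_image_negligible[OF _ C0])
      show "A differentiable_on ?C"
        unfolding A_def by (auto simp: differentiable_on_def intro!: derivative_intros)
    qed simp
    ultimately show ?thesis using negligible_subset by blast
  qed
  then show ?thesis using negligible_subset sweep_mono N(1) space_face by metis
qed

lemma not_negligible_sweep_normal: "\<not> negligible (sweep n F)"
proof
  assume neg: "negligible (sweep n F)"
  obtain z where z: "z \<in> F" using ne by blast
  obtain r where r: "0 < r" "\<And>x. n \<bullet> x = c \<Longrightarrow> dist z x < r \<Longrightarrow> x \<in> F"
    using disc_in[OF z] by blast
  have "ball z r \<subseteq> sweep n F"
  proof
    fix x assume x: "x \<in> ball z r"
    have "plane_proj n c x \<in> F"
      using x plane_proj_dist[OF unit in_plane[OF z], of x] plane_proj_in[OF unit, of c x]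
      by (intro r(2)) auto
    moreover have "x = plane_proj n c x + (n \<bullet> x - c) *\<^sub>R n" by (simp add: plane_proj_def)
    ultimately show "x \<in> sweep n F" unfolding sweep_def by blast
  qed
  then have "negligible (ball z r)" using neg negligible_subset by blast
  then show False using r(1) open_not_negligible[of "ball z r"] by auto
qed

end

section \<open>Geometry of simplices and polytopal sets\<close>

lemma simplex_rel_boundary:
  assumes "m simplex s"
  shows "\<exists>\<A>. finite \<A> \<and> (\<forall>A\<in>\<A>. aff_dim A = m - 1 \<and> A facet_of s) \<and> s - rel_interior s = \<Union>\<A>"
proof -
  have p: "polytope s" using assms by (rule simplex_imp_polytope)
  then have "polyhedron s" by (rule polytope_imp_polyhedron)
  then have "s - rel_interior s = \<Union>{A. A facet_of s}" by (rule rel_boundary_of_polyhedron)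
  moreover have "finite {A. A facet_of s}" using p by (rule finite_polytope_facets)
  moreover have "aff_dim s = m" using assms by (rule aff_dim_simplex)
  ultimately show ?thesis by (intro exI[of _ "{A. A facet_of s}"]) (auto simp: facet_of_def)
qed

lemma polytopal_setE:
  assumes "polytopal_set m P"
  obtains S where "finite S" "\<forall>s\<in>S. m simplex s" "aff_dim (\<Union>S) = m" "P = rel_interior (\<Union>S)"
    "P \<noteq> {}" "compact (\<Union>S)"
proof -
  obtain S where S: "finite S" "\<forall>s\<in>S. m simplex s" "aff_dim (\<Union>S) = m" "P = rel_interior (\<Union>S)" "P \<noteq> {}"
    using assms by (auto simp: polytopal_set_def)
  have "compact (\<Union>S)" using S(1,2) compact_simplex by (intro compact_Union) auto
  then show ?thesis using S that[of S] by blast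
qed

lemma polytopal_set_bounded: "polytopal_set m P \<Longrightarrow> bounded P"
  by (erule polytopal_setE) (metis bounded_subset compact_imp_bounded rel_interior_subset)

lemma polytopal_set_rel_boundary:
  assumes "polytopal_set m P"
  shows "\<exists>\<A>. finite \<A> \<and> (\<forall>A\<in>\<A>. aff_dim A \<le> m - 1) \<and> closure P - P \<subseteq> \<Union>\<A>"
proof -
  obtain S where S: "finite S" "\<forall>s\<in>S. m simplex s" "aff_dim (\<Union>S) = m" "P = rel_interior (\<Union>S)"
    "P \<noteq> {}" "compact (\<Union>S)"
    using assms by (rule polytopal_setE)
  have "\<exists>\<A>. finite \<A> \<and> (\<forall>A\<in>\<A>. aff_dim A = m - 1 \<and> A facet_of s) \<and> s - rel_interior s = \<Union>\<A>" if "s \<in> S" for s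
    using simplex_rel_boundary[OF bspec[OF S(2) that]] .
  then obtain \<A> where \<A>: "\<And>s. s \<in> S \<Longrightarrow> finite (\<A> s)" "\<And>s A. s \<in> S \<Longrightarrow> A \<in> \<A> s \<Longrightarrow> aff_dim A = m - 1"
    "\<And>s. s \<in> S \<Longrightarrow> s - rel_interior s = \<Union>(\<A> s)"
    by metis
  have "closure P - P \<subseteq> \<Union>(\<Union>s\<in>S. \<A> s)"
  proof
    fix x assume x: "x \<in> closure P - P"
    have "closure P \<subseteq> \<Union>S"
      unfolding S(4) by (rule closure_minimal[OF rel_interior_subset compact_imp_closed[OF S(6)]])
    then obtain s where s: "s \<in> S" "x \<in> s" using x by blast
    have "affine hull s \<subseteq> affine hull (\<Union>S)" using s(1) by (intro hull_mono) auto
    moreover have "aff_dim (affine hull s) = aff_dim (affine hull (\<Union>S))"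
      using bspec[OF S(2) s(1)] S(3) by (simp add: aff_dim_simplex)
    moreover have "affine hull s \<noteq> {}" using s(2) hull_inc by fastforce
    ultimately have "affine hull s = affine hull (\<Union>S)"
      by (meson affine_affine_hull affine_dim_equal aff_dim_affine_hull)
    then have "rel_interior s \<subseteq> rel_interior (\<Union>S)"
      using s(1) by (intro rel_interior_mono) auto
    then have "x \<in> s - rel_interior s" using x s S(4) by blast
    then show "x \<in> \<Union>(\<Union>s\<in>S. \<A> s)" using \<A>(3)[OF s(1)] s(1) by auto
  qed
  then show ?thesis using \<A> S(1) by (intro exI[of _ "\<Union>s\<in>S. \<A> s"]) auto
qed

lemma polytopal_set_full_open:
  assumes "polytopal_set (int DIM('a)) (T :: 'a::euclidean_space set)"
  shows "open T" "T \<noteq> {}"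
proof -
  obtain S where S: "aff_dim (\<Union>S) = int DIM('a)" "T = rel_interior (\<Union>S)" "T \<noteq> {}"
    using assms by (rule polytopal_setE)
  then show "open T" "T \<noteq> {}" by (auto simp: aff_dim_eq_full rel_interior_interior)
qed

lemma polytopal_flat_face:
  assumes "polytopal_set (int DIM('a) - 1) (F :: 'a::euclidean_space set)"
  shows "\<exists>n c. flat_face F n c"
proof -
  obtain S where S: "finite S" "\<forall>s\<in>S. (int DIM('a) - 1) simplex s" "aff_dim (\<Union>S) = int DIM('a) - 1"
    "F = rel_interior (\<Union>S)" "F \<noteq> {}" "compact (\<Union>S)"
    using assms by (rule polytopal_setE)
  have opF: "openin (top_of_set (affine hull (\<Union>S))) F" unfolding S(4) by (rule openin_rel_interior)
  have hF: "affine hull F = affine hull (\<Union>S)" by (rule affine_hull_openin[OF opF S(5)])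
  obtain a b where ab: "a \<noteq> 0" "affine hull (\<Union>S) = {x. a \<bullet> x = b}"
    using S(3) aff_dim_eq_hyperplane[of "\<Union>S"] by auto
  have ex: "norm ((1 / norm a) *\<^sub>R a) = 1 \<and> F \<subseteq> {x. ((1 / norm a) *\<^sub>R a) \<bullet> x = b / norm a}"
  proof
    have "F \<subseteq> {x. a \<bullet> x = b}" using hF ab(2) hull_subset by metis
    then show "F \<subseteq> {x. ((1 / norm a) *\<^sub>R a) \<bullet> x = b / norm a}" by auto
  qed (use ab(1) in simp)
  obtain n c where nc: "(SOME (n, c). norm n = 1 \<and> F \<subseteq> {x. n \<bullet> x = c}) = (n, c)" by fastforce
  define P where "P = (\<lambda>(n, c). norm n = 1 \<and> F \<subseteq> {x. n \<bullet> x = c})"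
  have "P ((1 / norm a) *\<^sub>R a, b / norm a)" using ex by (simp add: P_def)
  then have "P (SOME x. P x)" by (rule someI)
  then have "P (n, c)" using nc by (simp add: P_def)
  then have n: "norm n = 1" "F \<subseteq> {x. n \<bullet> x = c}" by (auto simp: P_def)
  have fm: "face_measure F = restrict_space (hyperplane_measure n c) F"
    by (simp add: face_measure_def nc)
  have sub: "affine hull F \<subseteq> {x. n \<bullet> x = c}" by (rule hull_minimal[of F _ affine, OF n(2) affine_hyperplane])
  have eq: "affine hull F = {x. n \<bullet> x = c}"
  proof (rule affine_dim_equal[OF affine_affine_hull affine_hyperplane _ sub])
    show "affine hull F \<noteq> {}" using S(5) by simp
    have "n \<noteq> 0" using n(1) by auto
    then show "aff_dim (affine hull F) = aff_dim {x. n \<bullet> x = c}"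
      using aff_dim_hyperplane[of n c] S(3) aff_dim_affine_hull[of "\<Union>S"] unfolding hF
      by (simp add: of_nat_diff)
  qed
  have "flat_face F n c"
  proof
    show "openin (top_of_set {x. n \<bullet> x = c}) F" using opF hF eq by metis
  qed (fact n eq S(5) fm polytopal_set_bounded[OF assms])+
  then show ?thesis by blast
qed

text \<open>A facet of a simplex contains a disc as large as any ball in the simplex: project the
  section of the ball parallel to the facet from the opposite vertex.\<close>

lemma simplex_facet_disc:
  fixes \<tau> :: "'a::euclidean_space set"
  assumes dim: "2 \<le> DIM('a)" and simp: "int DIM('a) simplex \<tau>" and fac: "\<sigma> facet_of \<tau>"
    and ball: "cball x0 r \<subseteq> \<tau>" "0 < r"
    and n: "norm n = 1" "affine hull \<sigma> = {x. n \<bullet> x = c}"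
  obtains z where "z \<in> \<sigma>" "\<And>x. n \<bullet> x = c \<Longrightarrow> dist z x \<le> r \<Longrightarrow> x \<in> \<sigma>"
proof -
  obtain C where C: "\<not> affine_dependent C" "int (card C) = int DIM('a) + 1" "\<tau> = convex hull C"
    using simp by (auto simp: simplex_def)
  obtain v where v: "\<sigma> \<noteq> {}" "v \<in> C" "\<sigma> = convex hull (C - {v})"
    using fac facet_of_convex_hull_affine_independent[OF C(1), of \<sigma>] C(3) by blast
  have "C - {v} \<noteq> {}" using v by auto
  have hull: "\<tau> = {x. \<exists>u\<ge>0. \<exists>w\<ge>0. \<exists>b. u + w = 1 \<and> b \<in> \<sigma> \<and> x = u *\<^sub>R v + w *\<^sub>R b}"
    using convex_hull_insert[OF \<open>C - {v} \<noteq> {}\<close>, of v] v C(3) by (auto simp: insert_absorb)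
  have \<sigma>c: "n \<bullet> s = c" if "s \<in> \<sigma>" for s using n(2) that hull_inc[of s \<sigma>] by blast
  have vc: "n \<bullet> v \<noteq> c"
  proof
    assume "n \<bullet> v = c"
    then have "v \<in> affine hull \<sigma>" unfolding n(2) by simp
    then have "v \<in> affine hull (C - {v})" unfolding v(3) affine_hull_convex_hull .
    then show False using C(1) v(2) by (auto simp: affine_dependent_def)
  qed
  have tau_eq: "\<exists>s\<in>\<sigma>. y = v + t *\<^sub>R (s - v)" if "y \<in> \<tau>" "n \<bullet> y = n \<bullet> v + t * (c - n \<bullet> v)" for y t
  proof -
    obtain u w b where b: "u + w = 1" "b \<in> \<sigma>" "y = u *\<^sub>R v + w *\<^sub>R b"
      using \<open>y \<in> \<tau>\<close> hull by blast
    have u: "u = 1 - w" using b by simp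
    have "n \<bullet> y = n \<bullet> v + w * (c - n \<bullet> v)"
      using \<sigma>c[OF b(2)] by (simp add: b(3) u inner_add_right algebra_simps)
    then have "w = t" using that(2) vc by auto
    then show ?thesis using b u by (intro bexI[of _ b]) (auto simp: algebra_simps)
  qed
  have in_ball: "y \<in> \<tau>" if "norm (y - x0) \<le> r" for y using that ball(1) by (auto simp: dist_norm norm_minus_commute)
  define t where "t = (n \<bullet> x0 - n \<bullet> v) / (c - n \<bullet> v)"
  have t: "n \<bullet> x0 = n \<bullet> v + t * (c - n \<bullet> v)" using vc by (simp add: t_def)
  obtain s0 where s0: "s0 \<in> \<sigma>" "x0 = v + t *\<^sub>R (s0 - v)"
    using tau_eq[OF in_ball t] ball(2) by auto
  have t1: "0 \<le> t \<and> t \<le> 1"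
  proof -
    obtain u w b where b: "0 \<le> u" "0 \<le> w" "u + w = 1" "b \<in> \<sigma>" "x0 = u *\<^sub>R v + w *\<^sub>R b"
      using in_ball[of x0] ball(2) hull by auto
    have "n \<bullet> x0 = n \<bullet> v + w * (c - n \<bullet> v)"
      using \<sigma>c[OF b(4)] b(3) by (simp add: b(5) inner_add_right algebra_simps flip: distrib_right)
    then have "w = t" using t vc by auto
    then show ?thesis using b by linarith
  qed
  have t0: "t \<noteq> 0"
  proof
    assume 0: "t = 0"
    obtain e :: 'a where e: "norm e = 1" "n \<bullet> e = 0"
    proof -
      have d: "dim {n} < DIM('a)" using dim_le_card'[of "{n}"] dim by simp
      obtain w where w: "w \<noteq> 0" "orthogonal w n"
      proof (rule orthogonal_to_subspace_exists[OF d])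
        fix x assume x: "x \<noteq> 0" "\<And>y. y \<in> span {n} \<Longrightarrow> orthogonal x y"
        show thesis using x(1) x(2)[OF span_base[of n "{n}"]] by (intro that) auto
      qed
      then have "n \<bullet> ((1 / norm w) *\<^sub>R w) = 0" by (simp add: orthogonal_def inner_commute)
      moreover have "norm ((1 / norm w) *\<^sub>R w) = 1" using w(1) by simp
      ultimately show ?thesis using that by blast
    qed
    then have "n \<bullet> (x0 + r *\<^sub>R e) = n \<bullet> v + t * (c - n \<bullet> v)" using t by (simp add: inner_add_right)
    from tau_eq[OF in_ball this] have "x0 + r *\<^sub>R e = v" using e ball(2) 0 by auto
    moreover have "x0 = v" using s0 0 by simp
    ultimately show False using e ball(2) by auto
  qed
  show ?thesis
  proof (rule that[OF s0(1)])
    fix x assume x: "n \<bullet> x = c" "dist s0 x \<le> r"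
    define y where "y = v + t *\<^sub>R (x - v)"
    have "y - x0 = t *\<^sub>R (x - s0)" by (simp add: y_def s0(2) algebra_simps)
    then have "norm (y - x0) = t * dist s0 x" using t1 by (simp add: dist_norm norm_minus_commute)
    also have "\<dots> \<le> 1 * r" using t1 x(2) ball(2) by (intro mult_mono) auto
    finally have "y \<in> \<tau>" by (intro in_ball) simp
    moreover have "n \<bullet> y = n \<bullet> v + t * (c - n \<bullet> v)" using x by (simp add: y_def inner_add_right inner_diff_right)
    ultimately obtain s where "s \<in> \<sigma>" "y = v + t *\<^sub>R (s - v)" using tau_eq by blast
    then have "t *\<^sub>R (x - v) = t *\<^sub>R (s - v)" by (simp add: y_def)
    then have "x = s" using t0 by simp
    then show "x \<in> \<sigma>" using \<open>s \<in> \<sigma>\<close> by simp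
  qed
qed

section \<open>Geometry of a regular mesh\<close>

locale mesh =
  fixes \<rho> :: real and \<Omega> :: "'a::euclidean_space set" and Th Fh :: "'a set set"
  assumes dim2: "2 \<le> DIM('a)" and opn: "open \<Omega>" and bdd\<Omega>: "bounded \<Omega>" and conv: "convex \<Omega>"
    and ne\<Omega>: "\<Omega> \<noteq> {}" and rho: "0 < \<rho>" and rho1: "\<rho> < 1" and reg: "regular_mesh \<rho> \<Omega> Th Fh"
begin

lemma poly_mesh: "polytopal_mesh \<Omega> Th Fh"
  using reg by (simp add: regular_mesh_def)

lemma finite_Th: "finite Th" and finite_Fh: "finite Fh"
  and disjoint_Th: "disjoint Th" and disjoint_Fh: "disjoint Fh"
  and closure_Un: "closure \<Omega> = (\<Union>T\<in>Th. closure T)"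
  and frontier_Un: "(\<Union>T\<in>Th. frontier T) = (\<Union>F\<in>Fh. closure F)"
  using poly_mesh by (simp_all add: polytopal_mesh_def)

lemma cell_polytopal: "T \<in> Th \<Longrightarrow> polytopal_set (int DIM('a)) T"
  and face_polytopal: "F \<in> Fh \<Longrightarrow> polytopal_set (int DIM('a) - 1) F"
  using poly_mesh by (auto simp: polytopal_mesh_def)

lemma cell_open: "T \<in> Th \<Longrightarrow> open T" and cell_ne: "T \<in> Th \<Longrightarrow> T \<noteq> {}"
  and cell_bounded: "T \<in> Th \<Longrightarrow> bounded T"
  using polytopal_set_full_open cell_polytopal polytopal_set_bounded by blast+

lemma interior_closure_\<Omega>: "interior (closure \<Omega>) = \<Omega>"
  using conv opn by (simp add: convex_interior_closure interior_open)

lemma cell_subset: "T \<in> Th \<Longrightarrow> T \<subseteq> \<Omega>"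
proof -
  assume T: "T \<in> Th"
  then have "T \<subseteq> closure \<Omega>" unfolding closure_Un using closure_subset by blast
  then show ?thesis using cell_open[OF T] interior_maximal interior_closure_\<Omega> by metis
qed

lemma finite_cell_faces: "finite (cell_faces Fh T)"
  using finite_Fh by (simp add: cell_faces_def)

lemma cell_faces_subset: "cell_faces Fh T \<subseteq> Fh"
  by (auto simp: cell_faces_def)

definition plane_normal :: "'a set \<Rightarrow> 'a" where "plane_normal F = fst (SOME (n, c). flat_face F n c)"
definition plane_offset :: "'a set \<Rightarrow> real" where "plane_offset F = snd (SOME (n, c). flat_face F n c)"

lemma flat: "F \<in> Fh \<Longrightarrow> flat_face F (plane_normal F) (plane_offset F)"
proof -
  assume "F \<in> Fh"
  then obtain n c where "flat_face F n c" using polytopal_flat_face face_polytopal by blast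
  then have "(\<lambda>(n, c). flat_face F n c) (n, c)" by simp
  then have "(\<lambda>(n, c). flat_face F n c) (SOME (n, c). flat_face F n c)" by (rule someI)
  then show ?thesis by (simp add: plane_normal_def plane_offset_def split_beta)
qed

text \<open>Opposite normals would put the set on both sides of the face at once.\<close>

lemma outward_unique:
  assumes F: "F \<in> Fh" and m: "outward_normal D F m" "outward_normal D F m'"
  shows "m = m'"
proof (rule ccontr)
  assume "m \<noteq> m'"
  interpret flat_face F "plane_normal F" "plane_offset F" by (rule flat[OF F])
  have "m' = - m"
    using normal_unique[of m] normal_unique[of m'] m \<open>m \<noteq> m'\<close> by (auto simp: outward_normal_def)
  have "AE x in face_measure F. (\<exists>e>0. D \<inter> ball x e = {y \<in> ball x e. m \<bullet> (y - x) < 0}) \<and>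
      (\<exists>e>0. D \<inter> ball x e = {y \<in> ball x e. m' \<bullet> (y - x) < 0})"
    using m unfolding outward_normal_def by (intro AE_conjI) auto
  from AE_face_witness[OF this] obtain x e e' where e: "0 < e" "D \<inter> ball x e = {y \<in> ball x e. m \<bullet> (y - x) < 0}"
    "0 < e'" "D \<inter> ball x e' = {y \<in> ball x e'. m' \<bullet> (y - x) < 0}" by blast
  define y where "y = x - (min e e' / 2) *\<^sub>R m"
  have nm: "norm m = 1" "m \<bullet> m = 1" using m by (auto simp: outward_normal_def norm_eq_1)
  have "y \<in> ball x e" "y \<in> ball x e'" using e nm by (auto simp: y_def dist_norm)
  moreover have "m \<bullet> (y - x) < 0" "\<not> m' \<bullet> (y - x) < 0"
    using e(1,3) nm by (simp_all add: y_def \<open>m' = - m\<close>)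
  ultimately show False using e(2,4) by blast
qed

lemma cell_normal_outward:
  assumes "T \<in> Th" "F \<in> cell_faces Fh T"
  shows "outward_normal T F (cell_normal T F)"
proof -
  have "\<forall>T\<in>Th. \<forall>F\<in>cell_faces Fh T. \<exists>n. outward_normal T F n"
    using poly_mesh by (simp add: polytopal_mesh_def)
  then obtain n where n: "outward_normal T F n" using assms by blast
  have "F \<in> Fh" using assms by (simp add: cell_faces_def)
  then have "cell_normal T F = n"
    unfolding cell_normal_def using n outward_unique by blast
  then show ?thesis using n by simp
qed

lemma cell_normal_eq:
  assumes "T \<in> Th" "F \<in> cell_faces Fh T"
  shows "cell_normal T F = plane_normal F \<or> cell_normal T F = - plane_normal F"
proof -
  have "F \<in> Fh" using assms by (simp add: cell_faces_def)
  then interpret flat_face F "plane_normal F" "plane_offset F" by (rule flat)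
  show ?thesis
    using cell_normal_outward[OF assms] by (intro normal_unique) (auto simp: outward_normal_def)
qed

definition submesh :: "'a set set" where
  "submesh = (SOME S. matching_simplicial_submesh \<Omega> Th Fh S \<and> (\<forall>\<tau>\<in>S. \<rho> * diameter \<tau> \<le> inradius \<tau>) \<and>
     (\<forall>T\<in>Th. \<forall>\<tau>\<in>S. interior \<tau> \<subseteq> T \<longrightarrow> \<rho> * diameter T \<le> diameter \<tau>))"

lemma submesh: "matching_simplicial_submesh \<Omega> Th Fh submesh"
  "\<tau> \<in> submesh \<Longrightarrow> \<rho> * diameter \<tau> \<le> inradius \<tau>"
  "T \<in> Th \<Longrightarrow> \<tau> \<in> submesh \<Longrightarrow> interior \<tau> \<subseteq> T \<Longrightarrow> \<rho> * diameter T \<le> diameter \<tau>"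
proof -
  have "\<exists>S. matching_simplicial_submesh \<Omega> Th Fh S \<and> (\<forall>\<tau>\<in>S. \<rho> * diameter \<tau> \<le> inradius \<tau>) \<and>
     (\<forall>T\<in>Th. \<forall>\<tau>\<in>S. interior \<tau> \<subseteq> T \<longrightarrow> \<rho> * diameter T \<le> diameter \<tau>)"
    using reg by (simp add: regular_mesh_def)
  from someI_ex[OF this] show "matching_simplicial_submesh \<Omega> Th Fh submesh"
  "\<tau> \<in> submesh \<Longrightarrow> \<rho> * diameter \<tau> \<le> inradius \<tau>"
  "T \<in> Th \<Longrightarrow> \<tau> \<in> submesh \<Longrightarrow> interior \<tau> \<subseteq> T \<Longrightarrow> \<rho> * diameter T \<le> diameter \<tau>"
    unfolding submesh_def[symmetric] by blast+
qed

lemma tri: "triangulation submesh"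
  and Sh_simplex: "\<tau> \<in> submesh \<Longrightarrow> int DIM('a) simplex \<tau>"
  and Sh_Un: "\<Union>submesh = closure \<Omega>"
  and Sh_cell: "\<tau> \<in> submesh \<Longrightarrow> \<exists>T\<in>Th. interior \<tau> \<subseteq> T"
  and Sh_face: "\<tau> \<in> submesh \<Longrightarrow> \<sigma> facet_of \<tau> \<Longrightarrow> F \<in> Fh \<Longrightarrow> rel_interior \<sigma> \<inter> F \<noteq> {} \<Longrightarrow> rel_interior \<sigma> \<subseteq> F"
  using submesh(1) unfolding matching_simplicial_submesh_def by blast+

lemma Sh_interior: assumes "\<tau> \<in> submesh"
  shows "interior \<tau> \<noteq> {}" "closure (interior \<tau>) = \<tau>" "rel_interior \<tau> = interior \<tau>" "closed \<tau>" "convex \<tau>"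
proof -
  have s: "int DIM('a) simplex \<tau>" using Sh_simplex[OF assms] .
  show cl: "closed \<tau>" using compact_simplex[OF s] compact_imp_closed by blast
  show cv: "convex \<tau>" using s by (rule convex_simplex)
  have "affine hull \<tau> = UNIV" using aff_dim_simplex[OF s] aff_dim_eq_full by blast
  then show ri: "rel_interior \<tau> = interior \<tau>" by (rule rel_interior_interior)
  have "\<tau> \<noteq> {}" using s by (auto simp: simplex_empty) 
  then show ne: "interior \<tau> \<noteq> {}" using ri rel_interior_eq_empty[OF cv] by simp
  show "closure (interior \<tau>) = \<tau>" using convex_closure_interior[OF cv ne] cl by simp
qed

definition cell_simps :: "'a set \<Rightarrow> 'a set set" where
  "cell_simps T = {\<tau> \<in> submesh. interior \<tau> \<subseteq> T}"

lemma finite_Sh: "finite submesh"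
  using tri by (simp add: triangulation_def)

lemma cell_covered:
  assumes T: "T \<in> Th"
  shows "closure T \<subseteq> \<Union>(cell_simps T)"
proof -
  let ?K = "\<Union>(cell_simps T)"
  have "finite (cell_simps T)" using finite_Sh by (simp add: cell_simps_def)
  then have clK: "closed ?K" using Sh_interior(4) by (intro closed_Union) (auto simp: cell_simps_def)
  have "T \<subseteq> ?K"
  proof (rule ccontr)
    assume "\<not> T \<subseteq> ?K"
    then obtain x where x: "x \<in> T" "x \<notin> ?K" by blast
    have "x \<in> closure \<Omega>" using x(1) cell_subset[OF T] closure_subset by blast
    then obtain \<tau> where \<tau>: "\<tau> \<in> submesh" "x \<in> \<tau>" using Sh_Un by blast
    obtain T' where T': "T' \<in> Th" "interior \<tau> \<subseteq> T'" using Sh_cell[OF \<tau>(1)] by blast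
    have "T' \<noteq> T" using x(2) \<tau> T' by (auto simp: cell_simps_def)
    then have "T' \<inter> T = {}" using disjoint_Th T T'(1) by (metis disjointD)
    then have "interior \<tau> \<inter> T = {}" using T'(2) by blast
    then have "closure (interior \<tau>) \<inter> T = {}" using cell_open[OF T] open_Int_closure_eq_empty by blast
    then show False using Sh_interior(2)[OF \<tau>(1)] \<tau>(2) x(1) by auto
  qed
  then show ?thesis using clK closure_minimal by blast
qed

lemma diameter_pos: "T \<in> Th \<Longrightarrow> 0 < diameter T"
proof -
  assume T: "T \<in> Th"
  obtain x where x: "x \<in> T" using cell_ne[OF T] by blast
  obtain e where e: "0 < e" "cball x e \<subseteq> T" using cell_open[OF T] x open_contains_cball by blast
  obtain b :: 'a where b: "b \<in> Basis" using nonempty_Basis by blast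
  have "x + e *\<^sub>R b \<in> T" using e b by (intro subsetD[OF e(2)]) (simp add: dist_norm)
  then have "dist x (x + e *\<^sub>R b) \<le> diameter T"
    using x cell_bounded[OF T] diameter_bounded_bound by blast
  then show ?thesis using e b by (simp add: dist_norm)
qed

text \<open>Half of the bound \<open>\<rho>\<^sup>2 h\<close> that regularity gives for the inradii of the
  simplices in \<open>T\<close>: the inradius is a supremum, so only smaller radii are known to be
  attained.\<close>

definition rad :: "'a set \<Rightarrow> real" where "rad T = \<rho>\<^sup>2 * diameter T / 2"

lemma rad_pos: "T \<in> Th \<Longrightarrow> 0 < rad T"
  using diameter_pos rho by (simp add: rad_def)

lemma simplex_inball:
  assumes T: "T \<in> Th" and \<tau>: "\<tau> \<in> cell_simps T"
  shows "\<exists>x. cball x (rad T) \<subseteq> \<tau> \<and> ball x (rad T) \<subseteq> interior \<tau>"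
proof -
  have t: "\<tau> \<in> submesh" "interior \<tau> \<subseteq> T" using \<tau> by (auto simp: cell_simps_def)
  let ?A = "{r. 0 \<le> r \<and> (\<exists>x. cball x r \<subseteq> \<tau>)}"
  have "rad T < \<rho> * (\<rho> * diameter T)"
    using diameter_pos[OF T] rho by (simp add: rad_def power2_eq_square)
  also have "\<dots> \<le> \<rho> * diameter \<tau>" using submesh(3)[OF T t] rho by simp
  also have "\<dots> \<le> Sup ?A" using submesh(2)[OF t(1)] by (simp add: inradius_def)
  finally have lt: "rad T < Sup ?A" .
  obtain y where "y \<in> \<tau>" using Sh_interior(1)[OF t(1)] interior_subset by blast
  then have "0 \<in> ?A" by (auto intro!: exI[of _ y])
  then obtain r where r: "r \<in> ?A" "rad T < r" using less_cSupD[OF _ lt] by blast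
  then obtain x where x: "cball x r \<subseteq> \<tau>" by blast
  have "cball x (rad T) \<subseteq> cball x r" using r(2) by (simp add: subset_cball)
  then have 1: "cball x (rad T) \<subseteq> \<tau>" using x by blast
  then have "ball x (rad T) \<subseteq> \<tau>" using ball_subset_cball by blast
  then have "ball x (rad T) \<subseteq> interior \<tau>" by (intro interior_maximal) auto
  then show ?thesis using 1 by blast
qed

lemma cell_simps_ne: "T \<in> Th \<Longrightarrow> cell_simps T \<noteq> {}"
  using cell_covered cell_ne closure_subset by fastforce

lemma cell_inball:
  assumes T: "T \<in> Th"
  shows "\<exists>x\<in>T. ball x (rad T) \<subseteq> T"
proof -
  obtain \<tau> where \<tau>: "\<tau> \<in> cell_simps T" using cell_simps_ne[OF T] by blast
  obtain x where "ball x (rad T) \<subseteq> interior \<tau>" using simplex_inball[OF T \<tau>] by blast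
  then have "ball x (rad T) \<subseteq> T" using \<tau> by (auto simp: cell_simps_def)
  moreover have "x \<in> ball x (rad T)" using rad_pos[OF T] by simp
  ultimately show ?thesis by blast
qed

lemma cell_subset_cball:
  assumes T: "T \<in> Th" and x: "x \<in> closure T"
  shows "closure T \<subseteq> cball x (diameter T)"
proof
  fix y assume y: "y \<in> closure T"
  have "bounded (closure T)" using cell_bounded[OF T] by (rule bounded_closure)
  then have "dist x y \<le> diameter (closure T)" using x y diameter_bounded_bound by blast
  then show "y \<in> cball x (diameter T)" using diameter_closure[OF cell_bounded[OF T]] by simp
qed

lemma interiors_disjoint:
  assumes "\<tau> \<in> submesh" "\<tau>' \<in> submesh" "\<tau> \<noteq> \<tau>'"
  shows "interior \<tau> \<inter> interior \<tau>' = {}"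
proof (rule ccontr)
  assume ne: "\<not> ?thesis"
  have f: "(\<tau> \<inter> \<tau>') face_of \<tau>" "(\<tau> \<inter> \<tau>') face_of \<tau>'"
    using tri assms(1,2) unfolding triangulation_def by (blast, metis Int_commute)
  have "\<tau> \<inter> \<tau>' = \<tau>"
  proof (rule ccontr)
    assume "\<tau> \<inter> \<tau>' \<noteq> \<tau>"
    then have "(\<tau> \<inter> \<tau>') \<inter> interior \<tau> = {}"
      using face_of_disjoint_rel_interior[OF f(1)] Sh_interior(3)[OF assms(1)] by simp
    then show False using ne interior_subset by blast
  qed
  moreover have "\<tau> \<inter> \<tau>' = \<tau>'"
  proof (rule ccontr)
    assume "\<tau> \<inter> \<tau>' \<noteq> \<tau>'"
    then have "(\<tau> \<inter> \<tau>') \<inter> interior \<tau>' = {}"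
      using face_of_disjoint_rel_interior[OF f(2)] Sh_interior(3)[OF assms(2)] by simp
    then show False using ne interior_subset by blast
  qed
  ultimately show False using assms(3) by simp
qed

text \<open>The simplices contain disjoint balls of radius \<open>rad T\<close>, all of them in a ball whose
  radius is the diameter of \<open>T\<close>.\<close>

lemma card_cell_simps:
  assumes T: "T \<in> Th"
  shows "real (card (cell_simps T)) \<le> (2 / \<rho>\<^sup>2) ^ DIM('a)"
proof -
  let ?r = "rad T" and ?h = "diameter T" and ?u = "unit_ball_vol (real DIM('a))"
  have "\<exists>x. ball x ?r \<subseteq> interior \<tau>" if "\<tau> \<in> cell_simps T" for \<tau>
    using simplex_inball[OF T that] by blast
  then obtain z where z: "\<And>\<tau>. \<tau> \<in> cell_simps T \<Longrightarrow> ball (z \<tau>) ?r \<subseteq> interior \<tau>" by metis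
  obtain x0 where x0: "x0 \<in> T" using cell_ne[OF T] by blast
  have fin: "finite (cell_simps T)" using finite_Sh by (simp add: cell_simps_def)
  have dis: "disjoint_family_on (\<lambda>\<tau>. ball (z \<tau>) ?r) (cell_simps T)"
    unfolding disjoint_family_on_def
  proof (intro ballI impI)
    fix \<tau> \<tau>' assume t: "\<tau> \<in> cell_simps T" "\<tau>' \<in> cell_simps T" "\<tau> \<noteq> \<tau>'"
    then have "interior \<tau> \<inter> interior \<tau>' = {}" using interiors_disjoint by (auto simp: cell_simps_def)
    then show "ball (z \<tau>) ?r \<inter> ball (z \<tau>') ?r = {}" using z[OF t(1)] z[OF t(2)] by blast
  qed
  have "(\<Sum>\<tau>\<in>cell_simps T. emeasure lborel (ball (z \<tau>) ?r)) = emeasure lborel (\<Union>\<tau>\<in>cell_simps T. ball (z \<tau>) ?r)"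
    by (rule sum_emeasure[OF _ dis fin]) auto
  also have "\<dots> \<le> emeasure lborel (cball x0 ?h)"
  proof (rule emeasure_mono)
    have "ball (z \<tau>) ?r \<subseteq> cball x0 ?h" if "\<tau> \<in> cell_simps T" for \<tau>
    proof -
      have "interior \<tau> \<subseteq> T" using that by (simp add: cell_simps_def)
      then show ?thesis using z[OF that] cell_subset_cball[OF T, of x0] x0 closure_subset[of T] by blast
    qed
    then show "(\<Union>\<tau>\<in>cell_simps T. ball (z \<tau>) ?r) \<subseteq> cball x0 ?h" by blast
  qed simp
  finally have "of_nat (card (cell_simps T)) * ennreal (?u * ?r ^ DIM('a)) \<le> ennreal (?u * ?h ^ DIM('a))"
    using rad_pos[OF T] diameter_pos[OF T] by (simp add: emeasure_ball emeasure_cball)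
  then have "ennreal (real (card (cell_simps T)) * (?u * ?r ^ DIM('a))) \<le> ennreal (?u * ?h ^ DIM('a))"
    using rad_pos[OF T] by (simp add: ennreal_mult ennreal_of_nat_eq_real_of_nat)
  then have le: "real (card (cell_simps T)) * (?u * ?r ^ DIM('a)) \<le> ?u * ?h ^ DIM('a)"
    using diameter_pos[OF T] by (subst (asm) ennreal_le_iff) auto
  have u: "0 < ?u" by simp
  have "real (card (cell_simps T)) * ?r ^ DIM('a) \<le> ?h ^ DIM('a)"
  proof -
    have "?u * (real (card (cell_simps T)) * ?r ^ DIM('a)) \<le> ?u * ?h ^ DIM('a)"
      using le by (simp add: mult.left_commute)
    then show ?thesis using u by simp
  qed
  then have "real (card (cell_simps T)) \<le> ?h ^ DIM('a) / ?r ^ DIM('a)"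
    using rad_pos[OF T] by (simp add: field_simps)
  also have "\<dots> = (2 / \<rho>\<^sup>2) ^ DIM('a)"
    using rho diameter_pos[OF T] by (simp add: rad_def field_simps flip: power_divide)
  finally show ?thesis .
qed

lemma frontier_covered:
  assumes T: "T \<in> Th" and x: "x \<in> frontier T"
  shows "\<exists>\<tau>\<in>cell_simps T. \<exists>\<sigma>. \<sigma> facet_of \<tau> \<and> x \<in> \<sigma>"
proof -
  obtain \<tau> where \<tau>: "\<tau> \<in> cell_simps T" "x \<in> \<tau>" using cell_covered[OF T] x frontier_def by fastforce
  have tS: "\<tau> \<in> submesh" "interior \<tau> \<subseteq> T" using \<tau> by (auto simp: cell_simps_def)
  have "x \<notin> T" using x cell_open[OF T] by (simp add: frontier_def interior_open)
  then have "x \<in> \<tau> - rel_interior \<tau>" using tS \<tau>(2) Sh_interior(3) by auto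
  then show ?thesis using simplex_rel_boundary[OF Sh_simplex[OF tS(1)]] \<tau>(1) by blast
qed

text \<open>A face of a cell contains a whole facet of one of its simplices, since what it contains
  otherwise is of lower dimension.\<close>

lemma face_contains_facet:
  assumes T: "T \<in> Th" and F: "F \<in> cell_faces Fh T"
  shows "\<exists>\<tau>\<in>cell_simps T. \<exists>\<sigma>. \<sigma> facet_of \<tau> \<and> affine hull \<sigma> = {x. plane_normal F \<bullet> x = plane_offset F} \<and> rel_interior \<sigma> \<subseteq> F
    \<and> rel_interior \<sigma> \<noteq> {}"
proof (rule ccontr)
  assume no: "\<not> ?thesis"
  have FFh: "F \<in> Fh" and fr: "F \<subseteq> frontier T" using F by (auto simp: cell_faces_def)
  interpret flat_face F "plane_normal F" "plane_offset F" by (rule flat[OF FFh])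
  let ?H = "{x. plane_normal F \<bullet> x = plane_offset F}"
  define \<Sigma> where "\<Sigma> = {\<sigma>. \<exists>\<tau>\<in>cell_simps T. \<sigma> facet_of \<tau>}"
  have fin: "finite \<Sigma>"
  proof -
    have "\<Sigma> = (\<Union>\<tau>\<in>cell_simps T. {\<sigma>. \<sigma> facet_of \<tau>})" by (auto simp: \<Sigma>_def)
    moreover have "finite {\<sigma>. \<sigma> facet_of \<tau>}" if "\<tau> \<in> cell_simps T" for \<tau>
      using that Sh_simplex simplex_imp_polytope finite_polytope_facets by (force simp: cell_simps_def)
    ultimately show ?thesis using finite_Sh by (simp add: cell_simps_def)
  qed
  have "\<exists>\<A>. finite \<A> \<and> (\<forall>A\<in>\<A>. aff_dim A \<le> int DIM('a) - 2) \<and> F \<inter> \<sigma> \<subseteq> \<Union>\<A>" if "\<sigma> \<in> \<Sigma>" for \<sigma>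
  proof -
    have "\<exists>\<tau>\<in>cell_simps T. \<sigma> facet_of \<tau>" using that by (simp add: \<Sigma>_def)
    then obtain \<tau> where \<tau>: "\<tau> \<in> cell_simps T" "\<sigma> facet_of \<tau>" by blast
    have tS: "\<tau> \<in> submesh" using \<tau> by (auto simp: cell_simps_def)
    have cs: "convex \<sigma>" using facet_of_imp_face_of[OF \<tau>(2)] face_of_imp_convex by blast
    have ds: "aff_dim \<sigma> = int DIM('a) - 1"
      using \<tau>(2) aff_dim_simplex[OF Sh_simplex[OF tS]] by (simp add: facet_of_def)
    have ne: "rel_interior \<sigma> \<noteq> {}" using \<tau>(2) rel_interior_eq_empty[OF cs] by (auto simp: facet_of_def)
    show ?thesis
    proof (cases "affine hull \<sigma> = ?H")
      case True
      then have "\<not> rel_interior \<sigma> \<subseteq> F" using no \<tau> ne by blast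
      then have "rel_interior \<sigma> \<inter> F = {}" using Sh_face[OF tS \<tau>(2) FFh] by blast
      have "polyhedron \<sigma>"
        using \<tau>(2) Sh_simplex[OF tS] simplex_imp_polytope polytope_imp_polyhedron
          facet_of_imp_face_of face_of_polyhedron_polyhedron by blast
      then have "\<sigma> - rel_interior \<sigma> = \<Union>{A. A facet_of \<sigma>}" by (rule rel_boundary_of_polyhedron)
      moreover have "finite {A. A facet_of \<sigma>}" using \<open>polyhedron \<sigma>\<close> by (rule finite_polyhedron_facets)
      ultimately show ?thesis using \<open>rel_interior \<sigma> \<inter> F = {}\<close> ds
        by (intro exI[of _ "{A. A facet_of \<sigma>}"]) (auto simp: facet_of_def)
    next
      case False
      have "aff_dim (affine hull \<sigma> \<inter> ?H) \<le> int DIM('a) - 2"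
      proof (rule ccontr)
        assume *: "\<not> ?thesis"
        have le: "aff_dim (affine hull \<sigma> \<inter> ?H) \<le> aff_dim (affine hull \<sigma>)" by (intro aff_dim_subset) auto
        have hd: "aff_dim ?H = int DIM('a) - 1"
        proof -
          have "plane_normal F \<noteq> 0" using unit by auto
          then show ?thesis by (simp add: aff_dim_hyperplane of_nat_diff)
        qed
        have eq: "aff_dim (affine hull \<sigma> \<inter> ?H) = int DIM('a) - 1"
          using * le ds by (simp add: aff_dim_affine_hull)
        then have ne': "affine hull \<sigma> \<inter> ?H \<noteq> {}" using dim2 by auto
        have a: "affine (affine hull \<sigma> \<inter> ?H)" by (intro affine_Int affine_affine_hull affine_hyperplane)
        have "affine hull \<sigma> \<inter> ?H = affine hull \<sigma>"
          by (rule affine_dim_equal[OF a affine_affine_hull ne']) (use eq ds in \<open>auto simp: aff_dim_affine_hull\<close>)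
        moreover have "affine hull \<sigma> \<inter> ?H = ?H"
          by (rule affine_dim_equal[OF a affine_hyperplane ne']) (use eq hd in auto)
        ultimately show False using False by simp
      qed
      moreover have "F \<inter> \<sigma> \<subseteq> affine hull \<sigma> \<inter> ?H" using in_plane hull_subset[of \<sigma> affine] by blast
      ultimately show ?thesis by (intro exI[of _ "{affine hull \<sigma> \<inter> ?H}"]) auto
    qed
  qed
  then obtain \<A> where \<A>: "\<And>\<sigma>. \<sigma> \<in> \<Sigma> \<Longrightarrow> finite (\<A> \<sigma>)" "\<And>\<sigma> A. \<sigma> \<in> \<Sigma> \<Longrightarrow> A \<in> \<A> \<sigma> \<Longrightarrow> aff_dim A \<le> int DIM('a) - 2"
    "\<And>\<sigma>. \<sigma> \<in> \<Sigma> \<Longrightarrow> F \<inter> \<sigma> \<subseteq> \<Union>(\<A> \<sigma>)" by metis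
  have "F \<subseteq> \<Union>(\<Union>\<sigma>\<in>\<Sigma>. \<A> \<sigma>)"
  proof
    fix x assume x: "x \<in> F"
    then obtain \<sigma> where "\<sigma> \<in> \<Sigma>" "x \<in> \<sigma>" using frontier_covered[OF T] fr unfolding \<Sigma>_def by blast
    then show "x \<in> \<Union>(\<Union>\<sigma>\<in>\<Sigma>. \<A> \<sigma>)" using \<A>(3) x by blast
  qed
  then have "negligible (sweep (plane_normal F) F)"
    using \<A>(1,2) fin by (intro negligible_sweep_finite[of "\<Union>\<sigma>\<in>\<Sigma>. \<A> \<sigma>"]) auto
  then show False using not_negligible_sweep_normal by simp
qed

lemma face_disc:
  assumes T: "T \<in> Th" and F: "F \<in> cell_faces Fh T"
  shows "\<exists>z\<in>F. \<forall>x. plane_normal F \<bullet> x = plane_offset F \<longrightarrow> dist z x < rad T \<longrightarrow> x \<in> F"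
proof -
  obtain \<tau> \<sigma> where \<sigma>: "\<tau> \<in> cell_simps T" "\<sigma> facet_of \<tau>" "affine hull \<sigma> = {x. plane_normal F \<bullet> x = plane_offset F}"
    "rel_interior \<sigma> \<subseteq> F"
    using face_contains_facet[OF T F] by blast
  have FFh: "F \<in> Fh" using F by (auto simp: cell_faces_def)
  interpret flat_face F "plane_normal F" "plane_offset F" by (rule flat[OF FFh])
  obtain x0 where x0: "cball x0 (rad T) \<subseteq> \<tau>" using simplex_inball[OF T \<sigma>(1)] by blast
  have "int DIM('a) simplex \<tau>" using \<sigma>(1) Sh_simplex by (simp add: cell_simps_def)
  from simplex_facet_disc[OF dim2 this \<sigma>(2) x0 rad_pos[OF T] unit \<sigma>(3)]
  obtain z where z: "z \<in> \<sigma>" "\<And>x. plane_normal F \<bullet> x = plane_offset F \<Longrightarrow> dist z x \<le> rad T \<Longrightarrow> x \<in> \<sigma>" by metis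
  let ?D = "{x. plane_normal F \<bullet> x = plane_offset F} \<inter> ball z (rad T)"
  have "?D \<subseteq> rel_interior \<sigma>"
  proof (rule rel_interior_maximal)
    show "?D \<subseteq> \<sigma>" using z(2) by auto
    show "openin (top_of_set (affine hull \<sigma>)) ?D" unfolding \<sigma>(3) by (rule openin_open_Int) simp
  qed
  then have D: "?D \<subseteq> F" using \<sigma>(4) by blast
  have "z \<in> ?D" using z(1) hull_inc[of z \<sigma> affine] \<sigma>(3) rad_pos[OF T] by auto
  then show ?thesis using D by (intro bexI[of _ z]) auto
qed

text \<open>Distinct faces are disjoint, so the facets of simplices that they contain are distinct.\<close>

lemma card_cell_faces:
  assumes T: "T \<in> Th"
  shows "real (card (cell_faces Fh T)) \<le> (real DIM('a) + 1) * (2 / \<rho>\<^sup>2) ^ DIM('a)"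
proof -
  define \<Sigma> where "\<Sigma> \<tau> = {\<sigma>. \<sigma> facet_of \<tau>}" for \<tau> :: "'a set"
  have cS: "finite (\<Sigma> \<tau>) \<and> card (\<Sigma> \<tau>) \<le> DIM('a) + 1" if "\<tau> \<in> cell_simps T" for \<tau>
  proof -
    have "int DIM('a) simplex \<tau>" using that Sh_simplex by (simp add: cell_simps_def)
    then obtain C where C: "\<not> affine_dependent C" "int (card C) = int DIM('a) + 1" "\<tau> = convex hull C"
      by (auto simp: simplex_def)
    have "finite C" using C(1) by (rule aff_independent_finite)
    moreover have "\<Sigma> \<tau> \<subseteq> (\<lambda>u. convex hull (C - {u})) ` C"
      unfolding \<Sigma>_def C(3) using facet_of_convex_hull_affine_independent[OF C(1)] by blast
    ultimately show ?thesis using C(2)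
      by (metis (no_types, lifting) card_image_le card_mono finite_imageI finite_subset le_trans of_nat_1 of_nat_add of_nat_eq_iff)
  qed
  have "\<exists>\<sigma>\<in>(\<Union>\<tau>\<in>cell_simps T. \<Sigma> \<tau>). rel_interior \<sigma> \<subseteq> F \<and> rel_interior \<sigma> \<noteq> {}" if "F \<in> cell_faces Fh T" for F
    using face_contains_facet[OF T that] unfolding \<Sigma>_def by blast
  then obtain s where s: "\<And>F. F \<in> cell_faces Fh T \<Longrightarrow> s F \<in> (\<Union>\<tau>\<in>cell_simps T. \<Sigma> \<tau>)"
    "\<And>F. F \<in> cell_faces Fh T \<Longrightarrow> rel_interior (s F) \<subseteq> F" "\<And>F. F \<in> cell_faces Fh T \<Longrightarrow> rel_interior (s F) \<noteq> {}"
    by metis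
  have "inj_on s (cell_faces Fh T)"
  proof (rule inj_onI, rule ccontr)
    fix F G assume FG: "F \<in> cell_faces Fh T" "G \<in> cell_faces Fh T" "s F = s G" "F \<noteq> G"
    then have "F \<inter> G = {}" using disjoint_Fh cell_faces_subset by (metis disjointD subsetD)
    then show False using s(2)[OF FG(1)] s(2)[OF FG(2)] s(3)[OF FG(1)] FG(3) by auto
  qed
  moreover have fin: "finite (cell_simps T)" using finite_Sh by (simp add: cell_simps_def)
  ultimately have "card (cell_faces Fh T) \<le> card (\<Union>\<tau>\<in>cell_simps T. \<Sigma> \<tau>)"
    using s(1) cS by (intro card_inj_on_le[of s]) auto
  also have "\<dots> \<le> (\<Sum>\<tau>\<in>cell_simps T. card (\<Sigma> \<tau>))" by (rule card_UN_le[OF fin])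
  also have "\<dots> \<le> (\<Sum>\<tau>\<in>cell_simps T. DIM('a) + 1)" by (intro sum_mono) (use cS in blast)
  finally have "card (cell_faces Fh T) \<le> card (cell_simps T) * (DIM('a) + 1)" by simp
  then have "real (card (cell_faces Fh T)) \<le> real (card (cell_simps T) * (DIM('a) + 1))"
    by (rule of_nat_mono)
  also have "\<dots> = (real DIM('a) + 1) * real (card (cell_simps T))" by (simp add: algebra_simps)
  also have "\<dots> \<le> (real DIM('a) + 1) * (2 / \<rho>\<^sup>2) ^ DIM('a)"
    using card_cell_simps[OF T] by (intro mult_left_mono) auto
  finally show ?thesis .
qed

end

section \<open>Piecewise polynomial families on the boundary of a cell\<close>

text \<open>Stated by components to cover both scalar families and tangential gradients. Only the values on
  the faces are restricted, since families differing outside the faces have the same boundary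
  integrals.\<close>

definition pw_polys :: "nat \<Rightarrow> 'a::euclidean_space set set \<Rightarrow> ('a set \<Rightarrow> 'a \<Rightarrow> 'b::euclidean_space) set" where
  "pw_polys l \<F> = {f. \<forall>F\<in>\<F>. \<forall>b\<in>Basis. \<exists>q\<in>polys l. \<forall>x\<in>F. f F x \<bullet> b = q x}"

lemma pwI: "(\<And>F b. F \<in> \<F> \<Longrightarrow> b \<in> Basis \<Longrightarrow> \<exists>q\<in>polys l. \<forall>x\<in>F. f F x \<bullet> b = q x) \<Longrightarrow> f \<in> pw_polys l \<F>"
  by (simp add: pw_polys_def)

lemma pwD: "f \<in> pw_polys l \<F> \<Longrightarrow> F \<in> \<F> \<Longrightarrow> b \<in> Basis \<Longrightarrow> \<exists>q\<in>polys l. \<forall>x\<in>F. f F x \<bullet> b = q x"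
  by (simp add: pw_polys_def)

lemma pw_realI:
  fixes f :: "'a::euclidean_space set \<Rightarrow> 'a \<Rightarrow> real"
  shows "(\<And>F. F \<in> \<F> \<Longrightarrow> \<exists>q\<in>polys l. \<forall>x\<in>F. f F x = q x) \<Longrightarrow> f \<in> pw_polys l \<F>"
  by (simp add: pw_polys_def)

lemma pw_realD:
  fixes f :: "'a::euclidean_space set \<Rightarrow> 'a \<Rightarrow> real"
  shows "f \<in> pw_polys l \<F> \<Longrightarrow> F \<in> \<F> \<Longrightarrow> \<exists>q\<in>polys l. \<forall>x\<in>F. f F x = q x"
  by (simp add: pw_polys_def)

lemma pw_family:
  fixes f :: "'a::euclidean_space set \<Rightarrow> 'a \<Rightarrow> real"
  assumes "\<And>F. F \<in> \<F> \<Longrightarrow> f F \<in> polys l"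
  shows "f \<in> pw_polys l \<F>"
proof (rule pw_realI)
  show "\<exists>q\<in>polys l. \<forall>x\<in>F. f F x = q x" if "F \<in> \<F>" for F
    by (rule bexI[of _ "f F"]) (simp_all add: assms that)
qed

lemma pw_mono: "l \<le> m \<Longrightarrow> f \<in> pw_polys l \<F> \<Longrightarrow> f \<in> pw_polys m \<F>"
  using polys_mono[of l m] unfolding pw_polys_def by blast

lemma pw_add: "f \<in> pw_polys l \<F> \<Longrightarrow> g \<in> pw_polys l \<F> \<Longrightarrow> (\<lambda>F x. f F x + g F x) \<in> pw_polys l \<F>"
proof (rule pwI)
  fix F and b :: 'b assume A: "f \<in> pw_polys l \<F>" "g \<in> pw_polys l \<F>" "F \<in> \<F>" "b \<in> Basis"
  obtain p where p: "p \<in> polys l" "\<forall>x\<in>F. f F x \<bullet> b = p x" using pwD[OF A(1,3,4)] by blast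
  obtain q where q: "q \<in> polys l" "\<forall>x\<in>F. g F x \<bullet> b = q x" using pwD[OF A(2,3,4)] by blast
  show "\<exists>q\<in>polys l. \<forall>x\<in>F. (f F x + g F x) \<bullet> b = q x"
    using p q by (intro bexI[OF _ polys_add[OF p(1) q(1)]]) (simp add: inner_add_left)
qed

lemma pw_scale: "f \<in> pw_polys l \<F> \<Longrightarrow> (\<lambda>F x. c *\<^sub>R f F x) \<in> pw_polys l \<F>"
proof (rule pwI)
  fix F and b :: 'b assume A: "f \<in> pw_polys l \<F>" "F \<in> \<F>" "b \<in> Basis"
  obtain p where p: "p \<in> polys l" "\<forall>x\<in>F. f F x \<bullet> b = p x" using pwD[OF A] by blast
  show "\<exists>q\<in>polys l. \<forall>x\<in>F. (c *\<^sub>R f F x) \<bullet> b = q x"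
    using p by (intro bexI[OF _ polys_cmult[OF p(1), of c]]) simp
qed

lemma pw_diff: "f \<in> pw_polys l \<F> \<Longrightarrow> g \<in> pw_polys l \<F> \<Longrightarrow> (\<lambda>F x. f F x - g F x) \<in> pw_polys l \<F>"
  using pw_add[of f l \<F> "\<lambda>F x. (-1) *\<^sub>R g F x"] pw_scale[of g l \<F> "-1"] by simp

lemma subspace_pw: "subspace (pw_polys l \<F>)"
proof (rule subspaceI)
  show "0 \<in> pw_polys l \<F>" using polys_const[of 0 l] by (intro pwI) (auto intro!: bexI[of _ "\<lambda>_. 0"])
qed (use pw_add pw_scale in \<open>auto simp: plus_fun_def scaleR_fun_def\<close>)

lemma pw_poly: "p \<in> polys l \<Longrightarrow> (\<lambda>F. p) \<in> pw_polys l \<F>"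
  by (rule pw_realI) auto

lemma bd_inner_cong:
  assumes "\<And>F. F \<in> \<F> \<Longrightarrow> space (face_measure F) = F"
    and "\<And>F x. F \<in> \<F> \<Longrightarrow> x \<in> F \<Longrightarrow> f F x = f' F x" "\<And>F x. F \<in> \<F> \<Longrightarrow> x \<in> F \<Longrightarrow> g F x = g' F x"
  shows "bd_inner \<F> f g = bd_inner \<F> f' g'"
  unfolding bd_inner_def using assms by (intro sum.cong refl Bochner_Integration.integral_cong) auto

lemma L2_inner_commute: "L2_inner S f g = L2_inner S g f"
  by (simp add: L2_inner_def inner_commute)

lemma L2_inner_eq:
  fixes p q :: "'a::euclidean_space \<Rightarrow> real"
  assumes "p \<in> borel_measurable borel" "q \<in> borel_measurable borel" "S \<in> sets borel"
  shows "L2_inner S p q = (LINT x:S|lborel. p x * q x)"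
  unfolding L2_inner_def set_lebesgue_integral_def inner_real_def
  using assms by (intro integral_completion) auto

lemma psd_form_L2_inner:
  assumes "bounded S" "S \<in> sets borel"
  shows "psd_form (polys l) (L2_inner S)"
  by (rule psd_form_cong[OF psd_form_L2[OF assms]])
    (simp add: L2_inner_eq polys_measurable assms(2))

lemma inner_grad: "grad p x \<bullet> grad q x = (\<Sum>b\<in>Basis. dderiv b p x * dderiv b q x)"
proof -
  have "grad p x \<bullet> b = dderiv b p x" if "b \<in> Basis" for b
    using that by (simp add: grad_def inner_sum_left inner_Basis if_distrib cong: if_cong)
  moreover have "grad q x \<bullet> b = dderiv b q x" if "b \<in> Basis" for b
    using that by (simp add: grad_def inner_sum_left inner_Basis if_distrib cong: if_cong)
  ultimately show ?thesis by (subst euclidean_inner) simp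
qed

lemma L2_inner_grad:
  assumes "p \<in> polys l" "q \<in> polys m" "bounded S" "S \<in> sets borel"
  shows "L2_inner S (grad p) (grad q) = (\<Sum>b\<in>Basis. L2_inner S (dderiv b p) (dderiv b q))"
proof -
  have m: "dderiv b p \<in> borel_measurable borel" "dderiv b q \<in> borel_measurable borel" for b
    using assms dderiv_polys' polys_measurable by blast+
  have "L2_inner S (grad p) (grad q) = (\<integral>x. indicator S x *\<^sub>R (\<Sum>b\<in>Basis. dderiv b p x * dderiv b q x) \<partial>lebesgue)"
    by (simp add: L2_inner_def set_lebesgue_integral_def inner_grad)
  also have "\<dots> = (LINT x:S|lborel. (\<Sum>b\<in>Basis. dderiv b p x * dderiv b q x))"
    unfolding set_lebesgue_integral_def using m assms(4)
    by (intro integral_completion borel_measurable_scaleR borel_measurable_indicator borel_measurable_sum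
        borel_measurable_times) auto
  also have "\<dots> = (\<Sum>b\<in>Basis. LINT x:S|lborel. dderiv b p x * dderiv b q x)"
    using polys_set_integrable_mult[OF dderiv_polys'[OF assms(1)] dderiv_polys'[OF assms(2)] assms(3,4)]
    unfolding set_lebesgue_integral_def set_integrable_def scaleR_sum_right
    by (intro Bochner_Integration.integral_sum) auto
  finally show ?thesis using m assms(4) by (simp add: L2_inner_eq)
qed

lemma hess_inner_pairs: "hess_inner S f g =
  (\<Sum>i\<in>Basis \<times> Basis. L2_inner S (dderiv (fst i) (dderiv (snd i) f)) (dderiv (fst i) (dderiv (snd i) g)))"
  unfolding hess_inner_def by (simp add: sum.cartesian_product split_beta)

lemma lin_on_dderiv': "lin_on (polys l) (dderiv v)"
  using lin_on_dderiv[of l v] by (auto simp: lin_on_def fun_eq_iff)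

lemma lin_on_dderiv2: "lin_on (polys l) (\<lambda>p. dderiv v (dderiv w p))"
proof (rule lin_onI)
  fix p q :: "'a \<Rightarrow> real" and c assume p: "p \<in> polys l" and q: "q \<in> polys l"
  show "dderiv v (dderiv w (p + q)) = dderiv v (dderiv w p) + dderiv v (dderiv w q)"
    using lin_on_add[OF lin_on_dderiv' p q] lin_on_add[OF lin_on_dderiv' dderiv_polys'[OF p] dderiv_polys'[OF q]]
    by simp
next
  fix p :: "'a \<Rightarrow> real" and c assume p: "p \<in> polys l"
  show "dderiv v (dderiv w (c *\<^sub>R p)) = c *\<^sub>R dderiv v (dderiv w p)"
    using lin_on_scale[OF lin_on_dderiv' p] lin_on_scale[OF lin_on_dderiv' dderiv_polys'[OF p]] by simp
qed

lemma psd_form_hess: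
  assumes "bounded S" "S \<in> sets borel"
  shows "psd_form (polys l) (hess_inner S)"
proof -
  have "hess_inner S = (\<lambda>f g. \<Sum>i\<in>Basis \<times> Basis.
      L2_inner S (dderiv (fst i) (dderiv (snd i) f)) (dderiv (fst i) (dderiv (snd i) g)))"
    by (intro ext) (rule hess_inner_pairs)
  then show ?thesis
    using psd_form_pullback_sum[OF psd_form_L2_inner[OF assms] subspace_polys, of "Basis \<times> Basis"
        l "\<lambda>i p. dderiv (fst i) (dderiv (snd i) p)" l]
    by (simp add: dderiv_polys' lin_on_dderiv2)
qed

lemma psd_form_grad:
  assumes "bounded S" "S \<in> sets borel"
  shows "psd_form (polys l) (\<lambda>p q. L2_inner S (grad p) (grad q))"
  by (rule psd_form_cong[OF psd_form_pullback_sum[OF psd_form_L2_inner[OF assms] subspace_polys, of Basis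
        l "\<lambda>b. dderiv b" l]])
    (simp_all add: dderiv_polys' lin_on_dderiv' L2_inner_grad[OF _ _ assms])

lemma laplacian_polys: "p \<in> polys l \<Longrightarrow> laplacian p \<in> polys l"
  unfolding laplacian_def by (intro polys_sum dderiv_polys')

lemma dderiv_sum:
  assumes "\<And>i. i \<in> I \<Longrightarrow> p i \<in> polys l"
  shows "dderiv v (\<lambda>x. \<Sum>i\<in>I. c i * p i x) x = (\<Sum>i\<in>I. c i * dderiv v (p i) x)"
  using polys_has_derivative[OF assms]
  by (intro dderiv_eqI) (auto intro!: derivative_eq_intros sum.cong)

lemma dderiv_dderiv_basis:
  assumes "p \<in> polys l"
  shows "dderiv w (dderiv v p) x = (\<Sum>b\<in>Basis. (v \<bullet> b) * dderiv w (dderiv b p) x)"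
proof -
  have "dderiv v p = (\<lambda>x. \<Sum>b\<in>Basis. (v \<bullet> b) * dderiv b p x)" using dderiv_basis[OF assms] by blast
  then show ?thesis using dderiv_sum[of Basis "\<lambda>b. dderiv b p" l w "\<lambda>b. v \<bullet> b" x] dderiv_polys'[OF assms] by simp
qed

lemma dderiv_unit_le:
  assumes "p \<in> polys l" "norm v \<le> 1"
  shows "(dderiv v p x)\<^sup>2 \<le> (\<Sum>b\<in>Basis. (dderiv b p x)\<^sup>2)"
proof -
  have "(dderiv v p x)\<^sup>2 \<le> (\<Sum>b\<in>Basis. (v \<bullet> b)\<^sup>2) * (\<Sum>b\<in>Basis. (dderiv b p x)\<^sup>2)"
    unfolding dderiv_basis[OF assms(1), of v x] by (rule Cauchy_Schwarz_ineq_sum)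
  also have "(\<Sum>b\<in>Basis. (v \<bullet> b)\<^sup>2) = (norm v)\<^sup>2"
    unfolding power2_norm_eq_inner by (subst euclidean_inner) (simp add: power2_eq_square)
  also have "(norm v)\<^sup>2 * (\<Sum>b\<in>Basis. (dderiv b p x)\<^sup>2) \<le> 1 * (\<Sum>b\<in>Basis. (dderiv b p x)\<^sup>2)"
    using assms(2) by (intro mult_right_mono sum_nonneg) (auto simp: power_le_one)
  finally show ?thesis by simp
qed

lemma polys_mean_value:
  assumes "p \<in> polys l" "y \<in> cball z h"
  shows "\<exists>\<xi>\<in>cball z h. p y - p z = dderiv (y - z) p \<xi>"
proof -
  have "((\<lambda>t. p (z + t *\<^sub>R (y - z))) has_derivative (\<lambda>s. dderiv (s *\<^sub>R (y - z)) p (z + t *\<^sub>R (y - z)))) (at t)" for t :: real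
    by (rule has_derivative_compose[OF _ polys_has_derivative[OF assms(1)]]) (auto intro!: derivative_eq_intros)
  then have d: "((\<lambda>t. p (z + t *\<^sub>R (y - z))) has_real_derivative dderiv (y - z) p (z + t *\<^sub>R (y - z))) (at t)" for t :: real
    unfolding has_field_derivative_def
    by (simp add: linear_cmul[OF dderiv_linear[OF assms(1)]] mult.commute[of _ "dderiv (y - z) p _"])
  obtain t :: real where t: "0 < t" "t < 1" "p (z + 1 *\<^sub>R (y - z)) - p (z + 0 *\<^sub>R (y - z)) = (1 - 0) * dderiv (y - z) p (z + t *\<^sub>R (y - z))"
    using MVT2[of 0 1 "\<lambda>t. p (z + t *\<^sub>R (y - z))" "\<lambda>t. dderiv (y - z) p (z + t *\<^sub>R (y - z))"] d by auto
  have "t * norm (y - z) \<le> 1 * h" using t assms(2)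
    by (intro mult_mono) (auto simp: dist_norm norm_minus_commute)
  then show ?thesis using t by (intro bexI[of _ "z + t *\<^sub>R (y - z)"]) (auto simp: dist_norm)
qed

section \<open>Inverse and trace inequalities on a cell\<close>

lemma polys_compose_tangent: "p \<in> polys l \<Longrightarrow> (\<lambda>y. p (y - (n \<bullet> (y - x)) *\<^sub>R n)) \<in> polys l"
  using polys_plane_proj[of p l n "n \<bullet> x"] by (simp add: plane_proj_def inner_diff_right)

lemma grad_add: "p \<in> polys l \<Longrightarrow> q \<in> polys l \<Longrightarrow> grad (\<lambda>x. p x + q x) x = grad p x + grad q x"
  by (simp add: grad_def dderiv_add[of p l q l] scaleR_add_left sum.distrib)

lemma grad_cmult: "p \<in> polys l \<Longrightarrow> grad (\<lambda>x. c * p x) x = c *\<^sub>R grad p x"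
  by (simp add: grad_def dderiv_cmult[of p l] scaleR_sum_right)

lemma tgrad_add: "p \<in> polys l \<Longrightarrow> q \<in> polys l \<Longrightarrow> tgrad n (\<lambda>x. p x + q x) x = tgrad n p x + tgrad n q x"
  unfolding tgrad_def by (rule grad_add; rule polys_compose_tangent)

lemma tgrad_cmult: "p \<in> polys l \<Longrightarrow> tgrad n (\<lambda>x. c * p x) x = c *\<^sub>R tgrad n p x"
  unfolding tgrad_def by (rule grad_cmult; rule polys_compose_tangent)

lemma tgrad_uminus_normal: "tgrad (- n) f x = tgrad n f x"
  by (simp add: tgrad_def)

lemma grad_inner_Basis: "b \<in> Basis \<Longrightarrow> grad p x \<bullet> b = dderiv b p x"
  by (simp add: grad_def inner_sum_left inner_Basis if_distrib cong: if_cong)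

lemma dderiv_tangent:
  assumes "p \<in> polys l"
  shows "dderiv b (\<lambda>y. p (y - (n \<bullet> (y - x)) *\<^sub>R n)) x = dderiv (b - (n \<bullet> b) *\<^sub>R n) p x"
proof (rule dderiv_eqI)
  have "((\<lambda>y. p (y - (n \<bullet> (y - x)) *\<^sub>R n)) has_derivative
      (\<lambda>b. dderiv (b - (n \<bullet> b) *\<^sub>R n) p (x - (n \<bullet> (x - x)) *\<^sub>R n))) (at x)"
    by (rule has_derivative_compose[OF _ polys_has_derivative[OF assms]])
      (auto intro!: derivative_eq_intros)
  then show "((\<lambda>y. p (y - (n \<bullet> (y - x)) *\<^sub>R n)) has_derivative (\<lambda>b. dderiv (b - (n \<bullet> b) *\<^sub>R n) p x)) (at x)"
    by simp
qed

lemma tgrad_le: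
  assumes p: "p \<in> polys l" and n: "norm n = 1"
  shows "tgrad n p x \<bullet> tgrad n p x \<le> (\<Sum>b\<in>Basis. (dderiv b p x)\<^sup>2)"
proof -
  let ?D = "\<lambda>v. dderiv v p x"
  have lin: "linear ?D" by (rule dderiv_linear[OF p])
  have "tgrad n p x \<bullet> tgrad n p x = (\<Sum>b\<in>Basis. (?D (b - (n \<bullet> b) *\<^sub>R n))\<^sup>2)"
    unfolding tgrad_def inner_grad by (simp add: dderiv_tangent[OF p] power2_eq_square)
  also have "\<dots> = (\<Sum>b\<in>Basis. (?D b)\<^sup>2 - 2 * ?D n * ((n \<bullet> b) * ?D b) + (?D n)\<^sup>2 * (n \<bullet> b)\<^sup>2)"
    by (intro sum.cong refl)
      (simp add: linear_diff[OF lin] linear_cmul[OF lin] power2_eq_square algebra_simps)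
  also have "\<dots> = (\<Sum>b\<in>Basis. (?D b)\<^sup>2) - 2 * ?D n * (\<Sum>b\<in>Basis. (n \<bullet> b) * ?D b) + (?D n)\<^sup>2 * (\<Sum>b\<in>Basis. (n \<bullet> b)\<^sup>2)"
    by (simp add: sum.distrib sum_subtractf sum_distrib_left)
  also have "(\<Sum>b\<in>Basis. (n \<bullet> b) * ?D b) = ?D n" by (rule dderiv_basis[OF p, symmetric])
  also have "(\<Sum>b\<in>Basis. (n \<bullet> b)\<^sup>2) = n \<bullet> n"
    by (simp add: euclidean_inner[of n n] power2_eq_square)
  finally show ?thesis using n by (simp add: norm_eq_1 power2_eq_square)
qed

lemma second_deriv_unit_le:
  assumes "p \<in> polys l" "norm v \<le> 1"
  shows "(\<Sum>a\<in>Basis. (dderiv a (dderiv v p) x)\<^sup>2) \<le> (\<Sum>a\<in>Basis. \<Sum>b\<in>Basis. (dderiv a (dderiv b p) x)\<^sup>2)"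
proof (rule sum_mono)
  fix a :: 'a
  have "(dderiv a (dderiv v p) x)\<^sup>2 \<le> (\<Sum>b\<in>Basis. (v \<bullet> b)\<^sup>2) * (\<Sum>b\<in>Basis. (dderiv a (dderiv b p) x)\<^sup>2)"
    unfolding dderiv_dderiv_basis[OF assms(1), of a v x] by (rule Cauchy_Schwarz_ineq_sum)
  also have "(\<Sum>b\<in>Basis. (v \<bullet> b)\<^sup>2) = (norm v)\<^sup>2"
    unfolding power2_norm_eq_inner by (subst euclidean_inner) (simp add: power2_eq_square)
  also have "(norm v)\<^sup>2 * (\<Sum>b\<in>Basis. (dderiv a (dderiv b p) x)\<^sup>2) \<le> 1 * (\<Sum>b\<in>Basis. (dderiv a (dderiv b p) x)\<^sup>2)"
    using assms(2) by (intro mult_right_mono sum_nonneg) (auto simp: power_le_one)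
  finally show "(dderiv a (dderiv v p) x)\<^sup>2 \<le> (\<Sum>b\<in>Basis. (dderiv a (dderiv b p) x)\<^sup>2)" by simp
qed

definition area_const :: "nat \<Rightarrow> real" where
  "area_const d = unit_ball_vol (real d) * 2 ^ d"

text \<open>The bound for the number of faces of a cell times the bound for the area of a face, up to powers
  of the diameter.\<close>

definition bdry_const :: "nat \<Rightarrow> real \<Rightarrow> real" where
  "bdry_const d \<rho> = (real d + 1) * (2 / \<rho>\<^sup>2) ^ d * area_const d"

text \<open>The constant \<open>K\<close> of the scale-invariant bound is a parameter, fixed before the mesh,
  so that the constants obtained from it do not depend on the mesh. The ratio
  \<open>\<rho>\<^sup>2 / 8\<close> of the radii is the one of \<open>face_inverse\<close>, where
  balls of radius \<open>rad T / 2\<close> and \<open>2 h\<close> are compared.\<close>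

locale mesh_cell = mesh \<rho> \<Omega> Th Fh for \<rho> and \<Omega> :: "'a::euclidean_space set" and Th Fh +
  fixes T :: "'a set" and k :: nat and K :: real
  assumes T: "T \<in> Th"
    and K0: "0 \<le> K"
    and K: "\<And>p (z::'a) h y. p \<in> polys (k + 2) \<Longrightarrow> 0 < h \<Longrightarrow> y \<in> cball z h \<Longrightarrow>
      (p y)\<^sup>2 \<le> K / h ^ DIM('a) * (LINT x:ball z (h * (\<rho>\<^sup>2 / 8))|lborel. (p x)\<^sup>2) \<and>
      (\<forall>b\<in>Basis. (h * dderiv b p y)\<^sup>2 \<le> K / h ^ DIM('a) * (LINT x:ball z (h * (\<rho>\<^sup>2 / 8))|lborel. (p x)\<^sup>2))"
begin

abbreviation "cf \<equiv> cell_faces Fh T"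
abbreviation "h \<equiv> diameter T"
abbreviation "nT \<equiv> cell_normal T"

lemma hpos: "0 < h" by (rule diameter_pos[OF T])
lemma Tb: "bounded T" and Tm: "T \<in> sets borel"
  using cell_bounded[OF T] cell_open[OF T] by (auto intro: borel_open)

lemma cf_Fh: "F \<in> cf \<Longrightarrow> F \<in> Fh" by (simp add: cell_faces_def)
lemma cf_flat: "F \<in> cf \<Longrightarrow> flat_face F (plane_normal F) (plane_offset F)" using flat cf_Fh by blast
lemma cf_space: "F \<in> cf \<Longrightarrow> space (face_measure F) = F" using flat_face.space_face cf_flat by blast
lemma cf_closure: "F \<in> cf \<Longrightarrow> F \<subseteq> closure T" by (auto simp: cell_faces_def frontier_def)
lemma finite_cf: "finite cf" by (rule finite_cell_faces)

lemmas bd_cong = bd_inner_cong[OF cf_space]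

lemma nT: "F \<in> cf \<Longrightarrow> nT F = plane_normal F \<or> nT F = - plane_normal F" by (rule cell_normal_eq[OF T])

lemma nT_unit: "F \<in> cf \<Longrightarrow> norm (nT F) = 1"
  using nT[of F] flat_face.unit[OF cf_flat, of F] by auto

definition "x0 = (SOME x. x \<in> T \<and> ball x (rad T) \<subseteq> T)"

lemma x0: "x0 \<in> T" "ball x0 (rad T) \<subseteq> T"
proof -
  have "\<exists>x. x \<in> T \<and> ball x (rad T) \<subseteq> T" using cell_inball[OF T] by blast
  from someI_ex[OF this] show "x0 \<in> T" "ball x0 (rad T) \<subseteq> T" by (auto simp: x0_def)
qed

lemma closure_T: "closure T \<subseteq> cball x0 h"
  using cell_subset_cball[OF T] x0(1) closure_subset by blast

lemma small_ball: "ball x0 (h * (\<rho>\<^sup>2 / 8)) \<subseteq> T"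
proof -
  have "h * (\<rho>\<^sup>2 / 8) \<le> rad T" using hpos by (simp add: rad_def)
  then have "ball x0 (h * (\<rho>\<^sup>2 / 8)) \<subseteq> ball x0 (rad T)" by (rule subset_ball)
  then show ?thesis using x0(2) by blast
qed

lemma ball_integral_le:
  assumes "p \<in> polys l"
  shows "(LINT x:ball x0 (h * (\<rho>\<^sup>2 / 8))|lborel. (p x)\<^sup>2) \<le> L2_inner T p p"
proof -
  have m: "p \<in> borel_measurable borel" by (rule polys_measurable[OF assms])
  have "set_integrable lborel T (\<lambda>x. (p x)\<^sup>2)"
    using polys_set_integrable_mult[OF assms assms Tb Tm] by (simp add: power2_eq_square)
  then have "(LINT x:ball x0 (h * (\<rho>\<^sup>2 / 8))|lborel. (p x)\<^sup>2) \<le> (LINT x:T|lborel. (p x)\<^sup>2)"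
    by (rule set_integral_mono_set[OF _ small_ball]) auto
  then show ?thesis by (simp add: L2_inner_eq[OF m m Tm] power2_eq_square)
qed

lemma sup_le:
  assumes p: "p \<in> polys (k + 2)" and y: "y \<in> cball x0 h"
  shows "(p y)\<^sup>2 \<le> K / h ^ DIM('a) * L2_inner T p p"
    and "b \<in> Basis \<Longrightarrow> (dderiv b p y)\<^sup>2 \<le> K / h ^ DIM('a) / h\<^sup>2 * L2_inner T p p"
proof -
  let ?I = "LINT x:ball x0 (h * (\<rho>\<^sup>2 / 8))|lborel. (p x)\<^sup>2"
  have I: "K / h ^ DIM('a) * ?I \<le> K / h ^ DIM('a) * L2_inner T p p"
    using ball_integral_le[OF p] K0 hpos by (intro mult_left_mono) auto
  show "(p y)\<^sup>2 \<le> K / h ^ DIM('a) * L2_inner T p p"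
    by (rule order_trans[OF conjunct1[OF K[OF p hpos y]] I])
  assume b: "b \<in> Basis"
  have "(h * dderiv b p y)\<^sup>2 \<le> K / h ^ DIM('a) * L2_inner T p p"
    by (rule order_trans[OF bspec[OF conjunct2[OF K[OF p hpos y]] b] I])
  then have "(dderiv b p y)\<^sup>2 * h\<^sup>2 \<le> K / h ^ DIM('a) * L2_inner T p p"
    by (simp only: power_mult_distrib mult.commute)
  then have "(dderiv b p y)\<^sup>2 \<le> (K / h ^ DIM('a) * L2_inner T p p) / h\<^sup>2"
    using hpos by (subst pos_le_divide_eq) auto
  then show "(dderiv b p y)\<^sup>2 \<le> K / h ^ DIM('a) / h\<^sup>2 * L2_inner T p p"
    by (simp only: times_divide_eq_left times_divide_eq_right)
qed

lemma L2_zero: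
  assumes p: "p \<in> polys l" and z: "L2_inner T p p = 0"
  shows "p x = 0"
proof -
  let ?I = "LINT x:ball x0 (h * (\<rho>\<^sup>2 / 8))|lborel. (p x)\<^sup>2"
  have "0 \<le> ?I" by (auto simp: set_lebesgue_integral_def intro!: integral_nonneg)
  then have I: "?I = 0" using ball_integral_le[OF p] unfolding z by (rule antisym[rotated])
  have "0 < h * (\<rho>\<^sup>2 / 8)" using hpos rho by simp
  from polys_integral_zero[OF p this I] show ?thesis .
qed

sublocale L2: psd_form "polys l" "L2_inner T" for l
  by (rule psd_form_L2_inner[OF Tb Tm])
sublocale He: psd_form "polys l" "hess_inner T" for l
  by (rule psd_form_hess[OF Tb Tm])
sublocale Gr: psd_form "polys l" "\<lambda>p q. L2_inner T (grad p) (grad q)" for l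
  by (rule psd_form_grad[OF Tb Tm])

lemma pw_integrable:
  fixes f g :: "'a set \<Rightarrow> 'a \<Rightarrow> 'b::euclidean_space"
  assumes "f \<in> pw_polys l cf" "g \<in> pw_polys l cf" "F \<in> cf"
  shows "integrable (face_measure F) (\<lambda>x. f F x \<bullet> g F x)"
proof -
  interpret flat_face F "plane_normal F" "plane_offset F" by (rule cf_flat[OF assms(3)])
  have "\<forall>b\<in>Basis. \<exists>q\<in>polys l. \<forall>x\<in>F. f F x \<bullet> b = q x" "\<forall>b\<in>Basis. \<exists>q\<in>polys l. \<forall>x\<in>F. g F x \<bullet> b = q x"
    using pwD assms by blast+
  then obtain p q where p: "\<forall>b\<in>Basis. p b \<in> polys l \<and> (\<forall>x\<in>F. f F x \<bullet> b = p b x)"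
    and q: "\<forall>b\<in>Basis. q b \<in> polys l \<and> (\<forall>x\<in>F. g F x \<bullet> b = q b x)"
    by metis
  show ?thesis
  proof (rule integrable_face)
    show "continuous_on UNIV (\<lambda>x. \<Sum>b\<in>Basis. p b x * q b x)"
      using p q polys_continuous_on by (intro continuous_on_sum continuous_on_mult) blast+
    show "f F x \<bullet> g F x = (\<Sum>b\<in>Basis. p b x * q b x)" if "x \<in> F" for x
      using p q that by (subst euclidean_inner) (auto intro: sum.cong)
  qed
qed

lemma psd_form_bd:
  "psd_form (pw_polys l cf) (bd_inner cf :: ('a set \<Rightarrow> 'a \<Rightarrow> 'b::euclidean_space) \<Rightarrow> _ \<Rightarrow> real)"
proof
  show "subspace (pw_polys l cf :: ('a set \<Rightarrow> 'a \<Rightarrow> 'b) set)" by (rule subspace_pw)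
  show "bilin_on (pw_polys l cf) (bd_inner cf :: ('a set \<Rightarrow> 'a \<Rightarrow> 'b) \<Rightarrow> _ \<Rightarrow> real)"
  proof (rule bilin_onI; rule lin_onI)
    fix f g g' :: "'a set \<Rightarrow> 'a \<Rightarrow> 'b" assume A: "f \<in> pw_polys l cf" "g \<in> pw_polys l cf" "g' \<in> pw_polys l cf"
    show "bd_inner cf f (g + g') = bd_inner cf f g + bd_inner cf f g'"
      unfolding bd_inner_def sum.distrib[symmetric] using A
      by (intro sum.cong refl) (simp add: inner_add_right pw_integrable)
    show "bd_inner cf (g + g') f = bd_inner cf g f + bd_inner cf g' f"
      unfolding bd_inner_def sum.distrib[symmetric] using A
      by (intro sum.cong refl) (simp add: inner_add_left pw_integrable)
  next
    fix f g :: "'a set \<Rightarrow> 'a \<Rightarrow> 'b" and c assume A: "f \<in> pw_polys l cf" "g \<in> pw_polys l cf"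
    show "bd_inner cf f (c *\<^sub>R g) = c *\<^sub>R bd_inner cf f g"
      by (simp add: bd_inner_def sum_distrib_left)
    show "bd_inner cf (c *\<^sub>R g) f = c *\<^sub>R bd_inner cf g f"
      by (simp add: bd_inner_def sum_distrib_left)
  qed
  show "bd_inner cf f g = bd_inner cf g f" for f g :: "'a set \<Rightarrow> 'a \<Rightarrow> 'b"
    by (simp add: bd_inner_def inner_commute)
  show "0 \<le> bd_inner cf f f" for f :: "'a set \<Rightarrow> 'a \<Rightarrow> 'b"
    unfolding bd_inner_def by (intro sum_nonneg integral_nonneg) auto
qed

sublocale Bd: psd_form "pw_polys l cf" "bd_inner cf :: ('a set \<Rightarrow> 'a \<Rightarrow> real) \<Rightarrow> _ \<Rightarrow> real" for l
  by (rule psd_form_bd)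
sublocale Bv: psd_form "pw_polys l cf" "bd_inner cf :: ('a set \<Rightarrow> 'a \<Rightarrow> 'a) \<Rightarrow> _ \<Rightarrow> real" for l
  by (rule psd_form_bd)

lemma area_const_nonneg: "0 \<le> area_const DIM('a)" by (simp add: area_const_def)
lemma bdry_const_nonneg: "0 \<le> bdry_const DIM('a) \<rho>" using rho area_const_nonneg by (simp add: bdry_const_def)

lemma area: "F \<in> cf \<Longrightarrow> (\<integral>x. 1 \<partial>face_measure F) \<le> area_const DIM('a) * h ^ DIM('a) / h"
  using flat_face.area_le[OF cf_flat, of F x0 h] cf_closure[of F] closure_T hpos unfolding area_const_def by blast

lemma face_integral_le:
  fixes f :: "'a set \<Rightarrow> 'a \<Rightarrow> 'b::euclidean_space"
  assumes f: "f \<in> pw_polys l cf" and F: "F \<in> cf" and M: "\<And>x. x \<in> F \<Longrightarrow> f F x \<bullet> f F x \<le> M" "0 \<le> M"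
  shows "(\<integral>x. f F x \<bullet> f F x \<partial>face_measure F) \<le> area_const DIM('a) * h ^ DIM('a) / h * M"
proof -
  interpret flat_face F "plane_normal F" "plane_offset F" by (rule cf_flat[OF F])
  have "(\<integral>x. f F x \<bullet> f F x \<partial>face_measure F) \<le> (\<integral>x. M \<partial>face_measure F)"
    using M(1) by (intro integral_mono pw_integrable[OF f f F] integrable_face[of "\<lambda>_. M"]) auto
  also have "\<dots> = (\<integral>x. 1 \<partial>face_measure F) * M" by simp
  also have "\<dots> \<le> area_const DIM('a) * h ^ DIM('a) / h * M" using area[OF F] M(2) by (rule mult_right_mono)
  finally show ?thesis .
qed

lemma family_le:
  fixes f :: "'a set \<Rightarrow> 'a \<Rightarrow> 'b::euclidean_space"
  assumes f: "f \<in> pw_polys l cf" and M: "\<And>F x. F \<in> cf \<Longrightarrow> x \<in> F \<Longrightarrow> f F x \<bullet> f F x \<le> M" "0 \<le> M"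
  shows "bd_inner cf f f \<le> bdry_const DIM('a) \<rho> * h ^ DIM('a) / h * M"
proof -
  have "bd_inner cf f f \<le> (\<Sum>F\<in>cf. area_const DIM('a) * h ^ DIM('a) / h * M)"
    unfolding bd_inner_def using M by (intro sum_mono face_integral_le[OF f]) auto
  also have "\<dots> = real (card cf) * (area_const DIM('a) * h ^ DIM('a) / h * M)" by simp
  also have "\<dots> \<le> ((real DIM('a) + 1) * (2 / \<rho>\<^sup>2) ^ DIM('a)) * (area_const DIM('a) * h ^ DIM('a) / h * M)"
    using card_cell_faces[OF T] area_const_nonneg hpos M(2) by (intro mult_right_mono) auto
  finally show ?thesis by (simp add: bdry_const_def)
qed

lemma L2_grad: "p \<in> polys l \<Longrightarrow> L2_inner T (grad p) (grad p) = (\<Sum>b\<in>Basis. L2_inner T (dderiv b p) (dderiv b p))"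
  by (rule L2_inner_grad[OF _ _ Tb Tm])

lemma sup_grad_le:
  assumes p: "p \<in> polys (k + 2)" and y: "y \<in> cball x0 h"
  shows "(\<Sum>b\<in>Basis. (dderiv b p y)\<^sup>2) \<le> K / h ^ DIM('a) * L2_inner T (grad p) (grad p)"
  unfolding L2_grad[OF p] sum_distrib_left
  by (intro sum_mono sup_le(1)[OF dderiv_polys'[OF p] y])

lemma sup_hess_le:
  assumes p: "p \<in> polys (k + 2)" and y: "y \<in> cball x0 h"
  shows "(\<Sum>a\<in>Basis. \<Sum>b\<in>Basis. (dderiv a (dderiv b p) y)\<^sup>2) \<le> K / h ^ DIM('a) * hess_inner T p p"
  unfolding hess_inner_def sum_distrib_left
  by (intro sum_mono sup_le(1)[OF dderiv_polys'[OF dderiv_polys'[OF p]] y])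

text \<open>The mean value theorem takes the place of a Poincare inequality. The segment from
  \<open>x0\<close> to \<open>y\<close> may leave the cell, but not the ball around it, where the
  derivatives of polynomials are still controlled by the cell.\<close>

lemma mean_value_sq:
  assumes p: "p \<in> polys l" and y: "y \<in> cball x0 h"
  shows "\<exists>\<xi>\<in>cball x0 h. (p y - p x0)\<^sup>2 \<le> h\<^sup>2 * (\<Sum>b\<in>Basis. (dderiv b p \<xi>)\<^sup>2)"
proof -
  obtain \<xi> where \<xi>: "\<xi> \<in> cball x0 h" "p y - p x0 = dderiv (y - x0) p \<xi>"
    using polys_mean_value[OF p y] by blast
  define v where "v = (1 / h) *\<^sub>R (y - x0)"
  have v: "norm v \<le> 1" "y - x0 = h *\<^sub>R v"
    using hpos y by (simp_all add: v_def dist_norm norm_minus_commute)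
  have "(p y - p x0)\<^sup>2 = h\<^sup>2 * (dderiv v p \<xi>)\<^sup>2"
    unfolding \<xi>(2) v(2) by (simp add: linear_cmul[OF dderiv_linear[OF p]] power_mult_distrib)
  also have "\<dots> \<le> h\<^sup>2 * (\<Sum>b\<in>Basis. (dderiv b p \<xi>)\<^sup>2)"
    by (intro mult_left_mono dderiv_unit_le[OF p v(1)]) auto
  finally show ?thesis using \<xi>(1) by blast
qed

lemma face_cball: "F \<in> cf \<Longrightarrow> x \<in> F \<Longrightarrow> x \<in> cball x0 h"
  using cf_closure closure_T by blast

lemma scale_cancel: "bdry_const DIM('a) \<rho> * h ^ DIM('a) / h * (K / h ^ DIM('a) * X) = bdry_const DIM('a) \<rho> * K * X / h"
  using hpos by simp

lemma ndiff_pw: "p \<in> polys (Suc l) \<Longrightarrow> ndiff T p \<in> pw_polys l cf"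
  unfolding ndiff_def[abs_def] by (intro pw_realI) (auto intro: dderiv_polys_Suc)

lemma ndiff_pw': "p \<in> polys l \<Longrightarrow> ndiff T p \<in> pw_polys l cf"
  unfolding ndiff_def[abs_def] by (intro pw_realI) (auto intro: dderiv_polys')

lemma trace_ndiff:
  assumes p: "p \<in> polys (k + 2)"
  shows "bd_inner cf (ndiff T p) (ndiff T p) \<le> bdry_const DIM('a) \<rho> * K * L2_inner T (grad p) (grad p) / h"
proof -
  have "bd_inner cf (ndiff T p) (ndiff T p) \<le> bdry_const DIM('a) \<rho> * h ^ DIM('a) / h * (K / h ^ DIM('a) * L2_inner T (grad p) (grad p))"
  proof (rule family_le[OF ndiff_pw'[OF p]])
    fix F x assume F: "F \<in> cf" "x \<in> F"
    have "(ndiff T p F x)\<^sup>2 \<le> (\<Sum>b\<in>Basis. (dderiv b p x)\<^sup>2)"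
      unfolding ndiff_def using nT_unit[OF F(1)] by (intro dderiv_unit_le[OF p]) simp
    also have "\<dots> \<le> K / h ^ DIM('a) * L2_inner T (grad p) (grad p)"
      by (rule sup_grad_le[OF p face_cball[OF F]])
    finally show "ndiff T p F x \<bullet> ndiff T p F x \<le> K / h ^ DIM('a) * L2_inner T (grad p) (grad p)"
      by (simp add: power2_eq_square)
  qed (use K0 hpos Gr.nonneg[OF p] in simp)
  then show ?thesis unfolding scale_cancel .
qed

lemma ndiff_lap_le:
  assumes w: "w \<in> polys (k + 2)"
  shows "bd_inner cf (ndiff T (laplacian w)) (ndiff T (laplacian w)) \<le> bdry_const DIM('a) \<rho> * K * (real DIM('a) * real DIM('a) * (hess_inner T w w / h\<^sup>2)) / h"
proof -
  have lw: "laplacian w \<in> polys (k + 2)" by (rule laplacian_polys[OF w])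
  have "bd_inner cf (ndiff T (laplacian w)) (ndiff T (laplacian w))
      \<le> bdry_const DIM('a) \<rho> * h ^ DIM('a) / h * (K / h ^ DIM('a) * (real DIM('a) * real DIM('a) * (hess_inner T w w / h\<^sup>2)))"
  proof (rule family_le[OF ndiff_pw'[OF lw]])
    fix F x assume F: "F \<in> cf" "x \<in> F"
    have dd: "dderiv a (dderiv a w) \<in> polys (k + 2)" for a by (intro dderiv_polys' w)
    have "(dderiv b (laplacian w) x)\<^sup>2 \<le> real DIM('a) * (K / h ^ DIM('a) * (hess_inner T w w / h\<^sup>2))" if b: "b \<in> Basis" for b
    proof -
      have "dderiv b (laplacian w) x = (\<Sum>a\<in>Basis. dderiv b (dderiv a (dderiv a w)) x)"
        using dderiv_sum[of Basis "\<lambda>a. dderiv a (dderiv a w)" "k + 2" b "\<lambda>_. 1" x] dd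
        unfolding laplacian_def[abs_def] by simp
      then have "(dderiv b (laplacian w) x)\<^sup>2 \<le> real DIM('a) * (\<Sum>a\<in>Basis. (dderiv b (dderiv a (dderiv a w)) x)\<^sup>2)"
        using sum_squared_le_sum_of_squares[of "\<lambda>a. dderiv b (dderiv a (dderiv a w)) x" Basis]
        by (simp add: mult.commute)
      also have "\<dots> \<le> real DIM('a) * (\<Sum>a\<in>Basis. K / h ^ DIM('a) / h\<^sup>2 * L2_inner T (dderiv a (dderiv a w)) (dderiv a (dderiv a w)))"
        by (intro mult_left_mono sum_mono sup_le(2)[OF dd face_cball[OF F] b]) auto
      also have "\<dots> = real DIM('a) * (K / h ^ DIM('a) / h\<^sup>2 * (\<Sum>a\<in>Basis. L2_inner T (dderiv a (dderiv a w)) (dderiv a (dderiv a w))))"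
        by (simp add: sum_distrib_left)
      also have "\<dots> \<le> real DIM('a) * (K / h ^ DIM('a) / h\<^sup>2 * hess_inner T w w)"
      proof (intro mult_left_mono)
        show "(\<Sum>a\<in>Basis. L2_inner T (dderiv a (dderiv a w)) (dderiv a (dderiv a w))) \<le> hess_inner T w w"
          unfolding hess_inner_def
          by (intro sum_mono member_le_sum[of _ Basis "\<lambda>b. L2_inner T (dderiv _ (dderiv b w)) (dderiv _ (dderiv b w))"]
              L2.nonneg[of _ "k + 2"] dderiv_polys' w) auto
      qed (use K0 hpos in auto)
      finally show ?thesis by simp
    qed
    then have "(\<Sum>b\<in>Basis. (dderiv b (laplacian w) x)\<^sup>2) \<le> (\<Sum>b\<in>(Basis::'a set). real DIM('a) * (K / h ^ DIM('a) * (hess_inner T w w / h\<^sup>2)))"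
      by (rule sum_mono)
    moreover have "(ndiff T (laplacian w) F x)\<^sup>2 \<le> (\<Sum>b\<in>Basis. (dderiv b (laplacian w) x)\<^sup>2)"
      unfolding ndiff_def using nT_unit[OF F(1)] by (intro dderiv_unit_le[OF lw]) simp
    ultimately show "ndiff T (laplacian w) F x \<bullet> ndiff T (laplacian w) F x \<le> K / h ^ DIM('a) * (real DIM('a) * real DIM('a) * (hess_inner T w w / h\<^sup>2))"
      by (simp add: power2_eq_square algebra_simps)
  qed (use K0 hpos He.nonneg[OF w] in simp)
  then show ?thesis unfolding scale_cancel .
qed

abbreviation "nn w \<equiv> (\<lambda>F. dderiv (nT F) (dderiv (nT F) w))"
abbreviation "nt w \<equiv> (\<lambda>F. tgrad (nT F) (dderiv (nT F) w))"

lemma nn_pw: "w \<in> polys (k + 2) \<Longrightarrow> nn w \<in> pw_polys k cf"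
  by (intro pw_realI) (auto intro!: dderiv_polys_Suc)

lemma nn_le:
  assumes w: "w \<in> polys (k + 2)"
  shows "bd_inner cf (nn w) (nn w) \<le> bdry_const DIM('a) \<rho> * K * hess_inner T w w / h"
proof -
  have "bd_inner cf (nn w) (nn w) \<le> bdry_const DIM('a) \<rho> * h ^ DIM('a) / h * (K / h ^ DIM('a) * hess_inner T w w)"
  proof (rule family_le[OF nn_pw[OF w]])
    fix F x assume F: "F \<in> cf" "x \<in> F"
    have n: "norm (nT F) \<le> 1" using nT_unit[OF F(1)] by simp
    have "(nn w F x)\<^sup>2 \<le> (\<Sum>a\<in>Basis. (dderiv a (dderiv (nT F) w) x)\<^sup>2)"
      by (rule dderiv_unit_le[OF dderiv_polys'[OF w] n])
    also have "\<dots> \<le> (\<Sum>a\<in>Basis. \<Sum>b\<in>Basis. (dderiv a (dderiv b w) x)\<^sup>2)" by (rule second_deriv_unit_le[OF w n])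
    also have "\<dots> \<le> K / h ^ DIM('a) * hess_inner T w w" by (rule sup_hess_le[OF w face_cball[OF F]])
    finally show "nn w F x \<bullet> nn w F x \<le> K / h ^ DIM('a) * hess_inner T w w" by (simp add: power2_eq_square)
  qed (use K0 hpos He.nonneg[OF w] in simp)
  then show ?thesis unfolding scale_cancel .
qed

text \<open>Near a point of a relatively open face, the projection to the hyperplane stays in the face. Hence
  the tangential gradient depends only on the values on the face, and that of a face polynomial is
  again a polynomial.\<close>

lemma tgrad_face:
  assumes F: "F \<in> cf" and x: "x \<in> F" and q: "q \<in> polys l" and f: "\<And>y. y \<in> F \<Longrightarrow> f y = q y"
  shows "tgrad (nT F) f x = grad (\<lambda>y. q (plane_proj (plane_normal F) (plane_offset F) y)) x"
proof -
  interpret flat_face F "plane_normal F" "plane_offset F" by (rule cf_flat[OF F])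
  let ?P = "plane_proj (plane_normal F) (plane_offset F)"
  have P: "y - (plane_normal F \<bullet> (y - x)) *\<^sub>R plane_normal F = ?P y" for y
    using in_plane[OF x] by (simp add: plane_proj_def inner_diff_right)
  obtain r where r: "0 < r" "\<And>z. plane_normal F \<bullet> z = plane_offset F \<Longrightarrow> dist x z < r \<Longrightarrow> z \<in> F" using disc_in[OF x] by blast
  have qP: "(\<lambda>y. q (?P y)) \<in> polys l" by (rule polys_plane_proj[OF q])
  have "dderiv b (\<lambda>y. f (?P y)) x = dderiv b (\<lambda>y. q (?P y)) x" for b
  proof (rule dderiv_eqI)
    show "((\<lambda>y. f (?P y)) has_derivative (\<lambda>b. dderiv b (\<lambda>y. q (?P y)) x)) (at x)"
    proof (rule has_derivative_transform_within_open[OF polys_has_derivative[OF qP], of "ball x r"])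
      fix y assume y: "y \<in> ball x r"
      have "dist x (?P y) \<le> dist x y" by (rule plane_proj_dist[OF unit in_plane[OF x]])
      then have "?P y \<in> F" using y plane_proj_in[OF unit] by (intro r(2)) auto
      then show "q (?P y) = f (?P y)" using f by simp
    qed (use r(1) in auto)
  qed
  then have "tgrad (plane_normal F) f x = grad (\<lambda>y. q (?P y)) x" by (simp add: tgrad_def grad_def P)
  then show ?thesis using nT[OF F] tgrad_uminus_normal by metis
qed

lemma tgrad_pw:
  assumes \<delta>: "\<delta> \<in> pw_polys l cf"
  shows "(\<lambda>F. tgrad (nT F) (\<delta> F)) \<in> pw_polys l cf"
proof (rule pwI)
  fix F and b :: 'a assume F: "F \<in> cf" and b: "b \<in> Basis"
  obtain q where q: "q \<in> polys l" "\<forall>x\<in>F. \<delta> F x = q x" using pw_realD[OF \<delta> F] by blast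
  show "\<exists>p\<in>polys l. \<forall>x\<in>F. tgrad (nT F) (\<delta> F) x \<bullet> b = p x"
  proof (intro bexI ballI)
    show "dderiv b (\<lambda>y. q (plane_proj (plane_normal F) (plane_offset F) y)) \<in> polys l"
      by (rule dderiv_polys'[OF polys_plane_proj[OF q(1)]])
    fix x assume "x \<in> F"
    then have "tgrad (nT F) (\<delta> F) x = grad (\<lambda>y. q (plane_proj (plane_normal F) (plane_offset F) y)) x"
      using tgrad_face[OF F _ q(1), of x "\<delta> F"] q(2) by blast
    then show "tgrad (nT F) (\<delta> F) x \<bullet> b = dderiv b (\<lambda>y. q (plane_proj (plane_normal F) (plane_offset F) y)) x"
      using b by (simp add: grad_inner_Basis)
  qed
qed

lemma dn_pw: "w \<in> polys l \<Longrightarrow> (\<lambda>F. dderiv (nT F) w) \<in> pw_polys l cf"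
  by (rule pw_realI) (blast intro: dderiv_polys')

lemma nt_pw: "w \<in> polys (k + 2) \<Longrightarrow> nt w \<in> pw_polys (k + 2) cf"
  by (rule tgrad_pw[OF dn_pw])

lemma nt_le:
  assumes w: "w \<in> polys (k + 2)"
  shows "bd_inner cf (nt w) (nt w) \<le> bdry_const DIM('a) \<rho> * K * hess_inner T w w / h"
proof -
  have "bd_inner cf (nt w) (nt w) \<le> bdry_const DIM('a) \<rho> * h ^ DIM('a) / h * (K / h ^ DIM('a) * hess_inner T w w)"
  proof (rule family_le[OF nt_pw[OF w]])
    fix F x assume F: "F \<in> cf" "x \<in> F"
    have "nt w F x \<bullet> nt w F x \<le> (\<Sum>a\<in>Basis. (dderiv a (dderiv (nT F) w) x)\<^sup>2)"
      by (rule tgrad_le[OF dderiv_polys'[OF w] nT_unit[OF F(1)]])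
    also have "\<dots> \<le> (\<Sum>a\<in>Basis. \<Sum>b\<in>Basis. (dderiv a (dderiv b w) x)\<^sup>2)"
      using nT_unit[OF F(1)] by (intro second_deriv_unit_le[OF w]) simp
    also have "\<dots> \<le> K / h ^ DIM('a) * hess_inner T w w" by (rule sup_hess_le[OF w face_cball[OF F]])
    finally show "nt w F x \<bullet> nt w F x \<le> K / h ^ DIM('a) * hess_inner T w w" .
  qed (use K0 hpos He.nonneg[OF w] in simp)
  then show ?thesis unfolding scale_cancel .
qed

text \<open>An inverse inequality on the face, reduced to one in the volume: the polynomial is extended
  constantly in normal direction, and the ball of radius \<open>rad T / 2\<close> that touches the
  face in the centre of its disc lies in the cylinder over the disc.\<close>

lemma face_inverse:
  assumes F: "F \<in> cf" and x: "x \<in> F" and g: "g \<in> polys (k + 2)" and b: "b \<in> Basis"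
  shows "(dderiv b (\<lambda>y. g (plane_proj (plane_normal F) (plane_offset F) y)) x)\<^sup>2 \<le> K / h ^ DIM('a) / h * (\<integral>x. (g x)\<^sup>2 \<partial>face_measure F)"
proof -
  interpret flat_face F "plane_normal F" "plane_offset F" by (rule cf_flat[OF F])
  let ?g = "\<lambda>y. g (plane_proj (plane_normal F) (plane_offset F) y)"
  let ?J = "\<integral>x. (g x)\<^sup>2 \<partial>face_measure F"
  obtain z where z: "z \<in> F" "\<And>x. plane_normal F \<bullet> x = plane_offset F \<Longrightarrow> dist z x < rad T \<Longrightarrow> x \<in> F"
    using face_disc[OF T F] by blast
  let ?z = "z + (rad T / 2) *\<^sub>R plane_normal F"
  have J0: "0 \<le> ?J" by (intro Bochner_Integration.integral_nonneg) auto
  have rho2: "\<rho>\<^sup>2 \<le> 1" using rho rho1 by (simp add: power_le_one)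
  have rad_le: "rad T \<le> h" using rho2 hpos by (simp add: rad_def mult_left_le_one_le)
  have "x \<in> cball ?z (2 * h)"
  proof -
    have c: "z \<in> closure T" "x \<in> closure T" using z(1) x cf_closure[OF F] by blast+
    have "x \<in> cball z h" using cell_subset_cball[OF T c(1)] c(2) by blast
    then have "dist z x \<le> h" by simp
    moreover have "dist ?z z = rad T / 2" using unit rad_pos[OF T] by (simp add: dist_norm)
    ultimately have "dist ?z x \<le> rad T / 2 + h" using dist_triangle[of ?z x z] by simp
    then show ?thesis using rad_le hpos by simp
  qed
  with K[OF polys_plane_proj[OF g], of "2 * h" x ?z] hpos b
  have "(2 * h * dderiv b ?g x)\<^sup>2 \<le> K / (2 * h) ^ DIM('a) * (LINT x:ball ?z (2 * h * (\<rho>\<^sup>2 / 8))|lborel. (?g x)\<^sup>2)"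
    by simp
  also have "2 * h * (\<rho>\<^sup>2 / 8) = rad T / 2" by (simp add: rad_def)
  also have "K / (2 * h) ^ DIM('a) * (LINT x:ball ?z (rad T / 2)|lborel. (?g x)\<^sup>2) \<le> K / (2 * h) ^ DIM('a) * (rad T * ?J)"
    using K0 hpos by (intro mult_left_mono face_integral_ge[OF g z(1) rad_pos[OF T] z(2)]) auto
  also have "\<dots> \<le> K / h ^ DIM('a) * (h * ?J)"
  proof (rule mult_mono)
    have "h ^ DIM('a) \<le> (2 * h) ^ DIM('a)" using hpos by (intro power_mono) auto
    then show "K / (2 * h) ^ DIM('a) \<le> K / h ^ DIM('a)" using K0 hpos by (intro divide_left_mono) auto
    show "rad T * ?J \<le> h * ?J" using rad_le J0 by (rule mult_right_mono)
  qed (use K0 hpos J0 rad_pos[OF T] in auto)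
  finally have "4 * h\<^sup>2 * (dderiv b ?g x)\<^sup>2 \<le> K / h ^ DIM('a) * (h * ?J)" by (simp add: power_mult_distrib)
  moreover have "h\<^sup>2 * (dderiv b ?g x)\<^sup>2 \<le> 4 * h\<^sup>2 * (dderiv b ?g x)\<^sup>2" by simp
  moreover have "K / h ^ DIM('a) * (h * ?J) = h\<^sup>2 * (K / h ^ DIM('a) / h * ?J)"
    using hpos by (simp add: power2_eq_square)
  ultimately have "h\<^sup>2 * (dderiv b ?g x)\<^sup>2 \<le> h\<^sup>2 * (K / h ^ DIM('a) / h * ?J)" by linarith
  then show ?thesis using hpos by (subst (asm) mult_le_cancel_left_pos) auto
qed

lemma tgrad_inverse:
  assumes \<delta>: "\<delta> \<in> pw_polys (k + 2) cf"
  shows "bd_inner cf (\<lambda>F. tgrad (nT F) (\<delta> F)) (\<lambda>F. tgrad (nT F) (\<delta> F)) \<le> area_const DIM('a) * real DIM('a) * K / h\<^sup>2 * bd_inner cf \<delta> \<delta>"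
  unfolding bd_inner_def sum_distrib_left
proof (rule sum_mono)
  fix F assume F: "F \<in> cf"
  interpret flat_face F "plane_normal F" "plane_offset F" by (rule cf_flat[OF F])
  obtain q where q: "q \<in> polys (k + 2)" "\<forall>x\<in>F. \<delta> F x = q x" using pw_realD[OF \<delta> F] by blast
  let ?J = "\<integral>x. (q x)\<^sup>2 \<partial>face_measure F"
  have J0: "0 \<le> ?J" by (intro Bochner_Integration.integral_nonneg) auto
  have "(\<integral>x. tgrad (nT F) (\<delta> F) x \<bullet> tgrad (nT F) (\<delta> F) x \<partial>face_measure F) \<le> area_const DIM('a) * h ^ DIM('a) / h * (real DIM('a) * (K / h ^ DIM('a) / h * ?J))"
  proof (rule face_integral_le[OF tgrad_pw[OF \<delta>] F])
    fix x assume x: "x \<in> F"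
    have "tgrad (nT F) (\<delta> F) x = grad (\<lambda>y. q (plane_proj (plane_normal F) (plane_offset F) y)) x"
      using tgrad_face[OF F x q(1)] q(2) by blast
    then have "tgrad (nT F) (\<delta> F) x \<bullet> tgrad (nT F) (\<delta> F) x = (\<Sum>b\<in>Basis. (dderiv b (\<lambda>y. q (plane_proj (plane_normal F) (plane_offset F) y)) x)\<^sup>2)"
      by (simp add: inner_grad power2_eq_square)
    also have "\<dots> \<le> (\<Sum>b\<in>(Basis::'a set). K / h ^ DIM('a) / h * ?J)"
      by (intro sum_mono face_inverse[OF F x q(1)])
    finally show "tgrad (nT F) (\<delta> F) x \<bullet> tgrad (nT F) (\<delta> F) x \<le> real DIM('a) * (K / h ^ DIM('a) / h * ?J)" by simp
  qed (use K0 hpos J0 in auto)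
  also have "\<dots> = area_const DIM('a) * real DIM('a) * K / h\<^sup>2 * ?J" using hpos by (simp add: power2_eq_square)
  also have "?J = (\<integral>x. \<delta> F x \<bullet> \<delta> F x \<partial>face_measure F)"
    by (rule integral_face_cong) (simp add: q(2) power2_eq_square)
  finally show "(\<integral>x. tgrad (nT F) (\<delta> F) x \<bullet> tgrad (nT F) (\<delta> F) x \<partial>face_measure F)
    \<le> area_const DIM('a) * real DIM('a) * K / h\<^sup>2 * (\<integral>x. \<delta> F x \<bullet> \<delta> F x \<partial>face_measure F)" .
qed

end

section \<open>Reconstructions, projections and local coercivity\<close>

text \<open>The absorption argument: a quantity that is a sum of terms, each bounded by the geometric
  mean of the quantity itself and some datum, is bounded by the data.\<close>

lemma absorb:
  fixes H :: real
  assumes "0 \<le> H" "H = a + b + c + e"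
    and "a\<^sup>2 \<le> A * H" "b\<^sup>2 \<le> B * H" "c\<^sup>2 \<le> C * H" "e\<^sup>2 \<le> E * H"
    and "0 \<le> A" "0 \<le> B" "0 \<le> C" "0 \<le> E"
  shows "H \<le> 4 * (A + B + C + E)"
proof (cases "H = 0")
  case True
  then show ?thesis using assms by simp
next
  case False
  have "H\<^sup>2 \<le> 4 * (a\<^sup>2 + b\<^sup>2 + c\<^sup>2 + e\<^sup>2)"
  proof -
    have "0 \<le> (a - b)\<^sup>2 + (a - c)\<^sup>2 + (a - e)\<^sup>2 + (b - c)\<^sup>2 + (b - e)\<^sup>2 + (c - e)\<^sup>2" by simp
    then show ?thesis unfolding assms(2) by (simp add: power2_eq_square algebra_simps)
  qed
  also have "\<dots> \<le> 4 * (A * H + B * H + C * H + E * H)" using assms(3-6) by simp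
  finally have "H * H \<le> (4 * (A + B + C + E)) * H" by (simp add: power2_eq_square algebra_simps)
  then show ?thesis using False assms(1) by simp
qed

context mesh_cell
begin

lemma face_polys_pw: "q \<in> (\<Pi>\<^sub>E F\<in>cf. face_polys l F) \<Longrightarrow> q \<in> pw_polys l cf"
  by (rule pw_realI) (force simp: face_polys_def PiE_def Pi_def)

lemma pw_face_polys:
  assumes "f \<in> pw_polys l cf"
  shows "\<exists>q\<in>(\<Pi>\<^sub>E F\<in>cf. face_polys l F). \<forall>F\<in>cf. \<forall>x\<in>F. q F x = f F x"
proof -
  have "\<forall>F\<in>cf. \<exists>p\<in>polys l. \<forall>x\<in>F. f F x = p x" using pw_realD[OF assms] by blast
  then obtain p where p: "\<forall>F\<in>cf. p F \<in> polys l \<and> (\<forall>x\<in>F. f F x = p F x)" by metis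
  then show ?thesis
    by (intro bexI[of _ "\<lambda>F\<in>cf. restrict (p F) F"]) (auto simp: face_polys_def)
qed

lemma bd_zero:
  fixes e :: "'a set \<Rightarrow> 'a \<Rightarrow> real"
  assumes e: "e \<in> pw_polys l cf" and z: "bd_inner cf e e = 0" and F: "F \<in> cf" and x: "x \<in> F"
  shows "e F x = 0"
proof -
  interpret flat_face F "plane_normal F" "plane_offset F" by (rule cf_flat[OF F])
  have "\<forall>F\<in>cf. (\<integral>x. e F x \<bullet> e F x \<partial>face_measure F) = 0"
    using z finite_cf unfolding bd_inner_def
    by (subst (asm) sum_nonneg_eq_0_iff) (auto intro!: Bochner_Integration.integral_nonneg)
  then have z: "(\<integral>x. e F x \<bullet> e F x \<partial>face_measure F) = 0" using F by blast
  obtain q where q: "q \<in> polys l" "\<forall>x\<in>F. e F x = q x" using pw_realD[OF e F] by blast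
  have "(\<integral>x. (q x)\<^sup>2 \<partial>face_measure F) = (\<integral>x. e F x \<bullet> e F x \<partial>face_measure F)"
    by (rule integral_face_cong) (simp add: q(2) power2_eq_square)
  then have "q x = 0" using face_integral_zero_on[OF q(1)] z in_plane[OF x] by simp
  then show ?thesis using q(2) x by simp
qed

text \<open>Existence follows in the finite-dimensional space of families of polynomials in space, where the
  boundary inner product is only semidefinite; uniqueness holds since the members of the range are
  extensional and a polynomial whose square has integral zero over a face vanishes on it.\<close>

lemma bd_proj_exists:
  assumes f: "f \<in> pw_polys m cf"
  shows "\<exists>!p. p \<in> (\<Pi>\<^sub>E F\<in>cf. face_polys l F) \<and> (\<forall>q\<in>(\<Pi>\<^sub>E F\<in>cf. face_polys l F). bd_inner cf p q = bd_inner cf f q)"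
proof -
  let ?V = "families cf (\<lambda>_. polys l) :: ('a set \<Rightarrow> 'a \<Rightarrow> real) set"
  let ?P = "\<Pi>\<^sub>E F\<in>cf. face_polys l F"
  have lM: "l \<le> max l m" and mM: "m \<le> max l m" by auto
  have Vl: "g \<in> pw_polys l cf" if "g \<in> ?V" for g
    using that by (intro pw_realI) (auto simp: families_def)
  have V: "?V \<subseteq> pw_polys (max l m) cf" using Vl pw_mono[OF lM] by blast
  have f': "f \<in> pw_polys (max l m) cf" using pw_mono[OF mM f] .
  obtain B where B: "finite B" "?V = span B"
    using fin_dim_families[OF finite_cf, of "\<lambda>_. polys l"] fin_dim_polys unfolding fin_dim_def by blast
  have "\<exists>w\<in>span B. \<forall>v\<in>span B. bd_inner cf w v = bd_inner cf f v"
  proof (rule psd_solve[OF B(1)])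
    show "bilin_on (span B) (bd_inner cf)" using bilin_on_mono[OF Bd.bilin V] B(2) by simp
    show "lin_on (span B) (bd_inner cf f)" using lin_on_mono[OF Bd.lin1[OF f'] V] B(2) by simp
    fix p assume p: "p \<in> span B" "bd_inner cf p p = 0"
    then have p': "p \<in> pw_polys (max l m) cf" using V B(2) by blast
    show "bd_inner cf f p = 0" using Bd.radical[OF p' f' p(2)] by blast
    fix q assume "q \<in> span B"
    then have "q \<in> pw_polys (max l m) cf" using V B(2) by blast
    then show "bd_inner cf p q = 0 \<and> bd_inner cf q p = 0" using Bd.radical[OF p' _ p(2)] by blast
  qed
  then obtain w where w: "w \<in> ?V" "\<And>v. v \<in> ?V \<Longrightarrow> bd_inner cf w v = bd_inner cf f v" using B(2) by blast
  define p where "p = (\<lambda>F\<in>cf. restrict (w F) F)"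
  have pP: "p \<in> ?P" using w(1) by (auto simp: p_def families_def face_polys_def)
  have pq: "bd_inner cf p q = bd_inner cf f q" if q: "q \<in> ?P" for q
  proof -
    have "\<forall>F\<in>cf. \<exists>r\<in>polys l. q F = restrict r F" using q by (auto simp: face_polys_def PiE_def Pi_def)
    then obtain r where r: "\<forall>F\<in>cf. r F \<in> polys l \<and> q F = restrict (r F) F" by metis
    define v where "v F = (if F \<in> cf then r F else 0)" for F
    have v: "v \<in> ?V" using r by (auto simp: v_def families_def)
    have "bd_inner cf p q = bd_inner cf w v"
      using r by (intro bd_cong) (auto simp: p_def v_def)
    also have "\<dots> = bd_inner cf f v" by (rule w(2)[OF v])
    also have "\<dots> = bd_inner cf f q" using r by (intro bd_cong) (auto simp: v_def)
    finally show ?thesis .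
  qed
  show ?thesis
  proof (rule ex1I[of _ p])
    fix p' assume p': "p' \<in> ?P \<and> (\<forall>q\<in>?P. bd_inner cf p' q = bd_inner cf f q)"
    have pw_polys: "p \<in> pw_polys l cf" "p' \<in> pw_polys l cf" using pP p' face_polys_pw by blast+
    let ?e = "p' - p"
    have e: "?e \<in> pw_polys l cf" using subspace_diff[OF subspace_pw pw_polys(2,1)] .
    obtain q where q: "q \<in> ?P" "\<forall>F\<in>cf. \<forall>x\<in>F. q F x = ?e F x" using pw_face_polys[OF e] by blast
    have qpw: "q \<in> pw_polys l cf" using face_polys_pw q(1) by blast
    have "bd_inner cf ?e ?e = bd_inner cf ?e q" using q(2) by (intro bd_cong) auto
    also have "\<dots> = bd_inner cf p' q - bd_inner cf p q"
      by (rule lin_on_diff[OF Bd.lin2[OF qpw] subspace_pw pw_polys(2,1)])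
    also have "\<dots> = 0" using p' pq q(1) by simp
    finally have z: "bd_inner cf ?e ?e = 0" .
    show "p' = p"
    proof (rule PiE_ext[of p' cf "face_polys l" p])
      fix F assume F: "F \<in> cf"
      have "p' F x = p F x" if "x \<in> F" for x using bd_zero[OF e z F that] by simp
      moreover have "p' F \<in> extensional F" "p F \<in> extensional F"
        using p' pP F by (auto simp: face_polys_def PiE_def Pi_def)
      ultimately show "p' F = p F" by (intro extensionalityI)
    qed (use p' pP in auto)
  qed (use pP pq in blast)
qed

abbreviation "Pr \<equiv> bd_proj k cf"

lemma Pr:
  assumes f: "f \<in> pw_polys m cf"
  shows "Pr f \<in> pw_polys k cf" and "q \<in> pw_polys k cf \<Longrightarrow> bd_inner cf (Pr f) q = bd_inner cf f q"
proof -
  have *: "Pr f \<in> (\<Pi>\<^sub>E F\<in>cf. face_polys k F) \<and> (\<forall>q\<in>(\<Pi>\<^sub>E F\<in>cf. face_polys k F). bd_inner cf (Pr f) q = bd_inner cf f q)"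
    unfolding bd_proj_def by (rule theI'[OF bd_proj_exists[OF f]])
  then show "Pr f \<in> pw_polys k cf" using face_polys_pw by blast
  assume q: "q \<in> pw_polys k cf"
  obtain q' where q': "q' \<in> (\<Pi>\<^sub>E F\<in>cf. face_polys k F)" "\<forall>F\<in>cf. \<forall>x\<in>F. q' F x = q F x"
    using pw_face_polys[OF q] by blast
  have "bd_inner cf (Pr f) q = bd_inner cf (Pr f) q'" using q'(2) by (intro bd_cong) auto
  also have "\<dots> = bd_inner cf f q'" using * q'(1) by blast
  also have "\<dots> = bd_inner cf f q" using q'(2) by (intro bd_cong) auto
  finally show "bd_inner cf (Pr f) q = bd_inner cf f q" .
qed

lemma k2: "q \<in> pw_polys k cf \<Longrightarrow> q \<in> pw_polys (k + 2) cf" by (rule pw_mono) auto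

lemma Pr_inner1: "f \<in> pw_polys (k + 2) cf \<Longrightarrow> g \<in> pw_polys (k + 2) cf \<Longrightarrow> bd_inner cf (Pr f) (Pr g) = bd_inner cf f (Pr g)"
  using Pr by blast

lemma Pr_inner2: "f \<in> pw_polys (k + 2) cf \<Longrightarrow> g \<in> pw_polys (k + 2) cf \<Longrightarrow> bd_inner cf (Pr f) (Pr g) = bd_inner cf (Pr f) g"
  using Pr_inner1[of g f] Bd.sym[of "Pr f" "k + 2" "Pr g"] Bd.sym[of "Pr f" "k + 2" g] Pr(1) k2 by metis

lemma bilin_Pr: "bilin_on (pw_polys (k + 2) cf) (\<lambda>f g. bd_inner cf (Pr f) (Pr g))"
proof (rule bilin_onI)
  fix f :: "'a set \<Rightarrow> 'a \<Rightarrow> real" assume f: "f \<in> pw_polys (k + 2) cf"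
  have p: "Pr f \<in> pw_polys (k + 2) cf" using Pr(1)[OF f] k2 by blast
  have sub: "x + y \<in> pw_polys (k + 2) cf" "c *\<^sub>R x \<in> pw_polys (k + 2) cf"
    if "x \<in> pw_polys (k + 2) cf" "y \<in> pw_polys (k + 2) cf" for x y :: "'a set \<Rightarrow> 'a \<Rightarrow> real" and c
    using that subspace_add[OF subspace_pw] subspace_scale[OF subspace_pw] by blast+
  show "lin_on (pw_polys (k + 2) cf) (\<lambda>g. bd_inner cf (Pr f) (Pr g))"
    by (rule lin_onI)
      (use sub in \<open>simp_all add: Pr_inner2[OF f] lin_on_add[OF Bd.lin1[OF p]] lin_on_scale[OF Bd.lin1[OF p], simplified]\<close>)
  show "lin_on (pw_polys (k + 2) cf) (\<lambda>g. bd_inner cf (Pr g) (Pr f))"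
    by (rule lin_onI)
      (use sub in \<open>simp_all add: Pr_inner1[OF _ f] lin_on_add[OF Bd.lin2[OF p]] lin_on_scale[OF Bd.lin2[OF p], simplified]\<close>)
qed

text \<open>The projection is the best approximation of degree \<open>k\<close>, in particular at least as
  good as \<open>q\<close>.\<close>

lemma Pr_best:
  assumes f: "f \<in> pw_polys (k + 2) cf" and q: "q \<in> pw_polys k cf"
  shows "bd_inner cf f f \<le> 2 * bd_inner cf (Pr f) (Pr f) + 2 * bd_inner cf (f - q) (f - q)"
proof -
  have p: "Pr f \<in> pw_polys k cf" "Pr f \<in> pw_polys (k + 2) cf" using Pr(1)[OF f] k2 by blast+
  have q2: "q \<in> pw_polys (k + 2) cf" using k2[OF q] .
  have fp: "f - Pr f \<in> pw_polys (k + 2) cf" and pq: "Pr f - q \<in> pw_polys (k + 2) cf" and pqk: "Pr f - q \<in> pw_polys k cf"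
    using subspace_diff[OF subspace_pw] f p q q2 by blast+
  have "bd_inner cf (f - Pr f) (Pr f - q) = bd_inner cf f (Pr f - q) - bd_inner cf (Pr f) (Pr f - q)"
    by (rule lin_on_diff[OF Bd.lin2[OF pq] subspace_pw f p(2)])
  also have "\<dots> = 0" using Pr(2)[OF f pqk] by simp
  finally have "bd_inner cf (f - Pr f) (f - Pr f) \<le> bd_inner cf (f - q) (f - q)"
    using Bd.pythagoras_le[OF fp pq] by simp
  moreover have "bd_inner cf f f \<le> 2 * bd_inner cf (Pr f) (Pr f) + 2 * bd_inner cf (f - Pr f) (f - Pr f)"
    using Bd.add_sq_le[OF p(2) fp] by simp
  ultimately show ?thesis by simp
qed

subsection \<open>Biharmonic part\<close>

abbreviation "tg \<delta> \<equiv> (\<lambda>F. tgrad (nT F) (\<delta> F))"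

definition rhsV :: "'a ffun \<Rightarrow> 'a ffun \<Rightarrow> ('a \<Rightarrow> real) \<Rightarrow> real" where
  "rhsV \<delta> \<epsilon> w = bd_inner cf \<delta> (ndiff T (laplacian w)) - bd_inner cf \<epsilon> (nn w) - bd_inner cf (tg \<delta>) (nt w)"

lemma lin_ndiff_lap: "lin_on (polys (k + 2)) (\<lambda>w. ndiff T (laplacian w))"
proof (rule lin_onI)
  fix v w :: "'a \<Rightarrow> real" assume v: "v \<in> polys (k + 2)" and w: "w \<in> polys (k + 2)"
  have "laplacian (v + w) = laplacian v + laplacian w"
    unfolding laplacian_def[abs_def]
    by (intro ext) (simp add: lin_on_add[OF lin_on_dderiv2 v w] sum.distrib)
  then show "ndiff T (laplacian (v + w)) = ndiff T (laplacian v) + ndiff T (laplacian w)"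
    using lin_on_add[OF lin_on_dderiv' laplacian_polys[OF v] laplacian_polys[OF w]]
    by (intro ext) (simp add: ndiff_def)
next
  fix w :: "'a \<Rightarrow> real" and c assume w: "w \<in> polys (k + 2)"
  have "laplacian (c *\<^sub>R w) = c *\<^sub>R laplacian w"
    unfolding laplacian_def[abs_def]
    by (intro ext) (simp add: lin_on_scale[OF lin_on_dderiv2 w] sum_distrib_left)
  then show "ndiff T (laplacian (c *\<^sub>R w)) = c *\<^sub>R ndiff T (laplacian w)"
    using lin_on_scale[OF lin_on_dderiv' laplacian_polys[OF w]]
    by (intro ext) (simp add: ndiff_def)
qed

lemma lin_nn: "lin_on (polys (k + 2)) nn"
proof (rule lin_onI)
  fix v w :: "'a \<Rightarrow> real" assume v: "v \<in> polys (k + 2)" and w: "w \<in> polys (k + 2)"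
  show "nn (v + w) = nn v + nn w"
    by (rule ext) (simp only: lin_on_add[OF lin_on_dderiv2 v w] plus_fun_apply)
next
  fix w :: "'a \<Rightarrow> real" and c assume w: "w \<in> polys (k + 2)"
  show "nn (c *\<^sub>R w) = c *\<^sub>R nn w"
    by (rule ext) (simp only: lin_on_scale[OF lin_on_dderiv2 w] scaleR_fun_apply)
qed

lemma lin_nt: "lin_on (polys (k + 2)) nt"
proof (rule lin_onI)
  fix v w :: "'a \<Rightarrow> real" assume v: "v \<in> polys (k + 2)" and w: "w \<in> polys (k + 2)"
  have "tgrad n (dderiv n (v + w)) = tgrad n (dderiv n v) + tgrad n (dderiv n w)" for n
    unfolding lin_on_add[OF lin_on_dderiv' v w]
    by (rule ext) (simp add: plus_fun_def tgrad_add[OF dderiv_polys'[OF v] dderiv_polys'[OF w]])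
  then show "nt (v + w) = nt v + nt w" by (simp only: plus_fun_def)
next
  fix w :: "'a \<Rightarrow> real" and c assume w: "w \<in> polys (k + 2)"
  have "tgrad n (dderiv n (c *\<^sub>R w)) = c *\<^sub>R tgrad n (dderiv n w)" for n
    unfolding lin_on_scale[OF lin_on_dderiv' w]
    by (rule ext) (simp add: scaleR_fun_def tgrad_cmult[OF dderiv_polys'[OF w]])
  then show "nt (c *\<^sub>R w) = c *\<^sub>R nt w" by (simp only: scaleR_fun_def)
qed

lemma lap_pw: "w \<in> polys (k + 2) \<Longrightarrow> ndiff T (laplacian w) \<in> pw_polys (k + 2) cf"
  by (intro ndiff_pw' laplacian_polys)

lemma nn_pw2: "w \<in> polys (k + 2) \<Longrightarrow> nn w \<in> pw_polys (k + 2) cf"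
  by (intro k2 nn_pw)

lemma lin_rhsV:
  assumes "\<delta> \<in> pw_polys (k + 2) cf" "\<epsilon> \<in> pw_polys (k + 2) cf"
  shows "lin_on (polys (k + 2)) (rhsV \<delta> \<epsilon>)"
  unfolding rhsV_def[abs_def]
  by (intro lin_on_minus lin_on_compose[OF lin_ndiff_lap lap_pw] lin_on_compose[OF lin_nn nn_pw2]
      lin_on_compose[OF lin_nt nt_pw] Bd.lin1 Bv.lin1 tgrad_pw assms)

lemma tg_add:
  assumes "\<delta> \<in> pw_polys l cf" "\<delta>' \<in> pw_polys l cf" "F \<in> cf" "x \<in> F"
  shows "tg (\<delta> + \<delta>') F x = tg \<delta> F x + tg \<delta>' F x"
proof -
  obtain p where p: "p \<in> polys l" "\<forall>x\<in>F. \<delta> F x = p x" using pw_realD[OF assms(1,3)] by blast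
  obtain q where q: "q \<in> polys l" "\<forall>x\<in>F. \<delta>' F x = q x" using pw_realD[OF assms(2,3)] by blast
  note P = polys_plane_proj[of _ l "plane_normal F" "plane_offset F"]
  have "tgrad (nT F) (\<delta> F) x = grad (\<lambda>y. p (plane_proj (plane_normal F) (plane_offset F) y)) x"
    "tgrad (nT F) (\<delta>' F) x = grad (\<lambda>y. q (plane_proj (plane_normal F) (plane_offset F) y)) x"
    "tgrad (nT F) ((\<delta> + \<delta>') F) x = grad (\<lambda>y. p (plane_proj (plane_normal F) (plane_offset F) y) + q (plane_proj (plane_normal F) (plane_offset F) y)) x"
    using tgrad_face[OF assms(3,4) p(1), of "\<delta> F"] tgrad_face[OF assms(3,4) q(1), of "\<delta>' F"]
      tgrad_face[OF assms(3,4) polys_add[OF p(1) q(1)], of "(\<delta> + \<delta>') F"] p(2) q(2) by simp_all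
  then show ?thesis using grad_add[OF P[OF p(1)] P[OF q(1)]] by simp
qed

lemma tg_scale:
  assumes "\<delta> \<in> pw_polys l cf" "F \<in> cf" "x \<in> F"
  shows "tg (c *\<^sub>R \<delta>) F x = c *\<^sub>R tg \<delta> F x"
proof -
  obtain p where p: "p \<in> polys l" "\<forall>x\<in>F. \<delta> F x = p x" using pw_realD[OF assms(1,2)] by blast
  have "tgrad (nT F) (\<delta> F) x = grad (\<lambda>y. p (plane_proj (plane_normal F) (plane_offset F) y)) x"
    "tgrad (nT F) ((c *\<^sub>R \<delta>) F) x = grad (\<lambda>y. c * p (plane_proj (plane_normal F) (plane_offset F) y)) x"
    using tgrad_face[OF assms(2,3) p(1), of "\<delta> F"]
      tgrad_face[OF assms(2,3) polys_cmult[OF p(1), of c], of "(c *\<^sub>R \<delta>) F"] p(2) by simp_all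
  then show ?thesis using grad_cmult[OF polys_plane_proj[OF p(1)]] by simp
qed

lemma lin_tg: "g \<in> pw_polys l cf \<Longrightarrow> lin_on (pw_polys l cf) (\<lambda>\<delta>. bd_inner cf (tg \<delta>) g)"
proof (rule lin_onI)
  fix \<delta> \<delta>' :: "'a ffun" assume g: "g \<in> pw_polys l cf" and \<delta>: "\<delta> \<in> pw_polys l cf" "\<delta>' \<in> pw_polys l cf"
  have "bd_inner cf (tg (\<delta> + \<delta>')) g = bd_inner cf (tg \<delta> + tg \<delta>') g"
    using tg_add[OF \<delta>] by (intro bd_cong) simp_all
  then show "bd_inner cf (tg (\<delta> + \<delta>')) g = bd_inner cf (tg \<delta>) g + bd_inner cf (tg \<delta>') g"
    using lin_on_add[OF Bv.lin2[OF g] tgrad_pw[OF \<delta>(1)] tgrad_pw[OF \<delta>(2)]] by simp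
next
  fix \<delta> :: "'a ffun" and c assume g: "g \<in> pw_polys l cf" and \<delta>: "\<delta> \<in> pw_polys l cf"
  have "bd_inner cf (tg (c *\<^sub>R \<delta>)) g = bd_inner cf (c *\<^sub>R tg \<delta>) g"
    using tg_scale[OF \<delta>] by (intro bd_cong) simp_all
  then show "bd_inner cf (tg (c *\<^sub>R \<delta>)) g = c *\<^sub>R bd_inner cf (tg \<delta>) g"
    using lin_on_scale[OF Bv.lin2[OF g] tgrad_pw[OF \<delta>], of c] by simp
qed

lemma bd_sq_le:
  fixes f g :: "'a ffun"
  assumes "f \<in> pw_polys l cf" "g \<in> pw_polys l cf" "bd_inner cf g g \<le> X"
  shows "(bd_inner cf f g)\<^sup>2 \<le> bd_inner cf f f * X"
  using Bd.cauchy_schwarz[OF assms(1,2)] Bd.nonneg[OF assms(1)] assms(3)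
  by (meson mult_left_mono order_trans)

lemma bv_sq_le:
  fixes f g :: "'a set \<Rightarrow> 'a \<Rightarrow> 'a"
  assumes "f \<in> pw_polys l cf" "g \<in> pw_polys l cf" "bd_inner cf g g \<le> X"
  shows "(bd_inner cf f g)\<^sup>2 \<le> bd_inner cf f f * X"
  using Bv.cauchy_schwarz[OF assms(1,2)] Bv.nonneg[OF assms(1)] assms(3)
  by (meson mult_left_mono order_trans)

text \<open>The compatibility condition for the reconstruction to exist: on functions with vanishing Hessian
  the boundary terms vanish as well, by the trace inequalities.\<close>

lemma rhsV_radical:
  assumes \<delta>: "\<delta> \<in> pw_polys (k + 2) cf" and \<epsilon>: "\<epsilon> \<in> pw_polys (k + 2) cf"
    and w: "w \<in> polys (k + 2)" "hess_inner T w w = 0"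
  shows "rhsV \<delta> \<epsilon> w = 0"
proof -
  have "(bd_inner cf \<delta> (ndiff T (laplacian w)))\<^sup>2 \<le> bd_inner cf \<delta> \<delta> * 0"
    using ndiff_lap_le[OF w(1)] w(2) by (intro bd_sq_le[OF \<delta> lap_pw[OF w(1)]]) simp
  moreover have "(bd_inner cf \<epsilon> (nn w))\<^sup>2 \<le> bd_inner cf \<epsilon> \<epsilon> * 0"
    using nn_le[OF w(1)] w(2) by (intro bd_sq_le[OF \<epsilon> nn_pw2[OF w(1)]]) simp
  moreover have "(bd_inner cf (tg \<delta>) (nt w))\<^sup>2 \<le> bd_inner cf (tg \<delta>) (tg \<delta>) * 0"
    using nt_le[OF w(1)] w(2) by (intro bv_sq_le[OF tgrad_pw[OF \<delta>] nt_pw[OF w(1)]]) simp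
  ultimately show ?thesis by (simp add: rhsV_def)
qed

lemma hess_zero:
  assumes p: "p \<in> polys l" and z: "hess_inner T p p = 0"
  shows "p \<in> polys 1"
proof (rule zero_hessian_polys_1[OF p])
  fix a b x :: 'a assume ab: "a \<in> Basis" "b \<in> Basis"
  have dd: "dderiv a (dderiv b p) \<in> polys l" for a b by (intro dderiv_polys' p)
  have "\<forall>i\<in>Basis \<times> Basis. L2_inner T (dderiv (fst i) (dderiv (snd i) p)) (dderiv (fst i) (dderiv (snd i) p)) = 0"
    using z unfolding hess_inner_pairs
    by (subst (asm) sum_nonneg_eq_0_iff) (auto intro!: L2.nonneg[OF dd])
  then have "L2_inner T (dderiv a (dderiv b p)) (dderiv a (dderiv b p)) = 0" using ab by auto
  then show "dderiv a (dderiv b p) x = 0" by (rule L2_zero[OF dd])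
qed

lemma hess_affine:
  assumes p: "p \<in> polys 1"
  shows "hess_inner T p p = 0"
proof -
  have "dderiv b p \<in> polys 0" for b using dderiv_polys[OF p] by simp
  then have "dderiv a (dderiv b p) = (\<lambda>x. 0)" for a b by (rule dderiv_polys_0)
  then show ?thesis by (simp add: hess_inner_def L2_inner_def set_lebesgue_integral_def)
qed

definition recV :: "('a \<Rightarrow> real) \<Rightarrow> 'a ffun \<Rightarrow> 'a ffun \<Rightarrow> 'a \<Rightarrow> real" where
  "recV v \<delta> \<epsilon> = (THE r. r \<in> polys (k + 2) \<and>
     (\<forall>w\<in>polys (k + 2). hess_inner T r w = hess_inner T v w + rhsV \<delta> \<epsilon> w) \<and>
     (\<forall>\<xi>\<in>polys 1. L2_inner T r \<xi> = L2_inner T v \<xi>))"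

text \<open>The first equation is solvable up to affine functions, which are invisible to the Hessian; the
  second one then fixes the affine part through the \<open>L\<^sup>2\<close> projection on affine
  functions.\<close>

lemma recV:
  assumes v: "v \<in> polys (k + 2)" and \<delta>: "\<delta> \<in> pw_polys (k + 2) cf" and \<epsilon>: "\<epsilon> \<in> pw_polys (k + 2) cf"
  shows "recV v \<delta> \<epsilon> \<in> polys (k + 2)"
    and "w \<in> polys (k + 2) \<Longrightarrow> hess_inner T (recV v \<delta> \<epsilon>) w = hess_inner T v w + rhsV \<delta> \<epsilon> w"
proof -
  let ?P = "\<lambda>r. r \<in> polys (k + 2) \<and>
     (\<forall>w\<in>polys (k + 2). hess_inner T r w = hess_inner T v w + rhsV \<delta> \<epsilon> w) \<and>
     (\<forall>\<xi>\<in>polys 1. L2_inner T r \<xi> = L2_inner T v \<xi>)"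
  obtain B where B: "finite B" "polys (k + 2) = (span B :: ('a \<Rightarrow> real) set)"
    using fin_dim_polys[where ?'a='a] unfolding fin_dim_def by blast
  obtain B1 where B1: "finite B1" "polys 1 = (span B1 :: ('a \<Rightarrow> real) set)"
    using fin_dim_polys[where ?'a='a] unfolding fin_dim_def by blast
  have 1: "\<xi> \<in> polys 1 \<Longrightarrow> \<xi> \<in> polys (k + 2)" for \<xi> :: "'a \<Rightarrow> real" using polys_mono[of 1 "k + 2"] by auto
  have "\<exists>r\<in>span B. \<forall>w\<in>span B. hess_inner T r w = hess_inner T v w + rhsV \<delta> \<epsilon> w"
  proof (rule psd_solve[OF B(1)]; (unfold B(2)[symmetric])?)
    show "bilin_on (polys (k + 2)) (hess_inner T)" by (rule He.bilin)
    show "lin_on (polys (k + 2)) (\<lambda>w. hess_inner T v w + rhsV \<delta> \<epsilon> w)"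
      by (intro lin_on_plus He.lin1[OF v] lin_rhsV[OF \<delta> \<epsilon>])
    fix p :: "'a \<Rightarrow> real" assume p: "p \<in> polys (k + 2)" "hess_inner T p p = 0"
    show "hess_inner T v p + rhsV \<delta> \<epsilon> p = 0"
      using He.radical[OF p(1) v p(2)] rhsV_radical[OF \<delta> \<epsilon> p] by simp
    show "hess_inner T p q = 0 \<and> hess_inner T q p = 0" if "q \<in> polys (k + 2)" for q
      by (rule He.radical[OF p(1) that p(2)])
  qed
  then obtain r0 where r0: "r0 \<in> polys (k + 2)"
    "\<And>w. w \<in> polys (k + 2) \<Longrightarrow> hess_inner T r0 w = hess_inner T v w + rhsV \<delta> \<epsilon> w"
    unfolding B(2)[symmetric] by blast
  have e: "v - r0 \<in> polys (k + 2)" by (rule subspace_diff[OF subspace_polys v r0(1)])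
  have "\<exists>r\<in>span B1. \<forall>\<xi>\<in>span B1. L2_inner T r \<xi> = L2_inner T (v - r0) \<xi>"
  proof (rule psd_solve[OF B1(1)]; (unfold B1(2)[symmetric])?)
    show "bilin_on (polys 1) (L2_inner T)" by (rule L2.bilin)
    show "lin_on (polys 1) (L2_inner T (v - r0))"
      using lin_on_mono[OF L2.lin1[OF e]] 1 by blast
    fix p :: "'a \<Rightarrow> real" assume p: "p \<in> polys 1" "L2_inner T p p = 0"
    show "L2_inner T (v - r0) p = 0" using L2.radical[OF 1[OF p(1)] e p(2)] by blast
    show "L2_inner T p q = 0 \<and> L2_inner T q p = 0" if "q \<in> polys 1" for q
      by (rule L2.radical[OF p(1) that p(2)])
  qed
  then obtain s where s: "s \<in> polys 1" "\<And>\<xi>. \<xi> \<in> polys 1 \<Longrightarrow> L2_inner T s \<xi> = L2_inner T (v - r0) \<xi>"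
    unfolding B1(2)[symmetric] by blast
  note s2 = 1[OF s(1)]
  have "?P (r0 + s)"
  proof (intro conjI ballI)
    show "r0 + s \<in> polys (k + 2)" by (rule subspace_add[OF subspace_polys r0(1) s2])
    fix w :: "'a \<Rightarrow> real" assume w: "w \<in> polys (k + 2)"
    have "hess_inner T (r0 + s) w = hess_inner T r0 w + hess_inner T s w"
      by (rule lin_on_add[OF He.lin2[OF w] r0(1) s2])
    then show "hess_inner T (r0 + s) w = hess_inner T v w + rhsV \<delta> \<epsilon> w"
      using r0(2)[OF w] He.radical[OF s2 w hess_affine[OF s(1)]] by simp
  next
    fix \<xi> :: "'a \<Rightarrow> real" assume \<xi>: "\<xi> \<in> polys 1"
    have "L2_inner T (r0 + s) \<xi> = L2_inner T r0 \<xi> + L2_inner T s \<xi>"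
      by (rule lin_on_add[OF L2.lin2[OF 1[OF \<xi>]] r0(1) s2])
    moreover have "L2_inner T s \<xi> = L2_inner T v \<xi> - L2_inner T r0 \<xi>"
      unfolding s(2)[OF \<xi>] by (rule lin_on_diff[OF L2.lin2[OF 1[OF \<xi>]] subspace_polys v r0(1)])
    ultimately show "L2_inner T (r0 + s) \<xi> = L2_inner T v \<xi>" by linarith
  qed
  moreover have "r = r'" if r: "?P r" and r': "?P r'" for r r'
  proof -
    have rp: "r \<in> polys (k + 2)" "r' \<in> polys (k + 2)" using r r' by auto
    let ?e = "r - r'"
    have ep: "?e \<in> polys (k + 2)" by (rule subspace_diff[OF subspace_polys rp])
    have "hess_inner T ?e ?e = hess_inner T r ?e - hess_inner T r' ?e"
      by (rule lin_on_diff[OF He.lin2[OF ep] subspace_polys rp])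
    also have "\<dots> = 0" using r r' ep by simp
    finally have e1: "?e \<in> polys 1" by (rule hess_zero[OF ep])
    have "L2_inner T ?e ?e = L2_inner T r ?e - L2_inner T r' ?e"
      by (rule lin_on_diff[OF L2.lin2[OF ep] subspace_polys rp])
    also have "\<dots> = 0" using r r' e1 by simp
    finally have "?e x = 0" for x by (rule L2_zero[OF ep])
    then show ?thesis by (intro ext) simp
  qed
  ultimately have "\<exists>!r. ?P r" by blast
  from theI'[OF this] have "?P (recV v \<delta> \<epsilon>)" unfolding recV_def .
  then show "recV v \<delta> \<epsilon> \<in> polys (k + 2)"
    "w \<in> polys (k + 2) \<Longrightarrow> hess_inner T (recV v \<delta> \<epsilon>) w = hess_inner T v w + rhsV \<delta> \<epsilon> w" by blast+
qed

definition dataV :: "(('a \<Rightarrow> real) \<times> 'a ffun \<times> 'a ffun) set" where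
  "dataV = polys (k + 2) \<times> pw_polys (k + 2) cf \<times> pw_polys (k + 2) cf"

definition locV :: "('a \<Rightarrow> real) \<times> 'a ffun \<times> 'a ffun \<Rightarrow> ('a \<Rightarrow> real) \<times> 'a ffun \<times> 'a ffun \<Rightarrow> real" where
  "locV d d' = hess_inner T (recV (fst d) (fst (snd d)) (snd (snd d))) (recV (fst d') (fst (snd d')) (snd (snd d')))
     + bd_inner cf (fst (snd d)) (fst (snd d')) / h ^ 3
     + bd_inner cf (Pr (snd (snd d))) (Pr (snd (snd d'))) / h"

lemma lin_rhs_data:
  assumes w: "w \<in> polys (k + 2)"
  shows "lin_on dataV (\<lambda>d. hess_inner T (fst d) w + rhsV (fst (snd d)) (snd (snd d)) w)"
proof (rule lin_on_plus)
  have f: "lin_on dataV fst" "lin_on dataV (\<lambda>d. fst (snd d))" "lin_on dataV (\<lambda>d. snd (snd d))"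
    by (simp_all add: lin_on_def)
  show "lin_on dataV (\<lambda>d. hess_inner T (fst d) w)"
    by (rule lin_on_compose[OF f(1) _ He.lin2[OF w]]) (auto simp: dataV_def)
  show "lin_on dataV (\<lambda>d. rhsV (fst (snd d)) (snd (snd d)) w)"
    unfolding rhsV_def
    by (intro lin_on_minus lin_on_compose[OF f(2) _ Bd.lin2[OF lap_pw[OF w]]]
        lin_on_compose[OF f(3) _ Bd.lin2[OF nn_pw2[OF w]]]
        lin_on_compose[OF f(2) _ lin_tg[OF nt_pw[OF w]]]) (auto simp: dataV_def)
qed

lemma recV_data:
  assumes "d \<in> dataV"
  shows "recV (fst d) (fst (snd d)) (snd (snd d)) \<in> polys (k + 2)"
    and "w \<in> polys (k + 2) \<Longrightarrow> hess_inner T (recV (fst d) (fst (snd d)) (snd (snd d))) w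
      = hess_inner T (fst d) w + rhsV (fst (snd d)) (snd (snd d)) w"
  using recV[of "fst d" "fst (snd d)" "snd (snd d)"] assms by (auto simp: dataV_def)

lemma subspace_dataV: "subspace dataV"
  unfolding dataV_def by (intro subspace_Times subspace_polys subspace_pw)

text \<open>Linearity in each argument is read off from the right-hand side of the equation defining the
  reconstruction, tested with the reconstruction of the other argument.\<close>

lemma bilin_locV: "bilin_on dataV locV"
proof -
  let ?R = "\<lambda>d. recV (fst d) (fst (snd d)) (snd (snd d))"
  have f: "lin_on dataV (\<lambda>d. fst (snd d))" "lin_on dataV (\<lambda>d. snd (snd d))" by (simp_all add: lin_on_def)
  have cl: "x + y \<in> dataV" "c *\<^sub>R x \<in> dataV" if "x \<in> dataV" "y \<in> dataV" for x y c
    using that subspace_add[OF subspace_dataV] subspace_scale[OF subspace_dataV] by blast+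
  have l: "lin_on dataV (\<lambda>d. hess_inner T (?R d) (?R d'))" if d': "d' \<in> dataV" for d'
  proof (rule lin_onI)
    fix x y assume xy: "x \<in> dataV" "y \<in> dataV"
    show "hess_inner T (?R (x + y)) (?R d') = hess_inner T (?R x) (?R d') + hess_inner T (?R y) (?R d')"
      using lin_on_add[OF lin_rhs_data[OF recV_data(1)[OF d']] xy]
      by (simp only: recV_data(2)[OF _ recV_data(1)[OF d']] xy cl[OF xy])
  next
    fix x c assume x: "x \<in> dataV"
    show "hess_inner T (?R (c *\<^sub>R x)) (?R d') = c *\<^sub>R hess_inner T (?R x) (?R d')"
      using lin_on_scale[OF lin_rhs_data[OF recV_data(1)[OF d']] x]
      by (simp only: recV_data(2)[OF _ recV_data(1)[OF d']] x cl[OF x x])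
  qed
  have r: "lin_on dataV (\<lambda>d. hess_inner T (?R d') (?R d))" if d': "d' \<in> dataV" for d'
    using l[OF d'] He.sym[OF recV_data(1)[OF d'] recV_data(1)] cl unfolding lin_on_def by metis
  show ?thesis
  proof (rule bilin_onI)
    fix d assume d: "d \<in> dataV"
    then have dm: "fst (snd d) \<in> pw_polys (k + 2) cf" "snd (snd d) \<in> pw_polys (k + 2) cf" by (auto simp: dataV_def)
    show "lin_on dataV (locV d)" unfolding locV_def
      by (intro lin_on_plus lin_on_divide r[OF d] lin_on_compose[OF f(1) _ Bd.lin1[OF dm(1)]]
          lin_on_compose[OF f(2) _ bilin_onD(1)[OF bilin_Pr dm(2)]]) (auto simp: dataV_def)
    show "lin_on dataV (\<lambda>d'. locV d' d)" unfolding locV_def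
      by (intro lin_on_plus lin_on_divide l[OF d] lin_on_compose[OF f(1) _ Bd.lin2[OF dm(1)]]
          lin_on_compose[OF f(2) _ bilin_onD(2)[OF bilin_Pr dm(2)]]) (auto simp: dataV_def)
  qed
qed

end

text \<open>With \<open>B\<close> from the trace inequalities and \<open>A\<close> from the tangential inverse
  inequality, the second factor bounds the Hessian and the first one adds the normal derivative
  (see \<open>coercive_V\<close>).\<close>

definition coer_const :: "nat \<Rightarrow> real \<Rightarrow> real \<Rightarrow> real" where
  "coer_const d \<rho> K = (let B = bdry_const d \<rho> * K; A = area_const d * real d * K in
     (1 + 2 * B) * (4 * (1 + B * (real d * real d) + B + A * B)) + 3)"

lemma coer_const_nonneg: "0 \<le> K \<Longrightarrow> 0 \<le> coer_const d \<rho> K"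
  unfolding coer_const_def Let_def bdry_const_def area_const_def
  by (intro add_nonneg_nonneg mult_nonneg_nonneg) auto

context mesh_cell
begin

lemma const_pw: "(\<lambda>F x. c F) \<in> pw_polys l cf" for c :: "'a set \<Rightarrow> real"
proof (rule pw_realI)
  show "\<exists>q\<in>polys l. \<forall>x\<in>F. c F = q x" for F
    by (rule bexI[of _ "\<lambda>_. c F"]) (simp_all add: polys_const)
qed

text \<open>The equation of the reconstruction tested with \<open>v\<close> bounds the Hessian by absorption,
  where \<open>\<epsilon>\<close> may be replaced by its projection because the second normal
  derivative of \<open>v\<close> has degree \<open>k\<close>. Then \<open>\<epsilon>\<close>
  itself is compared with the family obtained by freezing the normal derivative at
  \<open>x0\<close>, which has degree \<open>k\<close> and differs from \<open>\<epsilon>\<close>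
  by a quantity bounded by the Hessian.\<close>

lemma coercive_V:
  assumes v: "v \<in> polys (k + 2)" and \<delta>: "\<delta> \<in> pw_polys (k + 2) cf" and \<eta>: "\<eta> \<in> pw_polys k cf"
    and \<epsilon>: "\<epsilon> = ndiff T v - \<eta>"
  shows "hess_inner T v v + bd_inner cf \<epsilon> \<epsilon> / h + bd_inner cf \<delta> \<delta> / h ^ 3
    \<le> coer_const DIM('a) \<rho> K * locV (v, \<delta>, \<epsilon>) (v, \<delta>, \<epsilon>)"
proof -
  define bK where "bK = bdry_const DIM('a) \<rho> * K"
  define aK where "aK = area_const DIM('a) * real DIM('a) * K"
  have bK0: "0 \<le> bK" and aK0: "0 \<le> aK" using bdry_const_nonneg area_const_nonneg K0 by (simp_all add: bK_def aK_def)
  have \<epsilon>p: "\<epsilon> \<in> pw_polys (k + 2) cf"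
    unfolding \<epsilon> by (rule subspace_diff[OF subspace_pw ndiff_pw'[OF v] k2[OF \<eta>]])
  define R where "R = recV v \<delta> \<epsilon>"
  have R: "R \<in> polys (k + 2)" "hess_inner T R v = hess_inner T v v + rhsV \<delta> \<epsilon> v"
    using recV[OF v \<delta> \<epsilon>p] v unfolding R_def by blast+
  define H where "H = hess_inner T v v"
  define X where "X = hess_inner T R R"
  define Y where "Y = bd_inner cf \<delta> \<delta> / h ^ 3"
  define Z where "Z = bd_inner cf (Pr \<epsilon>) (Pr \<epsilon>) / h"
  have Pr\<epsilon>: "Pr \<epsilon> \<in> pw_polys k cf" "Pr \<epsilon> \<in> pw_polys (k + 2) cf" using Pr(1)[OF \<epsilon>p] k2 by blast+
  have H0: "0 \<le> H" unfolding H_def by (rule He.nonneg[OF v])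
  have X0: "0 \<le> X" unfolding X_def by (rule He.nonneg[OF R(1)])
  have Y0: "0 \<le> Y" unfolding Y_def using Bd.nonneg[OF \<delta>] hpos by simp
  have Z0: "0 \<le> Z" unfolding Z_def using Bd.nonneg[OF Pr\<epsilon>(1)] hpos by simp
  have "H \<le> 4 * (X + bK * (real DIM('a) * real DIM('a)) * Y + bK * Z + aK * bK * Y)"
  proof (rule absorb[OF H0])
    show "H = hess_inner T R v + - bd_inner cf \<delta> (ndiff T (laplacian v)) + bd_inner cf \<epsilon> (nn v)
        + bd_inner cf (tg \<delta>) (nt v)"
      using R(2) by (simp add: H_def rhsV_def)
    show "(hess_inner T R v)\<^sup>2 \<le> X * H"
      unfolding X_def H_def by (rule He.cauchy_schwarz[OF R(1) v])
    have "(bd_inner cf \<delta> (ndiff T (laplacian v)))\<^sup>2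
        \<le> bd_inner cf \<delta> \<delta> * (bdry_const DIM('a) \<rho> * K * (real DIM('a) * real DIM('a) * (H / h\<^sup>2)) / h)"
      unfolding H_def by (rule bd_sq_le[OF \<delta> lap_pw[OF v] ndiff_lap_le[OF v]])
    also have "\<dots> = bK * (real DIM('a) * real DIM('a)) * Y * H"
      using hpos by (simp add: Y_def bK_def power2_eq_square power3_eq_cube)
    finally show "(- bd_inner cf \<delta> (ndiff T (laplacian v)))\<^sup>2 \<le> bK * (real DIM('a) * real DIM('a)) * Y * H"
      by simp
    have "(bd_inner cf (Pr \<epsilon>) (nn v))\<^sup>2 \<le> bd_inner cf (Pr \<epsilon>) (Pr \<epsilon>) * (bdry_const DIM('a) \<rho> * K * H / h)"
      unfolding H_def by (rule bd_sq_le[OF Pr\<epsilon>(1) nn_pw[OF v] nn_le[OF v]])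
    also have "bd_inner cf (Pr \<epsilon>) (nn v) = bd_inner cf \<epsilon> (nn v)" by (rule Pr(2)[OF \<epsilon>p nn_pw[OF v]])
    finally show "(bd_inner cf \<epsilon> (nn v))\<^sup>2 \<le> bK * Z * H" by (simp add: Z_def bK_def mult.commute mult.left_commute)
    have "(bd_inner cf (tg \<delta>) (nt v))\<^sup>2 \<le> bd_inner cf (tg \<delta>) (tg \<delta>) * (bdry_const DIM('a) \<rho> * K * H / h)"
      unfolding H_def by (rule bv_sq_le[OF tgrad_pw[OF \<delta>] nt_pw[OF v] nt_le[OF v]])
    also have "\<dots> \<le> (aK / h\<^sup>2 * bd_inner cf \<delta> \<delta>) * (bdry_const DIM('a) \<rho> * K * H / h)"
      using tgrad_inverse[OF \<delta>] bK0 H0 hpos unfolding aK_def bK_def by (intro mult_right_mono) auto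
    also have "\<dots> = aK * bK * Y * H"
      using hpos by (simp add: Y_def bK_def power2_eq_square power3_eq_cube)
    finally show "(bd_inner cf (tg \<delta>) (nt v))\<^sup>2 \<le> aK * bK * Y * H" .
    show "0 \<le> bK * (real DIM('a) * real DIM('a)) * Y" "0 \<le> bK * Z" "0 \<le> aK * bK * Y"
      using bK0 aK0 Y0 Z0 by simp_all
  qed (rule X0)
  also have "\<dots> \<le> 4 * (1 + bK * (real DIM('a) * real DIM('a)) + bK + aK * bK) * (X + Y + Z)"
    using bK0 aK0 X0 Y0 Z0 by (simp add: algebra_simps)
  finally have HB: "H \<le> 4 * (1 + bK * (real DIM('a) * real DIM('a)) + bK + aK * bK) * (X + Y + Z)" .
  define q where "q = (\<lambda>F x. dderiv (nT F) v x0 - \<eta> F x)"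
  have qp: "q \<in> pw_polys k cf" unfolding q_def
    by (rule pw_diff[OF const_pw \<eta>])
  have eq: "\<epsilon> - q = (\<lambda>F x. dderiv (nT F) v x - dderiv (nT F) v x0)"
    by (simp add: \<epsilon> q_def fun_eq_iff ndiff_def)
  have "bd_inner cf (\<epsilon> - q) (\<epsilon> - q) \<le> bdry_const DIM('a) \<rho> * h ^ DIM('a) / h * (K / h ^ DIM('a) * (h\<^sup>2 * H))"
  proof (rule family_le)
    show "\<epsilon> - q \<in> pw_polys (k + 2) cf" by (rule subspace_diff[OF subspace_pw \<epsilon>p k2[OF qp]])
    fix F x assume F: "F \<in> cf" "x \<in> F"
    have n: "norm (nT F) \<le> 1" using nT_unit[OF F(1)] by simp
    obtain \<xi> where \<xi>: "\<xi> \<in> cball x0 h"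
      "(dderiv (nT F) v x - dderiv (nT F) v x0)\<^sup>2 \<le> h\<^sup>2 * (\<Sum>b\<in>Basis. (dderiv b (dderiv (nT F) v) \<xi>)\<^sup>2)"
      using mean_value_sq[OF dderiv_polys'[OF v] face_cball[OF F]] by blast
    note \<xi>(2)
    also have "h\<^sup>2 * (\<Sum>b\<in>Basis. (dderiv b (dderiv (nT F) v) \<xi>)\<^sup>2) \<le> h\<^sup>2 * (K / h ^ DIM('a) * H)"
      unfolding H_def
      by (intro mult_left_mono order_trans[OF second_deriv_unit_le[OF v n] sup_hess_le[OF v \<xi>(1)]]) auto
    finally show "(\<epsilon> - q) F x \<bullet> (\<epsilon> - q) F x \<le> K / h ^ DIM('a) * (h\<^sup>2 * H)"
      unfolding eq by (simp add: power2_eq_square mult.left_commute)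
  qed (use K0 hpos H0 in simp)
  then have "bd_inner cf (\<epsilon> - q) (\<epsilon> - q) \<le> bK * H * h"
    unfolding scale_cancel bK_def using hpos by (simp add: power2_eq_square mult.commute mult.left_commute)
  then have "bd_inner cf \<epsilon> \<epsilon> \<le> 2 * bd_inner cf (Pr \<epsilon>) (Pr \<epsilon>) + 2 * (bK * H * h)"
    using Pr_best[OF \<epsilon>p qp] by simp
  then have "bd_inner cf \<epsilon> \<epsilon> / h \<le> (2 * bd_inner cf (Pr \<epsilon>) (Pr \<epsilon>) + 2 * (bK * H * h)) / h"
    using hpos by (intro divide_right_mono) auto
  also have "\<dots> = 2 * Z + 2 * bK * H" using hpos by (simp add: Z_def add_divide_distrib)
  finally have E: "bd_inner cf \<epsilon> \<epsilon> / h \<le> 2 * Z + 2 * bK * H" .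
  have "H + bd_inner cf \<epsilon> \<epsilon> / h + Y \<le> (1 + 2 * bK) * H + 3 * (X + Y + Z)"
    using E X0 Y0 Z0 by (simp add: algebra_simps)
  also have "\<dots> \<le> (1 + 2 * bK) * (4 * (1 + bK * (real DIM('a) * real DIM('a)) + bK + aK * bK) * (X + Y + Z)) + 3 * (X + Y + Z)"
    using HB bK0 by (intro add_right_mono mult_left_mono) auto
  also have "\<dots> = coer_const DIM('a) \<rho> K * (X + Y + Z)"
    unfolding coer_const_def Let_def bK_def aK_def by (simp only: distrib_right mult.assoc)
  also have "X + Y + Z = locV (v, \<delta>, \<epsilon>) (v, \<delta>, \<epsilon>)"
    by (simp add: locV_def X_def Y_def Z_def R_def)
  finally show ?thesis by (simp add: H_def Y_def)
qed

subsection \<open>Second-order part\<close>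

definition rhsU :: "'a ffun \<Rightarrow> ('a \<Rightarrow> real) \<Rightarrow> real" where
  "rhsU \<delta> w = - bd_inner cf \<delta> (ndiff T w)"

lemma k1: "p \<in> polys (k + 1) \<Longrightarrow> p \<in> polys (k + 2)" for p :: "'a \<Rightarrow> real"
  using polys_mono[of "k + 1" "k + 2"] by auto

lemma lin_ndiff: "lin_on (polys (k + 1)) (ndiff T)"
proof (rule lin_onI)
  fix v w :: "'a \<Rightarrow> real" assume v: "v \<in> polys (k + 1)" and w: "w \<in> polys (k + 1)"
  show "ndiff T (v + w) = ndiff T v + ndiff T w"
    by (intro ext) (simp only: ndiff_def lin_on_add[OF lin_on_dderiv' v w] plus_fun_apply)
next
  fix w :: "'a \<Rightarrow> real" and c assume w: "w \<in> polys (k + 1)"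
  show "ndiff T (c *\<^sub>R w) = c *\<^sub>R ndiff T w"
    by (intro ext) (simp only: ndiff_def lin_on_scale[OF lin_on_dderiv' w] scaleR_fun_apply)
qed

lemma lin_rhsU:
  assumes "\<delta> \<in> pw_polys (k + 2) cf"
  shows "lin_on (polys (k + 1)) (rhsU \<delta>)"
  using lin_on_compose[OF lin_ndiff ndiff_pw'[OF k1] Bd.lin1[OF assms]]
  by (simp add: lin_on_def rhsU_def[abs_def])

lemma rhsU_radical:
  assumes \<delta>: "\<delta> \<in> pw_polys (k + 2) cf" and w: "w \<in> polys (k + 1)" "L2_inner T (grad w) (grad w) = 0"
  shows "rhsU \<delta> w = 0"
proof -
  have "(bd_inner cf \<delta> (ndiff T w))\<^sup>2 \<le> bd_inner cf \<delta> \<delta> * 0"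
    using trace_ndiff[OF k1[OF w(1)]] w(2) by (intro bd_sq_le[OF \<delta> ndiff_pw'[OF k1[OF w(1)]]]) simp
  then show ?thesis by (simp add: rhsU_def)
qed

lemma grad_zero:
  assumes p: "p \<in> polys l" and z: "L2_inner T (grad p) (grad p) = 0"
  shows "p x = p y"
proof (rule zero_dderiv_const[OF p])
  fix b x :: 'a assume b: "b \<in> Basis"
  have "\<forall>b\<in>Basis. L2_inner T (dderiv b p) (dderiv b p) = 0"
    using z unfolding L2_grad[OF p]
    by (subst (asm) sum_nonneg_eq_0_iff) (auto intro!: L2.nonneg[OF dderiv_polys'[OF p]])
  then show "dderiv b p x = 0" using L2_zero[OF dderiv_polys'[OF p]] b by blast
qed

lemma grad_const: "L2_inner T (grad (\<lambda>x. c)) (grad (\<lambda>x. c)) = 0"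
  by (simp add: L2_inner_def inner_grad dderiv_const set_lebesgue_integral_def)

definition recU :: "('a \<Rightarrow> real) \<Rightarrow> 'a ffun \<Rightarrow> 'a \<Rightarrow> real" where
  "recU u \<delta> = (THE g. g \<in> polys (k + 1) \<and>
     (\<forall>w\<in>polys (k + 1). L2_inner T (grad g) (grad w) = L2_inner T (grad u) (grad w) + rhsU \<delta> w) \<and>
     L2_inner T g (\<lambda>_. 1) = L2_inner T u (\<lambda>_. 1))"

text \<open>As for the biharmonic reconstruction, with a constant in place of an affine function: the equation
  determines the gradient, and the mean value fixes the constant.\<close>

lemma recU:
  assumes u: "u \<in> polys (k + 1)" and \<delta>: "\<delta> \<in> pw_polys (k + 2) cf"
  shows "recU u \<delta> \<in> polys (k + 1)"
    and "w \<in> polys (k + 1) \<Longrightarrow> L2_inner T (grad (recU u \<delta>)) (grad w) = L2_inner T (grad u) (grad w) + rhsU \<delta> w"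
proof -
  let ?P = "\<lambda>g. g \<in> polys (k + 1) \<and>
     (\<forall>w\<in>polys (k + 1). L2_inner T (grad g) (grad w) = L2_inner T (grad u) (grad w) + rhsU \<delta> w) \<and>
     L2_inner T g (\<lambda>_. 1) = L2_inner T u (\<lambda>_. 1)"
  let ?a = "\<lambda>p q. L2_inner T (grad p) (grad q)"
  have c: "(\<lambda>x::'a. s) \<in> polys (k + 1)" for s by (rule polys_const)
  obtain B where B: "finite B" "polys (k + 1) = (span B :: ('a \<Rightarrow> real) set)"
    using fin_dim_polys[where ?'a='a] unfolding fin_dim_def by blast
  have "\<exists>r\<in>span B. \<forall>w\<in>span B. ?a r w = ?a u w + rhsU \<delta> w"
  proof (rule psd_solve[OF B(1)]; (unfold B(2)[symmetric])?)
    show "bilin_on (polys (k + 1)) ?a" by (rule Gr.bilin)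
    show "lin_on (polys (k + 1)) (\<lambda>w. ?a u w + rhsU \<delta> w)"
      by (intro lin_on_plus Gr.lin1[OF u] lin_rhsU[OF \<delta>])
    fix p :: "'a \<Rightarrow> real" assume p: "p \<in> polys (k + 1)" "?a p p = 0"
    show "?a u p + rhsU \<delta> p = 0" using Gr.radical[OF p(1) u p(2)] rhsU_radical[OF \<delta> p] by simp
    show "?a p q = 0 \<and> ?a q p = 0" if "q \<in> polys (k + 1)" for q
      by (rule Gr.radical[OF p(1) that p(2)])
  qed
  then obtain r0 where r0: "r0 \<in> polys (k + 1)" "\<And>w. w \<in> polys (k + 1) \<Longrightarrow> ?a r0 w = ?a u w + rhsU \<delta> w"
    unfolding B(2)[symmetric] by blast
  let ?V = "L2_inner T (\<lambda>_. 1) (\<lambda>_. 1 :: real)"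
  have V: "?V \<noteq> 0" using L2_zero[OF c[of 1]] by auto
  define s where "s = (L2_inner T u (\<lambda>_. 1) - L2_inner T r0 (\<lambda>_. 1)) / ?V"
  have s: "(\<lambda>_. s) = s *\<^sub>R ((\<lambda>_. 1) :: 'a \<Rightarrow> real)" by (simp add: fun_eq_iff)
  have "?P (r0 + (\<lambda>_. s))"
  proof (intro conjI ballI)
    show "r0 + (\<lambda>_. s) \<in> polys (k + 1)" by (rule subspace_add[OF subspace_polys r0(1) c])
    fix w :: "'a \<Rightarrow> real" assume w: "w \<in> polys (k + 1)"
    have "?a (r0 + (\<lambda>_. s)) w = ?a r0 w + ?a (\<lambda>_. s) w" by (rule lin_on_add[OF Gr.lin2[OF w] r0(1) c])
    then show "?a (r0 + (\<lambda>_. s)) w = ?a u w + rhsU \<delta> w"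
      using r0(2)[OF w] Gr.radical[OF c w grad_const] by simp
  next
    have "L2_inner T (r0 + (\<lambda>_. s)) (\<lambda>_. 1) = L2_inner T r0 (\<lambda>_. 1) + L2_inner T (\<lambda>_. s) (\<lambda>_. 1)"
      by (rule lin_on_add[OF L2.lin2[OF c] r0(1) c])
    moreover have "L2_inner T (\<lambda>_. s) (\<lambda>_. 1) = s * ?V"
      unfolding s using lin_on_scale[OF L2.lin2[OF c[of 1]] c[of 1], of s] by simp
    ultimately show "L2_inner T (r0 + (\<lambda>_. s)) (\<lambda>_. 1) = L2_inner T u (\<lambda>_. 1)" using V by (simp add: s_def)
  qed
  moreover have "r = r'" if r: "?P r" and r': "?P r'" for r r'
  proof -
    have rp: "r \<in> polys (k + 1)" "r' \<in> polys (k + 1)" using r r' by auto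
    let ?e = "r - r'"
    have ep: "?e \<in> polys (k + 1)" by (rule subspace_diff[OF subspace_polys rp])
    have "?a ?e ?e = ?a r ?e - ?a r' ?e" by (rule lin_on_diff[OF Gr.lin2[OF ep] subspace_polys rp])
    also have "\<dots> = 0" using r r' ep by simp
    finally have e: "?e x = ?e 0" for x by (rule grad_zero[OF ep])
    have "L2_inner T ?e (\<lambda>_. 1) = L2_inner T r (\<lambda>_. 1) - L2_inner T r' (\<lambda>_. 1)"
      by (rule lin_on_diff[OF L2.lin2[OF c] subspace_polys rp])
    also have "\<dots> = 0" using r r' by simp
    finally have z: "L2_inner T ?e (\<lambda>_. 1) = 0" .
    have es: "?e = ?e 0 *\<^sub>R (\<lambda>_. 1)" by (rule ext, subst e) simp
    have "L2_inner T ?e ?e = L2_inner T ?e (?e 0 *\<^sub>R (\<lambda>_. 1))" using arg_cong[OF es] by blast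
    also have "\<dots> = ?e 0 *\<^sub>R L2_inner T ?e (\<lambda>_. 1)"
      by (rule lin_on_scale[OF L2.lin1[OF ep] c])
    finally have "L2_inner T ?e ?e = 0" using z by simp
    then have "?e x = 0" for x by (rule L2_zero[OF ep])
    then show ?thesis by (intro ext) simp
  qed
  ultimately have "\<exists>!r. ?P r" by blast
  from theI'[OF this] have "?P (recU u \<delta>)" unfolding recU_def .
  then show "recU u \<delta> \<in> polys (k + 1)"
    "w \<in> polys (k + 1) \<Longrightarrow> ?a (recU u \<delta>) w = ?a u w + rhsU \<delta> w" by blast+
qed

definition dataU :: "(('a \<Rightarrow> real) \<times> 'a ffun) set" where
  "dataU = polys (k + 1) \<times> pw_polys (k + 2) cf"

definition locU :: "('a \<Rightarrow> real) \<times> 'a ffun \<Rightarrow> ('a \<Rightarrow> real) \<times> 'a ffun \<Rightarrow> real" where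
  "locU d d' = L2_inner T (grad (recU (fst d) (snd d))) (grad (recU (fst d') (snd d')))
     + bd_inner cf (Pr (snd d)) (Pr (snd d')) / h"

lemma subspace_dataU: "subspace dataU"
  unfolding dataU_def by (intro subspace_Times subspace_polys subspace_pw)

lemma lin_rhs_dataU:
  assumes w: "w \<in> polys (k + 1)"
  shows "lin_on dataU (\<lambda>d. L2_inner T (grad (fst d)) (grad w) + rhsU (snd d) w)"
proof (rule lin_on_plus)
  have f: "lin_on dataU fst" "lin_on dataU snd" by (simp_all add: lin_on_def)
  show "lin_on dataU (\<lambda>d. L2_inner T (grad (fst d)) (grad w))"
    by (rule lin_on_compose[OF f(1) _ Gr.lin2[OF w]]) (auto simp: dataU_def)
  have "lin_on dataU (\<lambda>d. bd_inner cf (snd d) (ndiff T w))"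
    by (rule lin_on_compose[OF f(2) _ Bd.lin2[OF ndiff_pw'[OF k1[OF w]]]]) (auto simp: dataU_def)
  then show "lin_on dataU (\<lambda>d. rhsU (snd d) w)" by (simp add: rhsU_def lin_on_def)
qed

lemma recU_data:
  assumes "d \<in> dataU"
  shows "recU (fst d) (snd d) \<in> polys (k + 1)"
    and "w \<in> polys (k + 1) \<Longrightarrow> L2_inner T (grad (recU (fst d) (snd d))) (grad w)
      = L2_inner T (grad (fst d)) (grad w) + rhsU (snd d) w"
  using recU[of "fst d" "snd d"] assms by (auto simp: dataU_def)

lemma bilin_locU: "bilin_on dataU locU"
proof -
  let ?R = "\<lambda>d. recU (fst d) (snd d)" and ?a = "\<lambda>p q. L2_inner T (grad p) (grad q)"
  have f: "lin_on dataU snd" by (simp add: lin_on_def)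
  have cl: "x + y \<in> dataU" "c *\<^sub>R x \<in> dataU" if "x \<in> dataU" "y \<in> dataU" for x y c
    using that subspace_add[OF subspace_dataU] subspace_scale[OF subspace_dataU] by blast+
  have l: "lin_on dataU (\<lambda>d. ?a (?R d) (?R d'))" if d': "d' \<in> dataU" for d'
  proof (rule lin_onI)
    fix x y assume xy: "x \<in> dataU" "y \<in> dataU"
    show "?a (?R (x + y)) (?R d') = ?a (?R x) (?R d') + ?a (?R y) (?R d')"
      using lin_on_add[OF lin_rhs_dataU[OF recU_data(1)[OF d']] xy]
      by (simp only: recU_data(2)[OF _ recU_data(1)[OF d']] xy cl[OF xy])
  next
    fix x c assume x: "x \<in> dataU"
    show "?a (?R (c *\<^sub>R x)) (?R d') = c *\<^sub>R ?a (?R x) (?R d')"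
      using lin_on_scale[OF lin_rhs_dataU[OF recU_data(1)[OF d']] x]
      by (simp only: recU_data(2)[OF _ recU_data(1)[OF d']] x cl[OF x x])
  qed
  have r: "lin_on dataU (\<lambda>d. ?a (?R d') (?R d))" if d': "d' \<in> dataU" for d'
    using l[OF d'] Gr.sym[OF recU_data(1)[OF d'] recU_data(1)] cl unfolding lin_on_def by metis
  show ?thesis
  proof (rule bilin_onI)
    fix d assume d: "d \<in> dataU"
    then have dm: "snd d \<in> pw_polys (k + 2) cf" by (auto simp: dataU_def)
    show "lin_on dataU (locU d)" unfolding locU_def
      by (intro lin_on_plus lin_on_divide r[OF d]
          lin_on_compose[OF f _ bilin_onD(1)[OF bilin_Pr dm]]) (auto simp: dataU_def)
    show "lin_on dataU (\<lambda>d'. locU d' d)" unfolding locU_def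
      by (intro lin_on_plus lin_on_divide l[OF d]
          lin_on_compose[OF f _ bilin_onD(2)[OF bilin_Pr dm]]) (auto simp: dataU_def)
  qed
qed

lemma coercive_U:
  assumes u: "u \<in> polys (k + 1)" and ub: "ub \<in> pw_polys k cf" and \<delta>: "\<delta> = (\<lambda>F x. u x - ub F x)"
  shows "L2_inner T (grad u) (grad u) + bd_inner cf \<delta> \<delta> / h
    \<le> coer_const DIM('a) \<rho> K * locU (u, \<delta>) (u, \<delta>)"
proof -
  define bK where "bK = bdry_const DIM('a) \<rho> * K"
  define aK where "aK = area_const DIM('a) * real DIM('a) * K"
  have bK0: "0 \<le> bK" and aK0: "0 \<le> aK" using bdry_const_nonneg area_const_nonneg K0 by (simp_all add: bK_def aK_def)
  note u2 = k1[OF u]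
  have \<delta>p: "\<delta> \<in> pw_polys (k + 2) cf" unfolding \<delta> by (rule pw_diff[OF pw_poly[OF u2] k2[OF ub]])
  define R where "R = recU u \<delta>"
  have R: "R \<in> polys (k + 1)" "L2_inner T (grad R) (grad u) = L2_inner T (grad u) (grad u) + rhsU \<delta> u"
    using recU[OF u \<delta>p] u unfolding R_def by blast+
  have nu: "ndiff T u \<in> pw_polys k cf" using u by (intro ndiff_pw) simp
  define H where "H = L2_inner T (grad u) (grad u)"
  define X where "X = L2_inner T (grad R) (grad R)"
  define Z where "Z = bd_inner cf (Pr \<delta>) (Pr \<delta>) / h"
  have Pr\<delta>: "Pr \<delta> \<in> pw_polys k cf" using Pr(1)[OF \<delta>p] .
  have H0: "0 \<le> H" unfolding H_def by (rule Gr.nonneg[OF u])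
  have X0: "0 \<le> X" unfolding X_def by (rule Gr.nonneg[OF R(1)])
  have Z0: "0 \<le> Z" unfolding Z_def using Bd.nonneg[OF Pr\<delta>] hpos by simp
  have "H \<le> 4 * (X + bK * Z + 0 + 0)"
  proof (rule absorb[OF H0])
    show "H = L2_inner T (grad R) (grad u) + bd_inner cf \<delta> (ndiff T u) + 0 + 0"
      using R(2) by (simp add: H_def rhsU_def)
    show "(L2_inner T (grad R) (grad u))\<^sup>2 \<le> X * H"
      unfolding X_def H_def by (rule Gr.cauchy_schwarz[OF R(1) u])
    have "(bd_inner cf (Pr \<delta>) (ndiff T u))\<^sup>2 \<le> bd_inner cf (Pr \<delta>) (Pr \<delta>) * (bdry_const DIM('a) \<rho> * K * H / h)"
      unfolding H_def by (rule bd_sq_le[OF Pr\<delta> nu trace_ndiff[OF u2]])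
    also have "bd_inner cf (Pr \<delta>) (ndiff T u) = bd_inner cf \<delta> (ndiff T u)" by (rule Pr(2)[OF \<delta>p nu])
    finally show "(bd_inner cf \<delta> (ndiff T u))\<^sup>2 \<le> bK * Z * H" by (simp add: Z_def bK_def mult.commute mult.left_commute)
  qed (use X0 Z0 bK0 in simp_all)
  also have "\<dots> \<le> 4 * (1 + bK) * (X + Z)" using bK0 X0 Z0 by (simp add: algebra_simps)
  finally have HB: "H \<le> 4 * (1 + bK) * (X + Z)" .
  define q where "q = (\<lambda>F x. u x0 - ub F x)"
  have qp: "q \<in> pw_polys k cf" unfolding q_def
    by (rule pw_diff[OF const_pw ub])
  have eq: "\<delta> - q = (\<lambda>F x. u x - u x0)" by (simp add: \<delta> q_def fun_eq_iff)
  have "bd_inner cf (\<delta> - q) (\<delta> - q) \<le> bdry_const DIM('a) \<rho> * h ^ DIM('a) / h * (K / h ^ DIM('a) * (h\<^sup>2 * H))"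
  proof (rule family_le)
    show "\<delta> - q \<in> pw_polys (k + 2) cf" by (rule subspace_diff[OF subspace_pw \<delta>p k2[OF qp]])
    fix F x assume F: "F \<in> cf" "x \<in> F"
    obtain \<xi> where \<xi>: "\<xi> \<in> cball x0 h" "(u x - u x0)\<^sup>2 \<le> h\<^sup>2 * (\<Sum>b\<in>Basis. (dderiv b u \<xi>)\<^sup>2)"
      using mean_value_sq[OF u face_cball[OF F]] by blast
    note \<xi>(2)
    also have "h\<^sup>2 * (\<Sum>b\<in>Basis. (dderiv b u \<xi>)\<^sup>2) \<le> h\<^sup>2 * (K / h ^ DIM('a) * H)"
      unfolding H_def by (intro mult_left_mono sup_grad_le[OF u2 \<xi>(1)]) auto
    finally show "(\<delta> - q) F x \<bullet> (\<delta> - q) F x \<le> K / h ^ DIM('a) * (h\<^sup>2 * H)"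
      unfolding eq by (simp add: power2_eq_square mult.left_commute)
  qed (use K0 hpos H0 in simp)
  then have "bd_inner cf (\<delta> - q) (\<delta> - q) \<le> bK * H * h"
    unfolding scale_cancel bK_def using hpos by (simp add: power2_eq_square mult.commute mult.left_commute)
  then have "bd_inner cf \<delta> \<delta> \<le> 2 * bd_inner cf (Pr \<delta>) (Pr \<delta>) + 2 * (bK * H * h)"
    using Pr_best[OF \<delta>p qp] by simp
  then have "bd_inner cf \<delta> \<delta> / h \<le> (2 * bd_inner cf (Pr \<delta>) (Pr \<delta>) + 2 * (bK * H * h)) / h"
    using hpos by (intro divide_right_mono) auto
  also have "\<dots> = 2 * Z + 2 * bK * H" using hpos by (simp add: Z_def add_divide_distrib)
  finally have E: "bd_inner cf \<delta> \<delta> / h \<le> 2 * Z + 2 * bK * H" .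
  have "H + bd_inner cf \<delta> \<delta> / h \<le> (1 + 2 * bK) * H + 3 * (X + Z)"
    using E X0 Z0 by (simp add: algebra_simps)
  also have "\<dots> \<le> (1 + 2 * bK) * (4 * (1 + bK) * (X + Z)) + 3 * (X + Z)"
    using HB bK0 by (intro add_right_mono mult_left_mono) auto
  also have "\<dots> \<le> (1 + 2 * bK) * (4 * (1 + bK * (real DIM('a) * real DIM('a)) + bK + aK * bK) * (X + Z)) + 3 * (X + Z)"
  proof (intro add_right_mono mult_left_mono mult_right_mono)
    have "0 \<le> bK * (real DIM('a) * real DIM('a))" "0 \<le> aK * bK"
      using bK0 aK0 by (intro mult_nonneg_nonneg; simp)+
    then show "1 + bK \<le> 1 + bK * (real DIM('a) * real DIM('a)) + bK + aK * bK" by linarith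
  qed (use X0 Z0 bK0 in auto)
  also have "\<dots> = coer_const DIM('a) \<rho> K * (X + Z)"
    unfolding coer_const_def Let_def bK_def aK_def by (simp only: distrib_right mult.assoc)
  also have "X + Z = locU (u, \<delta>) (u, \<delta>)"
    by (simp add: locU_def X_def Z_def R_def)
  finally show ?thesis by (simp add: H_def)
qed

end

section \<open>The local forms in terms of local data\<close>

context mesh_cell
begin

lemma bd_proj_cong:
  assumes "\<And>F x. F \<in> cf \<Longrightarrow> x \<in> F \<Longrightarrow> f F x = g F x"
  shows "bd_proj l cf f = bd_proj l cf g"
proof -
  have "bd_inner cf f q = bd_inner cf g q" for q using assms by (intro bd_cong) auto
  then show ?thesis by (simp add: bd_proj_def)
qed

lemma recR_eq:
  assumes v: "v \<in> polys (k + 2)" and q: "\<And>F. F \<in> cf \<Longrightarrow> q F \<in> polys (k + 2)"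
    and vb: "\<And>F x. F \<in> cf \<Longrightarrow> x \<in> F \<Longrightarrow> vb F x = q F x" and \<eta>: "\<And>F x. F \<in> cf \<Longrightarrow> x \<in> F \<Longrightarrow> \<eta>b F x = \<eta> F x"
  shows "recR k Fh T (v, vb, \<eta>b) = recV v (\<lambda>F x. v x - q F x) (\<lambda>F x. ndiff T v F x - \<eta> F x)"
proof -
  let ?\<delta> = "\<lambda>F x. v x - q F x" and ?\<epsilon> = "\<lambda>F x. ndiff T v F x - \<eta> F x"
  have tg: "tgrad (nT F) (\<lambda>x. v x - vb F x) x = tg ?\<delta> F x" if "F \<in> cf" "x \<in> F" for F x
    using tgrad_face[OF that polys_diff[OF v q[OF that(1)]], of "\<lambda>x. v x - vb F x"]
      tgrad_face[OF that polys_diff[OF v q[OF that(1)]], of "?\<delta> F"] vb[OF that(1)] by simp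
  have r: "bd_inner cf (\<lambda>F x. v x - vb F x) (ndiff T (laplacian w))
      - bd_inner cf (\<lambda>F x. ndiff T v F x - \<eta>b F x) (nn w)
      - bd_inner cf (\<lambda>F. tgrad (nT F) (\<lambda>x. v x - vb F x)) (nt w) = rhsV ?\<delta> ?\<epsilon> w" for w
  proof -
    have "bd_inner cf (\<lambda>F x. v x - vb F x) (ndiff T (laplacian w)) = bd_inner cf ?\<delta> (ndiff T (laplacian w))"
      using vb by (intro bd_cong) auto
    moreover have "bd_inner cf (\<lambda>F x. ndiff T v F x - \<eta>b F x) (nn w) = bd_inner cf ?\<epsilon> (nn w)"
      using \<eta> by (intro bd_cong) auto
    moreover have "bd_inner cf (\<lambda>F. tgrad (nT F) (\<lambda>x. v x - vb F x)) (nt w) = bd_inner cf (tg ?\<delta>) (nt w)"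
      using tg by (intro bd_cong) auto
    ultimately show ?thesis by (simp add: rhsV_def)
  qed
  have "hess_inner T v w + bd_inner cf (\<lambda>F x. v x - vb F x) (ndiff T (laplacian w))
      - bd_inner cf (\<lambda>F x. ndiff T v F x - \<eta>b F x) (nn w)
      - bd_inner cf (\<lambda>F. tgrad (nT F) (\<lambda>x. v x - vb F x)) (nt w) = hess_inner T v w + rhsV ?\<delta> ?\<epsilon> w" for w
    using r[of w] by linarith
  then show ?thesis unfolding recR.simps recV_def by (simp only:)
qed

lemma recG_eq:
  assumes ub: "\<And>F x. F \<in> cf \<Longrightarrow> x \<in> F \<Longrightarrow> ub F x = g F x"
  shows "recG k Fh T (u, ub) = recU u (\<lambda>F x. u x - g F x)"
proof -
  have "bd_inner cf (\<lambda>F x. u x - ub F x) (ndiff T w) = bd_inner cf (\<lambda>F x. u x - g F x) (ndiff T w)" for w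
    using ub by (intro bd_cong) auto
  then have "L2_inner T (grad u) (grad w) - bd_inner cf (\<lambda>F x. u x - ub F x) (ndiff T w)
      = L2_inner T (grad u) (grad w) + rhsU (\<lambda>F x. u x - g F x) w" for w
    by (simp add: rhsU_def)
  then show ?thesis unfolding recG.simps recU_def by (simp only:)
qed

text \<open>The seminorms and the stabilization use the differences of traces with opposite signs.\<close>

lemma Pr_uminus:
  assumes f: "f \<in> pw_polys (k + 2) cf" and g: "g \<in> pw_polys (k + 2) cf"
    and f': "\<And>F x. F \<in> cf \<Longrightarrow> x \<in> F \<Longrightarrow> f' F x = - f F x" and g': "\<And>F x. F \<in> cf \<Longrightarrow> x \<in> F \<Longrightarrow> g' F x = - g F x"
  shows "bd_inner cf (Pr f') (Pr g') = bd_inner cf (Pr f) (Pr g)"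
proof -
  have "Pr f' = Pr ((- 1) *\<^sub>R f)" "Pr g' = Pr ((- 1) *\<^sub>R g)"
    using f' g' by (auto intro!: bd_proj_cong)
  moreover have "(- 1) *\<^sub>R g \<in> pw_polys (k + 2) cf" by (rule subspace_scale[OF subspace_pw g])
  ultimately have "bd_inner cf (Pr f') (Pr g') = - bd_inner cf (Pr f) (Pr ((- 1) *\<^sub>R g))"
    using lin_on_scale[OF bilin_onD(2)[OF bilin_Pr] f, of "(- 1) *\<^sub>R g" "- 1"] by simp
  also have "bd_inner cf (Pr f) (Pr ((- 1) *\<^sub>R g)) = - bd_inner cf (Pr f) (Pr g)"
    using lin_on_scale[OF bilin_onD(1)[OF bilin_Pr f] g, of "- 1"] by simp
  finally show ?thesis by simp
qed

lemma stabV_eq: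
  assumes y: "\<And>F x. F \<in> cf \<Longrightarrow> x \<in> F \<Longrightarrow> yb F x = q F x" "\<And>F x. F \<in> cf \<Longrightarrow> x \<in> F \<Longrightarrow> \<gamma>b F x = \<gamma> F x"
    and v: "\<And>F x. F \<in> cf \<Longrightarrow> x \<in> F \<Longrightarrow> vb F x = q' F x" "\<And>F x. F \<in> cf \<Longrightarrow> x \<in> F \<Longrightarrow> \<eta>b F x = \<eta> F x"
    and \<epsilon>: "(\<lambda>F x. ndiff T y F x - \<gamma> F x) \<in> pw_polys (k + 2) cf" "(\<lambda>F x. ndiff T v F x - \<eta> F x) \<in> pw_polys (k + 2) cf"
  shows "stabV k Fh T (y, yb, \<gamma>b) (v, vb, \<eta>b) =
    bd_inner cf (\<lambda>F x. y x - q F x) (\<lambda>F x. v x - q' F x) / h ^ 3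
    + bd_inner cf (Pr (\<lambda>F x. ndiff T y F x - \<gamma> F x)) (Pr (\<lambda>F x. ndiff T v F x - \<eta> F x)) / h"
proof -
  have "bd_inner cf (\<lambda>F x. yb F x - y x) (\<lambda>F x. vb F x - v x)
      = bd_inner cf (\<lambda>F x. - (y x - q F x)) (\<lambda>F x. - (v x - q' F x))"
    using y v by (intro bd_cong) auto
  also have "\<dots> = bd_inner cf (\<lambda>F x. y x - q F x) (\<lambda>F x. v x - q' F x)"
    unfolding bd_inner_def inner_minus_left inner_minus_right minus_minus ..
  finally have 1: "bd_inner cf (\<lambda>F x. yb F x - y x) (\<lambda>F x. vb F x - v x)
      = bd_inner cf (\<lambda>F x. y x - q F x) (\<lambda>F x. v x - q' F x)" .
  have 2: "bd_inner cf (Pr (\<lambda>F x. \<gamma>b F x - ndiff T y F x)) (Pr (\<lambda>F x. \<eta>b F x - ndiff T v F x))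
      = bd_inner cf (Pr (\<lambda>F x. ndiff T y F x - \<gamma> F x)) (Pr (\<lambda>F x. ndiff T v F x - \<eta> F x))"
    using y v by (intro Pr_uminus[OF \<epsilon>]) auto
  show ?thesis unfolding stabV.simps 1 2 ..
qed

lemma stabU_eq:
  assumes z: "\<And>F x. F \<in> cf \<Longrightarrow> x \<in> F \<Longrightarrow> zb F x = g F x" "\<And>F x. F \<in> cf \<Longrightarrow> x \<in> F \<Longrightarrow> ub F x = g' F x"
    and \<delta>: "(\<lambda>F x. z x - g F x) \<in> pw_polys (k + 2) cf" "(\<lambda>F x. u x - g' F x) \<in> pw_polys (k + 2) cf"
  shows "stabU k Fh T (z, zb) (u, ub) = bd_inner cf (Pr (\<lambda>F x. z x - g F x)) (Pr (\<lambda>F x. u x - g' F x)) / h"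
proof -
  have "bd_inner cf (Pr (\<lambda>F x. zb F x - z x)) (Pr (\<lambda>F x. ub F x - u x))
      = bd_inner cf (Pr (\<lambda>F x. z x - g F x)) (Pr (\<lambda>F x. u x - g' F x))"
    using z by (intro Pr_uminus[OF \<delta>]) auto
  then show ?thesis unfolding stabU.simps by (rule arg_cong)
qed

lemma semiV_eq:
  assumes "\<And>F x. F \<in> cf \<Longrightarrow> x \<in> F \<Longrightarrow> vb F x = q F x" "\<And>F x. F \<in> cf \<Longrightarrow> x \<in> F \<Longrightarrow> \<eta>b F x = \<eta> F x"
  shows "semiV_sq Fh T (v, vb, \<eta>b) = hess_inner T v v
    + bd_inner cf (\<lambda>F x. ndiff T v F x - \<eta> F x) (\<lambda>F x. ndiff T v F x - \<eta> F x) / h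
    + bd_inner cf (\<lambda>F x. v x - q F x) (\<lambda>F x. v x - q F x) / h ^ 3"
proof -
  have 1: "bd_inner cf (\<lambda>F x. ndiff T v F x - \<eta>b F x) (\<lambda>F x. ndiff T v F x - \<eta>b F x) =
      bd_inner cf (\<lambda>F x. ndiff T v F x - \<eta> F x) (\<lambda>F x. ndiff T v F x - \<eta> F x)"
    using assms by (intro bd_cong) auto
  have 2: "bd_inner cf (\<lambda>F x. v x - vb F x) (\<lambda>F x. v x - vb F x) =
      bd_inner cf (\<lambda>F x. v x - q F x) (\<lambda>F x. v x - q F x)"
    using assms by (intro bd_cong) auto
  show ?thesis unfolding semiV_sq.simps Let_def 1 2 ..
qed

lemma semiU_eq:
  assumes "\<And>F x. F \<in> cf \<Longrightarrow> x \<in> F \<Longrightarrow> ub F x = g F x"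
  shows "semiU_sq Fh T (u, ub) = L2_inner T (grad u) (grad u)
    + bd_inner cf (\<lambda>F x. u x - g F x) (\<lambda>F x. u x - g F x) / h"
proof -
  have 1: "bd_inner cf (\<lambda>F x. u x - ub F x) (\<lambda>F x. u x - ub F x) =
      bd_inner cf (\<lambda>F x. u x - g F x) (\<lambda>F x. u x - g F x)"
    using assms by (intro bd_cong) auto
  show ?thesis unfolding semiU_sq.simps Let_def 1 ..
qed

lemma locV_nonneg: "d \<in> dataV \<Longrightarrow> 0 \<le> locV d d"
  unfolding locV_def using hpos recV_data(1)[of d] Bd.nonneg Pr(1)[of "snd (snd d)"]
  by (intro add_nonneg_nonneg divide_nonneg_nonneg He.nonneg Bd.nonneg) (auto simp: dataV_def)

lemma locU_nonneg: "d \<in> dataU \<Longrightarrow> 0 \<le> locU d d"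
  unfolding locU_def using hpos recU_data(1)[of d] Pr(1)[of "snd d"]
  by (intro add_nonneg_nonneg divide_nonneg_nonneg Gr.nonneg Bd.nonneg) (auto simp: dataU_def)

end

section \<open>Leaving a union of cells along a line\<close>

lemma open_in_hyperplane_empty:
  fixes U :: "'a::euclidean_space set"
  assumes "open U" "U \<subseteq> {y. n \<bullet> (y - x) = 0}" "n \<noteq> 0"
  shows "U = {}"
proof -
  have "{y. n \<bullet> (y - x) = 0} = {y. n \<bullet> y = n \<bullet> x}" by (auto simp: inner_diff_right)
  then have "U \<subseteq> interior {y. n \<bullet> y = n \<bullet> x}" using assms(1,2) by (intro interior_maximal) auto
  then show ?thesis using interior_hyperplane[OF assms(3)] by simp
qed

lemma polys_1_line:
  assumes "p \<in> polys 1"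
  shows "p (x + y) = p x + dderiv y p z"
proof -
  obtain \<xi> where "p (x + y) - p x = dderiv (x + y - x) p \<xi>"
    using polys_mean_value[OF assms, of "x + y" x "norm y"] by (auto simp: dist_norm)
  moreover have "dderiv y p \<in> polys 0" using dderiv_polys[OF assms, of y] by simp
  then have "dderiv y p \<xi> = dderiv y p z" using polys_0 by metis
  ultimately show ?thesis by simp
qed

lemma line_exits:
  fixes K :: "'a::euclidean_space set"
  assumes K: "bounded K" and x: "x \<in> interior K" and e: "e \<noteq> 0"
  shows "\<exists>t>0. x + t *\<^sub>R e \<in> frontier K"
proof -
  let ?S = "(\<lambda>t. x + t *\<^sub>R e) ` {0..}"
  have "connected ?S" by (intro connected_continuous_image continuous_intros) auto
  moreover have "?S \<inter> K \<noteq> {}"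
  proof -
    have "x + 0 *\<^sub>R e \<in> ?S" by (intro imageI) auto
    then show ?thesis using x interior_subset by auto
  qed
  moreover have "?S - K \<noteq> {}"
  proof -
    obtain M where M: "\<forall>y\<in>K. norm y \<le> M" using K bounded_iff by blast
    have M0: "0 \<le> M" using M x interior_subset by (metis norm_ge_zero order_trans subsetD)
    define t where "t = (M + norm x + 1) / norm e"
    have t: "0 \<le> t" "t * norm e = M + norm x + 1" using M0 e by (auto simp: t_def)
    have "norm (t *\<^sub>R e) \<le> norm (x + t *\<^sub>R e) + norm x"
      using norm_triangle_ineq4[of "x + t *\<^sub>R e" x] by simp
    then have "M < norm (x + t *\<^sub>R e)" using t by simp
    then have "x + t *\<^sub>R e \<notin> K" using M by fastforce
    then show ?thesis using t(1) by auto
  qed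
  ultimately have "?S \<inter> frontier K \<noteq> {}" by (rule connected_Int_frontier)
  then obtain t where t: "0 \<le> t" "x + t *\<^sub>R e \<in> frontier K" by auto
  have "t \<noteq> 0" using t(2) x by (auto simp: frontier_def)
  then show ?thesis using t by (intro exI[of _ t]) auto
qed

context mesh
begin

definition good :: "('a set \<Rightarrow> 'a) \<Rightarrow> 'a set \<Rightarrow> 'a \<Rightarrow> bool" where
  "good nF F x \<longleftrightarrow> (\<forall>T\<in>Th. F \<in> cell_faces Fh T \<longrightarrow>
       (\<exists>e>0. T \<inter> ball x e = {y \<in> ball x e. cell_normal T F \<bullet> (y - x) < 0})) \<and>
     (F \<in> boundary_faces \<Omega> Fh \<longrightarrow> (\<exists>e>0. \<Omega> \<inter> ball x e = {y \<in> ball x e. nF F \<bullet> (y - x) < 0}))"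

lemma AE_good:
  assumes nF: "face_normals \<Omega> Fh nF" and F: "F \<in> Fh"
  shows "AE x in face_measure F. good nF F x"
proof -
  have "AE x in face_measure F. F \<in> cell_faces Fh T \<longrightarrow>
      (\<exists>e>0. T \<inter> ball x e = {y \<in> ball x e. cell_normal T F \<bullet> (y - x) < 0})" if "T \<in> Th" for T
    using cell_normal_outward[OF that, of F] unfolding outward_normal_def
    by (cases "F \<in> cell_faces Fh T") auto
  then have "AE x in face_measure F. \<forall>T\<in>Th. F \<in> cell_faces Fh T \<longrightarrow>
      (\<exists>e>0. T \<inter> ball x e = {y \<in> ball x e. cell_normal T F \<bullet> (y - x) < 0})"
    by (rule AE_finite_allI[OF finite_Th])
  moreover have "AE x in face_measure F. F \<in> boundary_faces \<Omega> Fh \<longrightarrow>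
      (\<exists>e>0. \<Omega> \<inter> ball x e = {y \<in> ball x e. nF F \<bullet> (y - x) < 0})"
    using nF unfolding face_normals_def outward_normal_def
    by (cases "F \<in> boundary_faces \<Omega> Fh") auto
  ultimately show ?thesis unfolding good_def by (rule AE_conjI)
qed

lemma half_ball_shrink:
  assumes "D \<inter> ball x e = {y \<in> ball x e. n \<bullet> (y - x) < 0}" "r \<le> e"
  shows "D \<inter> ball x r = {y \<in> ball x r. n \<bullet> (y - x) < (0::real)}"
proof -
  have "ball x r \<subseteq> ball x e" using assms(2) by (rule subset_ball)
  then show ?thesis using assms(1) by blast
qed

lemma half_ball_point:
  assumes "norm n = 1" "0 < r"
  shows "x - (r / 2) *\<^sub>R n \<in> {y \<in> ball x r. n \<bullet> (y - x) < 0}"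
  using assms by (simp add: dist_norm dot_square_norm)

text \<open>Near such a point two cells with the face in their frontiers fill the two opposite half balls up
  to the hyperplane, and at a boundary face the domain itself fills only one half ball. Either way
  there is no space for a third cell.\<close>

lemma good_point:
  fixes x :: 'a
  assumes F: "F \<in> Fh" and x: "x \<in> F" "good nF F x" and nF: "face_normals \<Omega> Fh nF"
    and T: "T \<in> Th" "x \<in> closure T"
  shows "F \<in> cell_faces Fh T \<and> (F \<in> boundary_faces \<Omega> Fh \<or>
    (\<exists>T'\<in>Th. F \<in> cell_faces Fh T' \<and> T' \<noteq> T \<and> (\<exists>r>0. ball x r \<subseteq> closure T \<union> closure T')))"
proof -
  interpret flat_face F "plane_normal F" "plane_offset F" by (rule flat[OF F])
  have two: "(\<exists>T1\<in>Th. \<exists>T2\<in>Th. T1 \<noteq> T2 \<and> F \<subseteq> frontier T1 \<inter> frontier T2) \<or> (\<exists>T1\<in>Th. F \<subseteq> frontier T1 \<inter> frontier \<Omega>)"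
  proof -
    have "\<forall>F\<in>Fh. (\<exists>T\<in>Th. \<exists>T'\<in>Th. T \<noteq> T' \<and> F \<subseteq> frontier T \<inter> frontier T') \<or> (\<exists>T\<in>Th. F \<subseteq> frontier T \<inter> frontier \<Omega>)"
      using poly_mesh unfolding polytopal_mesh_def by (elim conjE)
    then show ?thesis using F by blast
  qed
  have meets: "T \<inter> ball x r \<noteq> {}" if "0 < r" for r
  proof -
    have "\<exists>y\<in>T. dist y x < r" using T(2) that unfolding closure_approachable by blast
    then show ?thesis by (auto simp: dist_commute)
  qed
  have pm: "cell_normal S F = plane_normal F \<or> cell_normal S F = - plane_normal F" if "S \<in> Th" "F \<in> cell_faces Fh S" for S
    by (rule cell_normal_eq[OF that])
  from two show ?thesis
  proof
    assume "\<exists>T1\<in>Th. \<exists>T2\<in>Th. T1 \<noteq> T2 \<and> F \<subseteq> frontier T1 \<inter> frontier T2"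
    then obtain T1 T2 where T12: "T1 \<in> Th" "T2 \<in> Th" "T1 \<noteq> T2" "F \<in> cell_faces Fh T1" "F \<in> cell_faces Fh T2"
      using F by (auto simp: cell_faces_def)
    obtain r1 where r1: "0 < r1" "T1 \<inter> ball x r1 = {y \<in> ball x r1. cell_normal T1 F \<bullet> (y - x) < 0}"
      using x(2) T12 unfolding good_def by blast
    obtain r2 where r2: "0 < r2" "T2 \<inter> ball x r2 = {y \<in> ball x r2. cell_normal T2 F \<bullet> (y - x) < 0}"
      using x(2) T12 unfolding good_def by blast
    define r where "r = min r1 r2"
    have r: "0 < r" using r1 r2 by (simp add: r_def)
    let ?n = "cell_normal T1 F"
    have h1: "T1 \<inter> ball x r = {y \<in> ball x r. ?n \<bullet> (y - x) < 0}"
      by (rule half_ball_shrink[OF r1(2)]) (simp add: r_def)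
    have h2: "T2 \<inter> ball x r = {y \<in> ball x r. cell_normal T2 F \<bullet> (y - x) < 0}"
      by (rule half_ball_shrink[OF r2(2)]) (simp add: r_def)
    have n1: "norm ?n = 1" using pm[OF T12(1,4)] unit by auto
    then have n0: "?n \<noteq> 0" by auto
    have dis: "T1 \<inter> T2 = {}" using disjoint_Th T12 by (metis disjointD)
    have "cell_normal T2 F \<noteq> ?n"
    proof
      assume "cell_normal T2 F = ?n"
      then have "T1 \<inter> ball x r = T2 \<inter> ball x r" using h1 h2 by simp
      then have "T1 \<inter> ball x r = {}" using dis by blast
      moreover have "x - (r / 2) *\<^sub>R ?n \<in> {y \<in> ball x r. ?n \<bullet> (y - x) < 0}"
        by (rule half_ball_point[OF n1 r])
      ultimately show False using h1 by blast
    qed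
    then have n2: "cell_normal T2 F = - ?n" using pm[OF T12(1,4)] pm[OF T12(2,5)] by auto
    have T12r: "ball x r - (T1 \<union> T2) \<subseteq> {y. ?n \<bullet> (y - x) = 0}"
    proof
      fix y assume y: "y \<in> ball x r - (T1 \<union> T2)"
      then have "\<not> ?n \<bullet> (y - x) < 0" "\<not> cell_normal T2 F \<bullet> (y - x) < 0" using h1 h2 by blast+
      then show "y \<in> {y. ?n \<bullet> (y - x) = 0}" unfolding n2 by simp
    qed
    have "T = T1 \<or> T = T2"
    proof (rule ccontr)
      assume "\<not> ?thesis"
      then have "T \<inter> T1 = {}" "T \<inter> T2 = {}" using disjoint_Th T(1) T12 by (metis disjointD)+
      then have sub: "T \<inter> ball x r \<subseteq> {y. ?n \<bullet> (y - x) = 0}" using T12r by blast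
      have "open (T \<inter> ball x r)" using cell_open[OF T(1)] by (rule open_Int) simp
      from open_in_hyperplane_empty[OF this sub n0] show False using meets[OF r] by simp
    qed
    moreover have "ball x r \<subseteq> closure T1 \<union> closure T2"
    proof -
      have sub: "ball x r - (closure T1 \<union> closure T2) \<subseteq> {y. ?n \<bullet> (y - x) = 0}"
        using T12r closure_subset[of T1] closure_subset[of T2] by blast
      have "open (ball x r - (closure T1 \<union> closure T2))" by auto
      from open_in_hyperplane_empty[OF this sub n0] show ?thesis by blast
    qed
    ultimately show ?thesis using T12 r by blast
  next
    assume "\<exists>T1\<in>Th. F \<subseteq> frontier T1 \<inter> frontier \<Omega>"
    then obtain T1 where T1: "T1 \<in> Th" "F \<in> cell_faces Fh T1" and Fb: "F \<in> boundary_faces \<Omega> Fh"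
      using F by (auto simp: cell_faces_def boundary_faces_def)
    obtain r1 where r1: "0 < r1" "T1 \<inter> ball x r1 = {y \<in> ball x r1. cell_normal T1 F \<bullet> (y - x) < 0}"
      using x(2) T1 unfolding good_def by blast
    obtain r2 where r2: "0 < r2" "\<Omega> \<inter> ball x r2 = {y \<in> ball x r2. nF F \<bullet> (y - x) < 0}"
      using x(2) Fb unfolding good_def by blast
    define r where "r = min r1 r2"
    have r: "0 < r" using r1 r2 by (simp add: r_def)
    let ?n = "cell_normal T1 F"
    have h1: "T1 \<inter> ball x r = {y \<in> ball x r. ?n \<bullet> (y - x) < 0}"
      by (rule half_ball_shrink[OF r1(2)]) (simp add: r_def)
    have h2: "\<Omega> \<inter> ball x r = {y \<in> ball x r. nF F \<bullet> (y - x) < 0}"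
      by (rule half_ball_shrink[OF r2(2)]) (simp add: r_def)
    have pF: "nF F = plane_normal F \<or> nF F = - plane_normal F"
      using nF F by (intro normal_unique) (auto simp: face_normals_def)
    have "nF F = ?n"
    proof (rule ccontr)
      assume "nF F \<noteq> ?n"
      then have n: "nF F = - ?n" using pm[OF T1] pF by auto
      have y: "x - (r / 2) *\<^sub>R ?n \<in> {y \<in> ball x r. ?n \<bullet> (y - x) < 0}"
        by (rule half_ball_point[OF _ r]) (use pm[OF T1] unit in auto)
      then have "x - (r / 2) *\<^sub>R ?n \<in> \<Omega> \<inter> ball x r"
        unfolding h1[symmetric] using cell_subset[OF T1(1)] by blast
      then have "x - (r / 2) *\<^sub>R ?n \<in> {y \<in> ball x r. nF F \<bullet> (y - x) < 0}" unfolding h2 .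
      then show False using y unfolding n by auto
    qed
    then have "\<Omega> \<inter> ball x r = T1 \<inter> ball x r" using h1 h2 by simp
    then have "T \<inter> ball x r \<subseteq> T1" using cell_subset[OF T(1)] by blast
    then have "T \<inter> T1 \<noteq> {}" using meets[OF r] by blast
    then have "T = T1" using disjoint_Th T(1) T1(1) by (metis disjointD)
    then show ?thesis using T1 Fb by blast
  qed
qed

text \<open>The union of the cells in \<open>Z\<close> is bounded, so a line through it leaves it at both
  ends. Almost every line in a fixed direction meets the faces only at good points, and there the
  union is only left through a face in the boundary of the domain. The function then has two zeros
  on the line, so it vanishes on it.\<close>

lemma affine_zero:
  assumes nF: "face_normals \<Omega> Fh nF" and Z: "Z \<subseteq> Th" "Z \<noteq> {}" and p: "p \<in> polys 1"
    and bdry: "\<And>T F x. T \<in> Z \<Longrightarrow> F \<in> cell_faces Fh T \<Longrightarrow> F \<in> boundary_faces \<Omega> Fh \<Longrightarrow> x \<in> F \<Longrightarrow> p x = 0"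
    and pass: "\<And>T T' F. T \<in> Z \<Longrightarrow> T' \<in> Th \<Longrightarrow> F \<in> cell_faces Fh T \<Longrightarrow> F \<in> cell_faces Fh T' \<Longrightarrow> T' \<in> Z"
  shows "p x = 0"
proof -
  obtain e :: 'a where "e \<in> Basis" using nonempty_Basis by blast
  then have e0: "e \<noteq> 0" by auto
  let ?K = "\<Union>T\<in>Z. closure T"
  have finZ: "finite Z" using Z(1) finite_Th finite_subset by blast
  have clK: "closed ?K" using finZ by auto
  have bK: "bounded ?K"
    using finZ Z(1) cell_bounded by (intro bounded_UN) (auto intro: bounded_closure)
  define N where "N = (\<Union>F\<in>Fh. {x \<in> F. \<not> good nF F x} \<union> (closure F - F))"
  have "negligible (sweep e ({x \<in> F. \<not> good nF F x} \<union> (closure F - F)))" if F: "F \<in> Fh" for F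
  proof -
    interpret flat_face F "plane_normal F" "plane_offset F" by (rule flat[OF F])
    have "negligible (sweep e {x \<in> F. \<not> good nF F x})"
      by (rule negligible_sweep_AE[OF AE_good[OF nF F]])
    moreover obtain \<A> where "finite \<A>" "\<forall>A\<in>\<A>. aff_dim A \<le> int DIM('a) - 1 - 1" "closure F - F \<subseteq> \<Union>\<A>"
      using polytopal_set_rel_boundary[OF face_polytopal[OF F]] by blast
    then have "negligible (sweep e (closure F - F))"
      by (intro negligible_sweep_finite[of \<A>]) auto
    ultimately show ?thesis unfolding sweep_Un by (rule negligible_Un)
  qed
  then have "negligible (\<Union>F\<in>Fh. sweep e ({x \<in> F. \<not> good nF F x} \<union> (closure F - F)))"
    using finite_Fh by (intro negligible_Union) auto
  then have negN: "negligible (sweep e N)" unfolding N_def sweep_UN .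
  have fr: "p y = 0" if y: "y \<in> frontier ?K" "y \<notin> N" for y
  proof -
    have "y \<in> ?K" using y(1) clK frontier_subset_closed by blast
    then obtain T where T: "T \<in> Z" "y \<in> closure T" by blast
    have TT: "T \<in> Th" using T(1) Z(1) by blast
    have "T \<subseteq> interior ?K"
      using T(1) closure_subset by (intro interior_maximal cell_open[OF TT]) blast
    then have "y \<in> frontier T" using y(1) T(2) cell_open[OF TT] by (auto simp: frontier_def interior_open)
    then obtain F where F: "F \<in> Fh" "y \<in> closure F" using frontier_Un TT by blast
    have yF: "y \<in> F" "good nF F y" using F y(2) by (auto simp: N_def)
    from good_point[OF F(1) yF nF TT T(2)] show ?thesis
    proof (elim conjE disjE)
      assume "F \<in> cell_faces Fh T" "F \<in> boundary_faces \<Omega> Fh"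
      then show ?thesis using bdry T(1) yF(1) by blast
    next
      assume FT: "F \<in> cell_faces Fh T"
        and "\<exists>T'\<in>Th. F \<in> cell_faces Fh T' \<and> T' \<noteq> T \<and> (\<exists>r>0. ball y r \<subseteq> closure T \<union> closure T')"
      then obtain T' r where T': "T' \<in> Th" "F \<in> cell_faces Fh T'" "0 < r" "ball y r \<subseteq> closure T \<union> closure T'"
        by blast
      have "T' \<in> Z" using pass[OF T(1) T'(1) FT T'(2)] .
      then have "ball y r \<subseteq> ?K" using T'(4) T(1) by blast
      then have "y \<in> interior ?K" using T'(3) mem_interior by blast
      then show ?thesis using y(1) by (simp add: frontier_def)
    qed
  qed
  obtain T0 where T0: "T0 \<in> Z" using Z(2) by blast
  obtain z r where zr: "0 < r" "ball z r \<subseteq> T0"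
    using cell_inball rad_pos T0 Z(1) by blast
  have T0K: "T0 \<subseteq> interior ?K"
    using T0 Z(1) closure_subset by (intro interior_maximal cell_open) blast+
  have main: "p y = 0" if y: "y \<in> ball z r" "y \<notin> sweep e N" for y
  proof -
    have yi: "y \<in> interior ?K" using y(1) zr(2) T0K by blast
    have nN: "y + t *\<^sub>R e \<notin> N" for t
    proof
      assume "y + t *\<^sub>R e \<in> N"
      then have "(y + t *\<^sub>R e) + (- t) *\<^sub>R e \<in> sweep e N" unfolding sweep_def by blast
      then show False using y(2) by simp
    qed
    obtain t1 where t1: "0 < t1" "y + t1 *\<^sub>R e \<in> frontier ?K" using line_exits[OF bK yi e0] by blast
    obtain t2 where t2: "0 < t2" "y + t2 *\<^sub>R (- e) \<in> frontier ?K"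
      using line_exits[OF bK yi, of "- e"] e0 by auto
    have z1: "p (y + t1 *\<^sub>R e) = 0" using fr[OF t1(2) nN] .
    have z2: "p (y + (- t2) *\<^sub>R e) = 0" using fr[of "y + (- t2) *\<^sub>R e"] t2(2) nN[of "- t2"] by simp
    let ?c = "dderiv e p y"
    have lin: "p (y + t *\<^sub>R e) = p y + t * ?c" for t
      using polys_1_line[OF p, of y "t *\<^sub>R e" y] linear_cmul[OF dderiv_linear[OF p]] by simp
    have "(t1 + t2) * ?c = 0" using z1 z2 lin[of t1] lin[of "- t2"] by (simp add: algebra_simps)
    then have "?c = 0" using t1 t2 by simp
    then show ?thesis using z1 lin[of t1] by simp
  qed
  have "AE y in lebesgue. y \<notin> sweep e N"
    using negN by (intro AE_not_in) (simp add: negligible_iff_null_sets)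
  then have "AE y in lborel. y \<notin> sweep e N" by (simp only: AE_completion_iff)
  then have "AE y in lborel. y \<in> ball z r \<longrightarrow> p y = 0"
    by eventually_elim (use main in blast)
  then show ?thesis by (rule polys_zero_AE_ball[OF p zr(1)])
qed

end

section \<open>The global problem\<close>

lemma sum_zero:
  fixes f :: "'i \<Rightarrow> real"
  assumes "finite I" "\<And>i. i \<in> I \<Longrightarrow> 0 \<le> f i" "sum f I \<le> 0" "i \<in> I"
  shows "f i = 0"
proof -
  have "sum f I = 0" using sum_nonneg[of I f] assms(2,3) by fastforce
  then show ?thesis using sum_nonneg_eq_0_iff[OF assms(1)] assms(2,4) by blast
qed

lemma extensional_family:
  assumes "v \<in> I \<rightarrow>\<^sub>E (V :: 'v::real_vector set)"
  shows "\<exists>v'\<in>families I (\<lambda>_. V). v = restrict v' I"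
  using assms
  by (intro bexI[of _ "\<lambda>i. if i \<in> I then v i else 0"]) (auto simp: families_def PiE_iff extensional_def)

lemma face_polys_family:
  assumes "f \<in> (\<Pi>\<^sub>E F\<in>I. face_polys l F)"
    and "\<And>F. F \<in> I \<Longrightarrow> B F \<Longrightarrow> \<forall>x\<in>F. f F x = 0"
  shows "\<exists>q\<in>families I (\<lambda>F. {r \<in> polys l. B F \<longrightarrow> (\<forall>x\<in>F. r x = 0)}). f = (\<lambda>F\<in>I. restrict (q F) F)"
proof -
  have "\<forall>F\<in>I. \<exists>r\<in>polys l. f F = restrict r F" using assms(1) by (auto simp: face_polys_def PiE_iff)
  then obtain r where r: "\<forall>F\<in>I. r F \<in> polys l \<and> f F = restrict (r F) F" by metis
  define q where "q F = (if F \<in> I then r F else 0)" for F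
  have "q F \<in> {r \<in> polys l. B F \<longrightarrow> (\<forall>x\<in>F. r x = 0)}" if F: "F \<in> I" for F
  proof -
    have "r F x = 0" if "B F" "x \<in> F" for x
    proof -
      have "f F x = r F x" using r F that(2) by simp
      then show ?thesis using assms(2)[OF F that(1)] that(2) by simp
    qed
    then show ?thesis using r F by (simp add: q_def)
  qed
  moreover have "f = (\<lambda>F\<in>I. restrict (q F) F)"
    using r assms(1) by (auto simp: fun_eq_iff q_def PiE_iff extensional_def)
  ultimately show ?thesis by (intro bexI[of _ q]) (auto simp: families_def q_def)
qed

locale mesh_problem = mesh \<rho> \<Omega> Th Fh for \<rho> and \<Omega> :: "'a::euclidean_space set" and Th Fh +
  fixes nF :: "'a set \<Rightarrow> 'a" and k :: nat and K :: real
  assumes nF: "face_normals \<Omega> Fh nF"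
    and K0: "0 \<le> K"
    and K: "\<And>p (z::'a) h y. p \<in> polys (k + 2) \<Longrightarrow> 0 < h \<Longrightarrow> y \<in> cball z h \<Longrightarrow>
      (p y)\<^sup>2 \<le> K / h ^ DIM('a) * (LINT x:ball z (h * (\<rho>\<^sup>2 / 8))|lborel. (p x)\<^sup>2) \<and>
      (\<forall>b\<in>Basis. (h * dderiv b p y)\<^sup>2 \<le> K / h ^ DIM('a) * (LINT x:ball z (h * (\<rho>\<^sup>2 / 8))|lborel. (p x)\<^sup>2))"
begin

lemma cell: "T \<in> Th \<Longrightarrow> mesh_cell \<rho> \<Omega> Th Fh T k K"
  using K0 K by unfold_locales

text \<open>Discrete functions are parametrized by families of polynomials on the whole space, which form a
  finite-dimensional vector space; extensional families are not closed under the pointwise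
  operations. The parametrization is not injective, as different polynomials may agree on a face.\<close>

definition bdry_polys :: "nat \<Rightarrow> 'a set \<Rightarrow> ('a \<Rightarrow> real) set" where
  "bdry_polys l F = {r \<in> polys l. F \<in> boundary_faces \<Omega> Fh \<longrightarrow> (\<forall>x\<in>F. r x = 0)}"

definition poly_data :: "('a gV \<times> 'a gU) set" where
  "poly_data = (families Th (\<lambda>_. polys (k + 2)) \<times> families Fh (bdry_polys (k + 2)) \<times> families Fh (\<lambda>_. polys k))
     \<times> (families Th (\<lambda>_. polys (k + 1)) \<times> families Fh (bdry_polys k))"

definition to_discrete :: "'a gV \<times> 'a gU \<Rightarrow> 'a gV \<times> 'a gU" where
  "to_discrete p = ((restrict (fst (fst p)) Th, \<lambda>F\<in>Fh. restrict (fst (snd (fst p)) F) F, \<lambda>F\<in>Fh. restrict (snd (snd (fst p)) F) F),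
     (restrict (fst (snd p)) Th, \<lambda>F\<in>Fh. restrict (snd (snd p) F) F))"

lemma fin_dim_bdry_polys: "fin_dim (bdry_polys l F)"
proof (rule fin_dim_sub[OF fin_dim_polys[of l]])
  show "subspace (bdry_polys l F)"
    unfolding bdry_polys_def using subspace_polys[of l]
    by (auto simp: subspace_def)
  show "bdry_polys l F \<subseteq> polys l" by (auto simp: bdry_polys_def)
qed

lemma fin_dim_poly_data: "fin_dim poly_data"
  unfolding poly_data_def
  by (intro fin_dim_Times fin_dim_families finite_Th finite_Fh fin_dim_polys fin_dim_bdry_polys)

lemma subspace_poly_data: "subspace poly_data"
  by (rule fin_dim_subspace[OF fin_dim_poly_data])

lemma to_discrete_in: "p \<in> poly_data \<Longrightarrow> to_discrete p \<in> spaceX k \<Omega> Th Fh"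
  unfolding to_discrete_def poly_data_def spaceX_def spaceV_def spaceU_def
  by (auto simp: families_def bdry_polys_def face_polys_def boundary_faces_def)

lemma to_discrete_surj:
  assumes "x \<in> spaceX k \<Omega> Th Fh"
  shows "\<exists>p\<in>poly_data. x = to_discrete p"
proof -
  obtain v vF \<eta> u uF where x: "x = ((v, vF, \<eta>), (u, uF))" by (metis prod.exhaust)
  have s: "v \<in> Th \<rightarrow>\<^sub>E polys (k + 2)" "vF \<in> (\<Pi>\<^sub>E F\<in>Fh. face_polys (k + 2) F)"
    "\<eta> \<in> (\<Pi>\<^sub>E F\<in>Fh. face_polys k F)" "\<forall>F\<in>boundary_faces \<Omega> Fh. \<forall>x\<in>F. vF F x = 0"
    "u \<in> Th \<rightarrow>\<^sub>E polys (k + 1)" "uF \<in> (\<Pi>\<^sub>E F\<in>Fh. face_polys k F)" "\<forall>F\<in>boundary_faces \<Omega> Fh. \<forall>x\<in>F. uF F x = 0"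
    using assms unfolding x spaceX_def spaceV_def spaceU_def by auto
  obtain v' where v': "v' \<in> families Th (\<lambda>_. polys (k + 2))" "v = restrict v' Th"
    using extensional_family[OF s(1)] by blast
  obtain u' where u': "u' \<in> families Th (\<lambda>_. polys (k + 1))" "u = restrict u' Th"
    using extensional_family[OF s(5)] by blast
  obtain q where q: "q \<in> families Fh (bdry_polys (k + 2))" "vF = (\<lambda>F\<in>Fh. restrict (q F) F)"
    using face_polys_family[OF s(2), of "\<lambda>F. F \<in> boundary_faces \<Omega> Fh"] s(4) unfolding bdry_polys_def[abs_def] by blast
  obtain g where g: "g \<in> families Fh (bdry_polys k)" "uF = (\<lambda>F\<in>Fh. restrict (g F) F)"
    using face_polys_family[OF s(6), of "\<lambda>F. F \<in> boundary_faces \<Omega> Fh"] s(7) unfolding bdry_polys_def[abs_def] by blast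
  obtain e where e: "e \<in> families Fh (\<lambda>_. polys k)" "\<eta> = (\<lambda>F\<in>Fh. restrict (e F) F)"
    using face_polys_family[OF s(3), of "\<lambda>_. False"] by auto
  show ?thesis
    by (rule bexI[of _ "((v', q, e), (u', g))"]) (use v' u' q g e in \<open>auto simp: x to_discrete_def poly_data_def\<close>)
qed

definition cell_dataV :: "'a set \<Rightarrow> 'a gV \<times> 'a gU \<Rightarrow> ('a \<Rightarrow> real) \<times> 'a ffun \<times> 'a ffun" where
  "cell_dataV T p = (fst (fst p) T, \<lambda>F x. fst (fst p) T x - fst (snd (fst p)) F x,
     \<lambda>F x. ndiff T (fst (fst p) T) F x - (nF F \<bullet> cell_normal T F) * snd (snd (fst p)) F x)"

definition cell_dataU :: "'a set \<Rightarrow> 'a gV \<times> 'a gU \<Rightarrow> ('a \<Rightarrow> real) \<times> 'a ffun" where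
  "cell_dataU T p = (fst (snd p) T, \<lambda>F x. fst (snd p) T x - snd (snd p) F x)"

lemma face_data_polys:
  assumes "p \<in> poly_data" "T \<in> Th" "F \<in> cell_faces Fh T"
  shows "fst (snd (fst p)) F \<in> polys (k + 2)" "snd (snd (fst p)) F \<in> polys k" "snd (snd p) F \<in> polys k"
  using assms by (auto simp: poly_data_def families_def bdry_polys_def cell_faces_def)

lemma cell_data_polys:
  assumes "p \<in> poly_data" "T \<in> Th"
  shows "fst (fst p) T \<in> polys (k + 2)" "fst (snd p) T \<in> polys (k + 1)"
  using assms by (auto simp: poly_data_def families_def)

lemma lin_cell_dataV: "T \<in> Th \<Longrightarrow> lin_on poly_data (cell_dataV T)"
proof (rule lin_onI)
  fix p q assume T: "T \<in> Th" and p: "p \<in> poly_data" and q: "q \<in> poly_data"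
  have "ndiff T (fst (fst p) T + fst (fst q) T) F x = ndiff T (fst (fst p) T) F x + ndiff T (fst (fst q) T) F x" for F x
    unfolding ndiff_def using lin_on_add[OF lin_on_dderiv cell_data_polys(1)[OF p T] cell_data_polys(1)[OF q T]] .
  then show "cell_dataV T (p + q) = cell_dataV T p + cell_dataV T q" by (simp add: cell_dataV_def fun_eq_iff algebra_simps)
next
  fix p and c :: real assume T: "T \<in> Th" and p: "p \<in> poly_data"
  have "ndiff T (c *\<^sub>R fst (fst p) T) F x = c * ndiff T (fst (fst p) T) F x" for F x
    unfolding ndiff_def using lin_on_scale[OF lin_on_dderiv cell_data_polys(1)[OF p T]] by simp
  then show "cell_dataV T (c *\<^sub>R p) = c *\<^sub>R cell_dataV T p" by (simp add: cell_dataV_def fun_eq_iff algebra_simps)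
qed

lemma lin_cell_dataU: "lin_on poly_data (cell_dataU T)"
  by (intro lin_onI) (simp_all add: cell_dataU_def fun_eq_iff algebra_simps)

definition cell_formV where
  "cell_formV T p p' = hess_inner T (recR k Fh T (localV Fh nF T (fst (to_discrete p)))) (recR k Fh T (localV Fh nF T (fst (to_discrete p'))))
     + stabV k Fh T (localV Fh nF T (fst (to_discrete p))) (localV Fh nF T (fst (to_discrete p')))"

definition cell_formU where
  "cell_formU T p p' = L2_inner T (grad (recG k Fh T (localU Fh T (snd (to_discrete p))))) (grad (recG k Fh T (localU Fh T (snd (to_discrete p')))))
     + stabU k Fh T (localU Fh T (snd (to_discrete p))) (localU Fh T (snd (to_discrete p')))"

lemma localV_to_discrete: "T \<in> Th \<Longrightarrow> localV Fh nF T (fst (to_discrete p)) = (fst (fst p) T,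
    restrict (\<lambda>F\<in>Fh. restrict (fst (snd (fst p)) F) F) (cell_faces Fh T),
    \<lambda>F\<in>cell_faces Fh T. \<lambda>x\<in>F. (nF F \<bullet> cell_normal T F) * (\<lambda>F\<in>Fh. restrict (snd (snd (fst p)) F) F) F x)"
  by (simp add: to_discrete_def)

lemma localU_to_discrete: "T \<in> Th \<Longrightarrow> localU Fh T (snd (to_discrete p)) = (fst (snd p) T,
    restrict (\<lambda>F\<in>Fh. restrict (snd (snd p) F) F) (cell_faces Fh T))"
  by (simp add: to_discrete_def)

lemma to_discrete_vals:
  assumes "F \<in> cell_faces Fh T" "x \<in> F"
  shows "restrict (\<lambda>F\<in>Fh. restrict (q F) F) (cell_faces Fh T) F x = q F x"
    and "(\<lambda>F\<in>cell_faces Fh T. \<lambda>x\<in>F. s F * (\<lambda>F\<in>Fh. restrict (q F) F) F x) F x = s F * q F x"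
  using assms cell_faces_subset by auto

end

lemma (in mesh_problem)
  assumes T: "T \<in> Th"
  shows cell_formV_nonneg: "p \<in> poly_data \<Longrightarrow> 0 \<le> cell_formV T p p" and cell_formU_nonneg: "p \<in> poly_data \<Longrightarrow> 0 \<le> cell_formU T p p"
    and coercive_cell_formV: "p \<in> poly_data \<Longrightarrow> semiV_sq Fh T (localV Fh nF T (fst (to_discrete p))) \<le> coer_const DIM('a) \<rho> K * cell_formV T p p"
    and coercive_cell_formU: "p \<in> poly_data \<Longrightarrow> semiU_sq Fh T (localU Fh T (snd (to_discrete p))) \<le> coer_const DIM('a) \<rho> K * cell_formU T p p"
    and bilin_cell_formV: "bilin_on poly_data (cell_formV T)" and bilin_cell_formU: "bilin_on poly_data (cell_formU T)"
proof -
  interpret C: mesh_cell \<rho> \<Omega> Th Fh T k K by (rule cell[OF T])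
  define sg where "sg F = nF F \<bullet> cell_normal T F" for F
  have e: "(\<lambda>F x. sg F * snd (snd (fst p)) F x) \<in> pw_polys k C.cf" if "p \<in> poly_data" for p
    using face_data_polys(2)[OF that T] by (intro pw_family polys_cmult)
  have \<delta>: "(\<lambda>F x. fst (fst p) T x - fst (snd (fst p)) F x) \<in> pw_polys (k + 2) C.cf" if p: "p \<in> poly_data" for p
  proof (rule pw_diff[OF pw_poly[OF cell_data_polys(1)[OF p T]]])
    show "fst (snd (fst p)) \<in> pw_polys (k + 2) C.cf" using face_data_polys(1)[OF p T] by (intro pw_family)
  qed
  have \<epsilon>: "(\<lambda>F x. ndiff T (fst (fst p) T) F x - sg F * snd (snd (fst p)) F x) \<in> pw_polys (k + 2) C.cf" if p: "p \<in> poly_data" for p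
    by (rule pw_diff[OF C.ndiff_pw'[OF cell_data_polys(1)[OF p T]] C.k2[OF e[OF p]]])
  have g: "snd (snd p) \<in> pw_polys k C.cf" if p: "p \<in> poly_data" for p
    using face_data_polys(3)[OF p T] by (intro pw_family)
  have \<delta>U: "(\<lambda>F x. fst (snd p) T x - snd (snd p) F x) \<in> pw_polys (k + 2) C.cf" if p: "p \<in> poly_data" for p
    by (rule pw_diff[OF pw_poly[OF C.k1[OF cell_data_polys(2)[OF p T]]] C.k2[OF g[OF p]]])
  have cell_dataV: "cell_dataV T p \<in> C.dataV" if p: "p \<in> poly_data" for p
    using cell_data_polys(1)[OF p T] \<delta>[OF p] \<epsilon>[OF p] by (simp add: cell_dataV_def C.dataV_def sg_def)
  have cell_dataU: "cell_dataU T p \<in> C.dataU" if p: "p \<in> poly_data" for p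
    using cell_data_polys(2)[OF p T] \<delta>U[OF p] by (simp add: cell_dataU_def C.dataU_def)
  define vb where "vb p = restrict (\<lambda>F\<in>Fh. restrict (fst (snd (fst p)) F) F) C.cf" for p :: "'a gV \<times> 'a gU"
  define \<eta>b where "\<eta>b p = (\<lambda>F\<in>C.cf. \<lambda>x\<in>F. sg F * (\<lambda>F\<in>Fh. restrict (snd (snd (fst p)) F) F) F x)" for p :: "'a gV \<times> 'a gU"
  define ub where "ub p = restrict (\<lambda>F\<in>Fh. restrict (snd (snd p) F) F) C.cf" for p :: "'a gV \<times> 'a gU"
  have lV: "localV Fh nF T (fst (to_discrete p)) = (fst (fst p) T, vb p, \<eta>b p)" for p
    unfolding localV_to_discrete[OF T] vb_def \<eta>b_def sg_def ..
  have lU: "localU Fh T (snd (to_discrete p)) = (fst (snd p) T, ub p)" for p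
    unfolding localU_to_discrete[OF T] ub_def ..
  have vals: "vb p F x = fst (snd (fst p)) F x" "\<eta>b p F x = sg F * snd (snd (fst p)) F x" "ub p F x = snd (snd p) F x"
    if "F \<in> C.cf" "x \<in> F" for p F x
    unfolding vb_def \<eta>b_def ub_def using to_discrete_vals[OF that] by blast+
  have dV_eq: "cell_dataV T p = (fst (fst p) T, \<lambda>F x. fst (fst p) T x - fst (snd (fst p)) F x,
      \<lambda>F x. ndiff T (fst (fst p) T) F x - sg F * snd (snd (fst p)) F x)" for p
    by (simp add: cell_dataV_def sg_def)
  have cell_formV: "cell_formV T p p' = C.locV (cell_dataV T p) (cell_dataV T p')" if p: "p \<in> poly_data" "p' \<in> poly_data" for p p'
  proof -
    have r: "recR k Fh T (fst (fst p) T, vb p, \<eta>b p) = C.recV (fst (fst p) T)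
        (\<lambda>F x. fst (fst p) T x - fst (snd (fst p)) F x)
        (\<lambda>F x. ndiff T (fst (fst p) T) F x - sg F * snd (snd (fst p)) F x)" if "p \<in> poly_data" for p
      by (rule C.recR_eq[OF cell_data_polys(1)[OF that T] face_data_polys(1)[OF that T]]) (use vals in blast)+
    have s: "stabV k Fh T (fst (fst p) T, vb p, \<eta>b p) (fst (fst p') T, vb p', \<eta>b p') =
        bd_inner C.cf (\<lambda>F x. fst (fst p) T x - fst (snd (fst p)) F x) (\<lambda>F x. fst (fst p') T x - fst (snd (fst p')) F x) / diameter T ^ 3
        + bd_inner C.cf (C.Pr (\<lambda>F x. ndiff T (fst (fst p) T) F x - sg F * snd (snd (fst p)) F x))
            (C.Pr (\<lambda>F x. ndiff T (fst (fst p') T) F x - sg F * snd (snd (fst p')) F x)) / diameter T"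
      by (rule C.stabV_eq[OF _ _ _ _ \<epsilon>[OF p(1)] \<epsilon>[OF p(2)]]) (use vals in blast)+
    show ?thesis
      unfolding cell_formV_def lV r[OF p(1)] r[OF p(2)] s C.locV_def dV_eq by simp
  qed
  have cell_formU: "cell_formU T p p' = C.locU (cell_dataU T p) (cell_dataU T p')" if p: "p \<in> poly_data" "p' \<in> poly_data" for p p'
  proof -
    have r: "recG k Fh T (fst (snd p) T, ub p) = C.recU (fst (snd p) T) (\<lambda>F x. fst (snd p) T x - snd (snd p) F x)" for p
      by (rule C.recG_eq) (use vals in blast)
    have s: "stabU k Fh T (fst (snd p) T, ub p) (fst (snd p') T, ub p') =
        bd_inner C.cf (C.Pr (\<lambda>F x. fst (snd p) T x - snd (snd p) F x))
          (C.Pr (\<lambda>F x. fst (snd p') T x - snd (snd p') F x)) / diameter T"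
      by (rule C.stabU_eq[OF _ _ \<delta>U[OF p(1)] \<delta>U[OF p(2)]]) (use vals in blast)+
    show ?thesis
      unfolding cell_formU_def lU r s C.locU_def cell_dataU_def by simp
  qed
  show "0 \<le> cell_formV T p p" if p: "p \<in> poly_data" unfolding cell_formV[OF p p] by (rule C.locV_nonneg[OF cell_dataV[OF p]])
  show "0 \<le> cell_formU T p p" if p: "p \<in> poly_data" unfolding cell_formU[OF p p] by (rule C.locU_nonneg[OF cell_dataU[OF p]])
  show "bilin_on poly_data (cell_formV T)"
    by (rule bilin_on_cong[OF bilin_on_pullback[OF C.bilin_locV lin_cell_dataV[OF T] cell_dataV] subspace_poly_data cell_formV])
  show "bilin_on poly_data (cell_formU T)"
    by (rule bilin_on_cong[OF bilin_on_pullback[OF C.bilin_locU lin_cell_dataU cell_dataU] subspace_poly_data cell_formU])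
  show "semiV_sq Fh T (localV Fh nF T (fst (to_discrete p))) \<le> coer_const DIM('a) \<rho> K * cell_formV T p p" if p: "p \<in> poly_data"
  proof -
    have "semiV_sq Fh T (localV Fh nF T (fst (to_discrete p))) = hess_inner T (fst (fst p) T) (fst (fst p) T)
      + bd_inner C.cf (snd (snd (cell_dataV T p))) (snd (snd (cell_dataV T p))) / diameter T
      + bd_inner C.cf (fst (snd (cell_dataV T p))) (fst (snd (cell_dataV T p))) / diameter T ^ 3"
      unfolding lV dV_eq fst_conv snd_conv by (rule C.semiV_eq) (use vals in blast)+
    also have "\<dots> \<le> coer_const DIM('a) \<rho> K * C.locV (fst (fst p) T, fst (snd (cell_dataV T p)), snd (snd (cell_dataV T p)))
        (fst (fst p) T, fst (snd (cell_dataV T p)), snd (snd (cell_dataV T p)))"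
      using \<delta>[OF p] by (intro C.coercive_V[OF cell_data_polys(1)[OF p T] _ e[OF p]])
        (simp_all add: cell_dataV_def sg_def fun_eq_iff)
    finally show ?thesis unfolding cell_formV[OF p p] by (simp add: cell_dataV_def)
  qed
  show "semiU_sq Fh T (localU Fh T (snd (to_discrete p))) \<le> coer_const DIM('a) \<rho> K * cell_formU T p p" if p: "p \<in> poly_data"
  proof -
    have "semiU_sq Fh T (localU Fh T (snd (to_discrete p))) = L2_inner T (grad (fst (snd p) T)) (grad (fst (snd p) T))
      + bd_inner C.cf (snd (cell_dataU T p)) (snd (cell_dataU T p)) / diameter T"
      unfolding lU cell_dataU_def snd_conv by (rule C.semiU_eq) (use vals in blast)
    also have "\<dots> \<le> coer_const DIM('a) \<rho> K * C.locU (fst (snd p) T, snd (cell_dataU T p)) (fst (snd p) T, snd (cell_dataU T p))"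
      by (rule C.coercive_U[OF cell_data_polys(2)[OF p T] g[OF p]]) (simp add: cell_dataU_def)
    finally show ?thesis unfolding cell_formU[OF p p] by (simp add: cell_dataU_def)
  qed
qed

context mesh_problem
begin

lemma broken_restrict: "broken Th (restrict v Th) = broken Th v"
  by (simp add: broken_def fun_eq_iff)

lemma broken_measurable:
  fixes u :: "'a ffun"
  assumes "\<And>T. T \<in> Th \<Longrightarrow> u T \<in> polys l"
  shows "broken Th u \<in> borel_measurable borel"
  unfolding broken_def[abs_def]
  using assms cell_open polys_measurable
  by (intro borel_measurable_sum borel_measurable_times borel_measurable_indicator) (auto intro: borel_open)

lemma broken_bounded:
  fixes u :: "'a ffun"
  assumes "\<And>T. T \<in> Th \<Longrightarrow> u T \<in> polys l"
  shows "\<exists>M. \<forall>x. \<bar>broken Th u x\<bar> \<le> M"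
proof -
  have "\<exists>M. \<forall>x. \<bar>indicator T x * u T x\<bar> \<le> M" if T: "T \<in> Th" for T
  proof -
    obtain z r where zr: "T \<subseteq> cball z r" using cell_bounded[OF T] bounded_subset_cball by blast
    obtain M where M: "\<forall>x\<in>cball z r. \<bar>u T x\<bar> \<le> M" using bounded_polys_cball[OF assms[OF T]] by blast
    have "\<bar>indicator T x * u T x\<bar> \<le> \<bar>M\<bar>" for x
    proof (cases "x \<in> T")
      case True
      then have "\<bar>u T x\<bar> \<le> M" using M zr by blast
      then show ?thesis using True by simp
    qed simp
    then show ?thesis by blast
  qed
  then obtain M where M: "\<And>T x. T \<in> Th \<Longrightarrow> \<bar>indicator T x * u T x\<bar> \<le> M T" by metis
  have "\<bar>broken Th u x\<bar> \<le> (\<Sum>T\<in>Th. M T)" for x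
    unfolding broken_def using M by (intro order_trans[OF sum_abs sum_mono]) auto
  then show ?thesis by blast
qed

lemma integrable_mult_broken:
  fixes u :: "'a ffun"
  assumes f: "set_integrable lebesgue \<Omega> f" and u: "\<And>T. T \<in> Th \<Longrightarrow> u T \<in> polys l"
  shows "set_integrable lebesgue \<Omega> (\<lambda>x. f x * broken Th u x)"
proof -
  obtain M where M: "\<forall>x. \<bar>broken Th u x\<bar> \<le> M" using broken_bounded[of u l] u by blast
  have fi: "integrable lebesgue (\<lambda>x. indicator \<Omega> x *\<^sub>R f x)" using f by (simp add: set_integrable_def)
  have bm: "broken Th u \<in> borel_measurable lebesgue"
    using broken_measurable[of u l] u by (intro measurable_completion) simp
  have "integrable lebesgue (\<lambda>x. (indicator \<Omega> x *\<^sub>R f x) * broken Th u x)"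
  proof (rule Bochner_Integration.integrable_bound[OF integrable_mult_right[OF fi, of M]])
    show "(\<lambda>x. (indicator \<Omega> x *\<^sub>R f x) * broken Th u x) \<in> borel_measurable lebesgue"
      using borel_measurable_integrable[OF fi] bm by (rule borel_measurable_times)
    have "\<bar>indicator \<Omega> x *\<^sub>R f x\<bar> * \<bar>broken Th u x\<bar> \<le> \<bar>indicator \<Omega> x *\<^sub>R f x\<bar> * \<bar>M\<bar>" for x
      using M by (intro mult_left_mono) (auto intro: order_trans)
    then show "AE x in lebesgue. norm ((indicator \<Omega> x *\<^sub>R f x) * broken Th u x) \<le> norm (M * (indicator \<Omega> x *\<^sub>R f x))"
      by (intro AE_I2) (simp add: abs_mult mult.commute)
  qed
  then show ?thesis by (simp add: set_integrable_def mult.assoc)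
qed

lemma integrable_one: "set_integrable lebesgue \<Omega> (\<lambda>x. 1 :: real)"
proof -
  have "\<Omega> \<in> lmeasurable" using bdd\<Omega> opn by (rule lmeasurable_open)
  then show ?thesis by (simp add: set_integrable_def lmeasurable_iff_integrable)
qed

lemma integrable_broken:
  fixes u :: "'a ffun"
  assumes "\<And>T. T \<in> Th \<Longrightarrow> u T \<in> polys l"
  shows "set_integrable lebesgue \<Omega> (broken Th u)"
  using integrable_mult_broken[OF integrable_one assms] by simp

lemma lin_L2_broken:
  assumes f: "set_integrable lebesgue \<Omega> f"
  shows "lin_on (families Th (\<lambda>_. polys l)) (\<lambda>u. L2_inner \<Omega> f (broken Th u))"
proof (rule lin_onI)
  fix u v :: "'a ffun" assume u: "u \<in> families Th (\<lambda>_. polys l)" and v: "v \<in> families Th (\<lambda>_. polys l)"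
  have i: "set_integrable lebesgue \<Omega> (\<lambda>x. f x * broken Th u x)" "set_integrable lebesgue \<Omega> (\<lambda>x. f x * broken Th v x)"
  proof -
    have u': "u T \<in> polys l" and v': "v T \<in> polys l" if "T \<in> Th" for T
      using u v that by (auto simp: families_def)
    show "set_integrable lebesgue \<Omega> (\<lambda>x. f x * broken Th u x)"
      by (rule integrable_mult_broken[OF f]) (rule u')
    show "set_integrable lebesgue \<Omega> (\<lambda>x. f x * broken Th v x)"
      by (rule integrable_mult_broken[OF f]) (rule v')
  qed
  have "broken Th (u + v) x = broken Th u x + broken Th v x" for x
    by (simp add: broken_def algebra_simps sum.distrib)
  then show "L2_inner \<Omega> f (broken Th (u + v)) = L2_inner \<Omega> f (broken Th u) + L2_inner \<Omega> f (broken Th v)"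
    using set_integral_add(2)[OF i] by (simp add: L2_inner_def algebra_simps)
next
  fix u :: "'a ffun" and c :: real assume u: "u \<in> families Th (\<lambda>_. polys l)"
  have b: "broken Th (c *\<^sub>R u) x = c * broken Th u x" for x
    by (simp add: broken_def sum_distrib_left algebra_simps)
  have "L2_inner \<Omega> f (broken Th (c *\<^sub>R u)) = (LINT x:\<Omega>|lebesgue. c * (f x * broken Th u x))"
    by (simp add: L2_inner_def b algebra_simps)
  then show "L2_inner \<Omega> f (broken Th (c *\<^sub>R u)) = c *\<^sub>R L2_inner \<Omega> f (broken Th u)"
    by (simp add: L2_inner_def)
qed

lemma bilin_cross: "bilin_on poly_data (\<lambda>p p'. L2_inner \<Omega> (broken Th (fst (snd p))) (broken Th (fst (fst p'))))"
proof (rule bilin_onI)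
  have f: "lin_on poly_data (\<lambda>p. fst (fst p))" "lin_on poly_data (\<lambda>p. fst (snd p))" by (simp_all add: lin_on_def)
  have m: "fst (fst p) \<in> families Th (\<lambda>_. polys (k + 2))" "fst (snd p) \<in> families Th (\<lambda>_. polys (k + 1))"
    if "p \<in> poly_data" for p using that by (auto simp: poly_data_def)
  fix p assume p: "p \<in> poly_data"
  show "lin_on poly_data (\<lambda>p'. L2_inner \<Omega> (broken Th (fst (snd p))) (broken Th (fst (fst p'))))"
    using cell_data_polys(2)[OF p]
    by (intro lin_on_compose[OF f(1) m(1) lin_L2_broken] integrable_broken)
  show "lin_on poly_data (\<lambda>p'. L2_inner \<Omega> (broken Th (fst (snd p'))) (broken Th (fst (fst p))))"
    unfolding L2_inner_commute[of \<Omega> "broken Th (fst (snd _))"]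
    using cell_data_polys(1)[OF p]
    by (intro lin_on_compose[OF f(2) m(2) lin_L2_broken] integrable_broken)
qed

lemma formA_to_discrete: "formA \<kappa> k \<Omega> Th Fh nF (to_discrete p) (to_discrete p') =
  (\<Sum>T\<in>Th. cell_formV T p p') - L2_inner \<Omega> (broken Th (fst (snd p))) (broken Th (fst (fst p')))
  + L2_inner \<Omega> (broken Th (fst (snd p'))) (broken Th (fst (fst p))) + \<kappa> * (\<Sum>T\<in>Th. cell_formU T p p')"
proof -
  have s: "to_discrete p = (fst (to_discrete p), snd (to_discrete p))" for p by simp
  have b: "broken Th (fst (fst (to_discrete p))) = broken Th (fst (fst p))"
    "broken Th (fst (snd (to_discrete p))) = broken Th (fst (snd p))" for p
    by (simp_all add: to_discrete_def broken_restrict)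
  show ?thesis
    by (subst s[of p], subst s[of p'], unfold formA.simps)
      (simp only: formV_def formU_def cell_formV_def cell_formU_def b
        L2_inner_commute[of \<Omega> "broken Th (fst (fst p))"])
qed

lemma bilin_formA: "bilin_on poly_data (\<lambda>p p'. formA \<kappa> k \<Omega> Th Fh nF (to_discrete p) (to_discrete p'))"
proof (rule bilin_onI)
  have V: "bilin_on poly_data (\<lambda>p p'. \<Sum>T\<in>Th. cell_formV T p p')" by (rule bilin_on_sum[OF bilin_cell_formV])
  have U: "bilin_on poly_data (\<lambda>p p'. \<Sum>T\<in>Th. cell_formU T p p')" by (rule bilin_on_sum[OF bilin_cell_formU])
  have sc: "lin_on poly_data (\<lambda>p. \<kappa> * g p)" if "lin_on poly_data g" for g :: "_ \<Rightarrow> real"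
    using that by (simp add: lin_on_def algebra_simps)
  fix p assume p: "p \<in> poly_data"
  show "lin_on poly_data (\<lambda>p'. formA \<kappa> k \<Omega> Th Fh nF (to_discrete p) (to_discrete p'))" unfolding formA_to_discrete
    by (intro lin_on_plus lin_on_minus sc bilin_onD(1)[OF V p] bilin_onD(1)[OF U p]
        bilin_onD(1)[OF bilin_cross p] bilin_onD(2)[OF bilin_cross p])
  show "lin_on poly_data (\<lambda>p'. formA \<kappa> k \<Omega> Th Fh nF (to_discrete p') (to_discrete p))" unfolding formA_to_discrete
    by (intro lin_on_plus lin_on_minus sc bilin_onD(2)[OF V p] bilin_onD(2)[OF U p]
        bilin_onD(1)[OF bilin_cross p] bilin_onD(2)[OF bilin_cross p])
qed

lemma normX_to_discrete: "normX_sq Th Fh nF (to_discrete p) =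
  (\<Sum>T\<in>Th. semiV_sq Fh T (localV Fh nF T (fst (to_discrete p)))) + (\<Sum>T\<in>Th. semiU_sq Fh T (localU Fh T (snd (to_discrete p))))"
  using normX_sq.simps[of Th Fh nF "fst (to_discrete p)" "snd (to_discrete p)"] by simp

text \<open>The coupling terms cancel on the diagonal. The factor \<open>1 + 1 / \<kappa>\<close> covers both
  large and small \<open>\<kappa>\<close>.\<close>

lemma coercive_formA:
  assumes \<kappa>: "0 < \<kappa>" and p: "p \<in> poly_data"
  shows "normX_sq Th Fh nF (to_discrete p) \<le>
    ((coer_const DIM('a) \<rho> K + 1) * (1 + 1 / \<kappa>)) * formA \<kappa> k \<Omega> Th Fh nF (to_discrete p) (to_discrete p)"
proof -
  let ?c = "coer_const DIM('a) \<rho> K" and ?V = "\<Sum>T\<in>Th. cell_formV T p p" and ?U = "\<Sum>T\<in>Th. cell_formU T p p"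
  have c0: "0 \<le> ?c" by (rule coer_const_nonneg[OF K0])
  have V0: "0 \<le> ?V" and U0: "0 \<le> ?U" by (intro sum_nonneg cell_formV_nonneg cell_formU_nonneg p; assumption)+
  have "normX_sq Th Fh nF (to_discrete p) \<le> ?c * ?V + ?c * ?U"
    unfolding normX_to_discrete sum_distrib_left
    by (intro add_mono sum_mono coercive_cell_formV coercive_cell_formU p)
  also have "\<dots> = ?c * (?V + ?U)" by (simp add: algebra_simps)
  also have "\<dots> \<le> (?c + 1) * ((1 + 1 / \<kappa>) * (?V + \<kappa> * ?U))"
  proof (rule mult_mono)
    have "(1 + 1 / \<kappa>) * (?V + \<kappa> * ?U) = ?V + ?U + ?V / \<kappa> + \<kappa> * ?U"
      using \<kappa> by (simp add: field_simps)
    then show "?V + ?U \<le> (1 + 1 / \<kappa>) * (?V + \<kappa> * ?U)" using V0 U0 \<kappa> by simp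
  qed (use V0 U0 c0 in auto)
  also have "?V + \<kappa> * ?U = formA \<kappa> k \<Omega> Th Fh nF (to_discrete p) (to_discrete p)"
    by (simp add: formA_to_discrete)
  finally show ?thesis by (simp only: mult.assoc)
qed

definition all_zero :: "'a gV \<times> 'a gU \<Rightarrow> bool" where
  "all_zero p \<longleftrightarrow> (\<forall>T\<in>Th. fst (fst p) T = 0 \<and> fst (snd p) T = 0) \<and>
     (\<forall>F\<in>Fh. \<forall>x\<in>F. fst (snd (fst p)) F x = 0 \<and> snd (snd (fst p)) F x = 0 \<and> snd (snd p) F x = 0)"

lemma all_zero_diff:
  assumes "all_zero (p - p')"
  shows "to_discrete p = to_discrete p'"
  using assms by (auto simp: all_zero_def to_discrete_def restrict_def fun_eq_iff)

end

lemma (in mesh_problem)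
  assumes T: "T \<in> Th"
  shows semiV_nonneg: "p \<in> poly_data \<Longrightarrow> 0 \<le> semiV_sq Fh T (localV Fh nF T (fst (to_discrete p)))"
    and semiU_nonneg: "p \<in> poly_data \<Longrightarrow> 0 \<le> semiU_sq Fh T (localU Fh T (snd (to_discrete p)))"
    and semiV_zero: "p \<in> poly_data \<Longrightarrow> semiV_sq Fh T (localV Fh nF T (fst (to_discrete p))) = 0 \<Longrightarrow>
      fst (fst p) T \<in> polys 1 \<and> (\<forall>F\<in>cell_faces Fh T. \<forall>x\<in>F. fst (fst p) T x = fst (snd (fst p)) F x \<and>
        ndiff T (fst (fst p) T) F x = (nF F \<bullet> cell_normal T F) * snd (snd (fst p)) F x)"
    and semiU_zero: "p \<in> poly_data \<Longrightarrow> semiU_sq Fh T (localU Fh T (snd (to_discrete p))) = 0 \<Longrightarrow>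
      (\<forall>x. fst (snd p) T x = fst (snd p) T 0) \<and> (\<forall>F\<in>cell_faces Fh T. \<forall>x\<in>F. fst (snd p) T x = snd (snd p) F x)"
proof -
  interpret C: mesh_cell \<rho> \<Omega> Th Fh T k K by (rule cell[OF T])
  have \<delta>: "fst (snd (cell_dataV T p)) \<in> pw_polys (k + 2) C.cf" if p: "p \<in> poly_data" for p
    unfolding cell_dataV_def using face_data_polys(1)[OF p T] cell_data_polys(1)[OF p T] by (auto intro!: pw_family polys_diff)
  have \<epsilon>: "snd (snd (cell_dataV T p)) \<in> pw_polys (k + 2) C.cf" if p: "p \<in> poly_data" for p
  proof -
    have e: "(\<lambda>F x. (nF F \<bullet> cell_normal T F) * snd (snd (fst p)) F x) \<in> pw_polys k C.cf"
      using face_data_polys(2)[OF p T] by (intro pw_family polys_cmult)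
    show ?thesis unfolding cell_dataV_def snd_conv
      by (rule pw_diff[OF C.ndiff_pw'[OF cell_data_polys(1)[OF p T]] C.k2[OF e]])
  qed
  have \<delta>U: "snd (cell_dataU T p) \<in> pw_polys (k + 2) C.cf" if p: "p \<in> poly_data" for p
  proof -
    have "snd (snd p) \<in> pw_polys k C.cf" using face_data_polys(3)[OF p T] by (intro pw_family)
    then show ?thesis unfolding cell_dataU_def snd_conv
      by (intro pw_diff[OF pw_poly[OF C.k1[OF cell_data_polys(2)[OF p T]]] C.k2])
  qed
  have V: "semiV_sq Fh T (localV Fh nF T (fst (to_discrete p))) = hess_inner T (fst (fst p) T) (fst (fst p) T)
      + bd_inner C.cf (snd (snd (cell_dataV T p))) (snd (snd (cell_dataV T p))) / diameter T
      + bd_inner C.cf (fst (snd (cell_dataV T p))) (fst (snd (cell_dataV T p))) / diameter T ^ 3" for p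
    unfolding localV_to_discrete[OF T] cell_dataV_def fst_conv snd_conv
    by (rule C.semiV_eq) (rule to_discrete_vals; assumption)+
  have U: "semiU_sq Fh T (localU Fh T (snd (to_discrete p))) = L2_inner T (grad (fst (snd p) T)) (grad (fst (snd p) T))
      + bd_inner C.cf (snd (cell_dataU T p)) (snd (cell_dataU T p)) / diameter T" for p
    unfolding localU_to_discrete[OF T] cell_dataU_def snd_conv
    by (rule C.semiU_eq) (rule to_discrete_vals; assumption)
  have n: "0 \<le> hess_inner T (fst (fst p) T) (fst (fst p) T)"
    "0 \<le> bd_inner C.cf (snd (snd (cell_dataV T p))) (snd (snd (cell_dataV T p))) / diameter T"
    "0 \<le> bd_inner C.cf (fst (snd (cell_dataV T p))) (fst (snd (cell_dataV T p))) / diameter T ^ 3"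
    "0 \<le> L2_inner T (grad (fst (snd p) T)) (grad (fst (snd p) T))"
    "0 \<le> bd_inner C.cf (snd (cell_dataU T p)) (snd (cell_dataU T p)) / diameter T" if p: "p \<in> poly_data" for p
    using C.He.nonneg[OF cell_data_polys(1)[OF p T]] C.Bd.nonneg[OF \<epsilon>[OF p]] C.Bd.nonneg[OF \<delta>[OF p]]
      C.Gr.nonneg[OF cell_data_polys(2)[OF p T]] C.Bd.nonneg[OF \<delta>U[OF p]] C.hpos by simp_all
  show "0 \<le> semiV_sq Fh T (localV Fh nF T (fst (to_discrete p)))" if p: "p \<in> poly_data"
    unfolding V using n[OF p] by linarith
  show "0 \<le> semiU_sq Fh T (localU Fh T (snd (to_discrete p)))" if p: "p \<in> poly_data"
    unfolding U using n[OF p] by linarith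
  show "fst (fst p) T \<in> polys 1 \<and> (\<forall>F\<in>cell_faces Fh T. \<forall>x\<in>F. fst (fst p) T x = fst (snd (fst p)) F x \<and>
        ndiff T (fst (fst p) T) F x = (nF F \<bullet> cell_normal T F) * snd (snd (fst p)) F x)"
    if p: "p \<in> poly_data" and z: "semiV_sq Fh T (localV Fh nF T (fst (to_discrete p))) = 0"
  proof -
    have z1: "hess_inner T (fst (fst p) T) (fst (fst p) T) = 0"
      and "bd_inner C.cf (snd (snd (cell_dataV T p))) (snd (snd (cell_dataV T p))) / diameter T = 0"
      and "bd_inner C.cf (fst (snd (cell_dataV T p))) (fst (snd (cell_dataV T p))) / diameter T ^ 3 = 0"
      using z n[OF p] unfolding V by linarith+
    then have z2: "bd_inner C.cf (snd (snd (cell_dataV T p))) (snd (snd (cell_dataV T p))) = 0"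
      and z3: "bd_inner C.cf (fst (snd (cell_dataV T p))) (fst (snd (cell_dataV T p))) = 0"
      using C.hpos by simp_all
    have "fst (fst p) T \<in> polys 1" by (rule C.hess_zero[OF cell_data_polys(1)[OF p T] z1])
    moreover have "fst (fst p) T x = fst (snd (fst p)) F x" if "F \<in> cell_faces Fh T" "x \<in> F" for F x
      using C.bd_zero[OF \<delta>[OF p] z3 that] by (simp add: cell_dataV_def)
    moreover have "ndiff T (fst (fst p) T) F x = (nF F \<bullet> cell_normal T F) * snd (snd (fst p)) F x"
      if "F \<in> cell_faces Fh T" "x \<in> F" for F x
      using C.bd_zero[OF \<epsilon>[OF p] z2 that] by (simp add: cell_dataV_def)
    ultimately show ?thesis by blast
  qed
  show "(\<forall>x. fst (snd p) T x = fst (snd p) T 0) \<and> (\<forall>F\<in>cell_faces Fh T. \<forall>x\<in>F. fst (snd p) T x = snd (snd p) F x)"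
    if p: "p \<in> poly_data" and z: "semiU_sq Fh T (localU Fh T (snd (to_discrete p))) = 0"
  proof -
    have z1: "L2_inner T (grad (fst (snd p) T)) (grad (fst (snd p) T)) = 0"
      and "bd_inner C.cf (snd (cell_dataU T p)) (snd (cell_dataU T p)) / diameter T = 0"
      using z n[OF p] unfolding U by linarith+
    then have z2: "bd_inner C.cf (snd (cell_dataU T p)) (snd (cell_dataU T p)) = 0" using C.hpos by simp
    have "fst (snd p) T x = snd (snd p) F x" if "F \<in> cell_faces Fh T" "x \<in> F" for F x
      using C.bd_zero[OF \<delta>U[OF p] z2 that] by (simp add: cell_dataU_def)
    moreover have "fst (snd p) T x = fst (snd p) T 0" for x
      by (rule C.grad_zero[OF cell_data_polys(2)[OF p T] z1])
    ultimately show ?thesis by blast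
  qed
qed

context mesh_problem
begin

lemma face_has_cell: "F \<in> Fh \<Longrightarrow> \<exists>T\<in>Th. F \<in> cell_faces Fh T"
proof -
  assume F: "F \<in> Fh"
  have "\<forall>F\<in>Fh. (\<exists>T\<in>Th. \<exists>T'\<in>Th. T \<noteq> T' \<and> F \<subseteq> frontier T \<inter> frontier T') \<or> (\<exists>T\<in>Th. F \<subseteq> frontier T \<inter> frontier \<Omega>)"
    using poly_mesh unfolding polytopal_mesh_def by (elim conjE)
  then show ?thesis using F by (fastforce simp: cell_faces_def)
qed

lemma normal_factor:
  assumes "T \<in> Th" "F \<in> cell_faces Fh T"
  shows "cell_normal T F = (nF F \<bullet> cell_normal T F) *\<^sub>R nF F" "(nF F \<bullet> cell_normal T F) * (nF F \<bullet> cell_normal T F) = 1"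
proof -
  have F: "F \<in> Fh" using assms cell_faces_subset by blast
  interpret flat_face F "plane_normal F" "plane_offset F" by (rule flat[OF F])
  have "nF F = plane_normal F \<or> nF F = - plane_normal F"
    using nF F by (intro normal_unique) (auto simp: face_normals_def)
  then show "cell_normal T F = (nF F \<bullet> cell_normal T F) *\<^sub>R nF F" "(nF F \<bullet> cell_normal T F) * (nF F \<bullet> cell_normal T F) = 1"
    using cell_normal_eq[OF assms] unit by (auto simp: dot_square_norm)
qed

text \<open>An affine function is determined by its values on a hyperplane and its derivative in normal
  direction.\<close>

lemma affine_match:
  assumes F: "F \<in> Fh" and w: "w \<in> polys 1" and 0: "\<And>x. x \<in> F \<Longrightarrow> w x = 0"
    and n: "\<And>x. x \<in> F \<Longrightarrow> dderiv (nF F) w x = 0"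
  shows "w y = 0"
proof -
  interpret flat_face F "plane_normal F" "plane_offset F" by (rule flat[OF F])
  have "(\<integral>x. (w x)\<^sup>2 \<partial>face_measure F) = (\<integral>x. 0 \<partial>face_measure F)"
    by (rule integral_face_cong) (simp add: 0)
  then have z: "w (plane_proj (plane_normal F) (plane_offset F) y) = 0" using face_integral_zero[OF w] by simp
  obtain x where x: "x \<in> F" using ne by blast
  have "nF F = plane_normal F \<or> nF F = - plane_normal F"
    using nF F by (intro normal_unique) (auto simp: face_normals_def)
  then obtain s where s: "plane_normal F = s *\<^sub>R nF F" by (metis scaleR_one scaleR_minus1_left minus_minus)
  let ?t = "plane_normal F \<bullet> y - plane_offset F"
  have "y = plane_proj (plane_normal F) (plane_offset F) y + (?t * s) *\<^sub>R nF F"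
    using s by (simp add: plane_proj_def flip: scaleR_scaleR)
  then have "w y = w (plane_proj (plane_normal F) (plane_offset F) y) + dderiv ((?t * s) *\<^sub>R nF F) w x"
    using polys_1_line[OF w] by metis
  also have "dderiv ((?t * s) *\<^sub>R nF F) w x = (?t * s) * dderiv (nF F) w x"
    using linear_cmul[OF dderiv_linear[OF w]] by simp
  finally show ?thesis using z n[OF x] by simp
qed

text \<open>Where the seminorm vanishes, the cell functions are affine, with the values and the normal
  derivatives given by the face unknowns. So they agree across each face, and
  \<open>affine_zero\<close> applies to the set of all cells that carry the same function.\<close>

lemma kernel:
  assumes p: "p \<in> poly_data" and z: "normX_sq Th Fh nF (to_discrete p) \<le> 0"
  shows "all_zero p"
proof -
  have V0: "0 \<le> (\<Sum>T\<in>Th. semiV_sq Fh T (localV Fh nF T (fst (to_discrete p))))"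
    and U0: "0 \<le> (\<Sum>T\<in>Th. semiU_sq Fh T (localU Fh T (snd (to_discrete p))))"
    by (intro sum_nonneg semiV_nonneg semiU_nonneg p; assumption)+
  have zV: "semiV_sq Fh T (localV Fh nF T (fst (to_discrete p))) = 0" if "T \<in> Th" for T
    by (rule sum_zero[OF finite_Th _ _ that]) (use z U0 semiV_nonneg p in \<open>auto simp: normX_to_discrete\<close>)
  have zU: "semiU_sq Fh T (localU Fh T (snd (to_discrete p))) = 0" if "T \<in> Th" for T
    by (rule sum_zero[OF finite_Th _ _ that]) (use z V0 semiU_nonneg p in \<open>auto simp: normX_to_discrete\<close>)
  define v q e u g where "v = fst (fst p)" and "q = fst (snd (fst p))" and "e = snd (snd (fst p))"
    and "u = fst (snd p)" and "g = snd (snd p)"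
  have v1: "v T \<in> polys 1" if "T \<in> Th" for T using semiV_zero[OF that p zV[OF that]] by (simp add: v_def)
  have vq: "v T x = q F x" and ve: "ndiff T (v T) F x = (nF F \<bullet> cell_normal T F) * e F x"
    if "T \<in> Th" "F \<in> cell_faces Fh T" "x \<in> F" for T F x
    using semiV_zero[OF that(1) p zV[OF that(1)]] that by (auto simp: v_def q_def e_def)
  have uc: "u T x = u T 0" if "T \<in> Th" for T x using semiU_zero[OF that p zU[OF that]] by (simp add: u_def)
  have ug: "u T x = g F x" if "T \<in> Th" "F \<in> cell_faces Fh T" "x \<in> F" for T F x
    using semiU_zero[OF that(1) p zU[OF that(1)]] that by (auto simp: u_def g_def)
  have bq: "q F x = 0" and bg: "g F x = 0" if "F \<in> boundary_faces \<Omega> Fh" "x \<in> F" for F x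
    using p that by (auto simp: poly_data_def families_def bdry_polys_def q_def g_def boundary_faces_def)
  have F_ne: "\<exists>x. x \<in> F" if "F \<in> Fh" for F using flat_face.ne[OF flat[OF that]] by blast
  have vn: "dderiv (nF F) (v T) x = e F x" if T: "T \<in> Th" "F \<in> cell_faces Fh T" "x \<in> F" for T F x
  proof -
    let ?s = "nF F \<bullet> cell_normal T F"
    have "?s * e F x = dderiv (?s *\<^sub>R nF F) (v T) x"
      using ve[OF T] normal_factor(1)[OF T(1,2)] by (simp add: ndiff_def)
    also have "\<dots> = ?s * dderiv (nF F) (v T) x"
      using linear_cmul[OF dderiv_linear[OF v1[OF T(1)]]] by simp
    finally show ?thesis using normal_factor(2)[OF T(1,2)] by auto
  qed
  have v0: "v T0 y = 0" if T0: "T0 \<in> Th" for T0 y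
  proof (rule affine_zero[OF nF, of "{T \<in> Th. v T = v T0}"])
    show "v T0 x = 0" if "T \<in> {T \<in> Th. v T = v T0}" "F \<in> cell_faces Fh T" "F \<in> boundary_faces \<Omega> Fh" "x \<in> F" for T F x
      using that vq[of T F x] bq[of F x] by auto
    fix T T' F assume A: "T \<in> {T \<in> Th. v T = v T0}" "T' \<in> Th" "F \<in> cell_faces Fh T" "F \<in> cell_faces Fh T'"
    have TT: "T \<in> Th" and FF: "F \<in> Fh" using A cell_faces_subset by auto
    have "(\<lambda>x. v T x - v T' x) y = 0" for y
    proof (rule affine_match[OF FF])
      show "(\<lambda>x. v T x - v T' x) \<in> polys 1" by (rule polys_diff[OF v1[OF TT] v1[OF A(2)]])
      fix x assume x: "x \<in> F"
      show "v T x - v T' x = 0" using vq[OF TT A(3) x] vq[OF A(2,4) x] by simp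
      show "dderiv (nF F) (\<lambda>x. v T x - v T' x) x = 0"
        using dderiv_diff[OF v1[OF TT] v1[OF A(2)]] vn[OF TT A(3) x] vn[OF A(2,4) x] by simp
    qed
    then have "v T' = v T" by (intro ext) simp
    then show "T' \<in> {T \<in> Th. v T = v T0}" using A by simp
  qed (use T0 v1 in auto)
  have u0: "u T0 y = 0" if T0: "T0 \<in> Th" for T0 y
  proof (rule affine_zero[OF nF, of "{T \<in> Th. u T = u T0}"])
    have c: "u T0 = (\<lambda>x. u T0 0)" using uc[OF T0] by blast
    show "u T0 \<in> polys 1" by (rule ssubst[OF c, of "\<lambda>z. z \<in> polys 1"]) (rule polys_const)
    show "u T0 x = 0" if "T \<in> {T \<in> Th. u T = u T0}" "F \<in> cell_faces Fh T" "F \<in> boundary_faces \<Omega> Fh" "x \<in> F" for T F x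
      using that ug[of T F x] bg[of F x] by auto
    fix T T' F assume A: "T \<in> {T \<in> Th. u T = u T0}" "T' \<in> Th" "F \<in> cell_faces Fh T" "F \<in> cell_faces Fh T'"
    have TT: "T \<in> Th" and FF: "F \<in> Fh" using A cell_faces_subset by auto
    obtain x where x: "x \<in> F" using F_ne[OF FF] by blast
    have "u T' y = u T y" for y
      using uc[OF TT, of y] uc[OF A(2), of y] uc[OF TT, of x] uc[OF A(2), of x] ug[OF TT A(3) x] ug[OF A(2,4) x]
      by simp
    then have "u T' = u T" by blast
    then show "T' \<in> {T \<in> Th. u T = u T0}" using A by simp
  qed (use T0 in auto)
  have f0: "q F x = 0 \<and> e F x = 0 \<and> g F x = 0" if F: "F \<in> Fh" and x: "x \<in> F" for F x
  proof -
    obtain T where T: "T \<in> Th" "F \<in> cell_faces Fh T" using face_has_cell[OF F] by blast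
    have "v T = (\<lambda>_. 0)" using v0[OF T(1)] by blast
    then show ?thesis
      using vq[OF T x] vn[OF T x] ug[OF T x] u0[OF T(1)] dderiv_const[of "nF F" 0 x] by simp
  qed
  show ?thesis
    unfolding all_zero_def v_def[symmetric] q_def[symmetric] e_def[symmetric] u_def[symmetric] g_def[symmetric]
    using v0 u0 f0 by (auto simp: fun_eq_iff)
qed

lemma L2_fun_integrable:
  assumes "L2_fun \<Omega> f"
  shows "set_integrable lebesgue \<Omega> f"
proof -
  have i: "set_integrable lebesgue \<Omega> (\<lambda>x. 1 + (f x)\<^sup>2)"
    using integrable_one assms by (intro set_integral_add(1)) (auto simp: L2_fun_def)
  show ?thesis unfolding set_integrable_def
  proof (rule Bochner_Integration.integrable_bound[OF i[unfolded set_integrable_def]])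
    show "(\<lambda>x. indicator \<Omega> x *\<^sub>R f x) \<in> borel_measurable lebesgue"
      using assms by (simp add: L2_fun_def set_borel_measurable_def)
    have "\<bar>y\<bar> \<le> 1 + y\<^sup>2" for y :: real
    proof -
      have "0 \<le> (\<bar>y\<bar> - 1)\<^sup>2" by simp
      then have "2 * \<bar>y\<bar> \<le> 1 + y\<^sup>2" by (simp add: power2_diff)
      then show ?thesis by simp
    qed
    then show "AE x in lebesgue. norm (indicator \<Omega> x *\<^sub>R f x) \<le> norm (indicator \<Omega> x *\<^sub>R (1 + (f x)\<^sup>2))"
      by (intro AE_I2) (auto simp: indicator_def intro: order_trans)
  qed
qed

text \<open>The system is solved for the parametrizing polynomials. The form is degenerate exactly at the data
  that represent the zero function, and the right-hand side vanishes there.\<close>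

lemma well_posed:
  assumes \<kappa>: "0 < \<kappa>" and f: "L2_fun \<Omega> f"
  shows "\<exists>!yz. yz \<in> spaceX k \<Omega> Th Fh \<and>
    (\<forall>(v, u)\<in>spaceX k \<Omega> Th Fh. formA \<kappa> k \<Omega> Th Fh nF yz (v, u) = L2_inner \<Omega> f (broken Th (fst u)))"
proof -
  let ?b = "\<lambda>p p'. formA \<kappa> k \<Omega> Th Fh nF (to_discrete p) (to_discrete p')"
  let ?\<phi> = "\<lambda>p :: 'a gV \<times> 'a gU. L2_inner \<Omega> f (broken Th (fst (snd p)))"
  have bil: "bilin_on poly_data ?b" by (rule bilin_formA)
  have \<phi>r: "?\<phi> p = L2_inner \<Omega> f (broken Th (fst (snd (to_discrete p))))" for p
    by (simp add: to_discrete_def broken_restrict)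
  have \<phi>: "lin_on poly_data ?\<phi>"
  proof (rule lin_on_compose[OF _ _ lin_L2_broken[OF L2_fun_integrable[OF f]]])
    show "lin_on poly_data (\<lambda>p. fst (snd p))" by (simp add: lin_on_def)
    show "fst (snd p) \<in> families Th (\<lambda>_. polys (k + 1))" if "p \<in> poly_data" for p using that by (auto simp: poly_data_def)
  qed
  have P0: "0 \<in> poly_data" by (rule subspace_0[OF subspace_poly_data])
  have deg: "all_zero p" if "p \<in> poly_data" "?b p p = 0" for p
    using kernel[OF that(1)] coercive_formA[OF \<kappa> that(1)] that(2) by simp
  have deg': "to_discrete p = to_discrete 0" if "p \<in> poly_data" "?b p p = 0" for p
    using all_zero_diff[of p 0] deg[OF that] by simp
  obtain B where B: "finite B" "poly_data = span B" using fin_dim_poly_data by (auto simp: fin_dim_def)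
  have "\<exists>w\<in>span B. \<forall>v\<in>span B. ?b w v = ?\<phi> v"
  proof (rule psd_solve[OF B(1)]; (unfold B(2)[symmetric])?)
    show "bilin_on poly_data ?b" by (rule bil)
    show "lin_on poly_data ?\<phi>" by (rule \<phi>)
    fix p assume p: "p \<in> poly_data" "?b p p = 0"
    have "?\<phi> p = L2_inner \<Omega> f (broken Th (fst (snd (to_discrete p))))" by (rule \<phi>r)
    also have "\<dots> = L2_inner \<Omega> f (broken Th (fst (snd (to_discrete 0))))" by (simp only: deg'[OF p])
    also have "\<dots> = ?\<phi> 0" by (rule \<phi>r[symmetric])
    finally have "?\<phi> p = ?\<phi> 0" .
    then show "?\<phi> p = 0" using lin_on_zero[OF \<phi> subspace_poly_data] by simp
    fix q assume q: "q \<in> poly_data"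
    show "?b p q = 0 \<and> ?b q p = 0"
      unfolding deg'[OF p]
      using lin_on_zero[OF bilin_onD(1)[OF bil q] subspace_poly_data] lin_on_zero[OF bilin_onD(2)[OF bil q] subspace_poly_data]
      by simp
  qed
  then obtain w where w: "w \<in> poly_data" "\<And>v. v \<in> poly_data \<Longrightarrow> ?b w v = ?\<phi> v" unfolding B(2)[symmetric] by blast
  have sol: "(\<forall>(v, u)\<in>spaceX k \<Omega> Th Fh. formA \<kappa> k \<Omega> Th Fh nF (to_discrete p) (v, u) = L2_inner \<Omega> f (broken Th (fst u)))
    \<longleftrightarrow> (\<forall>p'\<in>poly_data. ?b p p' = ?\<phi> p')" for p
  proof
    assume A: "\<forall>(v, u)\<in>spaceX k \<Omega> Th Fh. formA \<kappa> k \<Omega> Th Fh nF (to_discrete p) (v, u) = L2_inner \<Omega> f (broken Th (fst u))"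
    show "\<forall>p'\<in>poly_data. ?b p p' = ?\<phi> p'"
    proof
      fix p' assume "p' \<in> poly_data"
      then have "to_discrete p' \<in> spaceX k \<Omega> Th Fh" by (rule to_discrete_in)
      from bspec[OF A this] have "case to_discrete p' of (v, u) \<Rightarrow> formA \<kappa> k \<Omega> Th Fh nF (to_discrete p) (v, u) = L2_inner \<Omega> f (broken Th (fst u))"
        .
      then have "?b p p' = L2_inner \<Omega> f (broken Th (fst (snd (to_discrete p'))))"
        by (simp only: case_prod_unfold prod.collapse)
      also have "\<dots> = ?\<phi> p'" by (rule \<phi>r[symmetric])
      finally show "?b p p' = ?\<phi> p'" .
    qed
  next
    assume A: "\<forall>p'\<in>poly_data. ?b p p' = ?\<phi> p'"
    show "\<forall>(v, u)\<in>spaceX k \<Omega> Th Fh. formA \<kappa> k \<Omega> Th Fh nF (to_discrete p) (v, u) = L2_inner \<Omega> f (broken Th (fst u))"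
    proof (clarify)
      fix v u assume "(v, u) \<in> spaceX k \<Omega> Th Fh"
      then obtain p' where p': "p' \<in> poly_data" "(v, u) = to_discrete p'" using to_discrete_surj by blast
      have "?b p p' = ?\<phi> p'" using A p'(1) by blast
      also have "\<dots> = L2_inner \<Omega> f (broken Th (fst (snd (to_discrete p'))))" by (rule \<phi>r)
      finally show "formA \<kappa> k \<Omega> Th Fh nF (to_discrete p) (v, u) = L2_inner \<Omega> f (broken Th (fst u))"
        unfolding p'(2)[symmetric] snd_conv .
    qed
  qed
  show ?thesis
  proof (rule ex1I[of _ "to_discrete w"])
    show "to_discrete w \<in> spaceX k \<Omega> Th Fh \<and> (\<forall>(v, u)\<in>spaceX k \<Omega> Th Fh.
        formA \<kappa> k \<Omega> Th Fh nF (to_discrete w) (v, u) = L2_inner \<Omega> f (broken Th (fst u)))"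
      unfolding sol using to_discrete_in[OF w(1)] w(2) by blast
    fix y assume y: "y \<in> spaceX k \<Omega> Th Fh \<and> (\<forall>(v, u)\<in>spaceX k \<Omega> Th Fh.
        formA \<kappa> k \<Omega> Th Fh nF y (v, u) = L2_inner \<Omega> f (broken Th (fst u)))"
    then obtain p where p: "p \<in> poly_data" "y = to_discrete p" using to_discrete_surj by blast
    have pb: "?b p p' = ?\<phi> p'" if "p' \<in> poly_data" for p' using y that unfolding p(2) sol by blast
    have d: "p - w \<in> poly_data" by (rule subspace_diff[OF subspace_poly_data p(1) w(1)])
    have "?b (p - w) (p - w) = ?b p (p - w) - ?b w (p - w)"
      by (rule lin_on_diff[OF bilin_onD(2)[OF bil d] subspace_poly_data p(1) w(1)])
    also have "\<dots> = 0" using pb[OF d] w(2)[OF d] by simp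
    finally have "all_zero (p - w)" by (rule deg[OF d])
    then show "y = to_discrete w" unfolding p(2) by (rule all_zero_diff)
  qed
qed

end

theorem mainTheorem5:
  fixes \<Omega> :: "'a::euclidean_space set" and \<kappa> \<rho> :: real and k :: nat
  assumes "DIM('a) \<in> {2, 3}"
    and "open \<Omega>" "bounded \<Omega>" "convex \<Omega>" "\<Omega> \<noteq> {}" "polytope (closure \<Omega>)"
    and "0 < \<kappa>"
    and "0 < \<rho>" "\<rho> < 1"
  shows "\<exists>C>0. \<forall>Th Fh nF. regular_mesh \<rho> \<Omega> Th Fh \<longrightarrow> face_normals \<Omega> Fh nF \<longrightarrow>
    (\<forall>vu \<in> spaceX k \<Omega> Th Fh. normX_sq Th Fh nF vu \<le> C * formA \<kappa> k \<Omega> Th Fh nF vu vu) \<and>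
    (\<forall>f. L2_fun \<Omega> f \<longrightarrow>
      (\<exists>!yz. yz \<in> spaceX k \<Omega> Th Fh \<and>
        (\<forall>(v, u) \<in> spaceX k \<Omega> Th Fh.
          formA \<kappa> k \<Omega> Th Fh nF yz (v, u) = L2_inner \<Omega> f (broken Th (fst u)))))"
proof -
  have "0 < \<rho>\<^sup>2 / 8" using assms by simp
  from poly_bound[OF this, of "k + 2", where ?'a = 'a]
  obtain K where K0: "0 \<le> K" and K: "\<forall>p\<in>polys (k + 2). \<forall>(z::'a) h. 0 < h \<longrightarrow> (\<forall>y\<in>cball z h.
     (p y)\<^sup>2 \<le> K / h ^ DIM('a) * (LINT x:ball z (h * (\<rho>\<^sup>2 / 8))|lborel. (p x)\<^sup>2) \<and>
     (\<forall>b\<in>Basis. (h * dderiv b p y)\<^sup>2 \<le> K / h ^ DIM('a) * (LINT x:ball z (h * (\<rho>\<^sup>2 / 8))|lborel. (p x)\<^sup>2)))"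
    by blast
  let ?C = "(coer_const DIM('a) \<rho> K + 1) * (1 + 1 / \<kappa>)"
  have C: "0 < ?C"
    using coer_const_nonneg[OF K0, of "DIM('a)" \<rho>] assms(7) by (intro mult_pos_pos add_nonneg_pos add_pos_pos) auto
  show ?thesis
  proof (intro exI[of _ ?C] conjI allI impI ballI)
    fix Th Fh nF assume reg: "regular_mesh \<rho> \<Omega> Th Fh" and nF: "face_normals \<Omega> Fh nF"
    interpret mesh_problem \<rho> \<Omega> Th Fh nF k K
      using assms reg nF K0 K by unfold_locales auto
    show "normX_sq Th Fh nF vu \<le> ?C * formA \<kappa> k \<Omega> Th Fh nF vu vu" if vu: "vu \<in> spaceX k \<Omega> Th Fh" for vu
      using to_discrete_surj[OF vu] coercive_formA[OF assms(7)] by blast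
    show "\<exists>!yz. yz \<in> spaceX k \<Omega> Th Fh \<and> (\<forall>(v, u)\<in>spaceX k \<Omega> Th Fh.
        formA \<kappa> k \<Omega> Th Fh nF yz (v, u) = L2_inner \<Omega> f (broken Th (fst u)))" if "L2_fun \<Omega> f" for f
      by (rule well_posed[OF assms(7) that])
  qed (rule C)
qed

end
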